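(* There exists a covariant functor $\mathcal{F}$ from the category of co-CR quaternionic vector spaces, whose morphisms are the co-CR quaternionic linear maps, to the category of holomorphic vector bundles over $\mathbb{C}P^1$, given by $\mathcal{F}(U)=\mathcal{U}$ (the holomorphic vector bundle of $U$) and $\mathcal{F}(t)=\mathcal{T}$ (the morphism of holomorphic vector bundles induced by $t$). Moreover, if $\mathcal{F}(U)=\mathcal{U}$ and $\mathcal{F}(U')=\mathcal{U}'$ then for any morphism of holomorphic vector bundles $\mathcal{T}:\mathcal{U}\to\mathcal{U}'$ which intertwines the conjugations, there exists a unique co-CR quaternionic linear map $t:U\to U'$ such that $\mathcal{F}(t)=\mathcal{T}$. Therefore two co-CR quaternionic vector spaces are isomorphic if and only if there exists an isomorphism, which intertwines the conjugations, between their holomorphic vector bundles. Furthermore, for any positive integer $k$ the set of isomorphism classes of co-CR quaternionic vector spaces $(U,E,\rho)$ with $\dim E=4k$ is nonempty and finite.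
   Context: All vector spaces are real and finite dimensional and linear maps are real unless stated otherwise. Let $\mathbb{H}$ be the quaternions; $\mathrm{Aut}(\mathbb{H})=\mathrm{SO}(3)$ (acting trivially on $\mathbb{R}$ and canonically on $\mathrm{Im}\,\mathbb{H}=\mathbb{R}^3$). A linear quaternionic structure on a vector space $E$ is an equivalence class of morphisms of associative algebras $\sigma:\mathbb{H}\to\mathrm{End}(E)$, where $\sigma\sim\tau$ if $\tau=\sigma\circ a$ for some $a\in\mathrm{SO}(3)$. The unit sphere $Z\cong S^2$ of $\sigma(\mathrm{Im}\,\mathbb{H})$ is the space of admissible linear complex structures of $E$. The dual $E^*$ is quaternionic via $\sigma^*(q)=\sigma(\overline{q})^{\mathrm{transpose}}$; the spaces $Z$ of $E$ and $E^*$ are thus identified. For $J\in Z$ let $E^J=\ker(J+\mathrm{i})\subseteq E^{\mathbb{C}}$ (the eigenspace of $J$ for $-\mathrm{i}$). $Z$ is identified with $\mathbb{C}P^1$ so that the subbundle $E^{0,1}\subseteq Z\times E^{\mathbb{C}}$ with fibre $E^J$ over $J$ is a holomorphic subbundle. A linear CR quaternionic structure on $U$ is a pair $(E,\iota)$ with $E$ a quaternionic vector space and $\iota:U\to E$ an injective linear map such that $\mathrm{im}\,\iota+J(\mathrm{im}\,\iota)=E$ for all $J\in Z$. A linear co-CR quaternionic structure on $U$ is a pair $(E,\rho)$ with $E$ a quaternionic vector space and $\rho:E\to U$ a (surjective) linear map such that $(E^*,\rho^* )$ is a linear CR quaternionic structure on $U^*$; then $(U,E,\rho)$ is a co-CR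 quaternionic vector space. A linear map $\widetilde t:E\to E'$ between quaternionic vector spaces is quaternionic with respect to $T:Z\to Z'$ if $\widetilde t\circ J=T(J)\circ\widetilde t$ for all $J\in Z$; if $\widetilde t\neq0$ then $T$ is unique and an orientation preserving isometry. A linear map $t:(U,E,\rho)\to(U',E',\rho')$ is co-CR quaternionic linear (with respect to $T$) if there exists $\widetilde t:E\to E'$ quaternionic with respect to $T$ such that $\rho'\circ\widetilde t=t\circ\rho$. The holomorphic vector bundle $\mathcal{U}\to Z$ of $(U,E,\rho)$ is the quotient of $Z\times U^{\mathbb{C}}$ by the image of the injective bundle morphism $E^{0,1}\to Z\times U^{\mathbb{C}}$ induced by $\rho$ (equivalently, the dual of the holomorphic bundle with fibres $(\rho^* )^{-1}((E^* )^J)\subseteq (U^* )^{\mathbb{C}}$). The conjugation of $U^{\mathbb{C}}$ together with the antipodal map $J\mapsto -J$ of $Z$ induces an involutive antiholomorphic diffeomorphism of $\mathcal{U}$, the conjugation of $\mathcal{U}$. A co-CR quaternionic linear map $t$ with respect to $T$ induces $\mathcal{T}:\mathcal{U}\to\mathcal{U}'$, over $T$, by $[(J,u)]\mapsto[(T(J),t(u))]$, and $\mathcal{T}$ intertwines the conjugations. Here the map $T$ is part of the data of a morphism, and is required to be an orientation preserving isometry (as is automatic when $t\ne0$); morphisms of holomorphic vector bundles are fibrewise linear holomorphic maps over holomorphic diffeomorphisms of $\mathbb{C}P^1$ (for instance, over the identity, after identifying $Z=Z'=\mathbb{C}P^1$). *)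

theory Defs
  imports "HOL-Analysis.Analysis" "HOL-Library.Function_Algebras"
begin

section \<open>Finite dimensional real vector spaces\<close>

text \<open>
  Vector spaces are finite dimensional subspaces of an arbitrary ambient real vector space,
  which plays the role of a universe. Functions into a real vector space form a real vector
  space pointwise, so dual spaces and endomorphism algebras are again of this kind.
\<close>

instantiation "fun" :: (type, real_vector) real_vector
begin

definition scaleR_fun :: "real \<Rightarrow> ('a \<Rightarrow> 'b) \<Rightarrow> 'a \<Rightarrow> 'b" where
  "scaleR_fun r f = (\<lambda>x. r *\<^sub>R f x)"

instance
  by standard (simp_all add: scaleR_fun_def fun_eq_iff scaleR_right_distrib scaleR_left_distrib)

end

definition fin_dim :: "'a::real_vector set \<Rightarrow> bool" where
  "fin_dim E \<longleftrightarrow> (\<exists>B. finite B \<and> span B = E)"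

text \<open>An infinite dimensional ambient space contains copies of all finite dimensional spaces.\<close>

lemma infinite_dimensional_ambient: "\<not> fin_dim (UNIV :: (nat \<Rightarrow> real) set)"
proof
  assume "fin_dim (UNIV :: (nat \<Rightarrow> real) set)"
  then obtain B :: "(nat \<Rightarrow> real) set" where B: "finite B" "span B = UNIV"
    by (auto simp: fin_dim_def)
  define e :: "nat \<Rightarrow> nat \<Rightarrow> real" where "e i j = (if i = j then 1 else 0)" for i j
  have "e i \<notin> span (range e - {e i})" for i
  proof
    assume "e i \<in> span (range e - {e i})"
    moreover have "subspace {f :: nat \<Rightarrow> real. f i = 0}"
      by (auto simp: subspace_def scaleR_fun_def)
    moreover have "range e - {e i} \<subseteq> {f. f i = 0}"
      by (auto simp: e_def fun_eq_iff split: if_splits)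
    ultimately have "e i \<in> {f. f i = 0}"
      using span_minimal by blast
    then show False by (simp add: e_def)
  qed
  then have "independent (range e)"
    by (auto simp: dependent_def)
  then have "finite (range e)"
    using independent_span_bound[of B "range e"] B by auto
  moreover have "inj e"
    by (rule injI) (metis e_def zero_neq_one)
  ultimately show False
    using finite_imageD by blast
qed

text \<open>
  A linear map between subspaces is represented by the function on the ambient space that
  vanishes off its domain; this makes the representation unique and compatible with sums,
  scalar multiples and composition.
\<close>

definition Hom :: "'a::real_vector set \<Rightarrow> 'b::real_vector set \<Rightarrow> ('a \<Rightarrow> 'b) set" where
  "Hom E F = {f. (\<forall>x\<in>E. f x \<in> F)
               \<and> (\<forall>x\<in>E. \<forall>y\<in>E. f (x + y) = f x + f y)
               \<and> (\<forall>r. \<forall>x\<in>E. f (r *\<^sub>R x) = r *\<^sub>R f x)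
               \<and> (\<forall>x. x \<notin> E \<longrightarrow> f x = 0)}"

definition id_map :: "'a::real_vector set \<Rightarrow> 'a \<Rightarrow> 'a" where
  "id_map E = (\<lambda>x. if x \<in> E then x else 0)"

definition Dual :: "'a::real_vector set \<Rightarrow> ('a \<Rightarrow> real) set" where
  "Dual E = Hom E UNIV"

definition transp ::
    "'b::real_vector set \<Rightarrow> ('a::real_vector \<Rightarrow> 'b) \<Rightarrow> ('b \<Rightarrow> real) \<Rightarrow> 'a \<Rightarrow> real" where
  "transp F f = (\<lambda>\<alpha>. if \<alpha> \<in> Dual F then \<alpha> \<circ> f else 0)"

text \<open>
  The complexification of \<open>E\<close> is \<open>E \<times> E\<close>, where \<open>(x, y)\<close> stands for \<open>x + \<i> y\<close>. The complex
  linear extension of a real linear map \<open>f\<close> is \<open>map_prod f f\<close>.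
\<close>

definition cscale :: "complex \<Rightarrow> 'a::real_vector \<times> 'a \<Rightarrow> 'a \<times> 'a" where
  "cscale c w = (Re c *\<^sub>R fst w - Im c *\<^sub>R snd w, Re c *\<^sub>R snd w + Im c *\<^sub>R fst w)"

definition cconj :: "'a::real_vector \<times> 'a \<Rightarrow> 'a \<times> 'a" where
  "cconj w = (fst w, - snd w)"


section \<open>Quaternionic vector spaces\<close>

text \<open>\<open>\<H> = \<real> \<oplus> Im \<H>\<close> with \<open>Im \<H> = \<real>\<^sup>3\<close>.\<close>

type_synonym quat = "real \<times> (real ^ 3)"

definition qmult :: "quat \<Rightarrow> quat \<Rightarrow> quat" where
  "qmult p q = (fst p * fst q - snd p \<bullet> snd q,
                fst p *\<^sub>R snd q + fst q *\<^sub>R snd p + cross3 (snd p) (snd q))"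

definition qcnj :: "quat \<Rightarrow> quat" where
  "qcnj q = (fst q, - snd q)"

definition so3_act :: "real ^ 3 ^ 3 \<Rightarrow> quat \<Rightarrow> quat" where
  "so3_act A q = (fst q, A *v snd q)"

definition quat_hom :: "'a::real_vector set \<Rightarrow> (quat \<Rightarrow> 'a \<Rightarrow> 'a) \<Rightarrow> bool" where
  "quat_hom E \<sigma> \<longleftrightarrow> linear \<sigma> \<and> (\<forall>q. \<sigma> q \<in> Hom E E) \<and> \<sigma> (1, 0) = id_map E
     \<and> (\<forall>p q. \<sigma> (qmult p q) = \<sigma> p \<circ> \<sigma> q)"

text \<open>
  A linear quaternionic structure is an equivalence class of morphisms. The zero space is left
  out: there the space of admissible complex structures would not be a 2-sphere.
\<close>

definition quat_structure ::
    "'a::real_vector set \<Rightarrow> (quat \<Rightarrow> 'a \<Rightarrow> 'a) set \<Rightarrow> bool" where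
  "quat_structure E Q \<longleftrightarrow> fin_dim E \<and> E \<noteq> {0} \<and>
     (\<exists>\<sigma>. quat_hom E \<sigma> \<and> Q = {\<sigma> \<circ> so3_act A | A. rotation_matrix A})"

definition adm :: "(quat \<Rightarrow> 'a \<Rightarrow> 'a) set \<Rightarrow> ('a \<Rightarrow> 'a) set" where
  "adm Q = {\<sigma> (0, v) | \<sigma> v. \<sigma> \<in> Q \<and> norm v = 1}"

definition dual_structure ::
    "'a::real_vector set \<Rightarrow> (quat \<Rightarrow> 'a \<Rightarrow> 'a) set
       \<Rightarrow> (quat \<Rightarrow> ('a \<Rightarrow> real) \<Rightarrow> 'a \<Rightarrow> real) set" where
  "dual_structure E Q = {\<lambda>q. transp E (\<sigma> (qcnj q)) | \<sigma>. \<sigma> \<in> Q}"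

text \<open>
  The metric and the orientation of the sphere of admissible complex structures are those
  transported from the unit sphere of \<open>Im \<H>\<close> by any representative of the structure.
\<close>

definition orient_isometry ::
    "(quat \<Rightarrow> 'a \<Rightarrow> 'a) set \<Rightarrow> (quat \<Rightarrow> 'b \<Rightarrow> 'b) set
       \<Rightarrow> (('a \<Rightarrow> 'a) \<Rightarrow> ('b \<Rightarrow> 'b)) \<Rightarrow> bool" where
  "orient_isometry Q Q' T \<longleftrightarrow> T \<in> adm Q \<rightarrow>\<^sub>E adm Q' \<and>
     (\<exists>\<sigma>\<in>Q. \<exists>\<sigma>'\<in>Q'. \<exists>A. rotation_matrix A \<and>
        (\<forall>v. norm v = 1 \<longrightarrow> T (\<sigma> (0, v)) = \<sigma>' (0, A *v v)))"

definition quat_linear ::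
    "'a::real_vector set \<Rightarrow> (quat \<Rightarrow> 'a \<Rightarrow> 'a) set \<Rightarrow> 'b::real_vector set
       \<Rightarrow> (('a \<Rightarrow> 'a) \<Rightarrow> ('b \<Rightarrow> 'b)) \<Rightarrow> ('a \<Rightarrow> 'b) \<Rightarrow> bool" where
  "quat_linear E Q E' T f \<longleftrightarrow> f \<in> Hom E E' \<and> (\<forall>J\<in>adm Q. f \<circ> J = T J \<circ> f)"


section \<open>CR and co-CR quaternionic vector spaces\<close>

definition cr_quat ::
    "'a::real_vector set \<Rightarrow> 'b::real_vector set \<Rightarrow> (quat \<Rightarrow> 'b \<Rightarrow> 'b) set
       \<Rightarrow> ('a \<Rightarrow> 'b) \<Rightarrow> bool" where
  "cr_quat U E Q \<iota> \<longleftrightarrow> fin_dim U \<and> quat_structure E Q \<and> \<iota> \<in> Hom U E \<and> inj_on \<iota> U \<and>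
     (\<forall>J\<in>adm Q. {x + J y | x y. x \<in> \<iota> ` U \<and> y \<in> \<iota> ` U} = E)"

record ('u, 'e) cocr =
  spc :: "'u set"
  qspc :: "'e set"
  qstr :: "(quat \<Rightarrow> 'e \<Rightarrow> 'e) set"
  rho :: "'e \<Rightarrow> 'u"

definition cocr_quat :: "('u::real_vector, 'e::real_vector) cocr \<Rightarrow> bool" where
  "cocr_quat X \<longleftrightarrow> fin_dim (spc X) \<and> quat_structure (qspc X) (qstr X)
     \<and> rho X \<in> Hom (qspc X) (spc X) \<and> rho X ` qspc X = spc X
     \<and> cr_quat (Dual (spc X)) (Dual (qspc X)) (dual_structure (qspc X) (qstr X))
         (transp (spc X) (rho X))"

definition cocr_mor ::
    "('u::real_vector, 'e::real_vector) cocr \<Rightarrow> ('u, 'e) cocr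
       \<Rightarrow> (('u \<Rightarrow> 'u) \<times> (('e \<Rightarrow> 'e) \<Rightarrow> ('e \<Rightarrow> 'e))) set" where
  "cocr_mor X Y = {(t, T). t \<in> Hom (spc X) (spc Y) \<and> orient_isometry (qstr X) (qstr Y) T \<and>
     (\<exists>f. quat_linear (qspc X) (qstr X) (qspc Y) T f \<and> rho Y \<circ> f = t \<circ> rho X)}"


section \<open>Categories\<close>

record ('o, 'm) cat =
  Obj :: "'o set"
  Mor :: "'o \<Rightarrow> 'o \<Rightarrow> 'm set"
  Idn :: "'o \<Rightarrow> 'm"
  Cmp :: "'o \<Rightarrow> 'o \<Rightarrow> 'o \<Rightarrow> 'm \<Rightarrow> 'm \<Rightarrow> 'm"

definition is_category :: "('o, 'm) cat \<Rightarrow> bool" where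
  "is_category C \<longleftrightarrow>
     (\<forall>X\<in>Obj C. Idn C X \<in> Mor C X X) \<and>
     (\<forall>X\<in>Obj C. \<forall>Y\<in>Obj C. \<forall>Z\<in>Obj C. \<forall>f\<in>Mor C X Y. \<forall>g\<in>Mor C Y Z.
        Cmp C X Y Z g f \<in> Mor C X Z) \<and>
     (\<forall>X\<in>Obj C. \<forall>Y\<in>Obj C. \<forall>f\<in>Mor C X Y.
        Cmp C X X Y f (Idn C X) = f \<and> Cmp C X Y Y (Idn C Y) f = f) \<and>
     (\<forall>X\<in>Obj C. \<forall>Y\<in>Obj C. \<forall>Z\<in>Obj C. \<forall>W\<in>Obj C.
        \<forall>f\<in>Mor C X Y. \<forall>g\<in>Mor C Y Z. \<forall>h\<in>Mor C Z W.
          Cmp C X Z W h (Cmp C X Y Z g f) = Cmp C X Y W (Cmp C Y Z W h g) f)"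

definition is_functor ::
    "('o, 'm) cat \<Rightarrow> ('p, 'n) cat \<Rightarrow> ('o \<Rightarrow> 'p) \<Rightarrow> ('o \<Rightarrow> 'o \<Rightarrow> 'm \<Rightarrow> 'n) \<Rightarrow> bool" where
  "is_functor C D F G \<longleftrightarrow>
     (\<forall>X\<in>Obj C. F X \<in> Obj D) \<and>
     (\<forall>X\<in>Obj C. \<forall>Y\<in>Obj C. \<forall>f\<in>Mor C X Y. G X Y f \<in> Mor D (F X) (F Y)) \<and>
     (\<forall>X\<in>Obj C. G X X (Idn C X) = Idn D (F X)) \<and>
     (\<forall>X\<in>Obj C. \<forall>Y\<in>Obj C. \<forall>Z\<in>Obj C. \<forall>f\<in>Mor C X Y. \<forall>g\<in>Mor C Y Z.
        G X Z (Cmp C X Y Z g f) = Cmp D (F X) (F Y) (F Z) (G Y Z g) (G X Y f))"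

definition is_iso :: "('o, 'm) cat \<Rightarrow> 'o \<Rightarrow> 'o \<Rightarrow> 'm \<Rightarrow> bool" where
  "is_iso C X Y f \<longleftrightarrow> f \<in> Mor C X Y \<and>
     (\<exists>g\<in>Mor C Y X. Cmp C X Y X g f = Idn C X \<and> Cmp C Y X Y f g = Idn C Y)"

definition iso_rel :: "('o, 'm) cat \<Rightarrow> ('o \<times> 'o) set" where
  "iso_rel C = {(X, Y). X \<in> Obj C \<and> Y \<in> Obj C \<and> (\<exists>f. is_iso C X Y f)}"

definition cocr_cat ::
    "(('u::real_vector, 'e::real_vector) cocr,
      ('u \<Rightarrow> 'u) \<times> (('e \<Rightarrow> 'e) \<Rightarrow> ('e \<Rightarrow> 'e))) cat" where
  "cocr_cat = \<lparr>Obj = {X. cocr_quat X}, Mor = cocr_mor,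
     Idn = (\<lambda>X. (id_map (spc X), restrict id (adm (qstr X)))),
     Cmp = (\<lambda>X Y Z g f. (fst g \<circ> fst f, compose (adm (qstr X)) (snd g) (snd f)))\<rparr>"


section \<open>The complex projective line\<close>

definition cline :: "complex \<Rightarrow> complex \<Rightarrow> (complex \<times> complex) set" where
  "cline a b = {(c * a, c * b) | c. True}"

typedef cp1 = "{cline a b | a b. (a, b) \<noteq> (0, 0)}"
  by blast

text \<open>The two standard affine parametrisations \<open>z \<mapsto> [1 : z]\<close> and \<open>z \<mapsto> [z : 1]\<close>.\<close>

definition aff0 :: "complex \<Rightarrow> cp1" where
  "aff0 z = Abs_cp1 (cline 1 z)"

definition aff1 :: "complex \<Rightarrow> cp1" where
  "aff1 z = Abs_cp1 (cline z 1)"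

definition cp1_open :: "cp1 set \<Rightarrow> bool" where
  "cp1_open V \<longleftrightarrow> open (aff0 -` V) \<and> open (aff1 -` V)"

text \<open>Only used for open \<open>V\<close>.\<close>

definition cp1_holo :: "cp1 set \<Rightarrow> (cp1 \<Rightarrow> complex) \<Rightarrow> bool" where
  "cp1_holo V h \<longleftrightarrow>
     (\<lambda>z. h (aff0 z)) holomorphic_on (aff0 -` V) \<and> (\<lambda>z. h (aff1 z)) holomorphic_on (aff1 -` V)"

text \<open>A map is holomorphic if it is continuous and pulls back holomorphic functions to such.\<close>

definition cp1_holo_map :: "(cp1 \<Rightarrow> cp1) \<Rightarrow> bool" where
  "cp1_holo_map g \<longleftrightarrow> (\<forall>V. cp1_open V \<longrightarrow> cp1_open (g -` V) \<and>
     (\<forall>h. cp1_holo V h \<longrightarrow> cp1_holo (g -` V) (h \<circ> g)))"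

definition cp1_biholo :: "(cp1 \<Rightarrow> cp1) \<Rightarrow> bool" where
  "cp1_biholo g \<longleftrightarrow> bij g \<and> cp1_holo_map g \<and> cp1_holo_map (inv g)"


section \<open>Holomorphic vector bundles over the complex projective line\<close>

record 't vfamily =
  total :: "'t set"
  proj :: "'t \<Rightarrow> cp1"
  vadd :: "'t \<Rightarrow> 't \<Rightarrow> 't"
  vscale :: "complex \<Rightarrow> 't \<Rightarrow> 't"

definition fibre :: "('t, 'z) vfamily_scheme \<Rightarrow> cp1 \<Rightarrow> 't set" where
  "fibre B p = {x \<in> total B. proj B x = p}"

text \<open>\<open>\<complex>\<^sup>n\<close> as the sequences supported in \<open>{..<n}\<close>.\<close>

definition Cn :: "nat \<Rightarrow> (nat \<Rightarrow> complex) set" where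
  "Cn n = {v. \<forall>i\<ge>n. v i = 0}"

text \<open>
  A local trivialisation over an open set \<open>V\<close>, given by its component \<open>\<phi>\<close> in \<open>\<complex>\<^sup>n\<close>. Since \<open>\<phi>\<close> is a
  bijection on each fibre that respects the operations, the fibres are complex vector spaces.
\<close>

definition local_triv ::
    "('t, 'z) vfamily_scheme \<Rightarrow> cp1 set \<Rightarrow> nat \<Rightarrow> ('t \<Rightarrow> nat \<Rightarrow> complex) \<Rightarrow> bool" where
  "local_triv B V n \<phi> \<longleftrightarrow> cp1_open V \<and>
     (\<forall>p\<in>V. bij_betw \<phi> (fibre B p) (Cn n) \<and>
        (\<forall>x\<in>fibre B p. \<forall>y\<in>fibre B p.
           vadd B x y \<in> fibre B p \<and> \<phi> (vadd B x y) = (\<lambda>i. \<phi> x i + \<phi> y i)) \<and>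
        (\<forall>c. \<forall>x\<in>fibre B p. vscale B c x \<in> fibre B p \<and> \<phi> (vscale B c x) = (\<lambda>i. c * \<phi> x i)))"

definition frame ::
    "('t, 'z) vfamily_scheme \<Rightarrow> ('t \<Rightarrow> nat \<Rightarrow> complex) \<Rightarrow> nat \<Rightarrow> cp1 \<Rightarrow> 't" where
  "frame B \<phi> j p = inv_into (fibre B p) \<phi> (\<lambda>i. if i = j then 1 else 0)"

definition holo_transition ::
    "('t, 'z) vfamily_scheme \<Rightarrow> cp1 set \<times> nat \<times> ('t \<Rightarrow> nat \<Rightarrow> complex)
       \<Rightarrow> cp1 set \<times> nat \<times> ('t \<Rightarrow> nat \<Rightarrow> complex) \<Rightarrow> bool" where
  "holo_transition B = (\<lambda>(V, n, \<phi>) (W, m, \<psi>).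
     \<forall>j<n. \<forall>i<m. cp1_holo (V \<inter> W) (\<lambda>p. \<psi> (frame B \<phi> j p) i))"

record 't hbundle = "'t vfamily" +
  atlas :: "(cp1 set \<times> nat \<times> ('t \<Rightarrow> nat \<Rightarrow> complex)) set"

text \<open>The holomorphic structure is a maximal holomorphic atlas of local trivialisations.\<close>

definition holo_bundle :: "'t hbundle \<Rightarrow> bool" where
  "holo_bundle B \<longleftrightarrow>
     (\<forall>(V, n, \<phi>)\<in>atlas B. local_triv B V n \<phi>) \<and>
     (\<forall>p. \<exists>(V, n, \<phi>)\<in>atlas B. p \<in> V) \<and>
     (\<forall>a\<in>atlas B. \<forall>b\<in>atlas B. holo_transition B a b) \<and>
     (\<forall>V n \<phi>. local_triv B V n \<phi> \<and>
        (\<forall>b\<in>atlas B. holo_transition B (V, n, \<phi>) b \<and> holo_transition B b (V, n, \<phi>))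
          \<longrightarrow> (V, n, \<phi>) \<in> atlas B)"

text \<open>
  Fibrewise linear holomorphic maps over holomorphic diffeomorphisms of the base; holomorphy
  means that the matrix entries in local trivialisations are holomorphic.
\<close>

definition bundle_mor :: "'t hbundle \<Rightarrow> 's hbundle \<Rightarrow> ('t \<Rightarrow> 's) set" where
  "bundle_mor B B' = {\<T>. \<T> \<in> total B \<rightarrow>\<^sub>E total B' \<and>
     (\<exists>g. cp1_biholo g \<and>
        (\<forall>x\<in>total B. proj B' (\<T> x) = g (proj B x)) \<and>
        (\<forall>p. \<forall>x\<in>fibre B p. \<forall>y\<in>fibre B p. \<T> (vadd B x y) = vadd B' (\<T> x) (\<T> y)) \<and>
        (\<forall>c. \<forall>x\<in>total B. \<T> (vscale B c x) = vscale B' c (\<T> x)) \<and>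
        (\<forall>(V, n, \<phi>)\<in>atlas B. \<forall>(W, m, \<psi>)\<in>atlas B'. \<forall>j<n. \<forall>i<m.
           cp1_holo (V \<inter> g -` W) (\<lambda>p. \<psi> (\<T> (frame B \<phi> j p)) i)))}"

definition bundle_cat :: "('t hbundle, 't \<Rightarrow> 't) cat" where
  "bundle_cat = \<lparr>Obj = {B. holo_bundle B}, Mor = bundle_mor,
     Idn = (\<lambda>B. restrict id (total B)),
     Cmp = (\<lambda>B B' B'' g f. compose (total B) g f)\<rparr>"

text \<open>
  Holomorphic subbundles of the trivial bundle whose fibre is the complexification \<open>E \<times> E\<close>:
  near each point there is a frame of holomorphic sections. No topology on the ambient space
  is needed, as a map into a finite dimensional space is holomorphic if it is a linear
  combination of fixed vectors with holomorphic coefficients.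
\<close>

definition holo_vector_map ::
    "'a::real_vector set \<Rightarrow> cp1 set \<Rightarrow> (cp1 \<Rightarrow> 'a \<times> 'a) \<Rightarrow> bool" where
  "holo_vector_map E V s \<longleftrightarrow>
     (\<exists>m (w :: nat \<Rightarrow> 'a \<times> 'a) h. (\<forall>j<m. w j \<in> E \<times> E \<and> cp1_holo V (h j)) \<and>
        (\<forall>p\<in>V. s p = (\<Sum>j<m. cscale (h j p) (w j))))"

definition holo_subbundle ::
    "'a::real_vector set \<Rightarrow> (cp1 \<Rightarrow> ('a \<times> 'a) set) \<Rightarrow> bool" where
  "holo_subbundle E S \<longleftrightarrow>
     (\<forall>p. \<exists>V n (s :: nat \<Rightarrow> cp1 \<Rightarrow> 'a \<times> 'a). cp1_open V \<and> p \<in> V \<and>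
        (\<forall>k<n. holo_vector_map E V (s k)) \<and>
        (\<forall>q\<in>V. S q = {\<Sum>k<n. cscale (c k) (s k q) | c. True} \<and>
           (\<forall>c. (\<Sum>k<n. cscale (c k) (s k q)) = 0 \<longrightarrow> (\<forall>k<n. c k = 0))))"

text \<open>
  The quotient of the trivial bundle with fibre \<open>U \<times> U\<close> by \<open>S\<close>. Its local trivialisations
  are those whose composition with the projection from the trivial bundle is holomorphic.
\<close>

definition coset :: "(cp1 \<Rightarrow> ('a::real_vector \<times> 'a) set) \<Rightarrow> cp1 \<Rightarrow> 'a \<times> 'a \<Rightarrow> ('a \<times> 'a) set" where
  "coset S p u = {u + s | s. s \<in> S p}"

definition quot_family ::
    "'a::real_vector set \<Rightarrow> (cp1 \<Rightarrow> ('a \<times> 'a) set) \<Rightarrow> (cp1 \<times> ('a \<times> 'a) set) vfamily" where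
  "quot_family U S =
     \<lparr>total = {(p, coset S p u) | p u. u \<in> U \<times> U},
      proj = fst,
      vadd = (\<lambda>x y. (fst x, {a + b | a b. a \<in> snd x \<and> b \<in> snd y})),
      vscale = (\<lambda>c x. (fst x, {cscale c a + s | a s. a \<in> snd x \<and> s \<in> S (fst x)}))\<rparr>"

definition quot_bundle ::
    "'a::real_vector set \<Rightarrow> (cp1 \<Rightarrow> ('a \<times> 'a) set) \<Rightarrow> (cp1 \<times> ('a \<times> 'a) set) hbundle" where
  "quot_bundle U S = vfamily.extend (quot_family U S)
     (hbundle.fields {(V, n, \<phi>). local_triv (quot_family U S) V n \<phi> \<and>
        (\<forall>u\<in>U \<times> U. \<forall>i<n. cp1_holo V (\<lambda>p. \<phi> (p, coset S p u) i))})"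


section \<open>The holomorphic vector bundle of a co-CR quaternionic vector space\<close>

text \<open>The eigenspace of \<open>J\<close> for \<open>-\<i>\<close> in the complexification of \<open>E\<close>.\<close>

definition E01 :: "'a::real_vector set \<Rightarrow> ('a \<Rightarrow> 'a) \<Rightarrow> ('a \<times> 'a) set" where
  "E01 E J = {w \<in> E \<times> E. map_prod J J w + cscale \<i> w = 0}"

text \<open>
  The identifications of the sphere of admissible complex structures with the projective line
  for which the \<open>-\<i>\<close> eigenspaces form a holomorphic subbundle. Such identifications exist, and
  any two of them differ by an automorphism of the projective line; \<open>ident\<close> is an arbitrary one.
\<close>

definition cp1_ident ::
    "'a::real_vector set \<Rightarrow> (quat \<Rightarrow> 'a \<Rightarrow> 'a) set \<Rightarrow> (('a \<Rightarrow> 'a) \<Rightarrow> cp1) \<Rightarrow> bool" where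
  "cp1_ident E Q \<zeta> \<longleftrightarrow> bij_betw \<zeta> (adm Q) UNIV \<and>
     holo_subbundle E (\<lambda>p. E01 E (inv_into (adm Q) \<zeta> p))"

definition ident :: "('u, 'e::real_vector) cocr \<Rightarrow> ('e \<Rightarrow> 'e) \<Rightarrow> cp1" where
  "ident X = (SOME \<zeta>. cp1_ident (qspc X) (qstr X) \<zeta>)"

definition cstr :: "('u, 'e::real_vector) cocr \<Rightarrow> cp1 \<Rightarrow> ('e \<Rightarrow> 'e)" where
  "cstr X = inv_into (adm (qstr X)) (ident X)"

definition ker_bundle ::
    "('u::real_vector, 'e::real_vector) cocr \<Rightarrow> cp1 \<Rightarrow> ('u \<times> 'u) set" where
  "ker_bundle X p = map_prod (rho X) (rho X) ` E01 (qspc X) (cstr X p)"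

definition F_obj ::
    "('u::real_vector, 'e::real_vector) cocr \<Rightarrow> (cp1 \<times> ('u \<times> 'u) set) hbundle" where
  "F_obj X = quot_bundle (spc X) (ker_bundle X)"

text \<open>The induced map \<open>[(J, u)] \<mapsto> [(T J, t u)]\<close>; the union is over equal cosets.\<close>

definition F_mor ::
    "('u::real_vector, 'e::real_vector) cocr \<Rightarrow> ('u, 'e) cocr
       \<Rightarrow> ('u \<Rightarrow> 'u) \<times> (('e \<Rightarrow> 'e) \<Rightarrow> ('e \<Rightarrow> 'e))
       \<Rightarrow> cp1 \<times> ('u \<times> 'u) set \<Rightarrow> cp1 \<times> ('u \<times> 'u) set" where
  "F_mor X Y = (\<lambda>(t, T). \<lambda>x\<in>total (F_obj X).
     let q = ident Y (T (cstr X (fst x)))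
     in (q, \<Union>u\<in>snd x. coset (ker_bundle Y) q (map_prod t t u)))"

text \<open>The conjugation \<open>[(J, u)] \<mapsto> [(-J, cconj u)]\<close> of the bundle of \<open>X\<close>.\<close>

definition conjugation ::
    "('u::real_vector, 'e::real_vector) cocr \<Rightarrow> cp1 \<times> ('u \<times> 'u) set \<Rightarrow> cp1 \<times> ('u \<times> 'u) set" where
  "conjugation X x = (ident X (- cstr X (fst x)), cconj ` snd x)"

definition intertwines ::
    "('u::real_vector, 'e::real_vector) cocr \<Rightarrow> ('u, 'e) cocr
       \<Rightarrow> (cp1 \<times> ('u \<times> 'u) set \<Rightarrow> cp1 \<times> ('u \<times> 'u) set) \<Rightarrow> bool" where
  "intertwines X Y \<T> \<longleftrightarrow>
     (\<forall>x\<in>total (F_obj X). \<T> (conjugation X x) = conjugation Y (\<T> x))"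

end

theory Submission
  imports Defs "HOL-Complex_Analysis.Complex_Analysis" "HOL-Computational_Algebra.Fundamental_Theorem_Algebra"
begin

text \<open>
  For a co-CR quaternionic vector space put \<open>K = ker \<rho>\<close>; the CR condition on the dual says that \<open>K \<inter> J K = 0\<close>
  for all admissible \<open>J\<close>. The Hopf fibration identifies the sphere of admissible structures with the
  projective line so that \<open>E\<^sup>J = {a w + b j w | w \<in> W}\<close> over \<open>[a : b]\<close>, where \<open>W = E\<^sup>i\<close>. Hence the image of
  \<open>E\<^sup>0\<^sup>,\<^sup>1\<close> in the trivial bundle is the image of a pencil \<open>a A + b B\<close> of linear maps on \<open>W\<close>, all of them injective.

  Such a pencil has a polynomial left inverse up to a scalar polynomial. Elementary manipulations with it replace the
  vanishing of the cohomology of \<open>\<O>(-1)\<close>: the images have zero intersection, so the functor is faithful, and every global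
  holomorphic section of the quotient bundle is the class of a constant vector. For fullness, an automorphism of the
  projective line that commutes with the antipodal map is a rotation, so after a change of the representative of
  the quaternionic structure the base map becomes the identity; the images of the constant
  sections are then constant, which gives a complex linear map between the complexifications, and the
  conjugations make it real.

  For finiteness, positivity of the degree gives \<open>2 dim K < dim E\<close>. The kernel of the multiplication map from
  \<open>\<H> \<otimes> K\<close> to \<open>E\<close>, together with its purely imaginary vectors, is again a pair satisfying the CR condition, of
  smaller dimension. The pair \<open>(E, K)\<close> is determined up to isomorphism by \<open>dim E\<close>, \<open>dim K\<close> and the
  isomorphism class of this smaller pair, and induction applies.
\<close>

section \<open>The projective line\<close>

text \<open>A left inverse \<open>\<pi>\<close> of \<open>A\<close> turns the pencil
  \<open>a A + b B\<close> on \<open>W\<close> into \<open>a - b M\<close> with the endomorphism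
  \<open>M = - \<pi> B\<close>. Over the complex numbers \<open>M\<close> is killed by a product of
  linear factors, and dividing by \<open>a - b M\<close> gives the polynomial left inverse. Its
  scalar factor may vanish at the point under study, so near a given point the pencil is rewritten
  in coordinates in which that point is \<open>[1 : 0]\<close>.

  The map \<open>ident\<close> in the definition of the bundle is an arbitrary choice, while all
  computations use the Hopf parametrisation \<open>std\<close>. The two differ by an automorphism
  \<open>\<theta>\<close> of the projective line, because the base point can be recovered
  holomorphically from any nonvanishing local section of the eigenspace bundle.

  The smaller pair suffices in the finiteness argument because taking real parts embeds its quotient
  by the imaginary vectors in \<open>K\<close>. An isomorphism of smaller pairs thus gives a real
  isomorphism between subspaces of the two kernels, and any extension of it to the whole kernels
  matches bases with the same quaternionic relations.\<close>

definition pt :: "complex \<Rightarrow> complex \<Rightarrow> cp1" where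
  "pt a b = Abs_cp1 (cline a b)"

text \<open>\<open>Abs_cp1\<close> is unspecified at the degenerate line spanned by
  \<open>(0, 0)\<close>, which is why representatives are required to be nonzero here and in nearly
  all later facts about \<open>pt\<close>.\<close>

lemma pt_eq_iff:
  assumes "(a, b) \<noteq> (0, 0)" "(c, d) \<noteq> (0, 0)"
  shows "pt a b = pt c d \<longleftrightarrow> a * d = b * c"
proof -
  have "pt a b = pt c d \<longleftrightarrow> cline a b = cline c d"
    unfolding pt_def by (rule Abs_cp1_inject) (use assms in blast)+
  also have "\<dots> \<longleftrightarrow> a * d = b * c"
  proof
    assume eq: "cline a b = cline c d"
    have "(a, b) \<in> cline a b"
      unfolding cline_def by (rule CollectI, rule exI[of _ 1]) simp
    then have "(a, b) \<in> cline c d" using eq by simp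
    then obtain e where "a = e * c" "b = e * d"
      unfolding cline_def by blast
    then show "a * d = b * c" by simp
  next
    assume eq: "a * d = b * c"
    obtain e where e: "a = e * c" "b = e * d" "e \<noteq> 0"
    proof (cases "c = 0")
      case True
      then have "d \<noteq> 0" "a = 0" using assms eq by auto
      then show ?thesis using assms that[of "b / d"] True by auto
    next
      case False
      then have "b = (a / c) * d" using eq by (simp add: field_simps)
      moreover have "a \<noteq> 0" using eq False assms by auto
      ultimately show ?thesis using False that[of "a / c"] by auto
    qed
    show "cline a b = cline c d"
      unfolding cline_def
    proof safe
      fix k show "\<exists>k'. (k * a, k * b) = (k' * c, k' * d) \<and> True"
        by (rule exI[of _ "k * e"]) (simp add: e)
    next
      fix k show "\<exists>k'. (k * c, k * d) = (k' * a, k' * b) \<and> True"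
        by (rule exI[of _ "k / e"]) (simp add: e)
    qed
  qed
  finally show ?thesis .
qed

lemma pt_scale: "k \<noteq> 0 \<Longrightarrow> (a, b) \<noteq> (0, 0) \<Longrightarrow> pt (k * a) (k * b) = pt a b"
  by (subst pt_eq_iff) auto

lemma pt_eqE:
  assumes "pt a b = pt c d" "(a, b) \<noteq> (0, 0)" "(c, d) \<noteq> (0, 0)"
  obtains k where "k \<noteq> 0" "a = k * c" "b = k * d"
proof (cases "c = 0")
  case True
  then have "d \<noteq> 0" "a = 0" using assms pt_eq_iff[of a b c d] by auto
  then show ?thesis using assms that[of "b / d"] True by auto
next
  case False
  have eq: "a * d = b * c" using assms pt_eq_iff by blast
  then have "b = (a / c) * d" using False by (simp add: field_simps)
  moreover have "a \<noteq> 0" using eq False assms by auto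
  ultimately show ?thesis using False that[of "a / c"] by auto
qed

lemma aff_pt: "aff0 z = pt 1 z" "aff1 z = pt z 1"
  by (simp_all add: aff0_def aff1_def pt_def)

lemma pt_exhaust:
  obtains a b where "(a, b) \<noteq> (0, 0)" "p = pt a b"
  by (cases p) (auto simp: pt_def)

lemma pt_aff0: "a \<noteq> 0 \<Longrightarrow> pt a b = aff0 (b / a)"
  by (simp add: aff_pt pt_eq_iff)

lemma pt_aff1: "b \<noteq> 0 \<Longrightarrow> pt a b = aff1 (a / b)"
  by (simp add: aff_pt pt_eq_iff)

lemma aff0_eq_aff1_iff: "aff0 z = aff1 w \<longleftrightarrow> z * w = 1"
  by (auto simp: aff_pt pt_eq_iff mult.commute)

lemma aff0_inj: "aff0 z = aff0 w \<longleftrightarrow> z = w"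
  by (auto simp: aff_pt pt_eq_iff)

lemma aff1_inj: "aff1 z = aff1 w \<longleftrightarrow> z = w"
  by (auto simp: aff_pt pt_eq_iff)

lemma aff0_cases: obtains z where "p = aff0 z" | "p = aff1 0"
  by (metis aff_pt div_0 pt_aff0 pt_aff1 pt_exhaust)

lemma aff1_cases: obtains z where "p = aff1 z" | "p = aff0 0"
  by (metis aff_pt div_0 pt_aff0 pt_aff1 pt_exhaust)

text \<open>With \<open>cp1_open\<close> as the topology of the type, the neighbourhood filters
  \<open>nhds\<close> become available, and local statements can be phrased with
  \<open>eventually\<close> instead of shrinking open sets by hand.\<close>

instantiation cp1 :: topological_space
begin

definition open_cp1 :: "cp1 set \<Rightarrow> bool" where
  "open_cp1 = cp1_open"

instance
proof
  fix K :: "cp1 set set"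
  assume "\<forall>S\<in>K. open S"
  then show "open (\<Union>K)"
    unfolding open_cp1_def cp1_open_def vimage_Union by auto
qed (auto simp: open_cp1_def cp1_open_def)

end

text \<open>Collecting the two affine parametrisations in a set lets arguments that are symmetric in
  them be carried out once.\<close>

definition chart :: "(complex \<Rightarrow> cp1) set" where
  "chart = {aff0, aff1}"

lemma chart_cases: obtains \<alpha> z where "\<alpha> \<in> chart" "p = \<alpha> z"
  unfolding chart_def by (metis aff0_cases insertCI)

lemma chart_inj: "\<alpha> \<in> chart \<Longrightarrow> \<alpha> z = \<alpha> w \<longleftrightarrow> z = w"
  unfolding chart_def using aff0_inj aff1_inj by auto

text \<open>Seen in its own chart the image is \<open>D\<close>; seen in the other chart it is the
  preimage of \<open>D\<close> under inversion, which is continuous away from 0.\<close>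

lemma chart_open_image:
  assumes "\<alpha> \<in> chart" "open D"
  shows "open (\<alpha> ` D)"
proof -
  have swap: "open {w. \<exists>z\<in>D. z * w = (1::complex)}" if "open D" for D
  proof -
    have "{w. \<exists>z\<in>D. z * w = 1} = inverse -` D \<inter> - {0}"
    proof safe
      fix w z :: complex assume "z \<in> D" "z * w = 1"
      then have "inverse w = z" by (metis inverse_unique inverse_inverse_eq)
      then show "w \<in> inverse -` D" using \<open>z \<in> D\<close> by simp
    next
      fix w :: complex assume "inverse w \<in> D" "w \<noteq> 0"
      then show "\<exists>z\<in>D. z * w = 1" by (intro bexI[of _ "inverse w"]) auto
    qed simp
    moreover have "continuous_on (- {0}) (inverse :: complex \<Rightarrow> complex)"
      by (auto intro!: continuous_intros)
    ultimately show ?thesis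
      using that continuous_on_open_vimage[of "- {0}" "inverse :: complex \<Rightarrow> complex"] by auto
  qed
  have "aff0 -` aff0 ` D = D" "aff1 -` aff1 ` D = D"
    by (auto simp: aff0_inj aff1_inj)
  moreover have "aff1 -` aff0 ` D = {w. \<exists>z\<in>D. z * w = 1}" 
    using aff0_eq_aff1_iff by (auto simp: image_iff) metis+
  moreover have "aff0 -` aff1 ` D = {w. \<exists>z\<in>D. z * w = 1}" 
    using aff0_eq_aff1_iff by (auto simp: image_iff mult.commute)
  ultimately show ?thesis
    using assms swap[of D] unfolding open_cp1_def cp1_open_def chart_def by auto
qed

lemma chart_open_vimage: "\<alpha> \<in> chart \<Longrightarrow> open V \<Longrightarrow> open (\<alpha> -` V)"
  unfolding open_cp1_def cp1_open_def chart_def by auto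

text \<open>Charts are open embeddings. Through this equation every local question on the projective
  line becomes one about a complex variable.\<close>

lemma nhds_chart:
  assumes "\<alpha> \<in> chart"
  shows "nhds (\<alpha> z) = filtermap \<alpha> (nhds z)"
proof (rule filter_eqI)
  fix P
  show "eventually P (nhds (\<alpha> z)) \<longleftrightarrow> eventually P (filtermap \<alpha> (nhds z))"
  proof
    assume "eventually P (nhds (\<alpha> z))"
    then obtain V where V: "open V" "\<alpha> z \<in> V" "\<forall>q\<in>V. P q"
      unfolding eventually_nhds by blast
    then have "open (\<alpha> -` V)" using assms chart_open_vimage by blast
    then show "eventually P (filtermap \<alpha> (nhds z))"
      unfolding eventually_filtermap eventually_nhds using V by blast
  next
    assume "eventually P (filtermap \<alpha> (nhds z))"
    then obtain D where D: "open D" "z \<in> D" "\<forall>w\<in>D. P (\<alpha> w)"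
      unfolding eventually_filtermap eventually_nhds by blast
    then have "open (\<alpha> ` D)" using assms chart_open_image by blast
    then show "eventually P (nhds (\<alpha> z))"
      unfolding eventually_nhds using D by blast
  qed
qed

subsection \<open>Holomorphic functions near a point\<close>

text \<open>\<open>cp1_holo\<close> needs a named open set, and local constructions keep shrinking
  it. Holomorphy as a property of the germ at a point combines directly with
  \<open>eventually\<close>.\<close>

definition hol_at :: "(cp1 \<Rightarrow> complex) \<Rightarrow> cp1 \<Rightarrow> bool" where
  "hol_at h p \<longleftrightarrow> (\<forall>\<alpha>\<in>chart. \<forall>z. \<alpha> z = p \<longrightarrow> (\<lambda>z. h (\<alpha> z)) analytic_on {z})"

lemma cp1_holo_iff:
  assumes "open V"
  shows "cp1_holo V h \<longleftrightarrow> (\<forall>p\<in>V. hol_at h p)"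
proof -
  have "open (aff0 -` V)" "open (aff1 -` V)"
    using assms chart_open_vimage unfolding chart_def by auto
  then show ?thesis
    unfolding cp1_holo_def hol_at_def chart_def
    by (auto simp: analytic_on_open[symmetric] analytic_on_analytic_at[of _ "aff0 -` V"]
        analytic_on_analytic_at[of _ "aff1 -` V"])
qed

text \<open>Both charts see a common point exactly when \<open>z * w = 1\<close>, and there the
  chart change is the analytic map \<open>inverse\<close>.\<close>

lemma aff01_analytic:
  assumes "(\<lambda>z. h (aff0 z)) analytic_on {z}" "z * w = 1"
  shows "(\<lambda>z. h (aff1 z)) analytic_on {w}"
proof -
  have w: "w \<noteq> 0" "inverse w = z"
    using assms(2) by (auto simp: inverse_unique mult.commute)
  have "(\<lambda>u. (\<lambda>z. h (aff0 z)) (inverse u)) analytic_on {w}"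
    by (rule analytic_on_compose[of inverse, unfolded o_def])
      (use w assms(1) in \<open>auto intro!: analytic_intros\<close>)
  moreover have "\<forall>\<^sub>F u in nhds w. h (aff0 (inverse u)) = h (aff1 u)"
  proof -
    have "\<forall>\<^sub>F u in nhds w. u \<noteq> 0" using w(1) by (rule t1_space_nhds)
    then show ?thesis
    proof eventually_elim
      case (elim u)
      then have "aff0 (inverse u) = aff1 u" by (simp add: aff0_eq_aff1_iff)
      then show ?case by simp
    qed
  qed
  ultimately show ?thesis
    using analytic_at_cong[of "\<lambda>u. h (aff0 (inverse u))" "\<lambda>z. h (aff1 z)" w w] by simp
qed

lemma aff10_analytic:
  assumes "(\<lambda>z. h (aff1 z)) analytic_on {z}" "z * w = 1"
  shows "(\<lambda>z. h (aff0 z)) analytic_on {w}"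
proof -
  have w: "w \<noteq> 0" "inverse w = z"
    using assms(2) by (auto simp: inverse_unique mult.commute)
  have "(\<lambda>u. (\<lambda>z. h (aff1 z)) (inverse u)) analytic_on {w}"
    by (rule analytic_on_compose[of inverse, unfolded o_def])
      (use w assms(1) in \<open>auto intro!: analytic_intros\<close>)
  moreover have "\<forall>\<^sub>F u in nhds w. h (aff1 (inverse u)) = h (aff0 u)"
  proof -
    have "\<forall>\<^sub>F u in nhds w. u \<noteq> 0" using w(1) by (rule t1_space_nhds)
    then show ?thesis
    proof eventually_elim
      case (elim u)
      then have "aff0 u = aff1 (inverse u)" by (simp add: aff0_eq_aff1_iff)
      then show ?case by simp
    qed
  qed
  ultimately show ?thesis
    using analytic_at_cong[of "\<lambda>u. h (aff1 (inverse u))" "\<lambda>z. h (aff0 z)" w w] by simp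
qed

lemma hol_at_chart:
  assumes "\<alpha> \<in> chart"
  shows "hol_at h (\<alpha> z) \<longleftrightarrow> (\<lambda>z. h (\<alpha> z)) analytic_on {z}"
proof
  assume an: "(\<lambda>z. h (\<alpha> z)) analytic_on {z}"
  show "hol_at h (\<alpha> z)"
    unfolding hol_at_def
  proof (intro ballI allI impI)
    fix \<beta> w assume "\<beta> \<in> chart" and eq: "\<beta> w = \<alpha> z"
    then consider "\<beta> = \<alpha>" | "\<alpha> = aff0" "\<beta> = aff1" | "\<alpha> = aff1" "\<beta> = aff0"
      using assms unfolding chart_def by auto
    then show "(\<lambda>z. h (\<beta> z)) analytic_on {w}"
    proof cases
      case 1
      then show ?thesis using an eq chart_inj assms by auto
    next
      case 2
      then have "z * w = 1" using eq aff0_eq_aff1_iff by metis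
      then show ?thesis using an 2 aff01_analytic by blast
    next
      case 3
      then have "w * z = 1" using eq aff0_eq_aff1_iff by metis
      then show ?thesis using an 3 aff10_analytic by (metis mult.commute)
    qed
  qed
qed (use assms hol_at_def in blast)

lemma inv_chart: "\<alpha> \<in> chart \<Longrightarrow> inv \<alpha> (\<alpha> z) = z"
  by (simp add: inv_f_f inj_def chart_inj)

lemma hol_at_inv_chart: "\<alpha> \<in> chart \<Longrightarrow> hol_at (inv \<alpha>) (\<alpha> z)"
  by (simp add: hol_at_chart inv_chart)

lemma chart01 [simp]: "aff0 \<in> chart" "aff1 \<in> chart"
  by (simp_all add: chart_def)

lemma hol_at_const [simp, intro]: "hol_at (\<lambda>_. c) p"
  by (simp add: hol_at_def)

lemma hol_at_add [intro]: "hol_at f p \<Longrightarrow> hol_at g p \<Longrightarrow> hol_at (\<lambda>q. f q + g q) p"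
  by (auto simp: hol_at_def intro!: analytic_intros)

lemma hol_at_diff [intro]: "hol_at f p \<Longrightarrow> hol_at g p \<Longrightarrow> hol_at (\<lambda>q. f q - g q) p"
  by (auto simp: hol_at_def intro!: analytic_intros)

lemma hol_at_mult [intro]: "hol_at f p \<Longrightarrow> hol_at g p \<Longrightarrow> hol_at (\<lambda>q. f q * g q) p"
  by (auto simp: hol_at_def intro!: analytic_intros)

lemma hol_at_divide [intro]:
  "hol_at f p \<Longrightarrow> hol_at g p \<Longrightarrow> g p \<noteq> 0 \<Longrightarrow> hol_at (\<lambda>q. f q / g q) p"
  by (auto simp: hol_at_def intro!: analytic_intros)

lemma hol_at_sum [intro]: "(\<And>i. i \<in> I \<Longrightarrow> hol_at (f i) p) \<Longrightarrow> hol_at (\<lambda>q. \<Sum>i\<in>I. f i q) p"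
  by (induction I rule: infinite_finite_induct) auto

lemma hol_at_compose:
  assumes "hol_at k p" "F analytic_on {k p}"
  shows "hol_at (\<lambda>q. F (k q)) p"
  using assms analytic_on_compose[of "\<lambda>z. k (_ z)" "{_}" F, unfolded o_def]
  by (auto simp: hol_at_def)

lemma hol_at_cong:
  assumes "\<forall>\<^sub>F q in nhds p. h q = k q"
  shows "hol_at h p \<longleftrightarrow> hol_at k p"
proof -
  obtain \<alpha> z where \<alpha>: "\<alpha> \<in> chart" "p = \<alpha> z" by (rule chart_cases)
  have "\<forall>\<^sub>F w in nhds z. h (\<alpha> w) = k (\<alpha> w)"
    using assms unfolding \<alpha>(2) nhds_chart[OF \<alpha>(1)] eventually_filtermap .
  then show ?thesis
    using analytic_at_cong[of "\<lambda>w. h (\<alpha> w)" "\<lambda>w. k (\<alpha> w)" z z] \<alpha> hol_at_chart by simp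
qed

lemma hol_at_tendsto: "hol_at h p \<Longrightarrow> (h \<longlongrightarrow> h p) (nhds p)"
proof -
  assume h: "hol_at h p"
  obtain \<alpha> z where \<alpha>: "\<alpha> \<in> chart" "p = \<alpha> z" by (rule chart_cases)
  have "(\<lambda>z. h (\<alpha> z)) analytic_on {z}" using h \<alpha> hol_at_chart by simp
  then have "isCont (\<lambda>z. h (\<alpha> z)) z"
    by (simp add: analytic_at_imp_isCont)
  then have "((\<lambda>z. h (\<alpha> z)) \<longlongrightarrow> h (\<alpha> z)) (nhds z)"
    using tendsto_at_iff_tendsto_nhds[of "\<lambda>z. h (\<alpha> z)" z] by (simp add: isCont_def)
  then show ?thesis
    unfolding \<alpha>(2) nhds_chart[OF \<alpha>(1)] by (simp add: filterlim_filtermap)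
qed

lemma hol_at_eventually:
  assumes "hol_at h p" "open S" "h p \<in> S"
  shows "\<forall>\<^sub>F q in nhds p. h q \<in> S"
  using hol_at_tendsto[OF assms(1)] assms(2,3) by (rule topological_tendstoD)

lemma hol_at_nonzero: "hol_at h p \<Longrightarrow> h p \<noteq> 0 \<Longrightarrow> \<forall>\<^sub>F q in nhds p. h q \<noteq> 0"
  using hol_at_eventually[of h p "- {0}"] by auto

lemma hol_at_eventually_hol_at:
  assumes "hol_at h p"
  shows "\<forall>\<^sub>F q in nhds p. hol_at h q"
proof -
  obtain \<alpha> z where \<alpha>: "\<alpha> \<in> chart" "p = \<alpha> z" by (rule chart_cases)
  have "(\<lambda>z. h (\<alpha> z)) analytic_on {z}" using assms \<alpha> hol_at_chart by simp
  then obtain D where D: "open D" "z \<in> D" "(\<lambda>z. h (\<alpha> z)) holomorphic_on D"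
    using analytic_at by blast
  then have "\<forall>w\<in>D. (\<lambda>z. h (\<alpha> z)) analytic_on {w}"
    using analytic_on_open analytic_on_analytic_at by blast
  then have "\<forall>\<^sub>F w in nhds z. hol_at h (\<alpha> w)"
    unfolding eventually_nhds using D hol_at_chart[OF \<alpha>(1)] by blast
  then show ?thesis
    unfolding \<alpha>(2) nhds_chart[OF \<alpha>(1)] eventually_filtermap .
qed

lemma eventually_nhds_at_point: "\<forall>\<^sub>F q in nhds p. P q \<Longrightarrow> P p"
  by (rule eventually_nhds_x_imp_x)

text \<open>No point of the projective line is isolated, so a nonzero value at \<open>p\<close>
  would persist at nearby points different from \<open>p\<close>.\<close>

lemma isolated_limit_zero:
  assumes "hol_at h p" "\<forall>\<^sub>F q in nhds p. q \<noteq> p \<longrightarrow> h q = 0"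
  shows "h p = 0"
proof (rule ccontr)
  assume nz: "h p \<noteq> 0"
  obtain \<alpha> z where \<alpha>: "\<alpha> \<in> chart" "p = \<alpha> z" by (rule chart_cases)
  have "\<forall>\<^sub>F q in nhds p. q = p"
    using hol_at_nonzero[OF assms(1) nz] assms(2) by eventually_elim auto
  then have "\<forall>\<^sub>F w in nhds z. \<alpha> w = \<alpha> z"
    unfolding \<alpha>(2) nhds_chart[OF \<alpha>(1)] eventually_filtermap .
  then have "\<forall>\<^sub>F w in nhds z. w = z"
    using chart_inj[OF \<alpha>(1)] by simp
  then obtain S where "open S" "z \<in> S" "\<forall>w\<in>S. w = z"
    unfolding eventually_nhds by blast
  then have "S = {z}" by blast
  then show False using \<open>open S\<close> not_open_singleton by blast
qed

subsection \<open>Holomorphic self-maps of the projective line\<close>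

text \<open>Local homogeneous coordinates of the image avoid deciding in advance which chart the
  image lies in. That this agrees with the definition by pulling back functions is the content of
  \<open>cp1_holo_mapI\<close> and \<open>cp1_holo_mapD\<close>.\<close>

definition hmap_at :: "(cp1 \<Rightarrow> cp1) \<Rightarrow> cp1 \<Rightarrow> bool" where
  "hmap_at g p \<longleftrightarrow> (\<exists>a b. hol_at a p \<and> hol_at b p \<and> (a p, b p) \<noteq> (0, 0) \<and>
     (\<forall>\<^sub>F q in nhds p. g q = pt (a q) (b q)))"

lemma hmap_at_chart:
  assumes "hmap_at g p"
  obtains \<alpha> f where "\<alpha> \<in> chart" "hol_at f p" "\<forall>\<^sub>F q in nhds p. g q = \<alpha> (f q)"
proof -
  obtain a b where ab: "hol_at a p" "hol_at b p" "(a p, b p) \<noteq> (0, 0)"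
      and ev: "\<forall>\<^sub>F q in nhds p. g q = pt (a q) (b q)"
    using assms unfolding hmap_at_def by blast
  show ?thesis
  proof (cases "a p = 0")
    case False
    have "\<forall>\<^sub>F q in nhds p. g q = aff0 (b q / a q)"
      using ev hol_at_nonzero[OF ab(1) False] by eventually_elim (simp add: pt_aff0)
    then show ?thesis using that[of aff0 "\<lambda>q. b q / a q"] False ab unfolding chart_def by blast
  next
    case True
    then have nz: "b p \<noteq> 0" using ab by auto
    have "\<forall>\<^sub>F q in nhds p. g q = aff1 (a q / b q)"
      using ev hol_at_nonzero[OF ab(2) nz] by eventually_elim (simp add: pt_aff1)
    then show ?thesis using that[of aff1 "\<lambda>q. a q / b q"] nz ab unfolding chart_def by blast
  qed
qed

lemma hmap_at_chartI:
  assumes "\<alpha> \<in> chart" "hol_at f p" "\<forall>\<^sub>F q in nhds p. g q = \<alpha> (f q)"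
  shows "hmap_at g p"
proof -
  consider "\<alpha> = aff0" | "\<alpha> = aff1" using assms(1) unfolding chart_def by auto
  then show ?thesis
  proof cases
    case 1
    then show ?thesis unfolding hmap_at_def
      using assms by (intro exI[of _ "\<lambda>_. 1"] exI[of _ f]) (simp add: aff_pt)
  next
    case 2
    then show ?thesis unfolding hmap_at_def
      using assms by (intro exI[of _ "\<lambda>_. 1"] exI[of _ f]) (simp add: aff_pt)
  qed
qed

lemma hmap_at_compose:
  assumes "hmap_at g p" "hol_at h (g p)"
  shows "hol_at (\<lambda>q. h (g q)) p"
proof -
  obtain \<alpha> f where f: "\<alpha> \<in> chart" "hol_at f p" and ev: "\<forall>\<^sub>F q in nhds p. g q = \<alpha> (f q)"
    using hmap_at_chart[OF assms(1)] by blast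
  have "g p = \<alpha> (f p)" using ev by (rule eventually_nhds_at_point)
  then have "(\<lambda>z. h (\<alpha> z)) analytic_on {f p}"
    using assms(2) hol_at_chart[OF f(1)] by simp
  then have "hol_at (\<lambda>q. h (\<alpha> (f q))) p"
    by (rule hol_at_compose[OF f(2)])
  moreover have "\<forall>\<^sub>F q in nhds p. h (g q) = h (\<alpha> (f q))"
    using ev by eventually_elim simp
  ultimately show ?thesis using hol_at_cong by metis
qed

lemma hmap_at_tendsto:
  assumes "hmap_at g p"
  shows "(g \<longlongrightarrow> g p) (nhds p)"
proof -
  obtain \<alpha> f where f: "\<alpha> \<in> chart" "hol_at f p" and ev: "\<forall>\<^sub>F q in nhds p. g q = \<alpha> (f q)"
    using hmap_at_chart[OF assms] by blast
  have gp: "g p = \<alpha> (f p)" using ev by (rule eventually_nhds_at_point)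
  have "((\<lambda>q. \<alpha> (f q)) \<longlongrightarrow> \<alpha> (f p)) (nhds p)"
  proof (rule filterlim_compose[OF _ hol_at_tendsto[OF f(2)]])
    show "(\<alpha> \<longlongrightarrow> \<alpha> (f p)) (nhds (f p))"
      unfolding nhds_chart[OF f(1)] by (simp add: filterlim_def)
  qed
  then show ?thesis unfolding gp using ev tendsto_cong by fastforce
qed

lemma cp1_holo_mapI:
  assumes "\<And>p. hmap_at g p"
  shows "cp1_holo_map g"
  unfolding cp1_holo_map_def open_cp1_def[symmetric]
proof (intro allI impI conjI)
  fix V :: "cp1 set" assume V: "open V"
  show op: "open (g -` V)"
    unfolding open_subopen[of "g -` V"]
  proof
    fix p assume "p \<in> g -` V"
    then have "\<forall>\<^sub>F q in nhds p. g q \<in> V"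
      using topological_tendstoD[OF hmap_at_tendsto[OF assms] V] by simp
    then show "\<exists>T. open T \<and> p \<in> T \<and> T \<subseteq> g -` V"
      unfolding eventually_nhds by blast
  qed
  fix h assume "cp1_holo V h"
  then show "cp1_holo (g -` V) (h \<circ> g)"
    using hmap_at_compose[OF assms] by (auto simp: cp1_holo_iff V op o_def)
qed

text \<open>The function to pull back is the inverse of a chart around \<open>g p\<close>: its
  pullback is the local coordinate expression of \<open>g\<close>.\<close>

lemma cp1_holo_mapD:
  assumes "cp1_holo_map g"
  shows "hmap_at g p"
proof -
  obtain \<alpha> z where \<alpha>: "\<alpha> \<in> chart" "g p = \<alpha> z" by (rule chart_cases)
  have V: "open (range \<alpha>)" using \<alpha>(1) chart_open_image by blast
  have inv: "inv \<alpha> (\<alpha> w) = w" for w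
    using chart_inj[OF \<alpha>(1)] by (simp add: inv_f_f inj_def)
  have "hol_at (inv \<alpha>) q" if "q \<in> range \<alpha>" for q
    using that hol_at_chart[OF \<alpha>(1)] by (auto simp: inv)
  then have "cp1_holo (range \<alpha>) (inv \<alpha>)" using cp1_holo_iff[OF V] by blast
  then have op: "open (g -` range \<alpha>)" and "cp1_holo (g -` range \<alpha>) (inv \<alpha> \<circ> g)"
    using assms V unfolding cp1_holo_map_def open_cp1_def by blast+
  then have "hol_at (inv \<alpha> \<circ> g) p"
    using cp1_holo_iff \<alpha>(2) by fastforce
  moreover have "\<forall>\<^sub>F q in nhds p. g q = \<alpha> ((inv \<alpha> \<circ> g) q)"
    unfolding eventually_nhds
    by (rule exI[of _ "g -` range \<alpha>"]) (use op \<alpha> inv in auto)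
  ultimately show ?thesis using hmap_at_chartI[OF \<alpha>(1)] by blast
qed

lemma cp1_holo_map_compose: "cp1_holo_map f \<Longrightarrow> cp1_holo_map g \<Longrightarrow> cp1_holo_map (g \<circ> f)"
  by (simp add: cp1_holo_map_def vimage_comp[symmetric] o_assoc)

lemma cp1_holo_map_id: "cp1_holo_map id"
  unfolding cp1_holo_map_def by simp

text \<open>In charts a bijective holomorphic map is an injective holomorphic function of one
  variable, and such a function has an open image and a holomorphic inverse.\<close>

lemma cp1_holo_map_inv:
  assumes "cp1_holo_map g" "bij g"
  shows "cp1_holo_map (inv g)"
proof (rule cp1_holo_mapI)
  fix q
  define p where "p = inv g q"
  have gp: "g p = q" unfolding p_def using assms(2) by (simp add: bij_is_surj surj_f_inv_f)
  obtain \<alpha> z where \<alpha>: "\<alpha> \<in> chart" "p = \<alpha> z" by (rule chart_cases)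
  obtain \<beta> f where \<beta>: "\<beta> \<in> chart" "hol_at f p" and ev: "\<forall>\<^sub>F q in nhds p. g q = \<beta> (f q)"
    using hmap_at_chart[OF cp1_holo_mapD[OF assms(1)]] by blast
  have "(\<lambda>w. f (\<alpha> w)) analytic_on {z}" using \<beta>(2) \<alpha> hol_at_chart by simp
  then obtain D1 where D1: "open D1" "z \<in> D1" "(\<lambda>w. f (\<alpha> w)) holomorphic_on D1"
    using analytic_at by blast
  have "\<forall>\<^sub>F w in nhds z. g (\<alpha> w) = \<beta> (f (\<alpha> w))"
    using ev unfolding \<alpha>(2) nhds_chart[OF \<alpha>(1)] eventually_filtermap .
  then obtain D2 where D2: "open D2" "z \<in> D2" "\<forall>w\<in>D2. g (\<alpha> w) = \<beta> (f (\<alpha> w))"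
    unfolding eventually_nhds by blast
  define D where "D = D1 \<inter> D2"
  have D: "open D" "z \<in> D" "(\<lambda>w. f (\<alpha> w)) holomorphic_on D"
    using D1 D2 holomorphic_on_subset unfolding D_def by auto
  have inj: "inj_on (\<lambda>w. f (\<alpha> w)) D"
  proof (rule inj_onI)
    fix w w' assume "w \<in> D" "w' \<in> D" "f (\<alpha> w) = f (\<alpha> w')"
    then have "g (\<alpha> w) = g (\<alpha> w')" using D2 unfolding D_def by auto
    then show "w = w'" using assms(2) chart_inj[OF \<alpha>(1)] by (metis bij_pointE)
  qed
  obtain k where k: "k holomorphic_on (\<lambda>w. f (\<alpha> w)) ` D" "\<And>w. w \<in> D \<Longrightarrow> k (f (\<alpha> w)) = w"
    using holomorphic_has_inverse[OF D(3,1) inj] by metis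
  have op: "open ((\<lambda>w. f (\<alpha> w)) ` D)" using open_mapping_thm3[OF D(3,1) inj] .
  have q: "q = \<beta> (f p)" using D2 \<alpha>(2) gp by auto
  have invg: "inv g (\<beta> u) = \<alpha> (k u)" if "u \<in> (\<lambda>w. f (\<alpha> w)) ` D" for u
  proof -
    obtain w where w: "w \<in> D" "u = f (\<alpha> w)" using \<open>u \<in> (\<lambda>w. f (\<alpha> w)) ` D\<close> by auto
    then have "\<beta> u = g (\<alpha> w)" using D2 unfolding D_def by auto
    then show ?thesis using w k(2) assms(2) by (simp add: bij_is_inj)
  qed
  have inv: "inv \<beta> (\<beta> w) = w" for w
    using chart_inj[OF \<beta>(1)] by (simp add: inv_f_f inj_def)
  have kan: "k analytic_on {f p}"
    using k(1) op D(2) \<alpha>(2) analytic_at by blast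
  show "hmap_at (inv g) q"
  proof (rule hmap_at_chartI[OF \<alpha>(1)])
    show "hol_at (\<lambda>q. k (inv \<beta> q)) q"
      unfolding q hol_at_chart[OF \<beta>(1)] using kan by (simp add: inv)
    have "\<forall>\<^sub>F u in nhds (f p). inv g (\<beta> u) = \<alpha> (k u)"
      unfolding eventually_nhds using op invg D(2) \<alpha>(2) by blast
    then show "\<forall>\<^sub>F q in nhds q. inv g q = \<alpha> (k (inv \<beta> q))"
      unfolding q nhds_chart[OF \<beta>(1)] eventually_filtermap by (simp add: inv)
  qed
qed

lemma cp1_biholoI: "bij g \<Longrightarrow> cp1_holo_map g \<Longrightarrow> cp1_biholo g"
  unfolding cp1_biholo_def using cp1_holo_map_inv by blast

lemma cp1_biholo_inv: "cp1_biholo g \<Longrightarrow> cp1_biholo (inv g)"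
  unfolding cp1_biholo_def by (simp add: bij_imp_bij_inv inv_inv_eq)

lemma cp1_biholo_compose: "cp1_biholo f \<Longrightarrow> cp1_biholo g \<Longrightarrow> cp1_biholo (g \<circ> f)"
  by (rule cp1_biholoI) (auto simp: cp1_biholo_def intro: bij_comp cp1_holo_map_compose)

lemma cp1_biholo_id: "cp1_biholo id"
  by (rule cp1_biholoI) (auto simp: cp1_holo_map_id)

lemma cp1_biholoD: "cp1_biholo g \<Longrightarrow> hmap_at g p" "cp1_biholo g \<Longrightarrow> bij g"
  unfolding cp1_biholo_def using cp1_holo_mapD by auto

lemma homogeneous_coordinates:
  obtains a b where "hol_at a p" "hol_at b p" "(a p, b p) \<noteq> (0, 0)"
    "\<forall>\<^sub>F q in nhds p. (a q, b q) \<noteq> (0, 0) \<and> q = pt (a q) (b q)"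
proof -
  obtain a b where ab: "hol_at a p" "hol_at b p" "(a p, b p) \<noteq> (0, 0)"
      and ev: "\<forall>\<^sub>F q in nhds p. id q = pt (a q) (b q)"
    using cp1_holo_mapD[OF cp1_holo_map_id, of p] unfolding hmap_at_def by blast
  have "\<forall>\<^sub>F q in nhds p. (a q, b q) \<noteq> (0, 0)"
  proof (cases "a p = 0")
    case True
    then have "\<forall>\<^sub>F q in nhds p. b q \<noteq> 0" using ab hol_at_nonzero by auto
    then show ?thesis by eventually_elim simp
  next
    case False
    then have "\<forall>\<^sub>F q in nhds p. a q \<noteq> 0" using ab hol_at_nonzero by auto
    then show ?thesis by eventually_elim simp
  qed
  then have "\<forall>\<^sub>F q in nhds p. (a q, b q) \<noteq> (0, 0) \<and> q = pt (a q) (b q)"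
    using ev by eventually_elim simp
  then show ?thesis using that ab by blast
qed

subsection \<open>Automorphisms commuting with the antipodal map\<close>

text \<open>The choice ranges over homogeneous coordinates of \<open>p\<close>;
  \<open>antip_pt\<close> shows that the result does not depend on them. Under the Hopf
  parametrisation this is \<open>v \<mapsto> - v\<close>, see \<open>sphp_antip\<close>.\<close>

definition antip :: "cp1 \<Rightarrow> cp1" where
  "antip p = (SOME q. \<exists>a b. (a, b) \<noteq> (0, 0) \<and> p = pt a b \<and> q = pt (- cnj b) (cnj a))"

lemma antip_pt:
  assumes "(a, b) \<noteq> (0, 0)"
  shows "antip (pt a b) = pt (- cnj b) (cnj a)"
proof -
  have "\<exists>q a' b'. (a', b') \<noteq> (0, 0) \<and> pt a b = pt a' b' \<and> q = pt (- cnj b') (cnj a')"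
    using assms by blast
  then have "\<exists>a' b'. (a', b') \<noteq> (0, 0) \<and> pt a b = pt a' b' \<and> antip (pt a b) = pt (- cnj b') (cnj a')"
    unfolding antip_def by (rule someI_ex)
  then obtain a' b' where *: "(a', b') \<noteq> (0, 0)" "pt a b = pt a' b'"
    "antip (pt a b) = pt (- cnj b') (cnj a')" by blast
  have "a * b' = b * a'" using * assms pt_eq_iff by blast
  then have "cnj a * cnj b' = cnj b * cnj a'" by (metis complex_cnj_mult)
  moreover have "(- cnj b', cnj a') \<noteq> (0, 0)" "(- cnj b, cnj a) \<noteq> (0, 0)"
    using * assms by auto
  ultimately show ?thesis
    unfolding *(3) by (subst pt_eq_iff) (auto simp: mult.commute)
qed

lemma antip_aff: "z \<noteq> 0 \<Longrightarrow> antip (aff0 z) = aff0 (- 1 / cnj z)"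
  by (auto simp: aff_pt antip_pt pt_eq_iff)

text \<open>Fixing \<open>[1 : 0]\<close> and commuting with the antipodal map forces
  \<open>[0 : 1]\<close> to be fixed too, so \<open>g\<close> is an entire injective function
  \<open>h\<close> with \<open>h 0 = 0\<close>. The antipodal symmetry bounds
  \<open>h z / z\<close>, and Liouville makes it a constant of modulus 1.\<close>

lemma antip_commuting_automorphism:
  assumes g: "cp1_biholo g" and g0: "g (aff0 0) = aff0 0" and com: "\<And>p. g (antip p) = antip (g p)"
  obtains c where "cmod c = 1" "\<And>a b. (a, b) \<noteq> (0, 0) \<Longrightarrow> g (pt a b) = pt a (c * b)"
proof -
  have bij: "bij g" using g cp1_biholoD by blast
  have a0: "antip (aff0 0) = aff1 0"
    by (simp add: aff_pt antip_pt)
  then have ginf: "g (aff1 0) = aff1 0" using com g0 by metis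
  have "\<exists>w. g (aff0 z) = aff0 w" for z
  proof (cases rule: aff0_cases[of "g (aff0 z)"])
    case 2
    then have "aff0 z = aff1 0" using ginf bij by (metis bij_pointE)
    then show ?thesis by (simp add: aff0_eq_aff1_iff)
  qed auto
  then obtain h where h: "\<And>z. g (aff0 z) = aff0 (h z)" by metis
  have c0: "aff0 \<in> chart" by (simp add: chart_def)
  have han: "h analytic_on {z}" for z
  proof -
    have inv: "inv aff0 (aff0 w) = w" for w
      by (simp add: inv_f_f inj_def aff0_inj)
    have "hol_at (inv aff0) (g (aff0 z))"
      unfolding h hol_at_chart[OF c0] by (simp add: inv)
    then have "hol_at (\<lambda>q. inv aff0 (g q)) (aff0 z)"
      using hmap_at_compose g cp1_biholoD by blast
    then show ?thesis
      unfolding hol_at_chart[OF c0] h inv .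
  qed
  have hinj: "h z = h w \<Longrightarrow> z = w" for z w
    using h bij aff0_inj by (metis bij_pointE)
  have h0: "h 0 = 0" using h g0 aff0_inj by metis
  have hnz: "z \<noteq> 0 \<Longrightarrow> h z \<noteq> 0" for z using hinj h0 by metis
  have hol: "h holomorphic_on UNIV"
    using han analytic_on_analytic_at analytic_imp_holomorphic by blast
  have hanti: "h (- 1 / cnj z) = - 1 / cnj (h z)" if "z \<noteq> 0" for z
  proof -
    have "aff0 (h (- 1 / cnj z)) = g (antip (aff0 z))"
      unfolding antip_aff[OF that] h ..
    also have "\<dots> = aff0 (- 1 / cnj (h z))"
      unfolding com h using antip_aff[OF hnz[OF that]] by simp
    finally show ?thesis by (simp add: aff0_inj)
  qed
  have d0: "deriv h 0 \<noteq> 0"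
    using holomorphic_injective_imp_regular[OF hol open_UNIV] hinj by (auto simp: inj_on_def)
  \<comment> \<open>At 0 the quotient \<open>h z / z\<close> is completed by the derivative, which
    is nonzero as \<open>h\<close> is injective. Being bounded away from 0 near 0, \<open>f\<close>
    is bounded near infinity by the relation \<open>fanti\<close>.\<close>
  define f where "f z = (if z = 0 then deriv h 0 else h z / z)" for z
  have fhol: "f holomorphic_on UNIV"
    by (rule pole_theorem_open_0[OF hol open_UNIV, where a = 0]) (auto simp: f_def h0)
  have fanti: "f (- 1 / cnj z) * cnj (f z) = 1" if "z \<noteq> 0" for z
    using that hanti[OF that] hnz[OF that] unfolding f_def by (simp add: divide_simps)
  have f0: "f 0 \<noteq> 0" using d0 unfolding f_def by simp
  have cont: "isCont f 0"
    using fhol by (meson UNIV_I continuous_on_eq_continuous_at holomorphic_on_imp_continuous_on open_UNIV)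
  then have "\<forall>\<^sub>F w in nhds 0. cmod (f 0) / 2 < cmod (f w)"
  proof -
    have "((\<lambda>w. cmod (f w)) \<longlongrightarrow> cmod (f 0)) (nhds 0)"
      using cont by (simp add: isCont_def tendsto_at_iff_tendsto_nhds tendsto_norm)
    moreover have "cmod (f 0) / 2 < cmod (f 0)" using f0 by simp
    ultimately show ?thesis by (rule order_tendstoD(1))
  qed
  then obtain e where e: "e > 0" "\<And>w. dist w 0 < e \<Longrightarrow> cmod (f 0) / 2 < cmod (f w)"
    unfolding eventually_nhds_metric by blast
  have far: "cmod (f z) \<le> 2 / cmod (f 0)" if "cmod z > 1 / e" for z
  proof -
    have z: "z \<noteq> 0" using that e by auto
    have "cmod (- 1 / cnj z) < e" using that e z by (simp add: norm_divide field_simps)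
    then have lt: "cmod (f 0) / 2 < cmod (f (- 1 / cnj z))" using e(2) by simp
    have "cmod (f (- 1 / cnj z)) * cmod (f z) = 1"
      using arg_cong[OF fanti[OF z], of cmod] by (simp add: norm_mult)
    then have "cmod (f 0) / 2 * cmod (f z) \<le> 1"
      using lt by (metis less_imp_le mult_right_mono norm_ge_zero)
    then show ?thesis using f0 by (simp add: field_simps)
  qed
  have "bounded (range f)"
  proof -
    have "compact (f ` cball 0 (1 / e))"
      using fhol holomorphic_on_imp_continuous_on holomorphic_on_subset
      by (intro compact_continuous_image) (auto intro: continuous_on_subset)
    then have "bounded (f ` cball 0 (1 / e))" by (rule compact_imp_bounded)
    moreover have "bounded (cball 0 (2 / cmod (f 0)) :: complex set)" by simp
    moreover have "range f \<subseteq> f ` cball 0 (1 / e) \<union> cball 0 (2 / cmod (f 0))"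
      by (auto simp: image_iff) (metis far not_le mem_cball_0)
    ultimately show ?thesis using bounded_subset bounded_Un by metis
  qed
  then obtain c where c: "\<And>z. f z = c"
    using Liouville_theorem[OF fhol] unfolding constant_on_def by auto
  have "c * cnj c = 1" using fanti[of 1] c by simp
  then have c1: "cmod c = 1"
    by (metis complex_norm_square norm_ge_zero of_real_eq_1_iff power2_eq_1_iff zero_neq_one
        neg_0_le_iff_le not_one_le_zero)
  then have cnz: "c \<noteq> 0" by auto
  have hc: "h z = c * z" for z
    using c[of z] h0 unfolding f_def by (cases "z = 0") (auto simp: field_simps)
  have "g (pt a b) = pt a (c * b)" if ab: "(a, b) \<noteq> (0, 0)" for a b
  proof (cases "a = 0")
    case True
    then have "pt a b = aff1 0" "pt a (c * b) = aff1 0"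
      using ab cnz by (auto simp: aff_pt pt_eq_iff)
    then show ?thesis using ginf by simp
  next
    case False
    then show ?thesis by (simp add: pt_aff0 h hc)
  qed
  then show ?thesis using that c1 by blast
qed

section \<open>Complex linear algebra on complexifications\<close>

text \<open>The complex structure lives on the whole product type, with \<open>E \<times> E\<close>
  as subspaces. Total complex linear maps on the ambient type are therefore easier to handle than
  elements of \<open>Hom\<close>, and maps on a subspace are replaced by linear extensions.\<close>

interpretation cx: vector_space "cscale :: complex \<Rightarrow> 'a::real_vector \<times> 'a \<Rightarrow> 'a \<times> 'a"
  by standard (auto simp: cscale_def algebra_simps)

interpretation cxp: vector_space_pair
  "cscale :: complex \<Rightarrow> 'a::real_vector \<times> 'a \<Rightarrow> 'a \<times> 'a"
  "cscale :: complex \<Rightarrow> 'b::real_vector \<times> 'b \<Rightarrow> 'b \<times> 'b"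
  by standard

interpretation cxf: vector_space_pair
  "cscale :: complex \<Rightarrow> 'a::real_vector \<times> 'a \<Rightarrow> 'a \<times> 'a" "(*) :: complex \<Rightarrow> complex \<Rightarrow> complex"
  by standard

abbreviation clin :: "('a::real_vector \<times> 'a \<Rightarrow> 'b::real_vector \<times> 'b) \<Rightarrow> bool" where
  "clin \<equiv> Vector_Spaces.linear cscale cscale"

abbreviation cfun :: "('a::real_vector \<times> 'a \<Rightarrow> complex) \<Rightarrow> bool" where
  "cfun \<equiv> Vector_Spaces.linear cscale (*)"

lemma clinI:
  "(\<And>x y. f (x + y) = f x + f y) \<Longrightarrow> (\<And>c x. f (cscale c x) = cscale c (f x)) \<Longrightarrow> clin f"
  by (simp add: Vector_Spaces.linear_iff cx.vector_space_axioms)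

lemma cfunI:
  "(\<And>x y. f (x + y) = f x + f y) \<Longrightarrow> (\<And>c x. f (cscale c x) = c * f x) \<Longrightarrow> cfun f"
  unfolding Vector_Spaces.linear_iff
  by (intro conjI cx.vector_space_axioms allI) (unfold_locales, auto simp: algebra_simps)

lemma clin_map_prod:
  assumes "linear f"
  shows "clin (map_prod f f)"
  by (rule clinI)
    (auto simp: cscale_def map_prod_def linear_add[OF assms] linear_diff[OF assms] linear_scale[OF assms])

lemma clinD:
  assumes "clin f"
  shows "f (x + y) = f x + f y" "f (x - y) = f x - f y" "f (cscale c x) = cscale c (f x)"
    "f 0 = 0" "f (- x) = - f x"
  using cxp.linear_add[OF assms] cxp.linear_diff[OF assms] cxp.linear_scale[OF assms]
    cxp.linear_0[OF assms] cxp.linear_neg[OF assms] by auto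

lemma cfunD:
  assumes "cfun f"
  shows "f (x + y) = f x + f y" "f (x - y) = f x - f y" "f (cscale c x) = c * f x"
    "f 0 = 0" "f (sum h I) = (\<Sum>i\<in>I. f (h i))"
  using cxf.linear_add[OF assms] cxf.linear_diff[OF assms] cxf.linear_scale[OF assms]
    cxf.linear_0[OF assms] cxf.linear_sum[OF assms] by auto

lemma clin_add: "clin f \<Longrightarrow> clin g \<Longrightarrow> clin (\<lambda>x. f x + g x)"
  by (rule clinI) (auto simp: clinD cx.scale_right_distrib)

lemma clin_scale: "clin f \<Longrightarrow> clin (\<lambda>x. cscale c (f x))"
  by (rule clinI) (auto simp: clinD cx.scale_right_distrib mult.commute)

lemma clin_neg: "clin f \<Longrightarrow> clin (\<lambda>x. - f x)"
  by (rule clinI) (auto simp: clinD cx.scale_minus_right)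

lemma clin_comp: "clin f \<Longrightarrow> clin g \<Longrightarrow> clin (\<lambda>x. g (f x))"
  by (rule clinI) (auto simp: clinD)

lemma cfun_comp: "clin f \<Longrightarrow> cfun g \<Longrightarrow> cfun (\<lambda>x. g (f x))"
  by (rule cfunI) (auto simp: clinD cfunD)

lemma cfun_separates:
  assumes "\<And>l. cfun l \<Longrightarrow> l x = 0"
  shows "x = 0"
proof (rule ccontr)
  assume "x \<noteq> 0"
  then have "cx.independent {x}" by simp
  then obtain l where "cfun l" "l x = 1"
    using cxf.linear_independent_extend[of "{x}" "\<lambda>_. 1"] by auto
  then show False using assms by force
qed

lemma span_image_lessThan:
  "x \<in> cx.span (f ` {..<n::nat}) \<Longrightarrow> \<exists>a. x = (\<Sum>i<n. cscale (a i) (f i))"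
proof (induction n arbitrary: x)
  case (Suc n)
  then have "x \<in> cx.span (insert (f n) (f ` {..<n}))"
    by (simp add: lessThan_Suc)
  then obtain k where "x - cscale k (f n) \<in> cx.span (f ` {..<n})"
    using cx.span_breakdown_eq by blast
  then obtain a where a: "x - cscale k (f n) = (\<Sum>i<n. cscale (a i) (f i))"
    using Suc.IH by blast
  have "x = (\<Sum>i<n. cscale (a i) (f i)) + cscale k (f n)"
    using a by (simp add: algebra_simps)
  also have "\<dots> = (\<Sum>i<Suc n. cscale ((a(n := k)) i) (f i))"
    by simp
  finally show ?case by (rule exI[of _ "a(n := k)"])
qed simp

lemma finite_dim_basis:
  assumes "cx.subspace W" "finite D" "W \<subseteq> cx.span D"
  obtains B where "finite B" "B \<subseteq> W" "cx.independent B" "cx.span B = W"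
proof -
  obtain B where B: "B \<subseteq> W" "cx.independent B" "W \<subseteq> cx.span B"
    using cx.basis_exists[of W] by metis
  then have "finite B"
    using cx.independent_span_bound[of D B] assms by auto
  moreover have "cx.span B = W"
    using B assms(1) cx.span_minimal by blast
  ultimately show ?thesis using that B by blast
qed

lemma dual_basis:
  assumes "cx.subspace W" "finite D" "W \<subseteq> cx.span D"
  obtains B \<nu> where "finite B" "B \<subseteq> W" "\<And>d. d \<in> B \<Longrightarrow> cfun (\<nu> d)"
    "\<And>d e. d \<in> B \<Longrightarrow> e \<in> B \<Longrightarrow> \<nu> d e = (if e = d then 1 else 0)"
    "\<And>x. x \<in> W \<Longrightarrow> x = (\<Sum>d\<in>B. cscale (\<nu> d x) d)"
proof -
  obtain B where B: "finite B" "B \<subseteq> W" "cx.independent B" "cx.span B = W"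
    using finite_dim_basis assms by metis
  have "\<exists>l. cfun l \<and> (\<forall>e\<in>B. l e = (if e = d then 1 else 0))" for d
    using cxf.linear_independent_extend[OF B(3), of "\<lambda>e. if e = d then 1 else 0"] by blast
  then obtain \<nu> where \<nu>: "\<And>d. cfun (\<nu> d)" "\<And>d e. e \<in> B \<Longrightarrow> \<nu> d e = (if e = d then 1 else 0)"
    by metis
  have "x = (\<Sum>d\<in>B. cscale (\<nu> d x) d)" if "x \<in> W" for x
  proof -
    have "x \<in> range (\<lambda>a. \<Sum>d\<in>B. cscale (a d) d)"
      using that unfolding B(4)[symmetric] cx.span_finite[OF B(1)] .
    then obtain a where a: "x = (\<Sum>d\<in>B. cscale (a d) d)"
      by (rule rangeE)
    have "\<nu> d x = a d" if "d \<in> B" for d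
    proof -
      have "\<nu> d x = (\<Sum>e\<in>B. a e * \<nu> d e)"
        unfolding a cfunD(5)[OF \<nu>(1)] cfunD(3)[OF \<nu>(1)] ..
      also have "\<dots> = (\<Sum>e\<in>B. if e = d then a e else 0)"
        by (rule sum.cong) (simp_all add: \<nu>(2))
      also have "\<dots> = a d" using that B(1) by simp
      finally show ?thesis .
    qed
    then have "(\<Sum>d\<in>B. cscale (\<nu> d x) d) = (\<Sum>d\<in>B. cscale (a d) d)"
      by (intro sum.cong) simp_all
    then show ?thesis using a by simp
  qed
  then show ?thesis using that[OF B(1,2), of \<nu>] \<nu> by blast
qed

subsection \<open>Annihilating products of linear factors\<close>

text \<open>The product of the factors \<open>M - c\<close>. An annihilating polynomial is kept as
  the list of its roots because the later inductions treat or remove one factor at a time.\<close>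

fun annih :: "('a::real_vector \<times> 'a \<Rightarrow> 'a \<times> 'a) \<Rightarrow> complex list \<Rightarrow> 'a \<times> 'a \<Rightarrow> 'a \<times> 'a" where
  "annih M [] w = w"
| "annih M (c # cs) w = M (annih M cs w) - cscale c (annih M cs w)"

lemma annih_append: "annih M (cs @ ds) w = annih M cs (annih M ds w)"
  by (induction cs) auto

lemma clin_annih: "clin M \<Longrightarrow> clin (annih M cs)"
proof (induction cs)
  case Nil
  then show ?case by (auto intro: clinI)
next
  case (Cons c cs)
  then show ?case
    by (intro clinI) (simp_all add: clinD algebra_simps cx.scale_right_distrib
        cx.scale_right_diff_distrib mult.commute[of c])
qed

lemma annih_commute: "clin M \<Longrightarrow> annih M cs (M w) = M (annih M cs w)"
  by (induction cs) (auto simp: clinD)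

lemma annih_swap: "clin M \<Longrightarrow> annih M cs (annih M ds w) = annih M ds (annih M cs w)"
  by (induction cs) (auto simp: clinD clin_annih annih_commute)

text \<open>The iterates of \<open>w\<close> lie in a finite dimensional space, so one of them
  depends linearly on its predecessors. This relation is a monic polynomial in \<open>M\<close> that
  kills \<open>w\<close>, and over the complex numbers it splits into linear factors.\<close>

lemma cyclic_annih:
  assumes M: "clin M" and D: "finite D" "\<And>i. (M ^^ i) w \<in> cx.span D"
  obtains cs where "annih M cs w = 0"
proof -
  define f where "f i = (M ^^ i) w" for i
  have "\<exists>n. f n \<in> cx.span (f ` {..<n})"
  proof (rule ccontr)
    assume no: "\<nexists>n. f n \<in> cx.span (f ` {..<n})"
    have ind: "cx.independent (f ` {..<n}) \<and> card (f ` {..<n}) = n" for n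
    proof (induction n)
      case (Suc n)
      have "f n \<notin> f ` {..<n}" using no cx.span_base[of "f n" "f ` {..<n}"] by blast
      then show ?case
        using Suc no by (simp add: lessThan_Suc cx.independent_insert)
    qed (simp add: cx.dependent_def)
    have "f ` {..<Suc (card D)} \<subseteq> cx.span D" using D(2) unfolding f_def by blast
    then have "card (f ` {..<Suc (card D)}) \<le> card D"
      using cx.independent_span_bound[OF D(1)] ind by blast
    then show False using ind[of "Suc (card D)"] by linarith
  qed
  then obtain n a where na: "f n = (\<Sum>i<n. cscale (a i) (f i))"
    using span_image_lessThan by metis
  \<comment> \<open>The polynomial \<open>p\<close> evaluated at \<open>M\<close> and applied to
    \<open>w\<close>; multiplication by the variable becomes application of
    \<open>M\<close>.\<close>
  define pm where "pm p = (\<Sum>i\<le>degree p. cscale (coeff p i) (f i))" for p :: "complex poly"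
  have pm_ge: "pm p = (\<Sum>i\<le>N. cscale (coeff p i) (f i))" if "degree p \<le> N" for p N
    unfolding pm_def using that
    by (intro sum.mono_neutral_left) (auto simp: coeff_eq_0)
  have pm_diff: "pm (p - q) = pm p - pm q" for p q
    using pm_ge[of p "max (degree p) (degree q)"] pm_ge[of q "max (degree p) (degree q)"]
      pm_ge[of "p - q" "max (degree p) (degree q)"] degree_diff_le_max[of p q]
    by (simp add: cx.scale_left_diff_distrib sum_subtractf)
  have pm_smult: "pm (smult c p) = cscale c (pm p)" for c p
    using pm_ge[of "smult c p" "degree p"] pm_ge[of p "degree p"]
    by (simp add: cx.scale_sum_right)
  have pm_shift: "pm (pCons 0 p) = M (pm p)" for p
  proof -
    have "pm (pCons 0 p) = (\<Sum>i\<le>Suc (degree p). cscale (coeff (pCons 0 p) i) (f i))"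
      by (rule pm_ge) (simp add: degree_pCons_le)
    also have "\<dots> = (\<Sum>i\<le>degree p. cscale (coeff p i) (f (Suc i)))"
      by (subst sum.atMost_Suc_shift) simp
    also have "\<dots> = M (pm p)"
      unfolding pm_def cxp.linear_sum[OF M] by (simp add: f_def clinD[OF M])
    finally show ?thesis .
  qed
  have pm_prod: "pm (prod_list (map (\<lambda>c. [:- c, 1:]) cs) * p) = annih M cs (pm p)" for cs p
  proof (induction cs)
    case (Cons c cs)
    have "[:- c, 1:] * q = pCons 0 q - smult c q" for q :: "complex poly"
      by simp
    then have "prod_list (map (\<lambda>c. [:- c, 1:]) (c # cs)) * p =
        pCons 0 (prod_list (map (\<lambda>c. [:- c, 1:]) cs) * p) - smult c (prod_list (map (\<lambda>c. [:- c, 1:]) cs) * p)"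
      by (simp only: list.map prod_list.Cons mult.assoc left_diff_distrib mult_pCons_left
          mult_smult_left smult_0_left add_0)
    then show ?case
      using Cons by (simp only: pm_diff pm_shift pm_smult annih.simps)
  qed simp
  \<comment> \<open>The monic polynomial that encodes the relation \<open>na\<close> among the
    iterates.\<close>
  define p where "p = monom 1 n - (\<Sum>i<n. monom (a i) i)"
  have cp: "coeff p i = (if i = n then 1 else if i < n then - a i else 0)" for i
  proof -
    have "(\<Sum>j<n. coeff (monom (a j) j) i) = (\<Sum>j<n. if j = i then a j else 0)"
      by (rule sum.cong) simp_all
    then show ?thesis unfolding p_def by (simp add: coeff_sum)
  qed
  have "p \<noteq> 0" using cp[of n] by auto
  have "degree p \<le> n" by (rule degree_le) (auto simp: cp)
  then have "pm p = (\<Sum>i\<le>n. cscale (coeff p i) (f i))" by (rule pm_ge)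
  also have "\<dots> = (\<Sum>i<n. cscale (coeff p i) (f i)) + f n"
    by (simp add: lessThan_Suc_atMost[symmetric] cp)
  also have "(\<Sum>i<n. cscale (coeff p i) (f i)) = - f n"
    unfolding na by (simp add: cp sum_negf[symmetric])
  finally have pm0: "pm p = 0" by simp
  obtain A where A: "p = smult (lead_coeff p) (\<Prod>x\<in>#A. [:- x, 1:])"
    using alg_closed_imp_factorization[OF \<open>p \<noteq> 0\<close>] by blast
  obtain cs where cs: "mset cs = A" using ex_mset by blast
  have "(\<Prod>x\<in>#mset cs. [:- x, 1:]) = prod_list (map (\<lambda>c. [:- c, 1:]) cs)"
    by (induction cs) auto
  then have p: "p = smult (lead_coeff p) (prod_list (map (\<lambda>c. [:- c, 1:]) cs) * 1)"
    using A unfolding cs[symmetric] by simp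
  have "pm 1 = w" unfolding pm_def by (simp add: f_def)
  then have "pm p = cscale (lead_coeff p) (annih M cs w)"
    using p pm_smult pm_prod by metis
  then show ?thesis using that pm0 \<open>p \<noteq> 0\<close> by simp
qed

text \<open>Factors of the form \<open>M - c\<close> commute, so the concatenation of the lists for
  the vectors of a basis kills all of them.\<close>

lemma annihilating_list:
  assumes M: "clin M" and W: "cx.subspace W" "finite D" "W \<subseteq> cx.span D" "M ` W \<subseteq> W"
  obtains cs where "\<And>w. w \<in> W \<Longrightarrow> annih M cs w = 0"
proof -
  obtain B where B: "finite B" "B \<subseteq> W" "cx.span B = W"
    using finite_dim_basis W by metis
  have pow: "(M ^^ i) w \<in> W" if "w \<in> W" for w i
    using that W(4) by (induction i) auto
  have "\<exists>cs. \<forall>w\<in>B'. annih M cs w = 0" if "finite B'" "B' \<subseteq> W" for B'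
    using that
  proof (induction B')
    case (insert w B')
    then obtain cs where cs: "\<forall>w\<in>B'. annih M cs w = 0" by auto
    obtain ds where ds: "annih M ds w = 0"
      using cyclic_annih[OF M W(2), of w] pow insert.prems W(3) by blast
    have "annih M (cs @ ds) w = 0"
      by (simp add: annih_append ds clinD(4)[OF clin_annih[OF M]])
    moreover have "annih M (cs @ ds) v = 0" if "v \<in> B'" for v
      using cs that by (simp add: annih_append annih_swap[OF M, of cs ds] clinD(4)[OF clin_annih[OF M]])
    ultimately show ?case by blast
  qed simp
  from this[OF B(1,2)] obtain cs where cs: "\<And>w. w \<in> B \<Longrightarrow> annih M cs w = 0" by blast
  have "annih M cs w = 0" if "w \<in> W" for w
    using cxp.linear_eq_0_on_span[OF clin_annih[OF M] cs] that B(3) by blast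
  then show ?thesis using that by blast
qed

text \<open>Applying the factors one after another to \<open>w\<close>, the last vector before 0
  appears is an eigenvector.\<close>

lemma eigenvector_of_annih:
  assumes "annih M cs w = 0" "w \<noteq> 0" "w \<in> W" "M ` W \<subseteq> W" "cx.subspace W"
  obtains v c where "v \<in> W" "v \<noteq> 0" "M v = cscale c v"
proof -
  have "annih M cs w \<in> W \<and> (annih M cs w = 0 \<longrightarrow> (\<exists>v\<in>W. \<exists>c. v \<noteq> 0 \<and> M v = cscale c v))" for cs
  proof (induction cs)
    case (Cons c cs)
    have "annih M (c # cs) w \<in> W"
      using Cons assms(4,5) by (auto intro!: cx.subspace_diff cx.subspace_scale)
    moreover have "\<exists>v\<in>W. \<exists>c. v \<noteq> 0 \<and> M v = cscale c v" if "annih M (c # cs) w = 0"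
      using Cons that by (cases "annih M cs w = 0") auto
    ultimately show ?case by blast
  qed (use assms in auto)
  then show ?thesis using assms(1) that by blast
qed

text \<open>It plays the role of the determinant of \<open>a - b M\<close>. As a form of degree
  \<open>length cs\<close> it has a zero set that depends only on the point
  \<open>pt a b\<close>.\<close>

definition lfac :: "complex list \<Rightarrow> complex \<Rightarrow> complex \<Rightarrow> complex" where
  "lfac cs a b = (\<Prod>c\<leftarrow>cs. a - b * c)"

text \<open>\<open>resol M cs a b / lfac cs a b\<close> is the inverse of \<open>a - b M\<close> when \<open>cs\<close> annihilates \<open>M\<close>.\<close>

fun resol :: "('a::real_vector \<times> 'a \<Rightarrow> 'a \<times> 'a) \<Rightarrow> complex list \<Rightarrow> complex \<Rightarrow> complex \<Rightarrow> 'a \<times> 'a \<Rightarrow> 'a \<times> 'a"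
  where
  "resol M [] a b y = 0"
| "resol M (c # cs) a b y =
     cscale (lfac cs a b) y + cscale b (M (resol M cs a b y) - cscale c (resol M cs a b y))"

lemma lfac_simps [simp]: "lfac [] a b = 1" "lfac (c # cs) a b = (a - b * c) * lfac cs a b"
  by (simp_all add: lfac_def)

text \<open>The products of the \<open>a - b c\<close> and of the \<open>b M - b c\<close> agree
  modulo \<open>a - b M\<close>; \<open>resol\<close> is the quotient of their difference by
  \<open>a - b M\<close>, built up one factor at a time.\<close>

lemma resol_inverse:
  assumes "clin M"
  shows "resol M cs a b (cscale a y - cscale b (M y)) =
    cscale (lfac cs a b) y - cscale (b ^ length cs) (annih M cs y)"
proof (induction cs)
  case (Cons c cs)
  show ?case
    unfolding resol.simps Cons
    by (simp add: clinD[OF assms] cx.scale_right_distrib cx.scale_right_diff_distrib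
        cx.scale_left_diff_distrib algebra_simps)
qed simp

lemma clin_resol: "clin M \<Longrightarrow> clin (resol M cs a b)"
proof (induction cs)
  case Nil
  then show ?case by (auto intro: clinI)
next
  case (Cons c cs)
  then show ?case
    by (intro clinI) (simp_all add: clinD algebra_simps cx.scale_right_distrib
        cx.scale_right_diff_distrib)
qed

lemma lfac_homogeneous: "lfac cs (t * a) (t * b) = t ^ length cs * lfac cs a b"
  by (induction cs) (auto simp: algebra_simps)

text \<open>The degree of \<open>resol\<close> is one less than the length of the list; the extra
  factor \<open>t\<close> on the left keeps subtraction of natural numbers out of the
  exponent.\<close>

lemma resol_homogeneous:
  assumes "clin M"
  shows "cscale t (resol M cs (t * a) (t * b) y) = cscale (t ^ length cs) (resol M cs a b y)"
proof (induction cs)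
  case (Cons c cs)
  have "cscale t (resol M (c # cs) (t * a) (t * b) y) =
      cscale (t * lfac cs (t * a) (t * b)) y + cscale (t * b) (M (cscale t (resol M cs (t * a) (t * b) y))
        - cscale c (cscale t (resol M cs (t * a) (t * b) y)))"
    by (simp add: clinD[OF assms] cx.scale_right_distrib cx.scale_right_diff_distrib mult_ac)
  also have "\<dots> = cscale (t ^ length (c # cs)) (resol M (c # cs) a b y)"
    unfolding Cons lfac_homogeneous
    by (simp add: clinD[OF assms] cx.scale_right_distrib cx.scale_right_diff_distrib mult_ac)
  finally show ?case .
qed simp

lemma resol_in:
  assumes "cx.subspace W" "M ` W \<subseteq> W" "y \<in> W"
  shows "resol M cs a b y \<in> W"
proof (induction cs)
  case (Cons c cs)
  then have "M (resol M cs a b y) \<in> W" using assms(2) by blast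
  then show ?case
    using Cons assms by (auto intro!: cx.subspace_add cx.subspace_diff cx.subspace_scale)
qed (use assms cx.subspace_0 in auto)

subsection \<open>Weakly holomorphic vector valued functions\<close>

text \<open>The ambient space has no topology and may be infinite dimensional, so holomorphy of
  vector valued functions is tested by complex linear functionals. By \<open>cfun_separates\<close>
  these also detect equality.\<close>

definition vhol :: "(cp1 \<Rightarrow> 'a::real_vector \<times> 'a) \<Rightarrow> cp1 \<Rightarrow> bool" where
  "vhol u p \<longleftrightarrow> (\<forall>l. cfun l \<longrightarrow> hol_at (\<lambda>q. l (u q)) p)"

lemma vholD: "vhol u p \<Longrightarrow> cfun l \<Longrightarrow> hol_at (\<lambda>q. l (u q)) p"
  by (simp add: vhol_def)

lemma hol_at_poly: "hol_at f p \<Longrightarrow> hol_at (\<lambda>q. poly r (f q)) p"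
  by (induction r) (simp_all add: hol_at_add hol_at_mult)

lemma hol_at_transfer: "hol_at h p \<Longrightarrow> \<forall>\<^sub>F q in nhds p. h q = k q \<Longrightarrow> hol_at k p"
  using hol_at_cong by blast

lemma vhol_const: "vhol (\<lambda>_. x) p"
  by (simp add: vhol_def)

lemma vhol_add: "vhol u p \<Longrightarrow> vhol v p \<Longrightarrow> vhol (\<lambda>q. u q + v q) p"
  by (auto simp: vhol_def cfunD)

lemma vhol_diff: "vhol u p \<Longrightarrow> vhol v p \<Longrightarrow> vhol (\<lambda>q. u q - v q) p"
  by (auto simp: vhol_def cfunD)

lemma vhol_scale: "hol_at f p \<Longrightarrow> vhol v p \<Longrightarrow> vhol (\<lambda>q. cscale (f q) (v q)) p"
  by (auto simp: vhol_def cfunD)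

lemma vhol_sum: "(\<And>i. i \<in> I \<Longrightarrow> vhol (u i) p) \<Longrightarrow> vhol (\<lambda>q. \<Sum>i\<in>I. u i q) p"
  by (induction I rule: infinite_finite_induct) (auto intro: vhol_const vhol_add)

lemma vhol_clin: "clin f \<Longrightarrow> vhol v p \<Longrightarrow> vhol (\<lambda>q. f (v q)) p"
  by (auto simp: vhol_def dest: cfun_comp)

lemmas vhol_intros = vhol_const vhol_add vhol_diff vhol_scale vhol_sum

lemma vhol_cong:
  assumes "\<forall>\<^sub>F q in nhds p. u q = v q"
  shows "vhol u p \<longleftrightarrow> vhol v p"
proof -
  have "hol_at (\<lambda>q. l (u q)) p = hol_at (\<lambda>q. l (v q)) p" for l :: "'a \<times> 'a \<Rightarrow> complex"
    by (rule hol_at_cong) (use assms in eventually_elim, simp)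
  then show ?thesis unfolding vhol_def by simp
qed

lemma hol_at_lfac: "hol_at a p \<Longrightarrow> hol_at b p \<Longrightarrow> hol_at (\<lambda>q. lfac cs (a q) (b q)) p"
  by (induction cs) (simp_all add: hol_at_mult hol_at_diff)

lemma vhol_resol:
  assumes "clin M" "hol_at a p" "hol_at b p" "vhol u p"
  shows "vhol (\<lambda>q. resol M cs (a q) (b q) (u q)) p"
proof (induction cs)
  case (Cons c cs)
  show ?case
    unfolding resol.simps
    by (intro vhol_add vhol_scale vhol_diff vhol_clin[OF assms(1)] hol_at_lfac assms Cons hol_at_const)
qed (simp add: vhol_const)

section \<open>Pencils of linear maps\<close>

text \<open>An injective bundle map from \<open>W\<close> tensored with the tautological line bundle
  to a trivial bundle; \<open>inj\<close> is injectivity in each fibre. The fibre of the target is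
  the whole ambient space, and a subspace of it is named only in the results that need one.\<close>

locale pencil =
  fixes W :: "('e::real_vector \<times> 'e) set" and A B :: "'e \<times> 'e \<Rightarrow> 'u::real_vector \<times> 'u"
  assumes sub: "cx.subspace W" and fin: "\<exists>D. finite D \<and> W \<subseteq> cx.span D"
    and linA: "clin A" and linB: "clin B"
    and inj: "\<And>a b w. (a, b) \<noteq> (0, 0) \<Longrightarrow> w \<in> W \<Longrightarrow> cscale a (A w) + cscale b (B w) = 0 \<Longrightarrow> w = 0"
begin

lemma inj_A: "inj_on A W"
proof (rule inj_onI)
  fix v w assume vw: "v \<in> W" "w \<in> W" "A v = A w"
  have "cscale 1 (A (v - w)) + cscale 0 (B (v - w)) = 0"
    using vw by (simp add: clinD[OF linA])
  then show "v = w"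
    using inj[of 1 0 "v - w"] vw sub cx.subspace_diff by fastforce
qed

text \<open>After composition with a left inverse \<open>\<pi>\<close> of \<open>A\<close> the
  pencil becomes \<open>a - b M\<close> with \<open>M = - \<pi> B\<close> mapping \<open>W\<close>
  to itself, and \<open>resol\<close> inverts this up to the scalar \<open>lfac\<close>.\<close>

lemma left_inverse:
  obtains \<pi> cs where "clin \<pi>" "\<And>x. \<pi> x \<in> W" "\<And>w. w \<in> W \<Longrightarrow> \<pi> (A w) = w"
    "\<And>w. w \<in> W \<Longrightarrow> annih (\<lambda>x. - \<pi> (B x)) cs w = 0" "clin (\<lambda>x. - \<pi> (B x))"
    "\<And>a b w. w \<in> W \<Longrightarrow>
      resol (\<lambda>x. - \<pi> (B x)) cs a b (\<pi> (cscale a (A w) + cscale b (B w))) = cscale (lfac cs a b) w"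
    "\<And>a b x. resol (\<lambda>x. - \<pi> (B x)) cs a b (\<pi> x) \<in> W"
proof -
  obtain \<pi> where \<pi>: "range \<pi> \<subseteq> W" "clin \<pi>" "\<And>w. w \<in> W \<Longrightarrow> \<pi> (A w) = w"
    using cxp.linear_exists_left_inverse_on[OF linA sub inj_A] by blast
  define M where "M = (\<lambda>x. - \<pi> (B x))"
  have linM: "clin M" unfolding M_def using clin_neg[OF clin_comp[OF linB \<pi>(2)]] .
  have MW: "M ` W \<subseteq> W" unfolding M_def using \<pi>(1) sub cx.subspace_neg by blast
  obtain cs where cs: "\<And>w. w \<in> W \<Longrightarrow> annih M cs w = 0"
    using annihilating_list[OF linM sub _ _ MW] fin by blast
  have "resol M cs a b (\<pi> (cscale a (A w) + cscale b (B w))) = cscale (lfac cs a b) w"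
    if "w \<in> W" for a b w
  proof -
    have "\<pi> (cscale a (A w) + cscale b (B w)) = cscale a w - cscale b (M w)"
      unfolding M_def using \<pi>(3)[OF that] by (simp add: clinD[OF \<pi>(2)] cx.scale_minus_right)
    then show ?thesis using resol_inverse[OF linM] cs[OF that] by simp
  qed
  moreover have "resol M cs a b (\<pi> x) \<in> W" for a b x
    using resol_in[OF sub MW] \<pi>(1) by blast
  ultimately show ?thesis using that[of \<pi> cs] \<pi> cs linM unfolding M_def by blast
qed

definition img :: "cp1 \<Rightarrow> ('u \<times> 'u) set" where
  "img p = {cscale a (A w) + cscale b (B w) |a b w. (a, b) \<noteq> (0, 0) \<and> p = pt a b \<and> w \<in> W}"

lemma img_pt:
  assumes "(a, b) \<noteq> (0, 0)"
  shows "img (pt a b) = {cscale a (A w) + cscale b (B w) |w. w \<in> W}"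
proof
  show "{cscale a (A w) + cscale b (B w) |w. w \<in> W} \<subseteq> img (pt a b)"
    unfolding img_def using assms by blast
  show "img (pt a b) \<subseteq> {cscale a (A w) + cscale b (B w) |w. w \<in> W}"
  proof
    fix x assume "x \<in> img (pt a b)"
    then obtain c d w where *: "(c, d) \<noteq> (0, 0)" "pt a b = pt c d" "w \<in> W"
      "x = cscale c (A w) + cscale d (B w)" unfolding img_def by blast
    obtain k where k: "k \<noteq> 0" "a = k * c" "b = k * d"
      using pt_eqE[OF *(2) assms *(1)] by blast
    have "x = cscale a (A (cscale (1 / k) w)) + cscale b (B (cscale (1 / k) w))"
      unfolding *(4) clinD(3)[OF linA] clinD(3)[OF linB] using k by simp
    then show "x \<in> {cscale a (A w) + cscale b (B w) |w. w \<in> W}"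
      using *(3) sub cx.subspace_scale by blast
  qed
qed

lemma img_ptI: "w \<in> W \<Longrightarrow> (a, b) \<noteq> (0, 0) \<Longrightarrow> cscale a (A w) + cscale b (B w) \<in> img (pt a b)"
  using img_pt by blast

lemma img_subspace: "cx.subspace (img p)"
proof -
  obtain a b where ab: "(a, b) \<noteq> (0, 0)" "p = pt a b" by (rule pt_exhaust)
  have "clin (\<lambda>w. cscale a (A w) + cscale b (B w))"
    by (intro clin_add clin_scale linA linB)
  then have "cx.subspace ((\<lambda>w. cscale a (A w) + cscale b (B w)) ` W)"
    using cxp.linear_subspace_image sub by blast
  then show ?thesis
    unfolding ab(2) img_pt[OF ab(1)] Setcompr_eq_image .
qed

text \<open>The scalar \<open>lfac\<close> in \<open>left_inverse\<close> may vanish at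
  \<open>p\<close>. A linear change of the coordinates of the pencil moves \<open>p\<close> to
  \<open>[1 : 0]\<close>, where \<open>lfac\<close> has the value 1.\<close>

lemma local_left_inverse:
  assumes ab: "hol_at a p" "hol_at b p" "(a p, b p) \<noteq> (0, 0)"
  obtains P Q where "hol_at P p" "P p \<noteq> 0" "\<And>u. vhol u p \<Longrightarrow> vhol (\<lambda>q. Q q (u q)) p"
    "\<And>q x. Q q x \<in> W"
    "\<And>q w. w \<in> W \<Longrightarrow> Q q (cscale (a q) (A w) + cscale (b q) (B w)) = cscale (P q) w"
proof -
  define a0 b0 N where "a0 = a p" and "b0 = b p" and "N = a p * cnj (a p) + b p * cnj (b p)"
  have "N = complex_of_real ((cmod (a p))\<^sup>2 + (cmod (b p))\<^sup>2)"
    unfolding a0_def b0_def N_def by (simp only: complex_norm_square of_real_add)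
  moreover have "(cmod (a p))\<^sup>2 + (cmod (b p))\<^sup>2 \<noteq> 0"
    using ab(3) by (auto simp: sum_power2_eq_zero_iff)
  ultimately have N: "N \<noteq> 0" by (metis of_real_eq_0_iff)
  \<comment> \<open>The rows \<open>(a0, b0)\<close> and \<open>(- cnj b0, cnj a0)\<close> form a
    matrix of determinant \<open>N\<close>, which is nonzero. In the new coordinates
    \<open>(s, t)\<close> the point \<open>p\<close> is \<open>(1, 0)\<close>.\<close>
  define A' where "A' w = cscale a0 (A w) + cscale b0 (B w)" for w
  define B' where "B' w = cscale (- cnj b0) (A w) + cscale (cnj a0) (B w)" for w
  define s where "s q = (a q * cnj a0 + b q * cnj b0) / N" for q
  define t where "t q = (b q * a0 - a q * b0) / N" for q
  have st: "s q * a0 - t q * cnj b0 = a q" "s q * b0 + t q * cnj a0 = b q" for q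
  proof -
    have "(s q * a0 - t q * cnj b0) * N = a q * N"
      unfolding s_def t_def using N by (simp add: field_simps) (simp add: a0_def b0_def N_def algebra_simps)
    then show "s q * a0 - t q * cnj b0 = a q" using N by simp
    have "(s q * b0 + t q * cnj a0) * N = b q * N"
      unfolding s_def t_def using N by (simp add: field_simps) (simp add: a0_def b0_def N_def algebra_simps)
    then show "s q * b0 + t q * cnj a0 = b q" using N by simp
  qed
  have change: "cscale (s q * k) (A' w) + cscale (t q * k) (B' w) = cscale k (cscale (a q) (A w) + cscale (b q) (B w))" for q k w
    unfolding A'_def B'_def st(1)[symmetric] st(2)[symmetric]
    by (simp add: cx.scale_right_distrib cx.scale_left_distrib cx.scale_left_diff_distrib cx.scale_minus_left algebra_simps)
  interpret P': pencil W A' B'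
  proof (rule pencil.intro)
    show "clin A'" "clin B'"
      unfolding A'_def B'_def by (intro clin_add clin_scale linA linB)+
    fix c d w assume cd: "(c, d) \<noteq> (0, 0)" "w \<in> W" "cscale c (A' w) + cscale d (B' w) = 0"
    have "cscale (c * a0 - d * cnj b0) (A w) + cscale (c * b0 + d * cnj a0) (B w) = 0"
      using cd(3) unfolding A'_def B'_def
      by (simp add: cx.scale_right_distrib cx.scale_left_distrib cx.scale_left_diff_distrib cx.scale_minus_left algebra_simps)
    moreover have "(c * a0 - d * cnj b0, c * b0 + d * cnj a0) \<noteq> (0, 0)"
    proof
      assume "(c * a0 - d * cnj b0, c * b0 + d * cnj a0) = (0, 0)"
      then have eq: "c * a0 = d * cnj b0" "c * b0 = - (d * cnj a0)"
        by (auto simp: eq_neg_iff_add_eq_0)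
      have "c * N = (c * a0) * cnj a0 + (c * b0) * cnj b0"
        by (simp add: a0_def b0_def N_def algebra_simps)
      then have "c = 0" unfolding eq using N by simp
      have "d * N = (d * cnj a0) * a0 + (d * cnj b0) * b0"
        by (simp add: a0_def b0_def N_def algebra_simps)
      also have "\<dots> = 0" using eq \<open>c = 0\<close> by auto
      finally have "d = 0" using N by simp
      then show False using cd \<open>c = 0\<close> by simp
    qed
    ultimately show "w = 0" using inj cd by blast
  qed (use sub fin in auto)
  obtain \<pi> cs where lin\<pi>: "clin \<pi>" and "\<And>x. \<pi> x \<in> W" "\<And>w. w \<in> W \<Longrightarrow> \<pi> (A' w) = w"
    "\<And>w. w \<in> W \<Longrightarrow> annih (\<lambda>x. - \<pi> (B' x)) cs w = 0" and \<pi>: "clin (\<lambda>x. - \<pi> (B' x))"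
    "\<And>a b w. w \<in> W \<Longrightarrow>
      resol (\<lambda>x. - \<pi> (B' x)) cs a b (\<pi> (cscale a (A' w) + cscale b (B' w))) = cscale (lfac cs a b) w"
    "\<And>a b x. resol (\<lambda>x. - \<pi> (B' x)) cs a b (\<pi> x) \<in> W"
    by (rule P'.left_inverse) (rule that)
  define Q where "Q q x = resol (\<lambda>x. - \<pi> (B' x)) cs (s q) (t q) (\<pi> x)" for q x
  have hst: "hol_at s p" "hol_at t p"
    unfolding s_def t_def using N by (simp_all add: hol_at_divide hol_at_add hol_at_diff hol_at_mult ab)
  have "s p = 1" "t p = 0"
    using N unfolding s_def t_def by (simp_all add: a0_def b0_def N_def)
  then have "lfac cs (s p) (t p) = 1"
    by (induction cs) auto
  moreover have "Q q (cscale (a q) (A w) + cscale (b q) (B w)) = cscale (lfac cs (s q) (t q)) w"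
    if "w \<in> W" for q w
    using \<pi>(2)[OF that, of "s q" "t q"] change[of q 1 w] unfolding Q_def by simp
  moreover have "vhol (\<lambda>q. Q q (u q)) p" if "vhol u p" for u
    unfolding Q_def by (rule vhol_resol[OF \<pi>(1) hst vhol_clin[OF lin\<pi> that]])
  moreover have "Q q x \<in> W" for q x unfolding Q_def by (rule \<pi>(3))
  ultimately show ?thesis
    using that[of "\<lambda>q. lfac cs (s q) (t q)" Q] hol_at_lfac[OF hst] by simp
qed

text \<open>With the local left inverse \<open>Q\<close>, membership of \<open>y\<close> in the
  image is the vanishing of the holomorphic expression \<open>P y - (a A + b B) (Q y)\<close>. It
  vanishes off \<open>p\<close>, hence also at \<open>p\<close>.\<close>

lemma img_closed:
  assumes y: "vhol y p" and ev: "\<forall>\<^sub>F q in nhds p. q \<noteq> p \<longrightarrow> y q \<in> img q"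
  shows "y p \<in> img p"
proof -
  obtain a b where ab: "hol_at a p" "hol_at b p" "(a p, b p) \<noteq> (0, 0)"
      and hc: "\<forall>\<^sub>F q in nhds p. (a q, b q) \<noteq> (0, 0) \<and> q = pt (a q) (b q)"
    by (rule homogeneous_coordinates)
  obtain P Q where PQ: "hol_at P p" "P p \<noteq> 0" "\<And>u. vhol u p \<Longrightarrow> vhol (\<lambda>q. Q q (u q)) p"
    "\<And>q x. Q q x \<in> W"
    "\<And>q w. w \<in> W \<Longrightarrow> Q q (cscale (a q) (A w) + cscale (b q) (B w)) = cscale (P q) w"
    by (rule local_left_inverse[OF ab]) (rule that)
  define g where "g q = cscale (P q) (y q) - (cscale (a q) (A (Q q (y q))) + cscale (b q) (B (Q q (y q))))" for q
  have vg: "vhol g p"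
    unfolding g_def by (intro vhol_intros vhol_clin[OF linA] vhol_clin[OF linB] PQ(1,3) ab y)
  have "\<forall>\<^sub>F q in nhds p. q \<noteq> p \<longrightarrow> g q = 0"
    using ev hc
  proof eventually_elim
    case (elim q)
    show ?case
    proof
      assume "q \<noteq> p"
      then have "y q \<in> img (pt (a q) (b q))" using elim by auto
      then obtain w where w: "w \<in> W" "y q = cscale (a q) (A w) + cscale (b q) (B w)"
        using img_pt elim by blast
      show "g q = 0"
        unfolding g_def w(2) PQ(5)[OF w(1)] clinD(3)[OF linA] clinD(3)[OF linB]
        by (simp add: cx.scale_right_distrib mult.commute)
    qed
  qed
  note gz = this
  have "l (g p) = 0" if "cfun l" for l
  proof (rule isolated_limit_zero)
    show "hol_at (\<lambda>q. l (g q)) p" using vg that by (rule vholD)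
    show "\<forall>\<^sub>F q in nhds p. q \<noteq> p \<longrightarrow> l (g q) = 0"
      using gz
      by eventually_elim (auto simp: cfunD(4)[OF that])
  qed
  then have "g p = 0" using cfun_separates by blast
  then have "cscale (P p) (y p) = cscale (a p) (A (Q p (y p))) + cscale (b p) (B (Q p (y p)))"
    unfolding g_def by simp
  then have "cscale (P p) (y p) \<in> img (pt (a p) (b p))"
    unfolding img_pt[OF ab(3)] using PQ(4) by blast
  then have "cscale (P p) (y p) \<in> img p"
    using eventually_nhds_at_point[OF hc] by simp
  then have "cscale (1 / P p) (cscale (P p) (y p)) \<in> img p"
    using img_subspace cx.subspace_scale by blast
  then show ?thesis using PQ(2) by simp
qed

text \<open>The tautological bundle has no nonzero sections: writing
  \<open>y = z A (f z) + B (f z)\<close> determines an entire function \<open>f\<close> that tends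
  to 0 at infinity, so Liouville gives \<open>f = 0\<close>.\<close>

lemma img_Inter:
  assumes y: "\<And>q. y \<in> img q"
  shows "y = 0"
proof -
  have "\<exists>w. w \<in> W \<and> y = cscale z (A w) + cscale 1 (B w)" for z
    using y[of "pt z 1"] by (subst (asm) img_pt) auto
  then obtain f where f: "\<And>z. f z \<in> W" "\<And>z. y = cscale z (A (f z)) + cscale 1 (B (f z))"
    by metis
  have "l (f 0) = 0" if l: "cfun l" for l
  proof (rule Liouville_weak_0[of "\<lambda>z. l (f z)" 0])
    have "(\<lambda>z. l (f z)) analytic_on {z}" for z
    proof -
      obtain P Q where PQ: "hol_at P (aff1 z)" "P (aff1 z) \<noteq> 0"
        "\<And>u. vhol u (aff1 z) \<Longrightarrow> vhol (\<lambda>q. Q q (u q)) (aff1 z)" 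
        "\<And>q w. w \<in> W \<Longrightarrow> Q q (cscale (inv aff1 q) (A w) + cscale 1 (B w)) = cscale (P q) w"
        by (rule local_left_inverse[of "inv aff1" "aff1 z" "\<lambda>_. 1"]) (auto simp: hol_at_inv_chart)
      have "hol_at (\<lambda>q. l (Q q y) / P q) (aff1 z)"
        by (rule hol_at_divide[OF vholD[OF PQ(3)[OF vhol_const] l] PQ(1,2)])
      moreover have "\<forall>\<^sub>F q in nhds (aff1 z). l (Q q y) / P q = l (f (inv aff1 q))"
        using hol_at_nonzero[OF PQ(1,2)]
      proof eventually_elim
        case (elim q)
        have "Q q y = cscale (P q) (f (inv aff1 q))"
          using PQ(4)[OF f(1), of q "inv aff1 q"] f(2)[of "inv aff1 q"] by simp
        then show ?case using elim cfunD(3)[OF l] by simp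
      qed
      ultimately have "hol_at (\<lambda>q. l (f (inv aff1 q))) (aff1 z)"
        by (rule hol_at_transfer)
      then show ?thesis by (simp add: hol_at_chart inv_chart)
    qed
    then show "(\<lambda>z. l (f z)) holomorphic_on UNIV"
      using analytic_on_analytic_at analytic_imp_holomorphic by blast
    obtain P Q where PQ: "hol_at P (aff0 0)" "P (aff0 0) \<noteq> 0"
      "\<And>u. vhol u (aff0 0) \<Longrightarrow> vhol (\<lambda>q. Q q (u q)) (aff0 0)"
      "\<And>q w. w \<in> W \<Longrightarrow> Q q (cscale 1 (A w) + cscale (inv aff0 q) (B w)) = cscale (P q) w"
      by (rule local_left_inverse[of "\<lambda>_. 1" "aff0 0" "inv aff0"]) (auto simp: hol_at_inv_chart)
    \<comment> \<open>With \<open>t = 1 / z\<close> the vector \<open>f z\<close> is obtained by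
      applying the local left inverse to \<open>t y\<close>, which vanishes at \<open>t = 0\<close>.
      This is the decay of \<open>f\<close> at infinity.\<close>
    define G where "G q = l (Q q (cscale (inv aff0 q) y)) / P q" for q
    have "hol_at G (aff0 0)"
      unfolding G_def
      by (rule hol_at_divide[OF vholD[OF PQ(3)[OF vhol_scale[OF _ vhol_const]] l] PQ(1,2)])
        (simp add: hol_at_inv_chart)
    then have "(\<lambda>t. G (aff0 t)) analytic_on {0}" by (simp add: hol_at_chart)
    then have "(\<lambda>t. G (aff0 t)) \<midarrow>0\<rightarrow> G (aff0 0)"
      using analytic_at_imp_isCont isCont_def by blast
    moreover have "G (aff0 0) = 0"
    proof -
      have "Q (aff0 0) 0 = 0"
        using PQ(4)[of 0 "aff0 0"] cx.subspace_0[OF sub] by (simp add: clinD[OF linA] clinD[OF linB])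
      then show ?thesis unfolding G_def by (simp add: inv_chart cfunD(4)[OF l])
    qed
    moreover have "\<forall>\<^sub>F t in at 0. G (aff0 t) = ((\<lambda>z. l (f z)) \<circ> inverse) t"
    proof -
      have "\<forall>\<^sub>F q in nhds (aff0 0). P q \<noteq> 0" using hol_at_nonzero PQ by blast
      then have "\<forall>\<^sub>F t in nhds 0. P (aff0 t) \<noteq> 0"
        unfolding nhds_chart[OF chart01(1)] eventually_filtermap .
      then show ?thesis
        unfolding eventually_at_filter
      proof eventually_elim
        case (elim t)
        show ?case
        proof (intro impI)
          assume t: "t \<noteq> 0"
          have "cscale t y = cscale 1 (A (f (inverse t))) + cscale t (B (f (inverse t)))"
            by (subst f(2)[of "inverse t"]) (simp add: cx.scale_right_distrib t)
          then have "Q (aff0 t) (cscale t y) = cscale (P (aff0 t)) (f (inverse t))"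
            using PQ(4)[OF f(1), of "aff0 t" "inverse t"] by (simp add: inv_chart)
          then show "G (aff0 t) = ((\<lambda>z. l (f z)) \<circ> inverse) t"
            using elim unfolding G_def by (simp add: inv_chart cfunD(3)[OF l])
        qed
      qed
    qed
    ultimately have "((\<lambda>z. l (f z)) \<circ> inverse) \<midarrow>0\<rightarrow> 0"
      using tendsto_cong by fastforce
    then show "((\<lambda>z. l (f z)) \<longlongrightarrow> 0) at_infinity"
      by (simp add: lim_at_infinity_0)
  qed
  then have "f 0 = 0" using cfun_separates by blast
  then show ?thesis using f(2)[of 0] by (simp add: clinD[OF linA] clinD[OF linB])
qed

text \<open>If \<open>A\<close> were onto, \<open>B\<close> would factor through \<open>A\<close> as
  an endomorphism of \<open>W\<close>, and the pencil would degenerate at an eigenvalue of it. This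
  is what positivity of the degree amounts to here.\<close>

lemma not_onto:
  assumes "w0 \<in> W" "w0 \<noteq> 0" "B ` W \<subseteq> UC"
  shows "A ` W \<noteq> UC"
proof
  assume eq: "A ` W = UC"
  obtain \<pi> cs where \<pi>: "clin \<pi>" "\<And>x. \<pi> x \<in> W" "\<And>w. w \<in> W \<Longrightarrow> \<pi> (A w) = w"
    "\<And>w. w \<in> W \<Longrightarrow> annih (\<lambda>x. - \<pi> (B x)) cs w = 0"
    using left_inverse by metis
  have "(\<lambda>x. - \<pi> (B x)) ` W \<subseteq> W" using \<pi>(2) sub cx.subspace_neg by blast
  then obtain v c where v: "v \<in> W" "v \<noteq> 0" "- \<pi> (B v) = cscale c v"
    using eigenvector_of_annih[OF \<pi>(4)[OF assms(1)] assms(2,1) _ sub] by metis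
  obtain v' where v': "v' \<in> W" "B v = A v'" using v(1) assms(3) eq by blast
  have "v' = - cscale c v" using v(3) v' \<pi>(3) by (metis minus_minus)
  then have "cscale c (A v) + cscale 1 (B v) = 0"
    unfolding v'(2) by (simp add: clinD[OF linA])
  then show False using inj[of c 1 v] v by auto
qed

text \<open>
  A global section is \<open>v z / lfac cs z 1\<close> modulo the image, with \<open>v\<close> a vector polynomial of degree
  at most the length of \<open>cs\<close>; the factors of the denominator are then removed one at a time.
\<close>

theorem constant_section:
  assumes UC: "cx.subspace UC" "finite D0" "UC \<subseteq> cx.span D0"
    and AB: "A ` W \<subseteq> UC" "B ` W \<subseteq> UC"
    and loc: "\<And>p. \<exists>u. vhol u p \<and> (\<forall>\<^sub>F q in nhds p. u q \<in> UC \<and> u q \<in> \<sigma> q)"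
    and coset: "\<And>q x y. x \<in> \<sigma> q \<Longrightarrow> y \<in> \<sigma> q \<longleftrightarrow> y - x \<in> img q"
  shows "\<exists>u\<in>UC. \<forall>q. u \<in> \<sigma> q"
proof -
  obtain \<pi> cs where lin\<pi>: "clin \<pi>" and "\<And>x. \<pi> x \<in> W" "\<And>w. w \<in> W \<Longrightarrow> \<pi> (A w) = w"
    "\<And>w. w \<in> W \<Longrightarrow> annih (\<lambda>x. - \<pi> (B x)) cs w = 0" and linM: "clin (\<lambda>x. - \<pi> (B x))"
    and res: "\<And>a b w. w \<in> W \<Longrightarrow>
      resol (\<lambda>x. - \<pi> (B x)) cs a b (\<pi> (cscale a (A w) + cscale b (B w))) = cscale (lfac cs a b) w"
    and resW: "\<And>a b x. resol (\<lambda>x. - \<pi> (B x)) cs a b (\<pi> x) \<in> W"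
    by (rule left_inverse) (rule that)
  define n where "n = length cs"
  define Q where "Q a b x = resol (\<lambda>x. - \<pi> (B x)) cs a b (\<pi> x)" for a b x
  \<comment> \<open>\<open>V a b\<close> kills the fibre of the image at \<open>pt a b\<close>, so
    it depends only on the coset; and it sends a vector into \<open>lfac\<close> times its own
    coset.\<close>
  define V where "V a b x = cscale (lfac cs a b) x - (cscale a (A (Q a b x)) + cscale b (B (Q a b x)))"
    for a b x
  have linQ: "clin (Q a b)" for a b
    unfolding Q_def by (rule clin_comp[OF lin\<pi> clin_resol[OF linM]])
  have linV: "V a b (x - y) = V a b x - V a b y" for a b x y
    unfolding V_def
    by (simp add: clinD[OF linQ] clinD[OF linA] clinD[OF linB] cx.scale_right_diff_distrib)
  have V_img: "V a b x = V a b y" if ab: "(a, b) \<noteq> (0, 0)" "x - y \<in> img (pt a b)" for a b x y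
  proof -
    obtain w where w: "w \<in> W" "x - y = cscale a (A w) + cscale b (B w)"
      using ab(2) unfolding img_pt[OF ab(1)] by blast
    have "V a b (x - y) = 0"
      unfolding w(2) V_def Q_def res[OF w(1)]
      by (simp add: clinD[OF linA] clinD[OF linB] cx.scale_right_distrib mult.commute)
    then show ?thesis using linV by simp
  qed
  have V_hom: "V (t * a) (t * b) x = cscale (t ^ n) (V a b x)" for t a b x
  proof -
    have h: "cscale t (Q (t * a) (t * b) x) = cscale (t ^ n) (Q a b x)"
      unfolding Q_def n_def by (rule resol_homogeneous[OF linM])
    have "cscale (t * a) (A (Q (t * a) (t * b) x)) = cscale a (A (cscale t (Q (t * a) (t * b) x)))"
      "cscale (t * b) (B (Q (t * a) (t * b) x)) = cscale b (B (cscale t (Q (t * a) (t * b) x)))"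
      by (simp_all add: clinD[OF linA] clinD[OF linB] mult.commute)
    then show ?thesis
      unfolding V_def h lfac_homogeneous n_def[symmetric]
      by (simp add: clinD[OF linA] clinD[OF linB] cx.scale_right_distrib cx.scale_right_diff_distrib mult_ac)
  qed
  have vhol_V: "vhol (\<lambda>q. V (a q) (b q) (u q)) p" if "hol_at a p" "hol_at b p" "vhol u p" for a b u p
  proof -
    have "vhol (\<lambda>q. Q (a q) (b q) (u q)) p"
      unfolding Q_def by (rule vhol_resol[OF linM that(1,2) vhol_clin[OF lin\<pi> that(3)]])
    then show ?thesis
      unfolding V_def
      by (intro vhol_intros vhol_clin[OF linA] vhol_clin[OF linB] hol_at_lfac that)
  qed
  have "\<exists>x. x \<in> UC \<and> x \<in> \<sigma> q" for q
    using loc[of q] eventually_nhds_at_point by blast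
  then obtain X where X: "\<And>q. X q \<in> UC" "\<And>q. X q \<in> \<sigma> q" by metis
  have loc_X: "\<exists>u. vhol u p \<and> (\<forall>\<^sub>F q in nhds p. u q - X q \<in> img q)" for p
  proof -
    obtain u where u: "vhol u p" "\<forall>\<^sub>F q in nhds p. u q \<in> UC \<and> u q \<in> \<sigma> q" using loc by blast
    from u(2) have "\<forall>\<^sub>F q in nhds p. u q - X q \<in> img q"
      by eventually_elim (use coset X(2) in blast)
    then show ?thesis using u(1) by blast
  qed
  have ABW: "A w \<in> UC" "B w \<in> UC" if "w \<in> W" for w
    using AB that by blast+
  obtain D \<nu> where D: "finite D" "D \<subseteq> UC" and lin\<nu>: "\<And>d. d \<in> D \<Longrightarrow> cfun (\<nu> d)"
    and \<nu>: "\<And>d e. d \<in> D \<Longrightarrow> e \<in> D \<Longrightarrow> \<nu> d e = (if e = d then 1 else 0)"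
    and exp: "\<And>x. x \<in> UC \<Longrightarrow> x = (\<Sum>d\<in>D. cscale (\<nu> d x) d)"
    by (rule dual_basis[OF UC]) (rule that)
  have \<nu>_sum: "\<nu> d (\<Sum>e\<in>D. cscale (k e) e) = k d" if "d \<in> D" for d k
  proof -
    have "\<nu> d (\<Sum>e\<in>D. cscale (k e) e) = (\<Sum>e\<in>D. if e = d then k e else 0)"
      unfolding cfunD(5)[OF lin\<nu>[OF that]] cfunD(3)[OF lin\<nu>[OF that]]
      by (rule sum.cong) (simp_all add: \<nu>[OF that])
    then show ?thesis using D(1) that by simp
  qed
  have img_cong: "x - cscale k (X q) \<in> img q \<longleftrightarrow> x - cscale k u \<in> img q" if "u - X q \<in> img q" for x k u q
  proof -
    have "cscale k (u - X q) \<in> img q" using that img_subspace cx.subspace_scale by blast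
    then have "x - cscale k (X q) - cscale k (u - X q) \<in> img q \<longleftrightarrow> x - cscale k (X q) \<in> img q"
      using cx.subspace_diff[OF img_subspace] cx.subspace_add[OF img_subspace] by (metis diff_add_cancel)
    then show ?thesis by (simp add: cx.scale_right_diff_distrib)
  qed
  \<comment> \<open>The representatives \<open>X\<close> are arbitrary choices, but \<open>v\<close>
    is holomorphic: near each point \<open>X\<close> may be replaced by a holomorphic representative
    without changing \<open>V\<close>.\<close>
  define v where "v z = V z 1 (X (aff1 z))" for z
  have v_UC: "v z \<in> UC" for z
    unfolding v_def V_def Q_def
    by (intro cx.subspace_diff cx.subspace_add cx.subspace_scale UC X ABW resW)
  have v_img: "v z - cscale (lfac cs z 1) (X (aff1 z)) \<in> img (aff1 z)" for z
  proof -
    have "v z - cscale (lfac cs z 1) (X (aff1 z)) =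
        - (cscale z (A (Q z 1 (X (aff1 z)))) + cscale 1 (B (Q z 1 (X (aff1 z)))))"
      unfolding v_def V_def by simp
    also have "\<dots> \<in> img (pt z 1)"
      by (rule cx.subspace_neg[OF img_subspace]) (rule img_ptI, simp_all add: Q_def resW)
    finally show ?thesis unfolding aff_pt .
  qed
  have poly_v: "\<exists>h. degree h \<le> n \<and> (\<forall>z. \<nu> d (v z) = poly h z)" if d: "d \<in> D" for d
  proof -
    have an: "(\<lambda>z. \<nu> d (v z)) analytic_on {z}" for z
    proof -
      obtain u where u: "vhol u (aff1 z)" "\<forall>\<^sub>F q in nhds (aff1 z). u q - X q \<in> img q"
        using loc_X by blast
      have "hol_at (\<lambda>q. \<nu> d (V (inv aff1 q) 1 (u q))) (aff1 z)"
        by (rule vholD[OF vhol_V lin\<nu>[OF d]]) (use u in \<open>auto simp: hol_at_inv_chart\<close>)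
      then have "(\<lambda>w. \<nu> d (V w 1 (u (aff1 w)))) analytic_on {z}"
        by (simp add: hol_at_chart inv_chart)
      moreover have "\<forall>\<^sub>F w in nhds z. u (aff1 w) - X (aff1 w) \<in> img (aff1 w)"
        using u(2) unfolding nhds_chart[OF chart01(2)] eventually_filtermap .
      then have "\<forall>\<^sub>F w in nhds z. \<nu> d (V w 1 (u (aff1 w))) = \<nu> d (v w)"
        by eventually_elim (use V_img in \<open>auto simp: v_def aff_pt\<close>)
      from analytic_at_cong[OF this refl]
      have "(\<lambda>w. \<nu> d (V w 1 (u (aff1 w)))) analytic_on {z} \<longleftrightarrow> (\<lambda>z. \<nu> d (v z)) analytic_on {z}" .
      ultimately show ?thesis by blast
    qed
    then have hol: "(\<lambda>z. \<nu> d (v z)) holomorphic_on UNIV"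
      using analytic_on_analytic_at analytic_imp_holomorphic by blast
    obtain u where u: "vhol u (aff0 0)" "\<forall>\<^sub>F q in nhds (aff0 0). u q - X q \<in> img q"
      using loc_X by blast
    define G where "G t = \<nu> d (V 1 t (u (aff0 t)))" for t
    have "hol_at (\<lambda>q. \<nu> d (V 1 (inv aff0 q) (u q))) (aff0 0)"
      by (rule vholD[OF vhol_V lin\<nu>[OF d]]) (use u in \<open>auto simp: hol_at_inv_chart\<close>)
    then have "G analytic_on {0}"
      unfolding G_def by (simp add: hol_at_chart inv_chart)
    then have "(G \<longlongrightarrow> G 0) (nhds 0)"
      by (metis analytic_at_imp_isCont isCont_def tendsto_at_iff_tendsto_nhds)
    then have ev1: "\<forall>\<^sub>F t in nhds 0. G t \<in> ball (G 0) 1"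
      by (rule topological_tendstoD) auto
    have ev2: "\<forall>\<^sub>F t in nhds 0. u (aff0 t) - X (aff0 t) \<in> img (aff0 t)"
      using u(2) unfolding nhds_chart[OF chart01(1)] eventually_filtermap .
    from ev1 ev2 have "\<forall>\<^sub>F t in nhds 0. cmod (G t) \<le> cmod (G 0) + 1 \<and> u (aff0 t) - X (aff0 t) \<in> img (aff0 t)"
    proof eventually_elim
      case (elim t)
      then show ?case using norm_triangle_ineq2[of "G t" "G 0"] by (auto simp: dist_norm norm_minus_commute)
    qed
    then obtain e where e: "e > 0" "\<And>t. dist t 0 < e \<Longrightarrow>
        cmod (G t) \<le> cmod (G 0) + 1 \<and> u (aff0 t) - X (aff0 t) \<in> img (aff0 t)"
      unfolding eventually_nhds_metric by blast
    \<comment> \<open>Homogeneity of degree \<open>n\<close> relates \<open>V z 1\<close> to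
      \<open>V 1 (1 / z)\<close>, which stays bounded near the point at infinity. An entire function
      with this growth is a polynomial of degree at most \<open>n\<close>.\<close>
    have bound: "cmod (\<nu> d (v z)) \<le> (cmod (G 0) + 1) * cmod z ^ n" if "2 / e \<le> cmod z" for z
    proof -
      have z: "z \<noteq> 0" using that e(1) by auto
      define t where "t = 1 / z"
      have "1 / e < cmod z" using that e(1) by (simp add: field_simps)
      then have t: "dist t 0 < e" "z * t = 1" 
        using z e(1) unfolding t_def by (auto simp: norm_divide field_simps)
      have "aff1 z = aff0 t"
        using aff0_eq_aff1_iff[of t z] t(2) by (simp add: mult.commute)
      then have "v z = V (z * 1) (z * t) (X (aff0 t))" unfolding v_def by (simp add: t(2))
      also have "\<dots> = cscale (z ^ n) (V 1 t (u (aff0 t)))"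
        unfolding V_hom using e(2)[OF t(1)] V_img[of 1 t "u (aff0 t)" "X (aff0 t)"] by (simp add: aff_pt)
      finally have "\<nu> d (v z) = z ^ n * G t"
        unfolding G_def by (simp add: cfunD(3)[OF lin\<nu>[OF d]])
      then have "cmod (\<nu> d (v z)) = cmod z ^ n * cmod (G t)" by (simp add: norm_mult norm_power)
      also have "\<dots> \<le> cmod z ^ n * (cmod (G 0) + 1)"
        using e(2)[OF t(1)] by (intro mult_left_mono) auto
      finally show ?thesis by (simp add: mult.commute)
    qed
    define h where "h = (\<Sum>k\<le>n. monom ((deriv ^^ k) (\<lambda>z. \<nu> d (v z)) 0 / fact k) k)"
    have "\<nu> d (v z) = poly h z" for z
      using Liouville_polynomial[OF hol bound] unfolding h_def by (simp add: poly_sum poly_monom)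
    moreover have "degree h \<le> n"
      unfolding h_def by (rule degree_sum_le) (auto intro: order_trans[OF degree_monom_le])
    ultimately show ?thesis by blast
  qed
  \<comment> \<open>Induction on the factors left in the denominator. At a root \<open>c\<close> the
    numerator lies in the image, say as \<open>c A w + B w\<close>; subtracting the section
    \<open>z A w + B w\<close> of the image does not change the class and leaves a numerator
    divisible by \<open>z - c\<close>.\<close>
  have descent: "\<exists>u\<in>UC. \<forall>z. u - X (aff1 z) \<in> img (aff1 z)"
    if "\<And>d. d \<in> D \<Longrightarrow> degree (h d) \<le> length cs'"
      "\<And>z. (\<Sum>d\<in>D. cscale (poly (h d) z) d) - cscale (lfac cs' z 1) (X (aff1 z)) \<in> img (aff1 z)"
    for h cs'
    using that
  proof (induction cs' arbitrary: h)
    case Nil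
    define u where "u = (\<Sum>d\<in>D. cscale (coeff (h d) 0) d)"
    have const: "poly (h d) z = coeff (h d) 0" if "d \<in> D" for d z
    proof -
      have "degree (h d) = 0" using Nil(1)[OF that] by simp
      then show ?thesis by (metis degree_eq_zeroE poly_pCons poly_0 mult_zero_right add.right_neutral coeff_pCons_0)
    qed
    have "(\<Sum>d\<in>D. cscale (poly (h d) z) d) = u" for z
      unfolding u_def by (rule sum.cong) (simp_all add: const)
    then have "u - X (aff1 z) \<in> img (aff1 z)" for z
      using Nil(2)[of z] by simp
    moreover have "u \<in> UC"
      unfolding u_def using D(2) UC(1) by (auto intro!: cx.subspace_sum cx.subspace_scale)
    ultimately show ?case by blast
  next
    case (Cons c cs')
    define y where "y z = (\<Sum>d\<in>D. cscale (poly (h d) z) d)" for z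
    have "y c \<in> img (pt c 1)"
      using Cons.prems(2)[of c] unfolding y_def aff_pt by simp
    then obtain w where w: "w \<in> W" "y c = cscale c (A w) + cscale 1 (B w)"
      using img_pt[of c 1] by auto
    define g where "g d = h d - [:\<nu> d (B w), \<nu> d (A w):]" for d
    have "poly (g d) c = 0" if "d \<in> D" for d
    proof -
      have "poly (h d) c = \<nu> d (y c)" unfolding y_def \<nu>_sum[OF that] ..
      then show ?thesis
        unfolding g_def w(2) cfunD(1)[OF lin\<nu>[OF that]] cfunD(3)[OF lin\<nu>[OF that]] by simp
    qed
    then have "\<exists>k. g d = [:- c, 1:] * k" if "d \<in> D" for d
      using that poly_eq_0_iff_dvd unfolding dvd_def by blast
    then obtain h' where h': "\<And>d. d \<in> D \<Longrightarrow> g d = [:- c, 1:] * h' d" by metis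
    have deg: "degree (h' d) \<le> length cs'" if "d \<in> D" for d
    proof (cases "h' d = 0")
      case False
      have "degree (g d) \<le> max (degree (h d)) (degree [:\<nu> d (B w), \<nu> d (A w):])"
        unfolding g_def by (rule degree_diff_le_max)
      \<comment> \<open>The subtracted polynomial is linear, and the list is nonempty, so the degree
        bound survives the subtraction; division then lowers it by one.\<close>
      also have "\<dots> \<le> Suc (length cs')"
        using Cons.prems(1)[OF that] by (auto simp: degree_pCons_le)
      finally show ?thesis
        unfolding h'[OF that] using False degree_mult_eq[of "[:- c, 1:]" "h' d"] by simp
    qed simp
    define y' where "y' z = (\<Sum>d\<in>D. cscale (poly (h' d) z) d)" for z
    have yy': "cscale (z - c) (y' z) = y z - (cscale z (A w) + cscale 1 (B w))" for z
    proof -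
      have "cscale (z - c) (y' z) = (\<Sum>d\<in>D. cscale (poly (g d) z) d)"
        unfolding y'_def cx.scale_sum_right by (rule sum.cong) (simp_all add: h' algebra_simps)
      also have "\<dots> = y z - (\<Sum>d\<in>D. cscale (\<nu> d (cscale z (A w) + cscale 1 (B w))) d)"
        unfolding y_def sum_subtractf[symmetric] g_def
        by (rule sum.cong) (simp_all add: cfunD(1,3)[OF lin\<nu>] cx.scale_left_diff_distrib[symmetric])
      also have "(\<Sum>d\<in>D. cscale (\<nu> d (cscale z (A w) + cscale 1 (B w))) d) = cscale z (A w) + cscale 1 (B w)"
        by (rule exp[symmetric]) (intro cx.subspace_add cx.subspace_scale UC ABW w)
      finally show ?thesis .
    qed
    have ne: "y' z - cscale (lfac cs' z 1) (X (aff1 z)) \<in> img (aff1 z)" if "z \<noteq> c" for z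
    proof -
      have "cscale (z - c) (y' z - cscale (lfac cs' z 1) (X (aff1 z))) =
          (y z - cscale (lfac (c # cs') z 1) (X (aff1 z))) - (cscale z (A w) + cscale 1 (B w))"
        unfolding cx.scale_right_diff_distrib yy' by (simp add: algebra_simps)
      also have "\<dots> \<in> img (aff1 z)"
      proof (rule cx.subspace_diff[OF img_subspace])
        show "cscale z (A w) + cscale 1 (B w) \<in> img (aff1 z)"
          unfolding aff_pt by (rule img_ptI[OF w(1)]) simp
      qed (use Cons.prems(2)[of z] y_def in simp)
      finally have "cscale (1 / (z - c)) (cscale (z - c) (y' z - cscale (lfac cs' z 1) (X (aff1 z)))) \<in> img (aff1 z)"
        using img_subspace cx.subspace_scale by blast
      then show ?thesis using that by simp
    qed
    have "y' z - cscale (lfac cs' z 1) (X (aff1 z)) \<in> img (aff1 z)" for z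
    proof (cases "z = c")
      \<comment> \<open>At the root itself division is impossible, and the claim follows from the
        neighbouring points by closedness of the image.\<close>
      case True
      obtain u where u: "vhol u (aff1 z)" "\<forall>\<^sub>F q in nhds (aff1 z). u q - X q \<in> img q"
        using loc_X by blast
      define k where "k q = y' (inv aff1 q) - cscale (lfac cs' (inv aff1 q) 1) (u q)" for q
      have poly_hol: "hol_at (\<lambda>q. poly r (inv aff1 q)) (aff1 z)" for r
        by (rule hol_at_poly) (simp add: hol_at_inv_chart)
      have "vhol k (aff1 z)"
        unfolding k_def y'_def
        by (intro vhol_intros hol_at_lfac poly_hol u hol_at_const) (simp add: hol_at_inv_chart)
      moreover have "\<forall>\<^sub>F q in nhds (aff1 z). q \<noteq> aff1 z \<longrightarrow> k q \<in> img q"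
        unfolding nhds_chart[OF chart01(2)] eventually_filtermap
        using u(2)[unfolded nhds_chart[OF chart01(2)] eventually_filtermap]
      proof eventually_elim
        case (elim w)
        show ?case
          using ne[of w] img_cong[OF elim, of "y' w" "lfac cs' w 1"] True
          by (simp add: k_def inv_chart aff1_inj)
      qed
      ultimately have "k (aff1 z) \<in> img (aff1 z)" by (rule img_closed)
      then show ?thesis
        using img_cong[of "u (aff1 z)" "aff1 z"] eventually_nhds_at_point[OF u(2)]
        unfolding k_def by (simp add: inv_chart)
    qed (use ne in blast)
    then show ?case
      using Cons.IH[of h'] deg unfolding y'_def by blast
  qed
  obtain h where h: "\<And>d. d \<in> D \<Longrightarrow> degree (h d) \<le> n" "\<And>d z. d \<in> D \<Longrightarrow> \<nu> d (v z) = poly (h d) z"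
    using poly_v by metis
  have "(\<Sum>d\<in>D. cscale (poly (h d) z) d) = v z" for z
    by (subst exp[OF v_UC]) (simp add: h(2)[symmetric] cong: sum.cong)
  then obtain u where u: "u \<in> UC" "\<And>z. u - X (aff1 z) \<in> img (aff1 z)"
    using descent[of h cs] h(1) v_img unfolding n_def by auto
  have "u - X q \<in> img q" for q
  proof (cases rule: aff1_cases[of q])
    \<comment> \<open>The point at infinity is again reached by closedness, from all points of the
      affine chart.\<close>
    case (2)
    obtain u' where u': "vhol u' q" "\<forall>\<^sub>F q in nhds q. u' q - X q \<in> img q"
      using loc_X by blast
    have "\<forall>\<^sub>F q' in nhds q. q' \<noteq> q \<longrightarrow> u - u' q' \<in> img q'"
      using u'(2)
    proof eventually_elim
      case (elim q')
      show ?case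
      proof
        assume "q' \<noteq> q"
        then obtain z where "q' = aff1 z" using 2 by (metis aff1_cases)
        then have "u - X q' \<in> img q'" using u(2) by simp
        then show "u - u' q' \<in> img q'"
          using img_cong[OF elim, of u 1] by simp
      qed
    qed
    then have "u - u' q \<in> img q"
      by (rule img_closed[OF vhol_diff[OF vhol_const u'(1)]])
    then show ?thesis
      using img_cong[OF eventually_nhds_at_point[OF u'(2)], of u 1] by simp
  qed (use u in simp)
  then show ?thesis using u(1) coset X(2) by blast
qed

end

section \<open>Quaternions and the Hopf fibration\<close>

text \<open>In four real coordinates the laws of quaternion multiplication become polynomial
  identities.\<close>

definition Q4 :: "real \<Rightarrow> real \<Rightarrow> real \<Rightarrow> real \<Rightarrow> quat" where
  "Q4 a b c d = (a, vector [b, c, d])"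

lemma vec3_eq_iff: "(v :: real ^ 3) = w \<longleftrightarrow> v $ 1 = w $ 1 \<and> v $ 2 = w $ 2 \<and> v $ 3 = w $ 3"
  by (simp add: vec_eq_iff forall_3)

lemma Q4_eq_iff: "Q4 a b c d = Q4 a' b' c' d' \<longleftrightarrow> a = a' \<and> b = b' \<and> c = c' \<and> d = d'"
  by (auto simp: Q4_def vec3_eq_iff)

lemma Q4_exhaust: "q = Q4 (fst q) (snd q $ 1) (snd q $ 2) (snd q $ 3)"
  by (auto simp: Q4_def vec3_eq_iff prod_eq_iff)

lemma qmult_Q4: "qmult (Q4 a b c d) (Q4 a' b' c' d') =
  Q4 (a * a' - b * b' - c * c' - d * d') (a * b' + b * a' + c * d' - d * c')
     (a * c' - b * d' + c * a' + d * b') (a * d' + b * c' - c * b' + d * a')"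
  by (simp add: qmult_def Q4_def vec3_eq_iff cross3_def inner_vec_def sum_3 algebra_simps)

lemma imag_Q4: "(0, v) = Q4 0 (v $ 1) (v $ 2) (v $ 3)"
  by (simp add: Q4_def vec3_eq_iff)

lemma Q4_add: "Q4 a b c d + Q4 a' b' c' d' = Q4 (a + a') (b + b') (c + c') (d + d')"
  by (simp add: Q4_def vec3_eq_iff)

lemma Q4_scale: "r *\<^sub>R Q4 a b c d = Q4 (r * a) (r * b) (r * c) (r * d)"
  by (simp add: Q4_def vec3_eq_iff)

lemma Q4_minus: "- Q4 a b c d = Q4 (- a) (- b) (- c) (- d)"
  by (simp add: Q4_def vec3_eq_iff)

lemma Q4_0: "0 = Q4 0 0 0 0" and Q4_1: "(1, 0) = Q4 1 0 0 0"
  by (simp_all add: Q4_def vec3_eq_iff prod_eq_iff)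

lemma norm_vec3: "norm (v :: real ^ 3) = 1 \<longleftrightarrow> (v $ 1)\<^sup>2 + (v $ 2)\<^sup>2 + (v $ 3)\<^sup>2 = 1"
  by (simp add: norm_vec_def L2_set_def sum_3)

abbreviation qi :: quat where "qi \<equiv> Q4 0 1 0 0"
abbreviation qj :: quat where "qj \<equiv> Q4 0 0 1 0"
abbreviation qk :: quat where "qk \<equiv> Q4 0 0 0 1"

text \<open>The quaternion \<open>\<alpha> + j \<beta>\<close>, where \<open>\<alpha>\<close> and \<open>\<beta>\<close> are \<open>cnj a\<close> and \<open>cnj b\<close> with \<open>\<i>\<close> read as \<open>i\<close>.\<close>

definition hq :: "complex \<Rightarrow> complex \<Rightarrow> quat" where
  "hq a b = Q4 (Re a) (- Im a) (Re b) (Im b)"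

text \<open>For nonzero \<open>h = hq a b\<close> this says \<open>v = h i h^-1\<close>, the Hopf
  map. Without the inverse the condition \<open>v h = h i\<close> is real linear in
  \<open>(a, b)\<close>.\<close>

definition hopf :: "real ^ 3 \<Rightarrow> complex \<Rightarrow> complex \<Rightarrow> bool" where
  "hopf v a b \<longleftrightarrow> qmult (0, v) (hq a b) = qmult (hq a b) qi"

lemma hopf_iff:
  fixes v :: "real ^ 3" and a b :: complex
  shows "hopf v a b \<longleftrightarrow>
     v $ 1 * Im a - v $ 2 * Re b - v $ 3 * Im b = Im a \<and>
     v $ 1 * Re a + v $ 2 * Im b - v $ 3 * Re b = Re a \<and>
     v $ 2 * Re a - v $ 3 * Im a - v $ 1 * Im b = Im b \<and>
     v $ 3 * Re a + v $ 1 * Re b + v $ 2 * Im a = - Re b"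
  unfolding hopf_def hq_def imag_Q4 qmult_Q4 Q4_eq_iff
  by (rule iffI; elim conjE; intro conjI; linarith)

lemma sum_four_squares_zero:
  "(a :: real)\<^sup>2 + b\<^sup>2 + c\<^sup>2 + d\<^sup>2 = 0 \<Longrightarrow> a = 0 \<and> b = 0 \<and> c = 0 \<and> d = 0"
  by (simp add: add_nonneg_eq_0_iff)

lemma hopf_exists:
  assumes "(a, b) \<noteq> (0, 0)"
  shows "\<exists>v. norm v = 1 \<and> hopf v a b"
proof -
  define N where "N = (Re a)\<^sup>2 + (Im a)\<^sup>2 + (Re b)\<^sup>2 + (Im b)\<^sup>2"
  have "N \<noteq> 0"
  proof
    assume "N = 0"
    then have "Re a = 0 \<and> Im a = 0 \<and> Re b = 0 \<and> Im b = 0"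
      unfolding N_def by (rule sum_four_squares_zero)
    then show False using assms by (auto simp: complex_eq_iff)
  qed
  \<comment> \<open>The coordinates of \<open>h i h^-1\<close>, computed as \<open>h i\<close> times
    the conjugate of \<open>h\<close>, divided by the squared norm \<open>N\<close>.\<close>
  define v :: "real ^ 3" where "v = vector [((Re a)\<^sup>2 + (Im a)\<^sup>2 - (Re b)\<^sup>2 - (Im b)\<^sup>2) / N,
      2 * (Im b * Re a - Re b * Im a) / N, - 2 * (Re b * Re a + Im b * Im a) / N]"
  have v: "v $ 1 = ((Re a)\<^sup>2 + (Im a)\<^sup>2 - (Re b)\<^sup>2 - (Im b)\<^sup>2) / N"
    "v $ 2 = 2 * (Im b * Re a - Re b * Im a) / N" "v $ 3 = - 2 * (Re b * Re a + Im b * Im a) / N"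
    unfolding v_def by simp_all
  have "((Re a)\<^sup>2 + (Im a)\<^sup>2 - (Re b)\<^sup>2 - (Im b)\<^sup>2)\<^sup>2 + (2 * (Im b * Re a - Re b * Im a))\<^sup>2 +
      (- 2 * (Re b * Re a + Im b * Im a))\<^sup>2 = N\<^sup>2"
    unfolding N_def by (simp add: power2_eq_square algebra_simps)
  then have "norm v = 1"
    unfolding norm_vec3 v power_divide add_divide_distrib[symmetric] using \<open>N \<noteq> 0\<close> by simp
  moreover have "hopf v a b"
    unfolding hopf_iff v using \<open>N \<noteq> 0\<close>
    by (simp add: field_simps) (simp add: N_def power2_eq_square algebra_simps)
  ultimately show ?thesis by blast
qed

lemma hopf_unique:
  assumes "hopf v a b" "hopf w a b" "(a, b) \<noteq> (0, 0)"
  shows "v = w"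
proof -
  \<comment> \<open>The difference \<open>u = v - w\<close> satisfies \<open>u h = 0\<close>, which
    is the list of equations \<open>e\<close>; multiplicativity of the norm then gives
    \<open>u = 0\<close>.\<close>
  define x y z where "x = v $ 1 - w $ 1" and "y = v $ 2 - w $ 2" and "z = v $ 3 - w $ 3"
  have e: "x * Im a - y * Re b - z * Im b = 0" "x * Re a + y * Im b - z * Re b = 0"
    "y * Re a - z * Im a - x * Im b = 0" "z * Re a + x * Re b + y * Im a = 0"
    using assms(1,2) unfolding hopf_iff x_def y_def z_def by (auto simp: algebra_simps)
  have "(x\<^sup>2 + y\<^sup>2 + z\<^sup>2) * ((Re a)\<^sup>2 + (Im a)\<^sup>2 + (Re b)\<^sup>2 + (Im b)\<^sup>2) =
    (x * Im a - y * Re b - z * Im b)\<^sup>2 + (x * Re a + y * Im b - z * Re b)\<^sup>2 +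
    (y * Re a - z * Im a - x * Im b)\<^sup>2 + (z * Re a + x * Re b + y * Im a)\<^sup>2"
    by (simp add: power2_eq_square algebra_simps)
  then have "x\<^sup>2 + y\<^sup>2 + z\<^sup>2 = 0 \<or> (Re a)\<^sup>2 + (Im a)\<^sup>2 + (Re b)\<^sup>2 + (Im b)\<^sup>2 = 0"
    unfolding e by simp
  moreover have "(Re a)\<^sup>2 + (Im a)\<^sup>2 + (Re b)\<^sup>2 + (Im b)\<^sup>2 \<noteq> 0"
  proof
    assume "(Re a)\<^sup>2 + (Im a)\<^sup>2 + (Re b)\<^sup>2 + (Im b)\<^sup>2 = 0"
    then have "Re a = 0 \<and> Im a = 0 \<and> Re b = 0 \<and> Im b = 0"
      by (rule sum_four_squares_zero)
    then show False using assms(3) by (auto simp: complex_eq_iff)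
  qed
  ultimately have "x = 0 \<and> y = 0 \<and> z = 0"
    by (simp add: add_nonneg_eq_0_iff)
  then show ?thesis unfolding vec3_eq_iff x_def y_def z_def by simp
qed

text \<open>Scaling the pair by \<open>k\<close> multiplies \<open>hq a b\<close> on the right by a
  quaternion in the span of 1 and \<open>i\<close>, and these commute with \<open>i\<close>.\<close>

lemma hopf_scale:
  assumes "hopf v a b"
  shows "hopf v (k * a) (k * b)"
proof -
  define x y z where "x = v $ 1" and "y = v $ 2" and "z = v $ 3"
  have e: "x * Im a - y * Re b - z * Im b = Im a" "x * Re a + y * Im b - z * Re b = Re a"
    "y * Re a - z * Im a - x * Im b = Im b" "z * Re a + x * Re b + y * Im a = - Re b"
    using assms unfolding hopf_iff x_def y_def z_def by auto
  show ?thesis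
    unfolding hopf_iff x_def[symmetric] y_def[symmetric] z_def[symmetric] times_complex.simps
  proof (intro conjI)
    let ?k = "Re k" and ?l = "Im k"
    have "x * (?k * Im a + ?l * Re a) - y * (?k * Re b - ?l * Im b) - z * (?k * Im b + ?l * Re b) =
        ?k * (x * Im a - y * Re b - z * Im b) + ?l * (x * Re a + y * Im b - z * Re b)"
      by (simp add: algebra_simps)
    then show "x * (?k * Im a + ?l * Re a) - y * (?k * Re b - ?l * Im b) - z * (?k * Im b + ?l * Re b) =
        ?k * Im a + ?l * Re a" unfolding e .
    have "x * (?k * Re a - ?l * Im a) + y * (?k * Im b + ?l * Re b) - z * (?k * Re b - ?l * Im b) =
        ?k * (x * Re a + y * Im b - z * Re b) - ?l * (x * Im a - y * Re b - z * Im b)"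
      by (simp add: algebra_simps)
    then show "x * (?k * Re a - ?l * Im a) + y * (?k * Im b + ?l * Re b) - z * (?k * Re b - ?l * Im b) =
        ?k * Re a - ?l * Im a" unfolding e .
    have "y * (?k * Re a - ?l * Im a) - z * (?k * Im a + ?l * Re a) - x * (?k * Im b + ?l * Re b) =
        ?k * (y * Re a - z * Im a - x * Im b) - ?l * (z * Re a + x * Re b + y * Im a)"
      by (simp add: algebra_simps)
    then show "y * (?k * Re a - ?l * Im a) - z * (?k * Im a + ?l * Re a) - x * (?k * Im b + ?l * Re b) =
        ?k * Im b + ?l * Re b" unfolding e by simp
    have "z * (?k * Re a - ?l * Im a) + x * (?k * Re b - ?l * Im b) + y * (?k * Im a + ?l * Re a) =
        ?k * (z * Re a + x * Re b + y * Im a) + ?l * (y * Re a - z * Im a - x * Im b)"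
      by (simp add: algebra_simps)
    then show "z * (?k * Re a - ?l * Im a) + x * (?k * Re b - ?l * Im b) + y * (?k * Im a + ?l * Re a) =
        - (?k * Re b - ?l * Im b)" unfolding e by simp
  qed
qed

lemma hopf_onto:
  assumes "norm v = 1"
  shows "\<exists>a b. (a, b) \<noteq> (0, 0) \<and> hopf v a b"
proof -
  have n: "(v $ 1)\<^sup>2 + (v $ 2)\<^sup>2 + (v $ 3)\<^sup>2 = 1" using assms norm_vec3 by blast
  show ?thesis
  proof (cases "v $ 1 = - 1")
    case True
    then have "v $ 2 = 0" "v $ 3 = 0"
      using n by (auto simp: sum_power2_eq_zero_iff)
    then show ?thesis using True
      by (intro exI[of _ 0] exI[of _ 1]) (simp add: hopf_iff)
  next
    case False
    \<comment> \<open>This is \<open>h = 1 - v i\<close>, which satisfies \<open>v h = h i\<close>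
      because \<open>v v = -1\<close>. It vanishes exactly for \<open>v = - i\<close>, hence the
      case distinction.\<close>
    have "hopf v (complex_of_real (1 + v $ 1)) (Complex (- (v $ 3)) (v $ 2))"
      using n unfolding hopf_iff by (simp add: power2_eq_square algebra_simps)
    moreover have "complex_of_real (1 + v $ 1) \<noteq> 0"
      using False by (metis add.inverse_unique of_real_eq_0_iff)
    ultimately show ?thesis by blast
  qed
qed

text \<open>Away from \<open>v = - i\<close> the ratio \<open>b / a\<close> is the stereographic
  projection of \<open>v\<close>, hence determined by it.\<close>

lemma hopf_inj:
  assumes "hopf v a b" "hopf v c d" "norm v = 1"
  shows "a * d = b * c"
proof (cases "v $ 1 = - 1")
  case True
  then have "v $ 2 = 0" "v $ 3 = 0"
    using assms(3) unfolding norm_vec3 by (auto simp: sum_power2_eq_zero_iff)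
  then have "a = 0" "c = 0"
    using assms(1,2) True unfolding hopf_iff by (auto simp: complex_eq_iff)
  then show ?thesis by simp
next
  case False
  define s where "s = Complex (- (v $ 3)) (v $ 2)"
  have "complex_of_real (1 + v $ 1) * b = a * s" "complex_of_real (1 + v $ 1) * d = c * s"
    using assms(1,2) unfolding hopf_iff s_def by (auto simp: complex_eq_iff algebra_simps)
  then have "complex_of_real (1 + v $ 1) * (a * d) = complex_of_real (1 + v $ 1) * (b * c)"
    by (metis mult.assoc mult.left_commute mult.commute)
  moreover have "complex_of_real (1 + v $ 1) \<noteq> 0"
    using False by (metis add.inverse_unique of_real_eq_0_iff)
  ultimately show ?thesis by simp
qed

text \<open>The new pair belongs to \<open>h j\<close> in place of \<open>h\<close>, and
  \<open>i j = - j i\<close>.\<close>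

lemma hopf_antipode: "hopf v a b \<Longrightarrow> hopf (- v) (- cnj b) (cnj a)"
  unfolding hopf_iff by (auto simp: algebra_simps)

text \<open>The identification of the projective line with the unit sphere of the imaginary
  quaternions: by the lemmas above the nonzero pairs over a given \<open>v\<close> fill exactly one
  complex line.\<close>

definition sphp :: "cp1 \<Rightarrow> real ^ 3" where
  "sphp p = (SOME v. \<exists>a b. (a, b) \<noteq> (0, 0) \<and> p = pt a b \<and> norm v = 1 \<and> hopf v a b)"

lemma sphp_pt:
  assumes "(a, b) \<noteq> (0, 0)"
  shows "norm (sphp (pt a b)) = 1" "hopf (sphp (pt a b)) a b"
proof -
  have "\<exists>v c d. (c, d) \<noteq> (0, 0) \<and> pt a b = pt c d \<and> norm v = 1 \<and> hopf v c d"
    using assms hopf_exists by blast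
  then have "\<exists>c d. (c, d) \<noteq> (0, 0) \<and> pt a b = pt c d \<and> norm (sphp (pt a b)) = 1 \<and> hopf (sphp (pt a b)) c d"
    unfolding sphp_def by (rule someI_ex)
  then obtain c d where *: "(c, d) \<noteq> (0, 0)" "pt a b = pt c d" "norm (sphp (pt a b)) = 1"
    "hopf (sphp (pt a b)) c d" by blast
  obtain k where "a = k * c" "b = k * d" using pt_eqE[OF *(2) assms *(1)] by blast
  then show "norm (sphp (pt a b)) = 1" "hopf (sphp (pt a b)) a b"
    using * hopf_scale by auto
qed

lemma sphp_eqI: "hopf v a b \<Longrightarrow> (a, b) \<noteq> (0, 0) \<Longrightarrow> sphp (pt a b) = v"
  using sphp_pt hopf_unique by blast

lemma norm_sphp: "norm (sphp p) = 1"
  by (metis pt_exhaust sphp_pt(1))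

lemma sphp_inj: "sphp p = sphp q \<Longrightarrow> p = q"
proof -
  assume eq: "sphp p = sphp q"
  obtain a b where ab: "(a, b) \<noteq> (0, 0)" "p = pt a b" by (rule pt_exhaust)
  obtain c d where cd: "(c, d) \<noteq> (0, 0)" "q = pt c d" by (rule pt_exhaust)
  have "a * d = b * c"
    using hopf_inj[of "sphp p" a b c d] sphp_pt[OF ab(1)] sphp_pt[OF cd(1)] eq ab cd by simp
  then show "p = q" using ab cd pt_eq_iff by blast
qed

lemma sphp_surj: "norm v = 1 \<Longrightarrow> \<exists>p. sphp p = v"
  using hopf_onto sphp_eqI by metis

lemma sphp_antip: "sphp (antip p) = - sphp p"
proof -
  obtain a b where ab: "(a, b) \<noteq> (0, 0)" "p = pt a b" by (rule pt_exhaust)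
  have "hopf (- sphp p) (- cnj b) (cnj a)"
    using hopf_antipode sphp_pt[OF ab(1)] ab(2) by blast
  then show ?thesis
    unfolding ab(2) antip_pt[OF ab(1)] using ab(1) by (intro sphp_eqI) auto
qed

lemma sphp_aff0: "sphp (aff0 0) = axis 1 1"
  unfolding aff_pt by (rule sphp_eqI) (auto simp: hopf_iff axis_def)

text \<open>Multiplying the second coordinate by a unit complex number turns the sphere about the
  axis through \<open>i\<close>, the point with coordinates \<open>[1 : 0]\<close>.\<close>

lemma rotation_about_axis:
  assumes "cmod c = 1"
  obtains R :: "real ^ 3 ^ 3" where "rotation_matrix R"
    "\<And>a b. (a, b) \<noteq> (0, 0) \<Longrightarrow> sphp (pt a (c * b)) = R *v sphp (pt a b)"
proof -
  define x y where "x = Re c" and "y = Im c"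
  have xy: "x\<^sup>2 + y\<^sup>2 = 1" using assms cmod_power2[of c] unfolding x_def y_def by simp
  define R :: "real ^ 3 ^ 3" where "R = vector [vector [1, 0, 0], vector [0, x, - y], vector [0, y, x]]"
  have R: "R *v v = vector [v $ 1, x * v $ 2 - y * v $ 3, y * v $ 2 + x * v $ 3]" for v
    unfolding R_def by (simp add: vec3_eq_iff matrix_vector_mult_def sum_3)
  have "transpose R ** R = mat 1"
    unfolding R_def using xy
    by (auto simp: vec_eq_iff forall_3 matrix_matrix_mult_def transpose_def sum_3 mat_def power2_eq_square algebra_simps)
  then have "orthogonal_matrix R"
    by (simp add: orthogonal_matrix)
  moreover have "det R = 1"
    unfolding R_def det_3 using xy by (simp add: power2_eq_square)
  ultimately have "rotation_matrix R" by (simp add: rotation_matrix_def)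
  moreover have "sphp (pt a (c * b)) = R *v sphp (pt a b)" if ab: "(a, b) \<noteq> (0, 0)" for a b
  proof (rule sphp_eqI)
    have h: "hopf (sphp (pt a b)) a b" using sphp_pt ab by blast
    define u v w where "u = sphp (pt a b) $ 1" and "v = sphp (pt a b) $ 2" and "w = sphp (pt a b) $ 3"
    have e: "u * Im a - v * Re b - w * Im b = Im a" "u * Re a + v * Im b - w * Re b = Re a"
      "v * Re a - w * Im a - u * Im b = Im b" "w * Re a + u * Re b + v * Im a = - Re b"
      using h unfolding hopf_iff u_def v_def w_def by auto
    show "hopf (R *v sphp (pt a b)) a (c * b)"
      unfolding hopf_iff R vector_3 times_complex.simps x_def[symmetric] y_def[symmetric]
        u_def[symmetric] v_def[symmetric] w_def[symmetric]
    proof (intro conjI)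
      have xy': "x * x + y * y = 1" using xy by (simp add: power2_eq_square)
      have "u * Im a - (x * v - y * w) * (x * Re b - y * Im b) - (y * v + x * w) * (x * Im b + y * Re b) =
          u * Im a - (x * x + y * y) * (v * Re b + w * Im b)"
        by (simp add: algebra_simps)
      then show "u * Im a - (x * v - y * w) * (x * Re b - y * Im b) - (y * v + x * w) * (x * Im b + y * Re b) = Im a"
        unfolding xy' using e by simp
      have "u * Re a + (x * v - y * w) * (x * Im b + y * Re b) - (y * v + x * w) * (x * Re b - y * Im b) =
          u * Re a + (x * x + y * y) * (v * Im b - w * Re b)"
        by (simp add: algebra_simps)
      then show "u * Re a + (x * v - y * w) * (x * Im b + y * Re b) - (y * v + x * w) * (x * Re b - y * Im b) = Re a"
        unfolding xy' using e by simp
      have "(x * v - y * w) * Re a - (y * v + x * w) * Im a - u * (x * Im b + y * Re b) =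
          x * (v * Re a - w * Im a - u * Im b) - y * (w * Re a + u * Re b + v * Im a)"
        by (simp add: algebra_simps)
      then show "(x * v - y * w) * Re a - (y * v + x * w) * Im a - u * (x * Im b + y * Re b) =
          x * Im b + y * Re b"
        unfolding e by simp
      have "(y * v + x * w) * Re a + u * (x * Re b - y * Im b) + (x * v - y * w) * Im a =
          y * (v * Re a - w * Im a - u * Im b) + x * (w * Re a + u * Re b + v * Im a)"
        by (simp add: algebra_simps)
      then show "(y * v + x * w) * Re a + u * (x * Re b - y * Im b) + (x * v - y * w) * Im a =
          - (x * Re b - y * Im b)"
        unfolding e by simp
    qed
    show "(a, c * b) \<noteq> (0, 0)" using ab assms by auto
  qed
  ultimately show ?thesis using that by blast
qed

lemma rotation_to_vector:
  assumes "norm v = 1"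
  obtains R :: "real ^ 3 ^ 3" where "rotation_matrix R" "R *v axis 1 1 = v"
proof -
  obtain f :: "real ^ 3 \<Rightarrow> real ^ 3" where f: "orthogonal_transformation f" "det (matrix f) = 1" "f (axis 1 1) = v"
    using rotation_exists[of "axis 1 1 :: real ^ 3" v] assms by auto
  have "rotation_matrix (matrix f)"
    using f orthogonal_transformation_matrix by (auto simp: rotation_matrix_def)
  moreover have "matrix f *v axis 1 1 = v"
    using fun_cong[OF matrix_vector_mul(2)[OF orthogonal_transformation_linear[OF f(1)]], of "axis 1 1"] f(3) by simp
  ultimately show ?thesis using that by blast
qed

lemma rotation_mult: "rotation_matrix (R :: real ^ 3 ^ 3) \<Longrightarrow> rotation_matrix S \<Longrightarrow> rotation_matrix (R ** S)"
  by (auto simp: rotation_matrix_def det_mul intro: orthogonal_matrix_mul)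

lemma rotation_one: "rotation_matrix (mat 1)"
  by (simp add: rotation_matrix_def orthogonal_matrix_id)

lemma rotation_inverse:
  assumes "rotation_matrix (R :: real ^ 3 ^ 3)"
  shows "rotation_matrix (transpose R)" "R ** transpose R = mat 1" "transpose R ** R = mat 1"
  using assms by (auto simp: rotation_matrix_def orthogonal_matrix_def det_transpose orthogonal_matrix_transpose)

lemma rotation_orthogonal_transformation:
  "rotation_matrix (R :: real ^ 3 ^ 3) \<Longrightarrow> orthogonal_transformation ((*v) R)"
  unfolding orthogonal_transformation_matrix rotation_matrix_def
  using matrix_of_matrix_vector_mul[of R] by simp

lemma rotation_norm: "rotation_matrix (R :: real ^ 3 ^ 3) \<Longrightarrow> norm (R *v v) = norm v"
  using orthogonal_transformation_norm[OF rotation_orthogonal_transformation, of R v] .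

lemma so3_act_mult: "so3_act (R ** S) = so3_act R \<circ> so3_act S"
  by (simp add: so3_act_def fun_eq_iff matrix_vector_mul_assoc)

lemma so3_act_one: "so3_act (mat 1) = id"
  by (simp add: so3_act_def fun_eq_iff)

text \<open>Quaternion multiplication is built from the inner and the cross product, and a rotation
  preserves both; for the cross product the determinant 1 matters.\<close>

lemma so3_act_qmult:
  assumes "rotation_matrix R"
  shows "so3_act R (qmult p q) = qmult (so3_act R p) (so3_act R q)"
proof -
  have "(R *v x) \<bullet> (R *v y) = x \<bullet> y" for x y
    using rotation_orthogonal_transformation[OF assms] unfolding orthogonal_transformation_def by blast
  moreover have "cross3 (R *v x) (R *v y) = R *v cross3 x y" for x y
    using cross_rotation_matrix[OF assms] .
  ultimately show ?thesis
    by (simp add: so3_act_def qmult_def matrix_vector_right_distrib matrix_vector_mult_scaleR)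
qed

lemma quat_hom_so3:
  assumes "quat_hom E \<sigma>" "rotation_matrix R"
  shows "quat_hom E (\<sigma> \<circ> so3_act R)"
proof -
  have "linear (so3_act R)"
    by (rule linearI) (auto simp: so3_act_def matrix_vector_right_distrib matrix_vector_mult_scaleR)
  then have "linear (\<sigma> \<circ> so3_act R)"
    using assms(1) linear_compose unfolding quat_hom_def by blast
  moreover have "so3_act R (1, 0) = (1, 0)" by (simp add: so3_act_def)
  ultimately show ?thesis
    using assms(1) unfolding quat_hom_def by (simp add: so3_act_qmult[OF assms(2)] del: split_paired_All)
qed

lemma adm_structure:
  assumes "Q = {\<sigma> \<circ> so3_act R |R. rotation_matrix R}"
  shows "adm Q = {\<sigma> (0, v) |v. norm v = 1}"
proof
  show "adm Q \<subseteq> {\<sigma> (0, v) |v. norm v = 1}"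
    unfolding adm_def assms by (auto simp: so3_act_def rotation_norm)
  have "\<sigma> \<in> Q" unfolding assms using rotation_one so3_act_one by (metis (mono_tags, lifting) comp_id mem_Collect_eq)
  then show "{\<sigma> (0, v) |v. norm v = 1} \<subseteq> adm Q"
    unfolding adm_def by blast
qed

text \<open>Rotations act transitively on the class, so any member may serve as its representative.
  Fullness exploits this freedom.\<close>

lemma structure_change:
  assumes "Q = {\<sigma> \<circ> so3_act R |R. rotation_matrix R}" "\<tau> \<in> Q"
  shows "Q = {\<tau> \<circ> so3_act R |R. rotation_matrix R}"
proof -
  obtain S where S: "rotation_matrix S" "\<tau> = \<sigma> \<circ> so3_act S" using assms by blast
  have "\<sigma> \<circ> so3_act R = \<tau> \<circ> so3_act (transpose S ** R)" for R
    unfolding S(2) comp_assoc so3_act_mult[symmetric] matrix_mul_assoc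
    using rotation_inverse(2)[OF S(1)] by simp
  moreover have "\<tau> \<circ> so3_act R = \<sigma> \<circ> so3_act (S ** R)" for R
    unfolding S(2) comp_assoc so3_act_mult[symmetric] ..
  ultimately show ?thesis
    unfolding assms(1) using rotation_mult S(1) rotation_inverse(1)[OF S(1)] by blast
qed

lemma structure_rep:
  assumes "quat_structure E Q"
  obtains \<sigma> where "quat_hom E \<sigma>" "Q = {\<sigma> \<circ> so3_act R |R. rotation_matrix R}" "fin_dim E" "E \<noteq> {0}"
  using assms unfolding quat_structure_def by blast

lemma structure_self: "Q = {\<sigma> \<circ> so3_act R |R. rotation_matrix R} \<Longrightarrow> \<sigma> \<in> Q"
  using rotation_one so3_act_one by (metis (mono_tags, lifting) comp_id mem_Collect_eq)

lemma structure_memD: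
  assumes "quat_structure E Q" "\<tau> \<in> Q"
  shows "quat_hom E \<tau>" "Q = {\<tau> \<circ> so3_act R |R. rotation_matrix R}"
proof -
  obtain \<sigma> where \<sigma>: "quat_hom E \<sigma>" "Q = {\<sigma> \<circ> so3_act R |R. rotation_matrix R}"
    using structure_rep[OF assms(1)] by blast
  show "quat_hom E \<tau>" using assms(2) \<sigma> quat_hom_so3 by blast
  show "Q = {\<tau> \<circ> so3_act R |R. rotation_matrix R}" using structure_change \<sigma>(2) assms(2) by blast
qed

section \<open>Linear maps on subspaces\<close>

lemma HomD:
  assumes "f \<in> Hom E F"
  shows "x \<in> E \<Longrightarrow> f x \<in> F" "x \<in> E \<Longrightarrow> y \<in> E \<Longrightarrow> f (x + y) = f x + f y"
    "x \<in> E \<Longrightarrow> f (r *\<^sub>R x) = r *\<^sub>R f x" "x \<notin> E \<Longrightarrow> f x = 0"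
  using assms unfolding Hom_def by auto

lemma HomI:
  assumes "\<And>x. x \<in> E \<Longrightarrow> f x \<in> F" "\<And>x y. x \<in> E \<Longrightarrow> y \<in> E \<Longrightarrow> f (x + y) = f x + f y"
    "\<And>r x. x \<in> E \<Longrightarrow> f (r *\<^sub>R x) = r *\<^sub>R f x" "\<And>x. x \<notin> E \<Longrightarrow> f x = 0"
  shows "f \<in> Hom E F"
  using assms unfolding Hom_def by auto

lemma fin_dim_subspace: "fin_dim E \<Longrightarrow> subspace E"
  unfolding fin_dim_def using subspace_span by blast

lemma Hom_more:
  assumes "f \<in> Hom E F" "subspace E"
  shows "f 0 = 0" "x \<in> E \<Longrightarrow> f (- x) = - f x" "x \<in> E \<Longrightarrow> y \<in> E \<Longrightarrow> f (x - y) = f x - f y"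
proof -
  have 0: "0 \<in> E" using assms(2) subspace_0 by blast
  show "f 0 = 0" using HomD(3)[OF assms(1) 0, of 0] by simp
  show neg: "f (- x) = - f x" if "x \<in> E" for x using HomD(3)[OF assms(1) that, of "-1"] by simp
  show "x \<in> E \<Longrightarrow> y \<in> E \<Longrightarrow> f (x - y) = f x - f y"
    using HomD(2)[OF assms(1), of x "- y"] neg assms(2) subspace_neg by force
qed

text \<open>An element of \<open>Hom\<close> vanishes off its domain and is in general not linear on
  the ambient type; a linear extension makes facts about total linear maps applicable.\<close>

lemma Hom_extend:
  assumes f: "f \<in> Hom E F" and E: "subspace E"
  obtains g where "linear g" "\<And>x. x \<in> E \<Longrightarrow> g x = f x"
proof -
  obtain B where B: "B \<subseteq> E" "independent B" "E \<subseteq> span B"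
    using basis_exists[of E] by metis
  obtain g where g: "linear g" "\<forall>x\<in>B. g x = f x"
    using linear_independent_extend[OF B(2), of f] by blast
  have "x \<in> E \<and> g x = f x" if "x \<in> span B" for x
    using that
  proof (induction rule: span_induct)
    show "subspace {x. x \<in> E \<and> g x = f x}"
      using E by (auto simp: subspace_def linear_0[OF g(1)] Hom_more(1)[OF f E] linear_add[OF g(1)]
          linear_scale[OF g(1)] HomD(2,3)[OF f])
  qed (use B g in auto)
  then show ?thesis using that g(1) B(3) by blast
qed

lemma complexification_subspace:
  assumes "subspace E"
  shows "cx.subspace (E \<times> E)"
  unfolding cx.subspace_def
  by (auto simp: cscale_def zero_prod_def
      intro!: subspace_add[OF assms] subspace_diff[OF assms] subspace_scale[OF assms] subspace_0[OF assms])

lemma complexification_fin_dim: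
  assumes "fin_dim E"
  obtains D where "finite D" "E \<times> E \<subseteq> cx.span D"
proof -
  obtain B where B: "finite B" "span B = E" using assms fin_dim_def by blast
  define D where "D = (\<lambda>b. (b, 0 :: 'a)) ` B"
  have re: "(x, 0) \<in> cx.span D" if "x \<in> E" for x
    using that unfolding B(2)[symmetric]
  proof (induction rule: span_induct)
    show "subspace {x. (x, 0) \<in> cx.span D}"
      unfolding subspace_def
    proof (safe)
      show "(0, 0) \<in> cx.span D" using cx.span_zero[of D] by (simp add: zero_prod_def)
      show "(x + y, 0) \<in> cx.span D" if "(x, 0) \<in> cx.span D" "(y, 0) \<in> cx.span D" for x y
        using cx.span_add[OF that] by simp
      show "(r *\<^sub>R x, 0) \<in> cx.span D" if "(x, 0) \<in> cx.span D" for r x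
        using cx.span_scale[OF that, of "complex_of_real r"] by (simp add: cscale_def)
    qed
  next
    fix x assume "x \<in> B"
    then show "(x, 0) \<in> cx.span D"
      unfolding D_def by (intro cx.span_base imageI)
  qed
  have "(x, y) \<in> cx.span D" if "x \<in> E" "y \<in> E" for x y
  proof -
    have "(x, 0) + cscale \<i> (y, 0) \<in> cx.span D"
      by (intro cx.span_add cx.span_scale re that)
    then show ?thesis by (simp add: cscale_def)
  qed
  then have "E \<times> E \<subseteq> cx.span D" by auto
  then show ?thesis using that B(1) unfolding D_def by blast
qed

section \<open>The sphere of complex structures as a projective line\<close>

lemma hq_inverse:
  assumes "(a, b) \<noteq> (0, 0)"
  obtains h' where "qmult h' (hq a b) = (1, 0)" "qmult (hq a b) h' = (1, 0)"
proof -
  define N where "N = (Re a)\<^sup>2 + (Im a)\<^sup>2 + (Re b)\<^sup>2 + (Im b)\<^sup>2"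
  have N: "N \<noteq> 0"
  proof
    assume "N = 0"
    then have "Re a = 0 \<and> Im a = 0 \<and> Re b = 0 \<and> Im b = 0"
      unfolding N_def by (rule sum_four_squares_zero)
    then show False using assms by (auto simp: complex_eq_iff)
  qed
  define h' where "h' = Q4 (Re a / N) (Im a / N) (- Re b / N) (- Im b / N)"
  have "qmult h' (hq a b) = (1, 0)" "qmult (hq a b) h' = (1, 0)"
    unfolding h'_def hq_def qmult_Q4 Q4_1 Q4_eq_iff using N
    by (auto simp: add_divide_distrib[symmetric] diff_divide_distrib[symmetric])
      (auto simp: N_def power2_eq_square algebra_simps)
  then show ?thesis using that by blast
qed

locale qmodule =
  fixes E :: "'e::real_vector set" and \<sigma> :: "quat \<Rightarrow> 'e \<Rightarrow> 'e"
  assumes hom: "quat_hom E \<sigma>" and fd: "fin_dim E"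
begin

lemma sub: "subspace E" using fd fin_dim_subspace by blast

lemma sHom: "\<sigma> q \<in> Hom E E" using hom unfolding quat_hom_def by blast

lemmas sD = HomD[OF sHom] Hom_more[OF sHom sub]

lemma s_linear: "linear \<sigma>" using hom unfolding quat_hom_def by blast

lemma s_add: "\<sigma> (p + q) x = \<sigma> p x + \<sigma> q x"
  using linear_add[OF s_linear] by (simp add: plus_fun_def)

lemma s_scale: "\<sigma> (r *\<^sub>R q) x = r *\<^sub>R \<sigma> q x"
  using linear_scale[OF s_linear] by (simp add: scaleR_fun_def)

lemma s_minus: "\<sigma> (- q) x = - \<sigma> q x"
  using s_scale[of "-1" q x] by simp

lemma s_one: "x \<in> E \<Longrightarrow> \<sigma> (1, 0) x = x"
  using hom unfolding quat_hom_def by (simp add: id_map_def)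

lemma s_mult: "\<sigma> p (\<sigma> q x) = \<sigma> (qmult p q) x"
  using hom unfolding quat_hom_def by (simp del: split_paired_All)

lemma s_Q4: "x \<in> E \<Longrightarrow> \<sigma> (Q4 a b c d) x = a *\<^sub>R x + b *\<^sub>R \<sigma> qi x + c *\<^sub>R \<sigma> qj x + d *\<^sub>R \<sigma> qk x"
proof -
  assume x: "x \<in> E"
  have "Q4 a b c d = a *\<^sub>R (1, 0) + b *\<^sub>R qi + c *\<^sub>R qj + d *\<^sub>R qk"
    unfolding Q4_1 Q4_scale Q4_add by simp
  then show ?thesis by (simp only: s_add s_scale s_one[OF x])
qed

lemma s_sq: "norm v = 1 \<Longrightarrow> x \<in> E \<Longrightarrow> \<sigma> (0, v) (\<sigma> (0, v) x) = - x"
proof -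
  assume v: "norm v = 1" and x: "x \<in> E"
  have "v \<bullet> v = 1" using v by (simp add: norm_eq_1)
  then have "qmult (0, v) (0, v) = - (1, 0)" by (simp add: qmult_def)
  then show ?thesis by (simp only: s_mult s_minus s_one[OF x])
qed

text \<open>For \<open>y = J x\<close> one has \<open>J (x + \<i> y) = - \<i> (x + \<i> y)\<close>.
  Thus taking real parts identifies the eigenspace with \<open>E\<close>.\<close>

lemma E01_graph:
  assumes "norm v = 1"
  shows "E01 E (\<sigma> (0, v)) = {(x, \<sigma> (0, v) x) |x. x \<in> E}"
proof -
  have "(x, y) \<in> E01 E (\<sigma> (0, v)) \<longleftrightarrow> x \<in> E \<and> y = \<sigma> (0, v) x" for x y
  proof -
    have "\<sigma> (0, v) y + x = 0" if "x \<in> E" "y = \<sigma> (0, v) x"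
      using s_sq[OF assms that(1)] that(2) by simp
    then show ?thesis
      unfolding E01_def cscale_def using sD(1)[of x "(0, v)"] by (auto simp: zero_prod_def)
  qed
  then show ?thesis by auto
qed

lemma qi_vec: "qi = (0, axis 1 1)" "norm (axis 1 1 :: real ^ 3) = 1"
  by (simp add: Q4_def vec3_eq_iff axis_def) simp

definition W :: "('e \<times> 'e) set" where
  "W = {(x, \<sigma> qi x) |x. x \<in> E}"

lemma WI: "x \<in> E \<Longrightarrow> (x, \<sigma> qi x) \<in> W"
  unfolding W_def by blast

lemma WE: "w \<in> W \<Longrightarrow> (\<And>x. x \<in> E \<Longrightarrow> w = (x, \<sigma> qi x) \<Longrightarrow> P) \<Longrightarrow> P"
  unfolding W_def by blast

lemma W_sub_E: "W \<subseteq> E \<times> E"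
  unfolding W_def using sD(1)[of _ qi] by auto

lemma W_subspace: "cx.subspace W"
  unfolding cx.subspace_def
proof (intro conjI ballI allI)
  show "0 \<in> W" using WI[of 0] sub subspace_0 sD(5) by (auto simp: zero_prod_def)
  fix w assume w: "w \<in> W"
  then obtain x where x: "x \<in> E" "w = (x, \<sigma> qi x)" by (rule WE)
  show "w + w' \<in> W" if "w' \<in> W" for w'
  proof -
    obtain y where y: "y \<in> E" "w' = (y, \<sigma> qi y)" using \<open>w' \<in> W\<close> by (rule WE)
    show ?thesis using WI[of "x + y"] x y sub subspace_add sD(2) by auto
  qed
  fix c
  have ii: "\<sigma> qi (\<sigma> qi x) = - x" using s_sq[OF qi_vec(2) x(1)] qi_vec(1) by simp
  have "Re c *\<^sub>R x - Im c *\<^sub>R \<sigma> qi x \<in> E"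
    by (intro subspace_diff[OF sub] subspace_scale[OF sub] sD(1) x)
  then have "(Re c *\<^sub>R x - Im c *\<^sub>R \<sigma> qi x, \<sigma> qi (Re c *\<^sub>R x - Im c *\<^sub>R \<sigma> qi x)) \<in> W" by (rule WI)
  moreover have "\<sigma> qi (Re c *\<^sub>R x - Im c *\<^sub>R \<sigma> qi x) = Re c *\<^sub>R \<sigma> qi x + Im c *\<^sub>R x"
    using x(1) by (simp add: sD subspace_scale[OF sub] ii)
  ultimately show "cscale c w \<in> W"
    unfolding x(2) cscale_def by simp
qed

lemma W_fin: "\<exists>D. finite D \<and> W \<subseteq> cx.span D"
  using complexification_fin_dim[OF fd] W_sub_E by (metis order_trans)

definition lext :: "quat \<Rightarrow> 'e \<Rightarrow> 'e" where
  "lext q = (SOME g. linear g \<and> (\<forall>x\<in>E. g x = \<sigma> q x))"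

lemma lext: "linear (lext q)" "x \<in> E \<Longrightarrow> lext q x = \<sigma> q x"
proof -
  have "\<exists>g. linear g \<and> (\<forall>x\<in>E. g x = \<sigma> q x)"
    using Hom_extend[OF sHom sub] by metis
  then have "linear (lext q) \<and> (\<forall>x\<in>E. lext q x = \<sigma> q x)"
    unfolding lext_def by (rule someI_ex)
  then show "linear (lext q)" "x \<in> E \<Longrightarrow> lext q x = \<sigma> q x" by auto
qed

definition Jc :: "'e \<times> 'e \<Rightarrow> 'e \<times> 'e" where
  "Jc = map_prod (lext qj) (lext qj)"

lemma Jc_clin: "clin Jc"
  unfolding Jc_def using clin_map_prod lext by blast

lemma Jc_W: "x \<in> E \<Longrightarrow> Jc (x, \<sigma> qi x) = (\<sigma> qj x, - \<sigma> qk x)"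
  unfolding Jc_def by (simp add: lext sD(1) s_mult qmult_Q4 s_minus[symmetric] Q4_minus)

text \<open>With \<open>h = hq a b\<close> the vectors \<open>a w + b j w\<close> are the pairs \<open>(h x, h i x)\<close>.\<close>

lemma pencil_graph:
  "x \<in> E \<Longrightarrow> cscale a (x, \<sigma> qi x) + cscale b (Jc (x, \<sigma> qi x)) =
     (\<sigma> (hq a b) x, \<sigma> (qmult (hq a b) qi) x)"
proof -
  assume x: "x \<in> E"
  have "\<sigma> (hq a b) x = Re a *\<^sub>R x - Im a *\<^sub>R \<sigma> qi x + Re b *\<^sub>R \<sigma> qj x + Im b *\<^sub>R \<sigma> qk x"
    unfolding hq_def s_Q4[OF x, of "Re a"] by simp
  moreover have "\<sigma> (qmult (hq a b) qi) x = Im a *\<^sub>R x + Re a *\<^sub>R \<sigma> qi x + Im b *\<^sub>R \<sigma> qj x - Re b *\<^sub>R \<sigma> qk x"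
    unfolding hq_def qmult_Q4 s_Q4[OF x, of "Re a * 0 - - Im a * 1 - Re b * 0 - Im b * 0"] by simp
  ultimately show ?thesis
    unfolding Jc_W[OF x] cscale_def by (simp add: algebra_simps)
qed

definition std :: "cp1 \<Rightarrow> 'e \<Rightarrow> 'e" where
  "std p = \<sigma> (0, sphp p)"

text \<open>By \<open>pencil_graph\<close> the right hand side consists of the pairs
  \<open>(h x, h i x)\<close>. The Hopf relation \<open>h i = J h\<close> makes them
  \<open>(h x, J (h x))\<close>, and \<open>h x\<close> runs through \<open>E\<close> because
  \<open>h\<close> is invertible.\<close>

lemma E01_std:
  assumes "(a, b) \<noteq> (0, 0)"
  shows "E01 E (std (pt a b)) = {cscale a w + cscale b (Jc w) |w. w \<in> W}"
proof -
  let ?v = "sphp (pt a b)"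
  have v: "norm ?v = 1" "qmult (0, ?v) (hq a b) = qmult (hq a b) qi"
    using sphp_pt[OF assms] unfolding hopf_def by auto
  obtain h' where h': "qmult h' (hq a b) = (1, 0)" "qmult (hq a b) h' = (1, 0)"
    by (rule hq_inverse[OF assms])
  show ?thesis
    unfolding std_def E01_graph[OF v(1)]
  proof (intro set_eqI iffI)
    fix y assume "y \<in> {(x, \<sigma> (0, ?v) x) |x. x \<in> E}"
    then obtain x where x: "x \<in> E" "y = (x, \<sigma> (0, ?v) x)" by blast
    define z where "z = \<sigma> h' x"
    have z: "z \<in> E" "\<sigma> (hq a b) z = x"
      unfolding z_def using x(1) sD(1) by (auto simp: s_mult h' s_one)
    have "y = (\<sigma> (hq a b) z, \<sigma> (qmult (hq a b) qi) z)"
      unfolding x(2) v(2)[symmetric] s_mult[symmetric] z(2) ..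
    then have "y = cscale a (z, \<sigma> qi z) + cscale b (Jc (z, \<sigma> qi z))"
      unfolding pencil_graph[OF z(1)] .
    then show "y \<in> {cscale a w + cscale b (Jc w) |w. w \<in> W}" using WI[OF z(1)] by blast
  next
    fix y assume "y \<in> {cscale a w + cscale b (Jc w) |w. w \<in> W}"
    then obtain w where w: "w \<in> W" "y = cscale a w + cscale b (Jc w)" by blast
    obtain x where x: "x \<in> E" "w = (x, \<sigma> qi x)" using w(1) by (rule WE)
    have "y = (\<sigma> (hq a b) x, \<sigma> (0, ?v) (\<sigma> (hq a b) x))"
      unfolding w(2) x(2) pencil_graph[OF x(1)] s_mult v(2) ..
    then show "y \<in> {(x, \<sigma> (0, ?v) x) |x. x \<in> E}" using sD(1)[OF x(1)] by blast
  qed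
qed

lemma pencil_inj:
  assumes "(a, b) \<noteq> (0, 0)" "w \<in> W" "cscale a w + cscale b (Jc w) = 0"
  shows "w = 0"
proof -
  obtain x where x: "x \<in> E" "w = (x, \<sigma> qi x)" using assms(2) by (rule WE)
  obtain h' where h': "qmult h' (hq a b) = (1, 0)"
    by (rule hq_inverse[OF assms(1)])
  have "\<sigma> (hq a b) x = 0"
    using assms(3) unfolding x(2) pencil_graph[OF x(1)] by (simp add: zero_prod_def)
  then have "\<sigma> h' (\<sigma> (hq a b) x) = 0" using sD(5) by simp
  then have "x = 0" by (simp add: s_mult h' s_one[OF x(1)])
  then show ?thesis unfolding x(2) using sD(5) by (simp add: zero_prod_def)
qed

text \<open>A vector of the eigenspace is \<open>(x, J x)\<close>, and the complexified
  \<open>R\<close> kills it when both \<open>x\<close> and \<open>J x\<close> lie in the kernel. The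
  CR condition is therefore fibrewise injectivity of the pencil.\<close>

lemma pencil_of_kernel:
  assumes R: "linear R" and ker: "\<And>v x. norm v = 1 \<Longrightarrow> x \<in> E \<Longrightarrow> R x = 0 \<Longrightarrow> R (\<sigma> (0, v) x) = 0 \<Longrightarrow> x = 0"
  shows "pencil W (map_prod R R) (\<lambda>w. map_prod R R (Jc w))"
proof (rule pencil.intro)
  have A: "clin (map_prod R R)" by (rule clin_map_prod[OF R])
  show "clin (map_prod R R)" "clin (\<lambda>w. map_prod R R (Jc w))" by (rule A, rule clin_comp[OF Jc_clin A])
  fix a b w assume ab: "(a, b) \<noteq> (0, 0)" and w: "w \<in> W"
    and 0: "cscale a (map_prod R R w) + cscale b (map_prod R R (Jc w)) = 0"
  let ?z = "cscale a w + cscale b (Jc w)"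
  have "?z \<in> E01 E (std (pt a b))" unfolding E01_std[OF ab] using w by blast
  then obtain x where x: "x \<in> E" "?z = (x, \<sigma> (0, sphp (pt a b)) x)"
    unfolding std_def E01_graph[OF norm_sphp] by blast
  have "map_prod R R ?z = 0" using 0 by (simp add: clinD[OF A])
  then have "R x = 0" "R (\<sigma> (0, sphp (pt a b)) x) = 0" unfolding x(2) by (simp_all add: zero_prod_def)
  then have "x = 0" by (rule ker[OF norm_sphp x(1)])
  then have "?z = 0" unfolding x(2) by (simp add: sD(5) zero_prod_def)
  then show "w = 0" by (rule pencil_inj[OF ab w])
qed (use W_subspace W_fin in auto)

lemma std_antip: "std (antip p) = - std p"
  unfolding std_def sphp_antip by (rule HOL.ext) (use s_minus[of "(0, sphp p)"] in simp)

end

locale qspace = qmodule E \<sigma> for E :: "'e::real_vector set" and \<sigma> :: "quat \<Rightarrow> 'e \<Rightarrow> 'e" +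
  assumes nz: "E \<noteq> {0}"
begin

text \<open>If \<open>p - q\<close> acted as zero, then so would its squared norm, its product with
  its conjugate; but that is a real number acting on a nonzero vector.\<close>

lemma s_inj: "\<sigma> p = \<sigma> q \<Longrightarrow> p = q"
proof -
  assume eq: "\<sigma> p = \<sigma> q"
  obtain x where x: "x \<in> E" "x \<noteq> 0" using nz sub subspace_0 by blast
  obtain a b c d where abcd: "p - q = Q4 a b c d" using Q4_exhaust by blast
  have "\<sigma> (p - q) x = 0" using linear_diff[OF s_linear] eq by simp
  then have "\<sigma> (Q4 a (- b) (- c) (- d)) (\<sigma> (p - q) x) = 0" using sD(5) by simp
  moreover have "qmult (Q4 a (- b) (- c) (- d)) (p - q) = (a * a + b * b + c * c + d * d) *\<^sub>R (1, 0)"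
    unfolding abcd qmult_Q4 Q4_1 Q4_scale Q4_eq_iff by simp
  ultimately have "(a * a + b * b + c * c + d * d) *\<^sub>R x = 0"
    by (simp only: s_mult s_scale s_one[OF x(1)])
  then have "a\<^sup>2 + b\<^sup>2 + c\<^sup>2 + d\<^sup>2 = 0" using x(2) by (simp add: power2_eq_square)
  from sum_four_squares_zero[OF this] have "p - q = 0" using abcd Q4_0 by simp
  then show "p = q" by simp
qed

lemma std_inj: "inj std"
  by (rule injI) (use s_inj sphp_inj in \<open>auto simp: std_def\<close>)

end

lemma nat_basis:
  assumes "cx.subspace W" "finite D" "W \<subseteq> cx.span D"
  obtains n and w :: "nat \<Rightarrow> 'a::real_vector \<times> 'a" where "\<And>k. k < n \<Longrightarrow> w k \<in> W"
    "W = {\<Sum>k<n. cscale (c k) (w k) |c. True}"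
    "\<And>c. (\<Sum>k<n. cscale (c k) (w k)) = 0 \<Longrightarrow> \<forall>k<n. c k = 0"
proof -
  obtain B where B: "finite B" "B \<subseteq> W" "cx.independent B" "cx.span B = W"
    by (rule finite_dim_basis[OF assms])
  obtain w where w: "bij_betw w {..<card B} B"
    using ex_bij_betw_nat_finite[OF B(1)] unfolding atLeast0LessThan by blast
  have inj: "inj_on w {..<card B}" and img: "w ` {..<card B} = B"
    using w unfolding bij_betw_def by auto
  show ?thesis
  proof (rule that[of "card B" w])
    show "w k \<in> W" if "k < card B" for k using that img B(2) by blast
    show "W = {\<Sum>k<card B. cscale (c k) (w k) |c. True}"
    proof (intro set_eqI iffI)
      fix x assume "x \<in> W"
      then have "x \<in> cx.span (w ` {..<card B})" using img B(4) by simp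
      then show "x \<in> {\<Sum>k<card B. cscale (c k) (w k) |c. True}"
        using span_image_lessThan by blast
    next
      fix x assume "x \<in> {\<Sum>k<card B. cscale (c k) (w k) |c. True}"
      then obtain c where c: "x = (\<Sum>k<card B. cscale (c k) (w k))" by blast
      show "x \<in> W"
        unfolding c using img B(2) by (intro cx.subspace_sum cx.subspace_scale assms(1)) auto
    qed
    fix c assume 0: "(\<Sum>k<card B. cscale (c k) (w k)) = 0"
    define d where "d b = c (inv_into {..<card B} w b)" for b
    have dw: "d (w k) = c k" if "k < card B" for k
      unfolding d_def using inj that by simp
    have "(\<Sum>b\<in>B. cscale (d b) b) = (\<Sum>k<card B. cscale (d (w k)) (w k))"
      using sum.reindex[OF inj, of "\<lambda>b. cscale (d b) b"] img by simp
    also have "\<dots> = 0" using 0 by (simp add: dw)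
    finally have "\<forall>b\<in>B. d b = 0"
      using cx.independentD[OF B(3,1) order_refl] by blast
    then show "\<forall>k<card B. c k = 0" using dw img by force
  qed
qed

lemma vhol_transfer: "vhol u p \<Longrightarrow> \<forall>\<^sub>F q in nhds p. u q = v q \<Longrightarrow> vhol v p"
  using vhol_cong by blast

lemma holo_vector_map_vhol:
  assumes "holo_vector_map E V s" "open V" "p \<in> V"
  shows "vhol s p"
proof -
  obtain m w h where h: "\<And>j. j < m \<Longrightarrow> cp1_holo V (h j)"
    and s: "\<And>p. p \<in> V \<Longrightarrow> s p = (\<Sum>j<(m::nat). cscale (h j p) (w j))"
    using assms(1) unfolding holo_vector_map_def by blast
  have "vhol (\<lambda>p. \<Sum>j<m. cscale (h j p) (w j)) p"
    using h cp1_holo_iff[OF assms(2)] assms(3) by (intro vhol_intros) auto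
  moreover have "\<forall>\<^sub>F q in nhds p. (\<Sum>j<m. cscale (h j q) (w j)) = s q"
    unfolding eventually_nhds using assms(2,3) s by auto
  ultimately show ?thesis by (rule vhol_transfer)
qed

context qspace
begin

lemma std_bij:
  assumes "Q = {\<sigma> \<circ> so3_act R |R. rotation_matrix R}"
  shows "bij_betw std UNIV (adm Q)"
  unfolding adm_structure[OF assms] bij_betw_def
proof
  show "range std = {\<sigma> (0, v) |v. norm v = 1}"
  proof safe
    show "\<exists>v. std p = \<sigma> (0, v) \<and> norm v = 1" for p
      unfolding std_def using norm_sphp by blast
    show "\<sigma> (0, v) \<in> range std" if "norm v = 1" for v
      using sphp_surj[OF that] unfolding std_def by blast
  qed
qed (rule std_inj)

text \<open>On the range of a chart the homogeneous coordinates are \<open>(1, z)\<close> or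
  \<open>(z, 1)\<close>, and a basis of \<open>W\<close> is carried by \<open>a w + b j w\<close> to
  a holomorphic frame.\<close>

lemma std_holo_subbundle: "holo_subbundle E (\<lambda>p. E01 E (std p))"
  unfolding holo_subbundle_def
proof
  fix p
  obtain n and w :: "nat \<Rightarrow> 'e \<times> 'e" where w: "\<And>k. k < n \<Longrightarrow> w k \<in> W"
    "W = {\<Sum>k<n. cscale (c k) (w k) |c. True}"
    "\<And>c. (\<Sum>k<n. cscale (c k) (w k)) = 0 \<Longrightarrow> \<forall>k<n. c k = 0"
  proof -
    obtain D where "finite D" "W \<subseteq> cx.span D" using W_fin by blast
    then show ?thesis by (rule nat_basis[OF W_subspace]) (rule that)
  qed
  obtain \<alpha> z where \<alpha>: "\<alpha> \<in> chart" "p = \<alpha> z" by (rule chart_cases)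
  define a where "a = (if \<alpha> = aff0 then (\<lambda>_. 1) else inv \<alpha>)"
  define b where "b = (if \<alpha> = aff0 then inv \<alpha> else (\<lambda>_. 1))"
  have ab: "(a q, b q) \<noteq> (0, 0)" "q = pt (a q) (b q)" if "q \<in> range \<alpha>" for q
    using that \<alpha>(1) unfolding a_def b_def chart_def by (auto simp: inv_chart aff_pt(1)[symmetric] aff_pt(2)[symmetric])
  have V: "open (range \<alpha>)" using \<alpha>(1) chart_open_image by blast
  have hab: "cp1_holo (range \<alpha>) a" "cp1_holo (range \<alpha>) b"
    unfolding cp1_holo_iff[OF V] a_def b_def using \<alpha>(1) hol_at_inv_chart by auto
  define s where "s k q = cscale (a q) (w k) + cscale (b q) (Jc (w k))" for k q
  have JE: "Jc x \<in> E \<times> E" if "x \<in> W" for x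
  proof -
    obtain y where "y \<in> E" "x = (y, \<sigma> qi y)" using \<open>x \<in> W\<close> by (rule WE)
    then show ?thesis using Jc_W sD(1) subspace_neg[OF sub] by simp
  qed
  have "holo_vector_map E (range \<alpha>) (s k)" if "k < n" for k
    unfolding holo_vector_map_def
  proof (intro exI[of _ "2 :: nat"] exI conjI)
    show "\<forall>j<2. (\<lambda>j::nat. if j = 0 then w k else Jc (w k)) j \<in> E \<times> E \<and> cp1_holo (range \<alpha>) ((\<lambda>j::nat. if j = 0 then a else b) j)"
      using w(1)[OF that] W_sub_E JE hab by auto
    show "\<forall>q\<in>range \<alpha>. s k q = (\<Sum>j<2. cscale ((\<lambda>j::nat. if j = 0 then a else b) j q) ((\<lambda>j::nat. if j = 0 then w k else Jc (w k)) j))"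
      by (simp add: s_def numeral_2_eq_2)
  qed
  moreover have comb: "(\<Sum>k<n. cscale (c k) (s k q)) =
      cscale (a q) (\<Sum>k<n. cscale (c k) (w k)) + cscale (b q) (Jc (\<Sum>k<n. cscale (c k) (w k)))" for c q
    unfolding s_def cxp.linear_sum[OF Jc_clin] cx.scale_sum_right
    by (simp add: cx.scale_right_distrib sum.distrib clinD[OF Jc_clin] mult.commute)
  have "E01 E (std q) = {\<Sum>k<n. cscale (c k) (s k q) |c. True}" if "q \<in> range \<alpha>" for q
  proof -
    have "E01 E (std q) = {cscale (a q) w + cscale (b q) (Jc w) |w. w \<in> W}"
      using E01_std[OF ab(1)[OF that]] unfolding ab(2)[OF that, symmetric] .
    also have "\<dots> = {\<Sum>k<n. cscale (c k) (s k q) |c. True}"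
    proof (intro set_eqI iffI)
      fix x assume "x \<in> {cscale (a q) w + cscale (b q) (Jc w) |w. w \<in> W}"
      then obtain w' where w': "w' \<in> W" "x = cscale (a q) w' + cscale (b q) (Jc w')" by blast
      obtain c where c: "w' = (\<Sum>k<n. cscale (c k) (w k))"
        using w'(1)[unfolded w(2)] by blast
      show "x \<in> {\<Sum>k<n. cscale (c k) (s k q) |c. True}"
        unfolding w'(2) c comb[symmetric] by blast
    next
      fix x assume "x \<in> {\<Sum>k<n. cscale (c k) (s k q) |c. True}"
      then obtain c where c: "x = (\<Sum>k<n. cscale (c k) (s k q))" by blast
      have "(\<Sum>k<n. cscale (c k) (w k)) \<in> W" unfolding w(2) by blast
      then show "x \<in> {cscale (a q) w + cscale (b q) (Jc w) |w. w \<in> W}"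
        unfolding c comb by blast
    qed
    finally show ?thesis .
  qed
  moreover have "\<forall>k<n. c k = 0" if "q \<in> range \<alpha>" "(\<Sum>k<n. cscale (c k) (s k q)) = 0" for q c
  proof -
    have "(\<Sum>k<n. cscale (c k) (w k)) \<in> W" unfolding w(2) by blast
    then have "(\<Sum>k<n. cscale (c k) (w k)) = 0"
      using pencil_inj ab(1)[OF that(1)] that(2) unfolding comb by blast
    then show ?thesis using w(3) by blast
  qed
  moreover have "p \<in> range \<alpha>" using \<alpha>(2) by blast
  ultimately have "cp1_open (range \<alpha>) \<and> p \<in> range \<alpha> \<and> (\<forall>k<n. holo_vector_map E (range \<alpha>) (s k)) \<and>
      (\<forall>q\<in>range \<alpha>. E01 E (std q) = {\<Sum>k<n. cscale (c k) (s k q) |c. True} \<and>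
        (\<forall>c. (\<Sum>k<n. cscale (c k) (s k q)) = 0 \<longrightarrow> (\<forall>k<n. c k = 0)))"
    using V unfolding open_cp1_def by (intro conjI ballI) (assumption | blast)+
  then show "\<exists>V n (s :: nat \<Rightarrow> cp1 \<Rightarrow> 'e \<times> 'e). cp1_open V \<and> p \<in> V \<and> (\<forall>k<n. holo_vector_map E V (s k)) \<and>
      (\<forall>q\<in>V. E01 E (std q) = {\<Sum>k<n. cscale (c k) (s k q) |c. True} \<and>
        (\<forall>c. (\<Sum>k<n. cscale (c k) (s k q)) = 0 \<longrightarrow> (\<forall>k<n. c k = 0)))"
    by blast
qed

lemma ident_exists:
  assumes "Q = {\<sigma> \<circ> so3_act R |R. rotation_matrix R}"
  shows "\<exists>\<zeta>. cp1_ident E Q \<zeta>"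
proof
  note b = std_bij[OF assms]
  have "inv_into (adm Q) (inv std) p = std p" for p
    by (rule inv_into_f_eq[OF bij_betw_imp_inj_on[OF bij_betw_inv_into[OF b]]])
      (use b in \<open>auto simp: bij_betw_def inv_f_f[OF std_inj]\<close>)
  then show "cp1_ident E Q (inv std)"
    unfolding cp1_ident_def using std_holo_subbundle bij_betw_inv_into[OF b] by simp
qed

text \<open>The projection of the complexification onto \<open>W\<close> along \<open>j W\<close>, composed with a functional.\<close>

lemma coordinate_functional:
  assumes "w0 \<in> W" "w0 \<noteq> 0"
  obtains l m where "cfun l" "cfun m" "l w0 \<noteq> 0"
    "\<And>a b w. w \<in> W \<Longrightarrow> l (cscale a w + cscale b (Jc w)) = a * l w"
    "\<And>a b w. w \<in> W \<Longrightarrow> m (cscale a w + cscale b (Jc w)) = b * l w"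
proof -
  obtain g where g: "cfun g" "g w0 \<noteq> 0" using cfun_separates assms(2) by blast
  define Ic where "Ic = map_prod (lext qi) (lext qi)"
  have Ic: "clin Ic" unfolding Ic_def using clin_map_prod lext by blast
  \<comment> \<open>The projection onto the \<open>-\<i>\<close> eigenspace of \<open>i\<close>,
    which is \<open>W\<close>; the subspace \<open>j W\<close> is the other eigenspace.\<close>
  define pr where "pr x = cscale (1/2) (x + cscale \<i> (Ic x))" for x
  have pr: "clin pr"
    unfolding pr_def by (intro clin_scale clin_add Ic cx.linear_ident)
  have prW: "pr w = w" "pr (Jc w) = 0" "Jc (Jc w) = - w" if "w \<in> W" for w
  proof -
    obtain x where x: "x \<in> E" "w = (x, \<sigma> qi x)" using \<open>w \<in> W\<close> by (rule WE)
    have m: "\<sigma> qi (\<sigma> qi x) = - x" "\<sigma> qi (\<sigma> qj x) = \<sigma> qk x" "\<sigma> qi (\<sigma> qk x) = - \<sigma> qj x"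
      "\<sigma> qj (\<sigma> qj x) = - x" "\<sigma> qj (\<sigma> qk x) = \<sigma> qi x"
      using s_one[OF x(1)] s_minus[of "(1, 0)" x] by (simp_all add: s_mult qmult_Q4 s_minus[symmetric] Q4_minus Q4_1)
    have in_E: "\<sigma> q x \<in> E" for q using sD(1) x(1) by blast
    have "Ic w = (\<sigma> qi x, - x)" unfolding Ic_def x(2) using x(1) in_E by (simp add: lext m)
    then show "pr w = w" unfolding pr_def x(2) cscale_def by (simp flip: scaleR_2)
    have "Ic (Jc w) = (\<sigma> qk x, \<sigma> qj x)"
      unfolding Ic_def x(2) Jc_W[OF x(1)] using in_E subspace_neg[OF sub] by (simp add: lext m sD)
    then show "pr (Jc w) = 0" unfolding pr_def x(2) Jc_W[OF x(1)] cscale_def by (simp add: zero_prod_def)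
    show "Jc (Jc w) = - w"
      unfolding x(2) Jc_W[OF x(1)] unfolding Jc_def using in_E subspace_neg[OF sub] by (simp add: lext m sD)
  qed
  have mm: "clin (\<lambda>x. - Jc x)" using clin_neg[OF Jc_clin] .
  show ?thesis
  \<comment> \<open>Since \<open>j j = -1\<close>, applying \<open>- j\<close> exchanges the two
    summands, so the same projection then reads off the coefficient \<open>b\<close>.\<close>
  proof (rule that[of "\<lambda>x. g (pr x)" "\<lambda>x. g (pr (- Jc x))"])
    show "cfun (\<lambda>x. g (pr x))" by (rule cfun_comp[OF pr g(1)])
    show "cfun (\<lambda>x. g (pr (- Jc x)))" by (rule cfun_comp[OF clin_comp[OF mm pr] g(1)])
    show "g (pr w0) \<noteq> 0" using prW assms(1) g(2) by simp
    fix a b w assume w: "w \<in> W"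
    show "g (pr (cscale a w + cscale b (Jc w))) = a * g (pr w)"
      by (simp add: clinD[OF pr] prW[OF w] cfunD[OF g(1)])
    have "- Jc (cscale a w + cscale b (Jc w)) = cscale b w - cscale a (Jc w)"
      by (simp add: clinD[OF Jc_clin] prW[OF w])
    then show "g (pr (- Jc (cscale a w + cscale b (Jc w)))) = b * g (pr w)"
      by (simp add: clinD[OF pr] prW[OF w] cfunD[OF g(1)])
  qed
qed

lemma W_nonzero: "\<exists>w\<in>W. w \<noteq> 0"
proof -
  obtain x where "x \<in> E" "x \<noteq> 0" using nz sub subspace_0 by blast
  then show ?thesis using WI[of x] by (force simp: zero_prod_def)
qed

text \<open>The base point can be read off from a nonvanishing local section of the eigenspace
  bundle: the section is \<open>a w + b j w\<close>, and two functionals return \<open>a\<close> and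
  \<open>b\<close> up to a common factor. Applied to a holomorphic frame, this makes the change of
  identification holomorphic.\<close>

theorem ident_std:
  assumes Q: "Q = {\<sigma> \<circ> so3_act R |R. rotation_matrix R}" and \<zeta>: "cp1_ident E Q \<zeta>"
  shows "cp1_biholo (\<zeta> \<circ> std)" "inv_into (adm Q) \<zeta> (\<zeta> (std p)) = std p"
proof -
  note b = std_bij[OF Q]
  have \<zeta>b: "bij_betw \<zeta> (adm Q) UNIV" and S: "holo_subbundle E (\<lambda>p. E01 E (inv_into (adm Q) \<zeta> p))"
    using \<zeta> unfolding cp1_ident_def by auto
  have inv: "inv_into (adm Q) \<zeta> (\<zeta> (std p)) = std p" for p
    by (rule inv_into_f_f[OF bij_betw_imp_inj_on[OF \<zeta>b]]) (use b in \<open>auto simp: bij_betw_def\<close>)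
  then show "inv_into (adm Q) \<zeta> (\<zeta> (std p)) = std p" .
  define \<theta> where "\<theta> = \<zeta> \<circ> std"
  have \<theta>: "bij \<theta>" unfolding \<theta>_def using bij_betw_trans[OF b \<zeta>b] .
  have E\<theta>: "E01 E (inv_into (adm Q) \<zeta> p) = E01 E (std (inv \<theta> p))" for p
  proof -
    have "p = \<zeta> (std (inv \<theta> p))" using \<theta> unfolding \<theta>_def by (metis bij_is_surj comp_apply surj_f_inv_f)
    then show ?thesis using inv by metis
  qed
  have "hmap_at (inv \<theta>) p" for p
  proof -
    obtain V n and s :: "nat \<Rightarrow> cp1 \<Rightarrow> 'e \<times> 'e" where *: "cp1_open V \<and> p \<in> V \<and>
        (\<forall>k<n. holo_vector_map E V (s k)) \<and>
        (\<forall>q\<in>V. E01 E (std (inv \<theta> q)) = {\<Sum>k<n. cscale (c k) (s k q) |c. True} \<and>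
           (\<forall>c. (\<Sum>k<n. cscale (c k) (s k q)) = 0 \<longrightarrow> (\<forall>k<n. c k = 0)))"
      using S[unfolded holo_subbundle_def E\<theta>, rule_format, of p] by (elim exE) (rule that)
    have V: "cp1_open V" "p \<in> V"
      and s: "\<And>k. k < n \<Longrightarrow> holo_vector_map E V (s k)"
      and span: "\<And>q. q \<in> V \<Longrightarrow> E01 E (std (inv \<theta> q)) = {\<Sum>k<n. cscale (c k) (s k q) |c. True}"
      and ind: "\<And>q c. q \<in> V \<Longrightarrow> (\<Sum>k<n. cscale (c k) (s k q)) = 0 \<Longrightarrow> \<forall>k<n. c k = 0"
      using * by simp_all
    have opV: "open V" using V unfolding open_cp1_def by simp
    obtain a0 b0 where ab0: "(a0, b0) \<noteq> (0, 0)" "inv \<theta> p = pt a0 b0" by (rule pt_exhaust)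
    have "n \<noteq> 0"
    proof
      assume "n = 0"
      then have "E01 E (std (inv \<theta> p)) = {0}" using span[OF V(2)] by auto
      moreover obtain w where w: "w \<in> W" "w \<noteq> 0" using W_nonzero by blast
      ultimately have "cscale a0 w + cscale b0 (Jc w) = 0"
        unfolding ab0(2) E01_std[OF ab0(1)] by blast
      then show False using pencil_inj[OF ab0(1)] w by blast
    qed
    then have n: "0 < n" by simp
    have s0_in: "s 0 q \<in> E01 E (std (inv \<theta> q))" if "q \<in> V" for q
    proof -
      have "(\<Sum>k<n. cscale ((\<lambda>k. if k = 0 then 1 else 0) k) (s k q)) = (\<Sum>k<n. if k = 0 then s k q else 0)"
        by (rule sum.cong) auto
      also have "\<dots> = s 0 q" using n by simp
      finally have "s 0 q = (\<Sum>k<n. cscale ((\<lambda>k. if k = 0 then 1 else 0) k) (s k q))" ..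
      then show ?thesis unfolding span[OF that]
        by (intro CollectI exI[of _ "\<lambda>k. if k = 0 then 1 else 0"] conjI TrueI)
    qed
    have s0_nz: "s 0 p \<noteq> 0"
    proof
      assume 0: "s 0 p = 0"
      have "(\<Sum>k<n. cscale ((\<lambda>k. if k = 0 then 1 else 0) k) (s k p)) = (\<Sum>k<n. if k = 0 then s k p else 0)"
        by (rule sum.cong) auto
      also have "\<dots> = 0" using 0 by simp
      finally show False using ind[OF V(2), of "\<lambda>k. if k = 0 then 1 else 0"] n by auto
    qed
    obtain w0 where w0: "w0 \<in> W" "s 0 p = cscale a0 w0 + cscale b0 (Jc w0)"
      using s0_in[OF V(2)] unfolding ab0(2) E01_std[OF ab0(1)] by blast
    have w0nz: "w0 \<noteq> 0" using s0_nz w0(2) clinD(4)[OF Jc_clin] by auto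
    obtain l m where lm: "cfun l" "cfun m" "l w0 \<noteq> 0"
      "\<And>a b w. w \<in> W \<Longrightarrow> l (cscale a w + cscale b (Jc w)) = a * l w"
      "\<And>a b w. w \<in> W \<Longrightarrow> m (cscale a w + cscale b (Jc w)) = b * l w"
      by (rule coordinate_functional[OF w0(1) w0nz]) (rule that)
    have vs: "vhol (s 0) p" using holo_vector_map_vhol[OF s[OF n] opV V(2)] .
    define a where "a q = l (s 0 q)" for q
    define b where "b q = m (s 0 q)" for q
    have hab: "hol_at a p" "hol_at b p" unfolding a_def b_def using vholD[OF vs] lm by auto
    have abp: "(a p, b p) \<noteq> (0, 0)"
      unfolding a_def b_def w0(2) lm(4,5)[OF w0(1)] using ab0(1) lm(3) by auto
    have "\<forall>\<^sub>F q in nhds p. (a q, b q) \<noteq> (0, 0)"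
    proof (cases "a p = 0")
      case True
      then have "\<forall>\<^sub>F q in nhds p. b q \<noteq> 0" using abp hab hol_at_nonzero by auto
      then show ?thesis by eventually_elim simp
    next
      case False
      then have "\<forall>\<^sub>F q in nhds p. a q \<noteq> 0" using hab hol_at_nonzero by auto
      then show ?thesis by eventually_elim simp
    qed
    moreover have "\<forall>\<^sub>F q in nhds p. q \<in> V" unfolding eventually_nhds using opV V by blast
    ultimately have "\<forall>\<^sub>F q in nhds p. inv \<theta> q = pt (a q) (b q)"
    proof eventually_elim
      case (elim q)
      obtain c d where cd: "(c, d) \<noteq> (0, 0)" "inv \<theta> q = pt c d" by (rule pt_exhaust)
      obtain w where w: "w \<in> W" "s 0 q = cscale c w + cscale d (Jc w)"
        using s0_in[OF elim(2)] unfolding cd(2) E01_std[OF cd(1)] by blast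
      have "a q = l w * c" "b q = l w * d"
        unfolding a_def b_def w(2) lm(4,5)[OF w(1)] by auto
      then show ?case using elim(1) pt_scale cd by auto
    qed
    then show ?thesis unfolding hmap_at_def using hab abp by blast
  qed
  then have "cp1_holo_map (inv \<theta>)" by (rule cp1_holo_mapI)
  then have "cp1_biholo (inv \<theta>)" using \<theta> bij_imp_bij_inv cp1_biholoI by blast
  then show "cp1_biholo (\<zeta> \<circ> std)"
    using cp1_biholo_inv \<theta> unfolding \<theta>_def by (metis inv_inv_eq)
qed

end

section \<open>Holomorphic vector bundles\<close>

text \<open>
  Gaussian elimination near a point at which the matrix of a holomorphic family of linear systems is
  the identity; no pivot vanishes there.
\<close>

lemma local_solve:
  assumes "\<And>i j. i < n \<Longrightarrow> j < n \<Longrightarrow> hol_at (G i j) p"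
    "\<And>i j. i < n \<Longrightarrow> j < n \<Longrightarrow> G i j p = (if i = j then 1 else 0)"
  shows "\<exists>sol :: cp1 \<Rightarrow> (nat \<Rightarrow> complex) \<Rightarrow> nat \<Rightarrow> complex.
    (\<forall>Y. (\<forall>j<n. hol_at (\<lambda>q. Y q j) p) \<longrightarrow> (\<forall>i<n. hol_at (\<lambda>q. sol q (Y q) i) p)) \<and>
    (\<forall>\<^sub>F q in nhds p. \<forall>x y. (\<forall>i<n. (\<Sum>j<n. G i j q * x j) = y i) \<longleftrightarrow> (\<forall>i<n. x i = sol q y i))"
  using assms
proof (induction n arbitrary: G)
  case 0
  then show ?case by auto
next
  case (Suc n)
  have hG: "hol_at (G i j) p" if "i \<le> n" "j \<le> n" for i j using Suc.prems(1) that by simp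
  have Gp: "G i j p = (if i = j then 1 else 0)" if "i \<le> n" "j \<le> n" for i j using Suc.prems(2) that by simp
  have gp: "G n n p \<noteq> 0" using Gp by simp
  \<comment> \<open>The Schur complement of the last pivot. At \<open>p\<close> the off-diagonal
    entries vanish, so it is again the identity there.\<close>
  define G' where "G' i j q = G i j q - G i n q * (G n j q / G n n q)" for i j q
  have "\<exists>sol :: cp1 \<Rightarrow> (nat \<Rightarrow> complex) \<Rightarrow> nat \<Rightarrow> complex.
    (\<forall>Y. (\<forall>j<n. hol_at (\<lambda>q. Y q j) p) \<longrightarrow> (\<forall>i<n. hol_at (\<lambda>q. sol q (Y q) i) p)) \<and>
    (\<forall>\<^sub>F q in nhds p. \<forall>x y. (\<forall>i<n. (\<Sum>j<n. G' i j q * x j) = y i) \<longleftrightarrow> (\<forall>i<n. x i = sol q y i))"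
  proof (rule Suc.IH)
    show "hol_at (G' i j) p" if "i < n" "j < n" for i j
      unfolding G'_def using that gp by (intro hol_at_diff hol_at_mult hol_at_divide hG) auto
    show "G' i j p = (if i = j then 1 else 0)" if "i < n" "j < n" for i j
      unfolding G'_def using that by (simp add: Gp)
  qed
  then obtain sol where sol: "\<And>Y i. (\<And>j. j < n \<Longrightarrow> hol_at (\<lambda>q. Y q j) p) \<Longrightarrow> i < n \<Longrightarrow> hol_at (\<lambda>q. sol q (Y q) i) p"
    "\<forall>\<^sub>F q in nhds p. \<forall>x y. (\<forall>i<n. (\<Sum>j<n. G' i j q * x j) = y i) \<longleftrightarrow> (\<forall>i<n. x i = sol q y i)"
    by blast
  define z where "z q y = sol q (\<lambda>k. y k - G k n q * (y n / G n n q))" for q y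
  define sol' where "sol' q y i = (if i < n then z q y i
      else (y n - (\<Sum>l<n. G n l q * z q y l)) / G n n q)" for q y i
  show ?case
  proof (intro exI[of _ sol'] conjI allI impI)
    fix Y i assume Y: "\<forall>j<Suc n. hol_at (\<lambda>q. Y q j) p" and i: "i < Suc n"
    have hz: "hol_at (\<lambda>q. z q (Y q) l) p" if "l < n" for l
      unfolding z_def
      by (rule sol(1)[where Y = "\<lambda>q k. Y q k - G k n q * (Y q n / G n n q)", OF _ that])
        (use Y gp in \<open>intro hol_at_diff hol_at_mult hol_at_divide hG; simp\<close>)
    have "hol_at (\<lambda>q. (Y q n - (\<Sum>l<n. G n l q * z q (Y q) l)) / G n n q) p"
      using Y gp by (intro hol_at_divide hol_at_diff hol_at_sum hol_at_mult hG hz) auto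
    then show "hol_at (\<lambda>q. sol' q (Y q) i) p"
      using hz by (cases "i < n") (simp_all add: sol'_def)
  next
    show "\<forall>\<^sub>F q in nhds p. \<forall>x y. (\<forall>i<Suc n. (\<Sum>j<Suc n. G i j q * x j) = y i) \<longleftrightarrow>
        (\<forall>i<Suc n. x i = sol' q y i)"
      using sol(2) hol_at_nonzero[OF hG[OF order_refl order_refl] gp]
    proof eventually_elim
      case (elim q)
      show ?case
      proof (intro allI)
        fix x y :: "nat \<Rightarrow> complex"
        have last: "(\<Sum>j<n. G n j q * x j) + G n n q * x n = y n \<longleftrightarrow>
            x n = (y n - (\<Sum>j<n. G n j q * x j)) / G n n q"
          using elim(2) by (auto simp: field_simps)
        have red: "(\<Sum>j<n. G i j q * x j) + G i n q * x n = y i \<longleftrightarrow>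
            (\<Sum>j<n. G' i j q * x j) = y i - G i n q * (y n / G n n q)"
          if xn: "x n = (y n - (\<Sum>j<n. G n j q * x j)) / G n n q" for i
        proof -
          have "(\<Sum>j<n. G' i j q * x j) = (\<Sum>j<n. G i j q * x j) - G i n q * ((\<Sum>j<n. G n j q * x j) / G n n q)"
          proof -
            have "(\<Sum>j<n. G' i j q * x j) = (\<Sum>j<n. G i j q * x j - G i n q / G n n q * (G n j q * x j))"
              unfolding G'_def by (rule sum.cong) (simp_all add: algebra_simps)
            then show ?thesis unfolding sum_subtractf sum_distrib_left[symmetric] by simp
          qed
          moreover have "G i n q * x n = G i n q * (y n / G n n q) - G i n q * ((\<Sum>j<n. G n j q * x j) / G n n q)"
            unfolding xn by (simp add: diff_divide_distrib right_diff_distrib)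
          ultimately have "(\<Sum>j<n. G i j q * x j) + G i n q * x n =
              (\<Sum>j<n. G' i j q * x j) + G i n q * (y n / G n n q)"
            by simp
          then show ?thesis by (simp add: eq_diff_eq)
        qed
        have "(\<forall>i<Suc n. (\<Sum>j<Suc n. G i j q * x j) = y i) \<longleftrightarrow>
            (\<forall>i<n. (\<Sum>j<n. G i j q * x j) + G i n q * x n = y i) \<and>
            x n = (y n - (\<Sum>j<n. G n j q * x j)) / G n n q"
          using last by (auto simp: less_Suc_eq)
        also have "\<dots> \<longleftrightarrow> (\<forall>i<n. (\<Sum>j<n. G' i j q * x j) = y i - G i n q * (y n / G n n q)) \<and>
            x n = (y n - (\<Sum>j<n. G n j q * x j)) / G n n q"
          using red by blast
        also have "\<dots> \<longleftrightarrow> (\<forall>i<n. x i = z q y i) \<and> x n = (y n - (\<Sum>j<n. G n j q * x j)) / G n n q"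
          using elim(1)[rule_format, of x "\<lambda>k. y k - G k n q * (y n / G n n q)"] unfolding z_def by simp
        also have "\<dots> \<longleftrightarrow> (\<forall>i<n. x i = z q y i) \<and> x n = (y n - (\<Sum>j<n. G n j q * z q y j)) / G n n q"
        proof -
          have "(\<Sum>j<n. G n j q * x j) = (\<Sum>j<n. G n j q * z q y j)" if "\<forall>i<n. x i = z q y i"
            using that by (intro sum.cong) auto
          then show ?thesis by auto
        qed
        also have "\<dots> \<longleftrightarrow> (\<forall>i<Suc n. x i = sol' q y i)"
          unfolding sol'_def by (auto simp: less_Suc_eq)
        finally show "(\<forall>i<Suc n. (\<Sum>j<Suc n. G i j q * x j) = y i) \<longleftrightarrow> (\<forall>i<Suc n. x i = sol' q y i)" .
      qed
    qed
  qed
qed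

lemma local_trivD:
  assumes "local_triv B V n \<phi>"
  shows "open V" "p \<in> V \<Longrightarrow> bij_betw \<phi> (fibre B p) (Cn n)"
    "p \<in> V \<Longrightarrow> x \<in> fibre B p \<Longrightarrow> y \<in> fibre B p \<Longrightarrow> vadd B x y \<in> fibre B p"
    "p \<in> V \<Longrightarrow> x \<in> fibre B p \<Longrightarrow> y \<in> fibre B p \<Longrightarrow> \<phi> (vadd B x y) i = \<phi> x i + \<phi> y i"
    "p \<in> V \<Longrightarrow> x \<in> fibre B p \<Longrightarrow> vscale B c x \<in> fibre B p"
    "p \<in> V \<Longrightarrow> x \<in> fibre B p \<Longrightarrow> \<phi> (vscale B c x) i = c * \<phi> x i"
  using assms unfolding local_triv_def open_cp1_def by auto

lemma frame_props:
  assumes "local_triv B V n \<phi>" "p \<in> V" "j < n"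
  shows "frame B \<phi> j p \<in> fibre B p" "\<phi> (frame B \<phi> j p) = (\<lambda>i. if i = j then 1 else 0)"
proof -
  have b: "bij_betw \<phi> (fibre B p) (Cn n)" using local_trivD(2)[OF assms(1,2)] .
  have e: "(\<lambda>i. if i = j then 1 else 0) \<in> Cn n" using assms(3) by (auto simp: Cn_def)
  then have e': "(\<lambda>i. if i = j then 1 else 0) \<in> \<phi> ` fibre B p" using b by (simp add: bij_betw_def)
  show "frame B \<phi> j p \<in> fibre B p" unfolding frame_def using inv_into_into[OF e'] .
  show "\<phi> (frame B \<phi> j p) = (\<lambda>i. if i = j then 1 else 0)" unfolding frame_def using f_inv_into_f[OF e'] .
qed

text \<open>Fibres are known only through \<open>vadd\<close> and \<open>vscale\<close>, so finite
  sums in them are not at hand. The coordinates of \<open>x\<close> are cleared one at a time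
  instead, by adding multiples of frame vectors.\<close>

lemma linear_in_frame:
  fixes L :: "'t \<Rightarrow> nat \<Rightarrow> complex"
  assumes B: "local_triv B V n \<phi>" and p: "p \<in> V" and x: "x \<in> fibre B p"
    and add: "\<And>x y. x \<in> fibre B p \<Longrightarrow> y \<in> fibre B p \<Longrightarrow> L (vadd B x y) i = L x i + L y i"
    and scale: "\<And>c x. x \<in> fibre B p \<Longrightarrow> L (vscale B c x) i = c * L x i"
  shows "L x i = (\<Sum>j<n. \<phi> x j * L (frame B \<phi> j p) i)"
proof -
  have b: "bij_betw \<phi> (fibre B p) (Cn n)" using local_trivD(2)[OF B p] .
  have "L x i = (\<Sum>j<k. \<phi> x j * L (frame B \<phi> j p) i)"
    if "x \<in> fibre B p" "k \<le> n" "\<forall>j\<ge>k. \<phi> x j = 0" for k x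
    using that
  proof (induction k arbitrary: x)
    case 0
    have in0: "vscale B 0 x \<in> fibre B p" using local_trivD(5)[OF B p] 0 by blast
    have "\<phi> (vscale B 0 x) = \<phi> x" using local_trivD(6)[OF B p] 0 by auto
    then have "vscale B 0 x = x" using b in0 0(1) by (auto simp: bij_betw_def dest: inj_onD)
    then show ?case using scale[OF 0(1), of 0] by simp
  next
    case (Suc k)
    define f where "f = frame B \<phi> k p"
    have f: "f \<in> fibre B p" "\<phi> f = (\<lambda>i. if i = k then 1 else 0)"
      unfolding f_def using frame_props[OF B p] Suc.prems(2) by auto
    define g where "g = vscale B (- \<phi> x k) f"
    have g: "g \<in> fibre B p" "\<And>j. \<phi> g j = - \<phi> x k * \<phi> f j" "L g i = - \<phi> x k * L f i"
      unfolding g_def using local_trivD(5,6)[OF B p f(1)] scale[OF f(1)] by auto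
    define y where "y = vadd B x g"
    have y: "y \<in> fibre B p" "\<And>j. \<phi> y j = \<phi> x j + \<phi> g j" "L y i = L x i + L g i"
      unfolding y_def using local_trivD(3,4)[OF B p Suc.prems(1) g(1)] add[OF Suc.prems(1) g(1)] by auto
    have "\<forall>j\<ge>k. \<phi> y j = 0"
      using Suc.prems(3) unfolding y(2) g(2) f(2) by (auto simp: Suc_le_eq)
    then have "L y i = (\<Sum>j<k. \<phi> y j * L (frame B \<phi> j p) i)"
      using Suc.IH[OF y(1)] Suc.prems(2) by simp
    also have "\<dots> = (\<Sum>j<k. \<phi> x j * L (frame B \<phi> j p) i)"
      by (rule sum.cong) (auto simp: y(2) g(2) f(2))
    finally show ?case
      using y(3) g(3) unfolding f_def by (simp add: algebra_simps)
  qed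
  moreover have "\<forall>j\<ge>n. \<phi> x j = 0" using b x unfolding bij_betw_def Cn_def by blast
  ultimately show ?thesis using x by blast
qed

subsection \<open>The category of bundles\<close>

lemma holo_bundleD:
  assumes "holo_bundle B"
  shows "(V, n, \<phi>) \<in> atlas B \<Longrightarrow> local_triv B V n \<phi>"
    "\<exists>V n \<phi>. (V, n, \<phi>) \<in> atlas B \<and> p \<in> V"
    "(V, n, \<phi>) \<in> atlas B \<Longrightarrow> (W, m, \<psi>) \<in> atlas B \<Longrightarrow> j < n \<Longrightarrow> i < m \<Longrightarrow>
       cp1_holo (V \<inter> W) (\<lambda>p. \<psi> (frame B \<phi> j p) i)"
proof -
  show "local_triv B V n \<phi>" if "(V, n, \<phi>) \<in> atlas B"
    using assms that unfolding holo_bundle_def by fast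
  show "\<exists>V n \<phi>. (V, n, \<phi>) \<in> atlas B \<and> p \<in> V"
    using assms unfolding holo_bundle_def by fast
  show "cp1_holo (V \<inter> W) (\<lambda>p. \<psi> (frame B \<phi> j p) i)"
    if "(V, n, \<phi>) \<in> atlas B" "(W, m, \<psi>) \<in> atlas B" "j < n" "i < m"
  proof -
    have "holo_transition B (V, n, \<phi>) (W, m, \<psi>)"
      using assms that(1,2) unfolding holo_bundle_def by blast
    then show ?thesis using that(3,4) unfolding holo_transition_def by simp
  qed
qed

lemma bundle_closed:
  assumes "holo_bundle B" "x \<in> fibre B p"
  shows "y \<in> fibre B p \<Longrightarrow> vadd B x y \<in> fibre B p" "vscale B c x \<in> fibre B p"
  using holo_bundleD(2)[OF assms(1), of p] holo_bundleD(1)[OF assms(1)] local_trivD(3,5) assms(2) by metis+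

lemma total_fibre: "x \<in> total B \<longleftrightarrow> x \<in> fibre B (proj B x)"
  by (simp add: fibre_def)

lemma fibre_total: "x \<in> fibre B p \<Longrightarrow> x \<in> total B \<and> proj B x = p"
  by (simp add: fibre_def)

text \<open>This records how a solution function behaves on holomorphic right hand sides; that it
  solves the system near \<open>p\<close> is always stated beside it.\<close>

definition hol_solver :: "cp1 \<Rightarrow> nat \<Rightarrow> (cp1 \<Rightarrow> (nat \<Rightarrow> complex) \<Rightarrow> nat \<Rightarrow> complex) \<Rightarrow> bool" where
  "hol_solver p n sol \<longleftrightarrow>
     (\<forall>Y. (\<forall>j<n. hol_at (\<lambda>q. Y q j) p) \<longrightarrow> (\<forall>i<n. hol_at (\<lambda>q. sol q (Y q) i) p))"

lemma hol_solverD: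
  "hol_solver p n sol \<Longrightarrow> (\<And>j. j < n \<Longrightarrow> hol_at (\<lambda>q. Y q j) p) \<Longrightarrow> i < n \<Longrightarrow> hol_at (\<lambda>q. sol q (Y q) i) p"
  unfolding hol_solver_def by blast

text \<open>\<open>bundle_mor\<close> with the base map made explicit and with the holomorphy
  conditions stated at points rather than on open sets.\<close>

definition mor_over :: "'t hbundle \<Rightarrow> 's hbundle \<Rightarrow> (cp1 \<Rightarrow> cp1) \<Rightarrow> ('t \<Rightarrow> 's) \<Rightarrow> bool" where
  "mor_over B B' g \<T> \<longleftrightarrow> \<T> \<in> total B \<rightarrow>\<^sub>E total B' \<and> cp1_biholo g \<and>
    (\<forall>p. \<forall>x\<in>fibre B p. \<T> x \<in> fibre B' (g p)) \<and>
    (\<forall>p. \<forall>x\<in>fibre B p. \<forall>y\<in>fibre B p. \<T> (vadd B x y) = vadd B' (\<T> x) (\<T> y)) \<and>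
    (\<forall>c. \<forall>x\<in>total B. \<T> (vscale B c x) = vscale B' c (\<T> x)) \<and>
    (\<forall>V n \<phi> W m \<psi> p j i. (V, n, \<phi>) \<in> atlas B \<longrightarrow> (W, m, \<psi>) \<in> atlas B' \<longrightarrow> j < n \<longrightarrow> i < m \<longrightarrow>
       p \<in> V \<longrightarrow> g p \<in> W \<longrightarrow> hol_at (\<lambda>p. \<psi> (\<T> (frame B \<phi> j p)) i) p)"

lemma bundle_mor_iff:
  assumes "holo_bundle B" "holo_bundle B'"
  shows "\<T> \<in> bundle_mor B B' \<longleftrightarrow> (\<exists>g. mor_over B B' g \<T>)"
proof -
  have eq: "(cp1_biholo g \<and>
        (\<forall>x\<in>total B. proj B' (\<T> x) = g (proj B x)) \<and>
        (\<forall>p. \<forall>x\<in>fibre B p. \<forall>y\<in>fibre B p. \<T> (vadd B x y) = vadd B' (\<T> x) (\<T> y)) \<and>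
        (\<forall>c. \<forall>x\<in>total B. \<T> (vscale B c x) = vscale B' c (\<T> x)) \<and>
        (\<forall>(V, n, \<phi>)\<in>atlas B. \<forall>(W, m, \<psi>)\<in>atlas B'. \<forall>j<n. \<forall>i<m.
           cp1_holo (V \<inter> g -` W) (\<lambda>p. \<psi> (\<T> (frame B \<phi> j p)) i))) \<longleftrightarrow> mor_over B B' g \<T>"
    if T: "\<T> \<in> total B \<rightarrow>\<^sub>E total B'" for g
  proof (cases "cp1_biholo g")
    case True
    have "cp1_holo (V \<inter> g -` W) h \<longleftrightarrow> (\<forall>p. p \<in> V \<longrightarrow> g p \<in> W \<longrightarrow> hol_at h p)"
      if "(V, n, \<phi>) \<in> atlas B" "(W, m, \<psi>) \<in> atlas B'" for V n \<phi> W m \<psi> h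
    proof -
      have "open V" "open W"
        using that local_trivD(1) holo_bundleD(1) assms by metis+
      then have "open (V \<inter> g -` W)"
        using True unfolding cp1_biholo_def cp1_holo_map_def open_cp1_def[symmetric] by blast
      then show ?thesis by (auto simp: cp1_holo_iff)
    qed
    then have a: "(\<forall>(V, n, \<phi>)\<in>atlas B. \<forall>(W, m, \<psi>)\<in>atlas B'. \<forall>j<n. \<forall>i<m.
           cp1_holo (V \<inter> g -` W) (\<lambda>p. \<psi> (\<T> (frame B \<phi> j p)) i)) \<longleftrightarrow>
        (\<forall>V n \<phi> W m \<psi> p j i. (V, n, \<phi>) \<in> atlas B \<longrightarrow> (W, m, \<psi>) \<in> atlas B' \<longrightarrow> j < n \<longrightarrow> i < m \<longrightarrow>
       p \<in> V \<longrightarrow> g p \<in> W \<longrightarrow> hol_at (\<lambda>p. \<psi> (\<T> (frame B \<phi> j p)) i) p)"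
      by fastforce
    have b: "(\<forall>x\<in>total B. proj B' (\<T> x) = g (proj B x)) \<longleftrightarrow> (\<forall>p. \<forall>x\<in>fibre B p. \<T> x \<in> fibre B' (g p))"
      using T by (auto simp: fibre_def)
    show ?thesis unfolding mor_over_def a b by (simp add: T)
  qed (simp add: mor_over_def)
  show ?thesis
  proof (cases "\<T> \<in> total B \<rightarrow>\<^sub>E total B'")
    case True
    then show ?thesis unfolding bundle_mor_def by (simp add: eq[OF True])
  next
    case False
    then show ?thesis unfolding bundle_mor_def mor_over_def by simp
  qed
qed

lemma mor_overD:
  assumes "mor_over B B' g \<T>"
  shows "\<T> \<in> total B \<rightarrow>\<^sub>E total B'" "cp1_biholo g" "x \<in> fibre B p \<Longrightarrow> \<T> x \<in> fibre B' (g p)"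
    "x \<in> fibre B p \<Longrightarrow> y \<in> fibre B p \<Longrightarrow> \<T> (vadd B x y) = vadd B' (\<T> x) (\<T> y)"
    "x \<in> fibre B p \<Longrightarrow> \<T> (vscale B c x) = vscale B' c (\<T> x)"
    "(V, n, \<phi>) \<in> atlas B \<Longrightarrow> (W, m, \<psi>) \<in> atlas B' \<Longrightarrow> j < n \<Longrightarrow> i < m \<Longrightarrow>
       p \<in> V \<Longrightarrow> g p \<in> W \<Longrightarrow> hol_at (\<lambda>p. \<psi> (\<T> (frame B \<phi> j p)) i) p"
  using assms unfolding mor_over_def by (auto simp: fibre_def)

lemma cp1_holo_map_vimage: "cp1_holo_map g \<Longrightarrow> open V \<Longrightarrow> open (g -` V)"
  unfolding cp1_holo_map_def open_cp1_def by blast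

lemma mor_over_id:
  assumes "holo_bundle B"
  shows "mor_over B B id (restrict id (total B))"
  unfolding mor_over_def
proof (intro conjI allI impI ballI)
  fix V n \<phi> W m \<psi> p j i
  assume a: "(V, n, \<phi>) \<in> atlas B" "(W, m, \<psi>) \<in> atlas B" "j < n" "i < m" "p \<in> V" "id p \<in> W"
  note tr = holo_bundleD(1)[OF assms]
  have op: "open (V \<inter> W)" using local_trivD(1) tr a(1,2) by blast
  have "hol_at (\<lambda>p. \<psi> (frame B \<phi> j p) i) p"
    using holo_bundleD(3)[OF assms a(1-4)] cp1_holo_iff[OF op] a by auto
  moreover have "\<forall>\<^sub>F q in nhds p. \<psi> (frame B \<phi> j q) i = \<psi> (restrict id (total B) (frame B \<phi> j q)) i"
    unfolding eventually_nhds
  proof (intro exI[of _ "V \<inter> W"] conjI op ballI)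
    fix q assume "q \<in> V \<inter> W"
    then have "frame B \<phi> j q \<in> total B" using fibre_total[OF frame_props(1)[OF tr[OF a(1)] _ a(3)]] by auto
    then show "\<psi> (frame B \<phi> j q) i = \<psi> (restrict id (total B) (frame B \<phi> j q)) i" by simp
  qed (use a in auto)
  ultimately show "hol_at (\<lambda>p. \<psi> (restrict id (total B) (frame B \<phi> j p)) i) p"
    by (rule hol_at_transfer)
next
  fix p x y assume "x \<in> fibre B p" "y \<in> fibre B p"
  then show "restrict id (total B) (vadd B x y) = vadd B (restrict id (total B) x) (restrict id (total B) y)"
    using bundle_closed(1)[OF assms] fibre_total by (metis id_apply restrict_apply')
next
  fix c x assume "x \<in> total B"
  then show "restrict id (total B) (vscale B c x) = vscale B c (restrict id (total B) x)"
    using bundle_closed(2)[OF assms] fibre_total total_fibre by (metis id_apply restrict_apply')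
qed (auto simp: cp1_biholo_id fibre_def)

text \<open>The image of a frame vector is expanded in a frame of the middle bundle; the matrix of
  the composition is then the product of two holomorphic matrices, the second one pulled back along
  \<open>g\<close>.\<close>

lemma mor_over_compose:
  assumes B: "holo_bundle B" "holo_bundle B'" "holo_bundle B''"
    and f: "mor_over B B' g \<F>" and h: "mor_over B' B'' g' \<G>"
  shows "mor_over B B'' (g' \<circ> g) (compose (total B) \<G> \<F>)"
  unfolding mor_over_def
proof (intro conjI allI impI ballI)
  have comp: "compose (total B) \<G> \<F> x = \<G> (\<F> x)" if "x \<in> fibre B p" for x p
    using that by (simp add: compose_def fibre_def)
  show "compose (total B) \<G> \<F> \<in> total B \<rightarrow>\<^sub>E total B''"
    using mor_overD(1)[OF f] mor_overD(1)[OF h] by (auto simp: compose_def PiE_iff)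
  show "cp1_biholo (g' \<circ> g)" by (rule cp1_biholo_compose[OF mor_overD(2)[OF f] mor_overD(2)[OF h]])
  show "compose (total B) \<G> \<F> x \<in> fibre B'' ((g' \<circ> g) p)" if "x \<in> fibre B p" for x p
    using mor_overD(3)[OF h mor_overD(3)[OF f that]] comp[OF that] by simp
  show "compose (total B) \<G> \<F> (vadd B x y) = vadd B'' (compose (total B) \<G> \<F> x) (compose (total B) \<G> \<F> y)"
    if "x \<in> fibre B p" "y \<in> fibre B p" for x y p
    using comp[OF that(1)] comp[OF that(2)] comp[OF bundle_closed(1)[OF B(1) that]]
      mor_overD(4)[OF f that] mor_overD(4)[OF h mor_overD(3)[OF f that(1)] mor_overD(3)[OF f that(2)]] by simp
  show "compose (total B) \<G> \<F> (vscale B c x) = vscale B'' c (compose (total B) \<G> \<F> x)" if "x \<in> total B" for c x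
  proof -
    have x: "x \<in> fibre B (proj B x)" using that by (simp add: fibre_def)
    show ?thesis
      using comp[OF x] comp[OF bundle_closed(2)[OF B(1) x]] mor_overD(5)[OF f x] mor_overD(5)[OF h mor_overD(3)[OF f x]] by simp
  qed
  fix V n \<phi> W m \<psi> p j i
  assume a: "(V, n, \<phi>) \<in> atlas B" "(W, m, \<psi>) \<in> atlas B''" "j < n" "i < m" "p \<in> V" "(g' \<circ> g) p \<in> W"
  obtain V' n' \<phi>' where b: "(V', n', \<phi>') \<in> atlas B'" "g p \<in> V'"
    using holo_bundleD(2)[OF B(2)] by blast
  note trB = holo_bundleD(1)[OF B(1) a(1)] and trB' = holo_bundleD(1)[OF B(2) b(1)] and trB'' = holo_bundleD(1)[OF B(3) a(2)]
  have "hol_at (\<lambda>q. \<Sum>l<n'. \<phi>' (\<F> (frame B \<phi> j q)) l * \<psi> (\<G> (frame B' \<phi>' l (g q))) i) p"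
  proof (intro hol_at_sum hol_at_mult)
    fix l assume l: "l \<in> {..<n'}"
    show "hol_at (\<lambda>q. \<phi>' (\<F> (frame B \<phi> j q)) l) p"
      using mor_overD(6)[OF f a(1) b(1) a(3) _ a(5) b(2)] l by simp
    have "hol_at (\<lambda>q. \<psi> (\<G> (frame B' \<phi>' l q)) i) (g p)"
      using mor_overD(6)[OF h b(1) a(2) _ a(4) b(2)] a(6) l by simp
    then show "hol_at (\<lambda>q. \<psi> (\<G> (frame B' \<phi>' l (g q))) i) p"
      using hmap_at_compose[OF cp1_biholoD(1)[OF mor_overD(2)[OF f]]] by blast
  qed
  moreover have "\<forall>\<^sub>F q in nhds p. (\<Sum>l<n'. \<phi>' (\<F> (frame B \<phi> j q)) l * \<psi> (\<G> (frame B' \<phi>' l (g q))) i) =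
      \<psi> (compose (total B) \<G> \<F> (frame B \<phi> j q)) i"
  proof -
    have "cp1_holo_map g" "cp1_holo_map g'"
      using mor_overD(2)[OF f] mor_overD(2)[OF h] unfolding cp1_biholo_def by auto
    then have "open (V \<inter> g -` (V' \<inter> g' -` W))"
      by (intro open_Int cp1_holo_map_vimage local_trivD(1)[OF trB] local_trivD(1)[OF trB'] local_trivD(1)[OF trB''])
    moreover have "p \<in> V \<inter> g -` (V' \<inter> g' -` W)" using a b by simp
    ultimately have "\<forall>\<^sub>F q in nhds p. q \<in> V \<inter> g -` (V' \<inter> g' -` W)"
      unfolding eventually_nhds by blast
    then show ?thesis
    proof eventually_elim
      case (elim q)
      then have q: "q \<in> V" "g q \<in> V'" "g' (g q) \<in> W" by auto
      have fr: "frame B \<phi> j q \<in> fibre B q" using frame_props(1)[OF trB q(1) a(3)] .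
      have "\<psi> (\<G> (\<F> (frame B \<phi> j q))) i = (\<Sum>l<n'. \<phi>' (\<F> (frame B \<phi> j q)) l * \<psi> (\<G> (frame B' \<phi>' l (g q))) i)"
        by (rule linear_in_frame[OF trB' q(2) mor_overD(3)[OF f fr], where L = "\<lambda>x. \<psi> (\<G> x)"])
          (use mor_overD[OF h] local_trivD(4,6)[OF trB'' q(3)] in auto)
      then show ?case using comp[OF fr] by simp
    qed
  qed
  ultimately show "hol_at (\<lambda>p. \<psi> (compose (total B) \<G> \<F> (frame B \<phi> j p)) i) p"
    by (rule hol_at_transfer)
qed

theorem bundle_category: "is_category bundle_cat"
  unfolding is_category_def bundle_cat_def
proof (simp, intro conjI allI impI ballI)
  fix X :: "'a hbundle" assume "holo_bundle X"
  then show "restrict id (total X) \<in> bundle_mor X X"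
    using mor_over_id by (subst bundle_mor_iff) auto
next
  fix X Y Z :: "'a hbundle" and f g
  assume B: "holo_bundle X" "holo_bundle Y" "holo_bundle Z" and "f \<in> bundle_mor X Y" "g \<in> bundle_mor Y Z"
  then obtain h k where "mor_over X Y h f" "mor_over Y Z k g"
    unfolding bundle_mor_iff[OF B(1,2)] bundle_mor_iff[OF B(2,3)] by blast
  then show "compose (total X) g f \<in> bundle_mor X Z"
    unfolding bundle_mor_iff[OF B(1,3)] using mor_over_compose[OF B] by blast
next
  fix X Y :: "'a hbundle" and f
  assume "holo_bundle X" "holo_bundle Y" and f: "f \<in> bundle_mor X Y"
  have f: "f \<in> total X \<rightarrow>\<^sub>E total Y" using f by (simp add: bundle_mor_def)
  show "compose (total X) f (restrict id (total X)) = f"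
    using f by (auto simp: compose_def fun_eq_iff PiE_iff extensional_def)
  show "compose (total X) (restrict id (total Y)) f = f"
    using f by (auto simp: compose_def fun_eq_iff PiE_iff extensional_def)
next
  fix X Y Z W :: "'a hbundle" and f g h
  assume "f \<in> bundle_mor X Y"
  then have f: "f \<in> total X \<rightarrow>\<^sub>E total Y" by (simp add: bundle_mor_def)
  show "compose (total X) h (compose (total X) g f) = compose (total X) (compose (total Y) h g) f"
    using f by (auto simp: compose_def fun_eq_iff PiE_iff)
qed

subsection \<open>Quotients of trivial bundles\<close>

lemma dual_functionals:
  assumes "finite B" "cx.independent B"
  obtains \<nu> where "\<And>d. cfun (\<nu> d)"
    "\<And>d e. d \<in> B \<Longrightarrow> e \<in> B \<Longrightarrow> \<nu> d e = (if e = d then 1 else 0)"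
    "\<And>x. x \<in> cx.span B \<Longrightarrow> x = (\<Sum>d\<in>B. cscale (\<nu> d x) d)"
proof -
  have "\<exists>l. cfun l \<and> (\<forall>e\<in>B. l e = (if e = d then 1 else 0))" for d
    using cxf.linear_independent_extend[OF assms(2), of "\<lambda>e. if e = d then 1 else 0"] by blast
  then obtain \<nu> where \<nu>: "\<And>d. cfun (\<nu> d)" "\<And>d e. e \<in> B \<Longrightarrow> \<nu> d e = (if e = d then 1 else 0)"
    by metis
  have "x = (\<Sum>d\<in>B. cscale (\<nu> d x) d)" if "x \<in> cx.span B" for x
  proof -
    have "x \<in> range (\<lambda>a. \<Sum>d\<in>B. cscale (a d) d)"
      using that unfolding cx.span_finite[OF assms(1)] .
    then obtain a where a: "x = (\<Sum>d\<in>B. cscale (a d) d)"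
      by (rule rangeE)
    have "\<nu> d x = a d" if "d \<in> B" for d
    proof -
      have "\<nu> d x = (\<Sum>e\<in>B. a e * \<nu> d e)"
        unfolding a cfunD(5)[OF \<nu>(1)] cfunD(3)[OF \<nu>(1)] ..
      also have "\<dots> = (\<Sum>e\<in>B. if e = d then a e else 0)"
        by (rule sum.cong) (simp_all add: \<nu>(2))
      also have "\<dots> = a d" using that assms(1) by simp
      finally show ?thesis .
    qed
    then have "(\<Sum>d\<in>B. cscale (\<nu> d x) d) = (\<Sum>d\<in>B. cscale (a d) d)"
      by (intro sum.cong) simp_all
    then show ?thesis using a by simp
  qed
  then show ?thesis using that[of \<nu>] \<nu> by blast
qed

locale quot =
  fixes U :: "'a::real_vector set" and S :: "cp1 \<Rightarrow> ('a \<times> 'a) set"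
  assumes fdU: "fin_dim U" and S: "holo_subbundle U S"
begin

lemma subU: "subspace U" using fdU fin_dim_subspace by blast

lemma subUU: "cx.subspace (U \<times> U)" using complexification_subspace subU by blast

lemma local_frame:
  obtains V n and s :: "nat \<Rightarrow> cp1 \<Rightarrow> 'a \<times> 'a" where "open V" "p \<in> V"
    "\<And>k. k < n \<Longrightarrow> holo_vector_map U V (s k)"
    "\<And>q. q \<in> V \<Longrightarrow> S q = {\<Sum>k<n. cscale (c k) (s k q) |c. True}"
    "\<And>q c. q \<in> V \<Longrightarrow> (\<Sum>k<n. cscale (c k) (s k q)) = 0 \<Longrightarrow> \<forall>k<n. c k = 0"
proof -
  obtain V n and s :: "nat \<Rightarrow> cp1 \<Rightarrow> 'a \<times> 'a" where *: "cp1_open V \<and> p \<in> V \<and>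
      (\<forall>k<n. holo_vector_map U V (s k)) \<and>
      (\<forall>q\<in>V. S q = {\<Sum>k<n. cscale (c k) (s k q) |c. True} \<and>
         (\<forall>c. (\<Sum>k<n. cscale (c k) (s k q)) = 0 \<longrightarrow> (\<forall>k<n. c k = 0)))"
    using S[unfolded holo_subbundle_def, rule_format, of p] by (elim exE) (rule that)
  show ?thesis
    by (rule that[of V n s]) (use * in \<open>simp_all add: open_cp1_def\<close>)
qed

lemma S_subspace: "cx.subspace (S p)" and S_sub: "S p \<subseteq> U \<times> U"
proof -
  obtain V n and s :: "nat \<Rightarrow> cp1 \<Rightarrow> 'a \<times> 'a" where V: "open V" "p \<in> V"
    and s: "\<And>k. k < n \<Longrightarrow> holo_vector_map U V (s k)"
    and span: "\<And>q. q \<in> V \<Longrightarrow> S q = {\<Sum>k<n. cscale (c k) (s k q) |c. True}"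
    by (rule local_frame[of p]) (rule that)
  have sU: "s k p \<in> U \<times> U" if "k < n" for k
  proof -
    obtain m w h where w: "\<And>j. j < m \<Longrightarrow> w j \<in> U \<times> U"
      and e: "\<And>p. p \<in> V \<Longrightarrow> s k p = (\<Sum>j<(m::nat). cscale (h j p) (w j))"
      using s[OF \<open>k < n\<close>] unfolding holo_vector_map_def by blast
    show ?thesis unfolding e[OF V(2)] using w by (intro cx.subspace_sum cx.subspace_scale subUU) auto
  qed
  show "cx.subspace (S p)"
    unfolding cx.subspace_def span[OF V(2)]
  proof (intro conjI ballI allI)
    show "0 \<in> {\<Sum>k<n. cscale (c k) (s k p) |c. True}"
      by (rule CollectI, rule exI[of _ "\<lambda>_. 0"]) simp
    fix x assume "x \<in> {\<Sum>k<n. cscale (c k) (s k p) |c. True}"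
    then obtain c where c: "x = (\<Sum>k<n. cscale (c k) (s k p))" by blast
    show "x + y \<in> {\<Sum>k<n. cscale (c k) (s k p) |c. True}"
      if "y \<in> {\<Sum>k<n. cscale (c k) (s k p) |c. True}" for y
    proof -
      obtain d where d: "y = (\<Sum>k<n. cscale (d k) (s k p))"
        using \<open>y \<in> {\<Sum>k<n. cscale (c k) (s k p) |c. True}\<close> by blast
      show ?thesis
        unfolding c d by (rule CollectI, rule exI[of _ "\<lambda>k. c k + d k"])
          (simp add: cx.scale_left_distrib sum.distrib)
    qed
    fix a show "cscale a x \<in> {\<Sum>k<n. cscale (c k) (s k p) |c. True}"
      unfolding c by (rule CollectI, rule exI[of _ "\<lambda>k. a * c k"]) (simp add: cx.scale_sum_right)
  qed
  show "S p \<subseteq> U \<times> U"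
  proof
    fix x assume "x \<in> S p"
    then obtain c where c: "x = (\<Sum>k<n. cscale (c k) (s k p))" unfolding span[OF V(2)] by blast
    show "x \<in> U \<times> U" unfolding c using sU by (intro cx.subspace_sum cx.subspace_scale subUU) auto
  qed
qed

abbreviation B where "B \<equiv> quot_bundle U S"

definition cl :: "cp1 \<Rightarrow> 'a \<times> 'a \<Rightarrow> cp1 \<times> ('a \<times> 'a) set" where
  "cl p u = (p, coset S p u)"

lemma coset_mem: "x \<in> coset S p u \<longleftrightarrow> x - u \<in> S p"
proof
  assume "x \<in> coset S p u"
  then show "x - u \<in> S p" unfolding coset_def by auto
next
  assume "x - u \<in> S p"
  then have "x = u + (x - u) \<and> x - u \<in> S p" by simp
  then show "x \<in> coset S p u" unfolding coset_def by blast
qed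

lemma coset_self: "u \<in> coset S p u"
  unfolding coset_mem using cx.subspace_0[OF S_subspace] by simp

lemma coset_eq: "coset S p u = coset S p v \<longleftrightarrow> u - v \<in> S p"
proof
  assume "coset S p u = coset S p v"
  then show "u - v \<in> S p" using coset_self[of u p] coset_mem by blast
next
  assume uv: "u - v \<in> S p"
  have "x - u \<in> S p \<longleftrightarrow> x - v \<in> S p" for x
  proof
    assume "x - u \<in> S p"
    from cx.subspace_add[OF S_subspace this uv] show "x - v \<in> S p" by simp
  next
    assume "x - v \<in> S p"
    from cx.subspace_diff[OF S_subspace this uv] show "x - u \<in> S p" by simp
  qed
  then show "coset S p u = coset S p v" by (intro set_eqI) (simp add: coset_mem)
qed

lemma cl_eq: "cl p u = cl q v \<longleftrightarrow> p = q \<and> u - v \<in> S p"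
  by (cases "p = q") (simp_all add: cl_def coset_eq)

lemma B_simps: "total B = {cl p u |p u. u \<in> U \<times> U}" "proj B = fst"
  "vadd B = vadd (quot_family U S)" "vscale B = vscale (quot_family U S)"
  "fibre B p = fibre (quot_family U S) p" "total (quot_family U S) = {cl p u |p u. u \<in> U \<times> U}"
  "proj (quot_family U S) = fst"
  "atlas B = {(V, n, \<phi>). local_triv (quot_family U S) V n \<phi> \<and>
        (\<forall>u\<in>U \<times> U. \<forall>i<n. cp1_holo V (\<lambda>p. \<phi> (cl p u) i))}"
  unfolding quot_bundle_def vfamily.extend_def hbundle.fields_def quot_family_def fibre_def cl_def by simp_all

lemma fibre_B: "fibre B p = cl p ` (U \<times> U)"
  unfolding fibre_def B_simps(1,2) by (auto simp: cl_def)

lemma local_triv_B: "local_triv (quot_family U S) V n \<phi> \<longleftrightarrow> local_triv B V n \<phi>"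
  unfolding local_triv_def B_simps(3,4,5) ..

lemma vadd_cl: "vadd B (cl p u) (cl p v) = cl p (u + v)"
proof -
  have "{a + b |a b. a \<in> coset S p u \<and> b \<in> coset S p v} = coset S p (u + v)"
  proof (intro set_eqI iffI)
    fix x assume "x \<in> {a + b |a b. a \<in> coset S p u \<and> b \<in> coset S p v}"
    then obtain a b where ab: "x = a + b" "a - u \<in> S p" "b - v \<in> S p" by (auto simp: coset_mem)
    from cx.subspace_add[OF S_subspace ab(2,3)] show "x \<in> coset S p (u + v)"
      unfolding coset_mem ab(1) by (simp add: algebra_simps)
  next
    fix x assume "x \<in> coset S p (u + v)"
    then have "x - v \<in> coset S p u" by (simp add: coset_mem algebra_simps)
    moreover have "x = (x - v) + v" by simp
    ultimately show "x \<in> {a + b |a b. a \<in> coset S p u \<and> b \<in> coset S p v}"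
      using coset_self by blast
  qed
  then show ?thesis unfolding B_simps(3) quot_family_def cl_def by simp
qed

lemma vscale_cl: "vscale B c (cl p u) = cl p (cscale c u)"
proof -
  have "{cscale c a + s |a s. a \<in> coset S p u \<and> s \<in> S p} = coset S p (cscale c u)"
  proof (intro set_eqI iffI)
    fix x assume "x \<in> {cscale c a + s |a s. a \<in> coset S p u \<and> s \<in> S p}"
    then obtain a s where as: "x = cscale c a + s" "a - u \<in> S p" "s \<in> S p" by (auto simp: coset_mem)
    have "cscale c (a - u) + s \<in> S p"
      by (intro cx.subspace_add cx.subspace_scale S_subspace as)
    then show "x \<in> coset S p (cscale c u)"
      unfolding coset_mem as(1) by (simp add: cx.scale_right_diff_distrib algebra_simps)
  next
    fix x assume "x \<in> coset S p (cscale c u)"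
    then have "x - cscale c u \<in> S p" by (simp add: coset_mem)
    moreover have "x = cscale c u + (x - cscale c u)" by simp
    ultimately show "x \<in> {cscale c a + s |a s. a \<in> coset S p u \<and> s \<in> S p}"
      using coset_self by blast
  qed
  then show ?thesis unfolding B_simps(4) quot_family_def cl_def by simp
qed

lemma atlas_iff: "(V, n, \<phi>) \<in> atlas B \<longleftrightarrow> local_triv B V n \<phi> \<and>
    (\<forall>u\<in>U \<times> U. \<forall>i<n. \<forall>p\<in>V. hol_at (\<lambda>p. \<phi> (cl p u) i) p)"
proof (cases "local_triv B V n \<phi>")
  case True
  then show ?thesis
    by (simp add: B_simps(8) local_triv_B cp1_holo_iff[OF local_trivD(1)[OF True]])
qed (simp add: B_simps(8) local_triv_B)

lemma triv_sum:
  assumes "local_triv B V n \<phi>" "p \<in> V" "\<And>k. k \<in> I \<Longrightarrow> c k \<in> U \<times> U"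
  shows "\<phi> (cl p (\<Sum>k\<in>I. cscale (a k) (c k))) i = (\<Sum>k\<in>I. a k * \<phi> (cl p (c k)) i)"
  using assms(3)
proof (induction I rule: infinite_finite_induct)
  case (insert k I)
  have in_fib: "cl p u \<in> fibre B p" if "u \<in> U \<times> U" for u unfolding fibre_B using that by blast
  have c: "c k \<in> U \<times> U" and s: "(\<Sum>k\<in>I. cscale (a k) (c k)) \<in> U \<times> U"
    using insert.prems by (auto intro!: cx.subspace_sum cx.subspace_scale subUU)
  have "\<phi> (cl p (cscale (a k) (c k))) i = a k * \<phi> (cl p (c k)) i"
    using local_trivD(6)[OF assms(1,2) in_fib[OF c]] by (simp add: vscale_cl)
  moreover have "\<phi> (cl p (cscale (a k) (c k) + (\<Sum>k\<in>I. cscale (a k) (c k)))) i =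
      \<phi> (cl p (cscale (a k) (c k))) i + \<phi> (cl p (\<Sum>k\<in>I. cscale (a k) (c k))) i"
    using local_trivD(4)[OF assms(1,2) in_fib[OF cx.subspace_scale[OF subUU c]] in_fib[OF s]] by (simp add: vadd_cl)
  ultimately show ?case using insert by simp
next
  case empty
  have 0: "0 \<in> U \<times> U" using cx.subspace_0[OF subUU] .
  then show ?case using local_trivD(6)[OF assms(1,2), of "cl p 0" 0] by (simp add: vscale_cl fibre_B)
next
  case (infinite A)
  have 0: "0 \<in> U \<times> U" using cx.subspace_0[OF subUU] .
  then show ?case using local_trivD(6)[OF assms(1,2), of "cl p 0" 0] infinite by (simp add: vscale_cl fibre_B)
qed

text \<open>Fixed vectors are chosen whose classes form the frame at \<open>p\<close>. By
  \<open>local_solve\<close> their classes still span nearby, so the class with given coordinates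
  has a representative that combines fixed vectors with coefficients obtained from the
  solver.\<close>

lemma local_lift:
  assumes "(V, n, \<phi>) \<in> atlas B" "p \<in> V"
  obtains c and sol :: "cp1 \<Rightarrow> (nat \<Rightarrow> complex) \<Rightarrow> nat \<Rightarrow> complex" where
    "\<And>i. i < n \<Longrightarrow> c i \<in> U \<times> U"
    "hol_solver p n sol"
    "\<forall>\<^sub>F q in nhds p. q \<in> V \<and> (\<forall>x\<in>fibre B q. x = cl q (\<Sum>i<n. cscale (sol q (\<phi> x) i) (c i)))"
proof -
  have tr: "local_triv B V n \<phi>" and hol: "\<And>u i q. u \<in> U \<times> U \<Longrightarrow> i < n \<Longrightarrow> q \<in> V \<Longrightarrow> hol_at (\<lambda>p. \<phi> (cl p u) i) q"
    using assms(1) atlas_iff by auto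
  have "\<exists>u\<in>U \<times> U. \<phi> (cl p u) = (\<lambda>i. if i = j then 1 else 0)" if "j < n" for j
  proof -
    obtain u where "u \<in> U \<times> U" "frame B \<phi> j p = cl p u"
      using frame_props(1)[OF tr assms(2) \<open>j < n\<close>] unfolding fibre_B by blast
    then show ?thesis using frame_props(2)[OF tr assms(2) that] by metis
  qed
  then obtain c where c: "\<And>j. j < n \<Longrightarrow> c j \<in> U \<times> U" "\<And>j. j < n \<Longrightarrow> \<phi> (cl p (c j)) = (\<lambda>i. if i = j then 1 else 0)"
    by metis
  obtain sol :: "cp1 \<Rightarrow> (nat \<Rightarrow> complex) \<Rightarrow> nat \<Rightarrow> complex" where
    sol: "hol_solver p n sol"
    "\<forall>\<^sub>F q in nhds p. \<forall>x y. (\<forall>i<n. (\<Sum>j<n. \<phi> (cl q (c j)) i * x j) = y i) \<longleftrightarrow> (\<forall>i<n. x i = sol q y i)"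
  proof -
    have "hol_at (\<lambda>q. \<phi> (cl q (c j)) i) p" if "i < n" "j < n" for i j
      using hol[OF c(1) _ assms(2)] that by blast
    moreover have "\<phi> (cl p (c j)) i = (if i = j then 1 else 0)" if "i < n" "j < n" for i j
      using c(2) that by simp
    ultimately show ?thesis
      using local_solve[of n "\<lambda>i j q. \<phi> (cl q (c j)) i" p] that unfolding hol_solver_def by blast
  qed
  have "\<forall>\<^sub>F q in nhds p. q \<in> V" unfolding eventually_nhds using local_trivD(1)[OF tr] assms(2) by blast
  with sol(2) have "\<forall>\<^sub>F q in nhds p. q \<in> V \<and> (\<forall>x\<in>fibre B q. x = cl q (\<Sum>i<n. cscale (sol q (\<phi> x) i) (c i)))"
  proof eventually_elim
    case (elim q)
    have "x = cl q (\<Sum>i<n. cscale (sol q (\<phi> x) i) (c i))" if x: "x \<in> fibre B q" for x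
    proof -
      let ?y = "cl q (\<Sum>i<n. cscale (sol q (\<phi> x) i) (c i))"
      have y: "?y \<in> fibre B q"
        unfolding fibre_B using c(1) by (auto intro!: imageI cx.subspace_sum cx.subspace_scale subUU)
      have b: "bij_betw \<phi> (fibre B q) (Cn n)" using local_trivD(2)[OF tr] elim(2) by blast
      have "\<phi> ?y i = \<phi> x i" for i
      proof (cases "i < n")
        case True
        have "\<phi> ?y i = (\<Sum>j<n. sol q (\<phi> x) j * \<phi> (cl q (c j)) i)"
          by (rule triv_sum[OF tr elim(2)]) (use c(1) in simp)
        also have "\<dots> = (\<Sum>j<n. \<phi> (cl q (c j)) i * sol q (\<phi> x) j)"
          by (simp add: mult.commute)
        also have "\<dots> = \<phi> x i"
          using elim(1)[rule_format, of "sol q (\<phi> x)" "\<phi> x"] True by blast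
        finally show ?thesis .
      next
        case False
        have "\<phi> ?y \<in> Cn n" "\<phi> x \<in> Cn n" using b x y unfolding bij_betw_def by blast+
        then show ?thesis using False by (simp add: Cn_def)
      qed
      then have "\<phi> x = \<phi> ?y" by (simp add: fun_eq_iff)
      then show ?thesis using b x y unfolding bij_betw_def by (meson inj_onD)
    qed
    then show ?case using elim(2) by blast
  qed
  then show ?thesis using that c(1) sol(1) by blast
qed

text \<open>By \<open>local_lift\<close> the frame of one trivialisation combines classes of
  constant sections holomorphically, and the other trivialisation is holomorphic on those by the
  definition of the atlas.\<close>

lemma transition_hol:
  assumes "(V, n, \<phi>) \<in> atlas B" "(W, m, \<psi>) \<in> atlas B" "p \<in> V" "p \<in> W" "j < n" "i < m"
  shows "hol_at (\<lambda>q. \<psi> (frame B \<phi> j q) i) p"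
proof -
  have tr: "local_triv B V n \<phi>" and tr': "local_triv B W m \<psi>"
    and hol': "\<And>u i q. u \<in> U \<times> U \<Longrightarrow> i < m \<Longrightarrow> q \<in> W \<Longrightarrow> hol_at (\<lambda>p. \<psi> (cl p u) i) q"
    using assms(1,2) atlas_iff by auto
  obtain c sol where c: "\<And>i. i < n \<Longrightarrow> c i \<in> U \<times> U"
    and sol: "hol_solver p n sol"
    and ev: "\<forall>\<^sub>F q in nhds p. q \<in> V \<and> (\<forall>x\<in>fibre B q. x = cl q (\<Sum>i<n. cscale (sol q (\<phi> x) i) (c i)))"
    by (rule local_lift[OF assms(1,3)]) (rule that)
  let ?e = "\<lambda>i. if i = j then 1 else (0 :: complex)"
  have "hol_at (\<lambda>q. \<Sum>l<n. sol q ?e l * \<psi> (cl q (c l)) i) p"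
    by (intro hol_at_sum hol_at_mult hol_solverD[OF sol] hol_at_const)
      (use hol'[OF c assms(6,4)] in auto)
  moreover have "\<forall>\<^sub>F q in nhds p. q \<in> W"
    unfolding eventually_nhds using local_trivD(1)[OF tr'] assms(4) by blast
  with ev have "\<forall>\<^sub>F q in nhds p. (\<Sum>l<n. sol q ?e l * \<psi> (cl q (c l)) i) = \<psi> (frame B \<phi> j q) i"
  proof eventually_elim
    case (elim q)
    then have f: "frame B \<phi> j q \<in> fibre B q" "\<phi> (frame B \<phi> j q) = ?e"
      using frame_props[OF tr _ assms(5)] by blast+
    have "frame B \<phi> j q = cl q (\<Sum>l<n. cscale (sol q (\<phi> (frame B \<phi> j q)) l) (c l))"
      using elim(1) f(1) by blast
    then have "frame B \<phi> j q = cl q (\<Sum>l<n. cscale (sol q ?e l) (c l))"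
      unfolding f(2) .
    then have "\<psi> (frame B \<phi> j q) i = \<psi> (cl q (\<Sum>l<n. cscale (sol q ?e l) (c l))) i" by simp
    also have "\<dots> = (\<Sum>l<n. sol q ?e l * \<psi> (cl q (c l)) i)"
      by (rule triv_sum[OF tr' elim(2)]) (use c in simp)
    finally show ?case ..
  qed
  ultimately show ?thesis by (rule hol_at_transfer)
qed

text \<open>A frame of \<open>S\<close> at \<open>p\<close> is completed by constant vectors to a
  basis. The completed family stays a basis near \<open>p\<close>, and the coordinates along the
  added vectors trivialise the quotient.\<close>

lemma atlas_exists: "\<exists>V n \<phi>. (V, n, \<phi>) \<in> atlas B \<and> p \<in> V"
proof -
  obtain V0 m and s :: "nat \<Rightarrow> cp1 \<Rightarrow> 'a \<times> 'a" where V0: "open V0" "p \<in> V0"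
    and s: "\<And>k. k < m \<Longrightarrow> holo_vector_map U V0 (s k)"
    and span: "\<And>q. q \<in> V0 \<Longrightarrow> S q = {\<Sum>k<m. cscale (c k) (s k q) |c. True}"
    and ind: "\<And>q c. q \<in> V0 \<Longrightarrow> (\<Sum>k<m. cscale (c k) (s k q)) = 0 \<Longrightarrow> \<forall>k<m. c k = 0"
    by (rule local_frame[of p]) (rule that)
  have s_in: "s k p \<in> U \<times> U" if "k < m" for k
  proof -
    have "s k p = (\<Sum>l<m. cscale (if l = k then 1 else 0) (s l p))"
      using that by (simp add: if_distrib[of "\<lambda>c. cscale c _"] cong: if_cong)
    then have "s k p \<in> S p" unfolding span[OF V0(2)]
      by (intro CollectI exI[of _ "\<lambda>l. if l = k then 1 else 0"]) simp
    then show ?thesis using S_sub by blast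
  qed
  define T where "T = (\<lambda>k. s k p) ` {..<m}"
  have inj: "inj_on (\<lambda>k. s k p) {..<m}"
  proof (rule inj_onI, rule ccontr)
    fix k l assume kl: "k \<in> {..<m}" "l \<in> {..<m}" "s k p = s l p" "k \<noteq> l"
    have "(\<Sum>i<m. cscale (if i = k then 1 else if i = l then - 1 else 0) (s i p)) =
        (\<Sum>i<m. (if i = k then s i p else 0) - (if i = l then s i p else 0))"
      using kl(4) by (intro sum.cong) auto
    also have "\<dots> = 0" using kl by (simp add: sum_subtractf)
    finally show False using ind[OF V0(2)] kl(1) by fastforce
  qed
  have indT: "cx.independent T"
  proof
    assume "cx.dependent T"
    then obtain u v where u: "(\<Sum>v\<in>T. cscale (u v) v) = 0" "v \<in> T" "u v \<noteq> 0"
      using cx.dependent_finite[of T] unfolding T_def by blast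
    have "(\<Sum>k<m. cscale (u (s k p)) (s k p)) = 0"
      using u(1) unfolding T_def sum.reindex[OF inj] by simp
    then show False using ind[OF V0(2), of "\<lambda>k. u (s k p)"] u(2,3) unfolding T_def by auto
  qed
  have "T \<subseteq> U \<times> U" unfolding T_def using s_in by blast
  then obtain BB where BB: "T \<subseteq> BB" "BB \<subseteq> U \<times> U" "cx.independent BB" "U \<times> U \<subseteq> cx.span BB"
    using cx.maximal_independent_subset_extend[OF _ indT] by metis
  obtain D where "finite D" "U \<times> U \<subseteq> cx.span D" by (rule complexification_fin_dim[OF fdU])
  then have fin: "finite BB" using cx.independent_span_bound[OF _ BB(3)] BB(2) by blast
  define r where "r = card (BB - T)"
  obtain e where e: "bij_betw e {..<r} (BB - T)"
    using ex_bij_betw_nat_finite[of "BB - T"] fin unfolding r_def atLeast0LessThan by blast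
  define N where "N = m + r"
  define f where "f j q = (if j < m then s j q else e (j - m))" for j q
  have f_BB: "bij_betw (\<lambda>j. f j p) {..<N} BB"
  proof -
    have 1: "bij_betw (\<lambda>j. f j p) {..<m} T"
      unfolding T_def using inj by (auto simp: bij_betw_def f_def inj_on_def)
    have "bij_betw (\<lambda>j. j - m) {m..<N} {..<r}"
      by (rule bij_betwI[where g = "\<lambda>i. i + m"]) (auto simp: N_def)
    then have "bij_betw (e \<circ> (\<lambda>j. j - m)) {m..<N} (BB - T)" using e bij_betw_trans by blast
    then have 2: "bij_betw (\<lambda>j. f j p) {m..<N} (BB - T)"
      by (subst bij_betw_cong[where g = "e \<circ> (\<lambda>j. j - m)"]) (auto simp: f_def)
    have "{..<N} = {..<m} \<union> {m..<N}" "BB = T \<union> (BB - T)" using BB(1) by (auto simp: N_def)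
    then show ?thesis using bij_betw_combine[OF 1 2] by auto
  qed
  obtain \<nu>' where \<nu>': "\<And>d. cfun (\<nu>' d)" "\<And>d e. d \<in> BB \<Longrightarrow> e \<in> BB \<Longrightarrow> \<nu>' d e = (if e = d then 1 else 0)"
    "\<And>x. x \<in> cx.span BB \<Longrightarrow> x = (\<Sum>d\<in>BB. cscale (\<nu>' d x) d)"
    by (rule dual_functionals[OF fin BB(3)]) (rule that)
  define \<nu> where "\<nu> i = \<nu>' (f i p)" for i
  have \<nu>: "cfun (\<nu> i)" for i unfolding \<nu>_def by (rule \<nu>')
  have \<nu>f: "\<nu> i (f j p) = (if i = j then 1 else 0)" if "i < N" "j < N" for i j
  proof -
    have "f i p \<in> BB" "f j p \<in> BB" "f j p = f i p \<longleftrightarrow> i = j"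
      using f_BB that unfolding bij_betw_def inj_on_def by auto
    then show ?thesis unfolding \<nu>_def using \<nu>'(2) by simp
  qed
  have \<nu>_faithful: "x = y" if "x \<in> U \<times> U" "y \<in> U \<times> U" "\<And>i. i < N \<Longrightarrow> \<nu> i x = \<nu> i y" for x y
  proof -
    have "\<nu>' d x = \<nu>' d y" if "d \<in> BB" for d
      using f_BB that \<open>\<And>i. i < N \<Longrightarrow> \<nu> i x = \<nu> i y\<close> unfolding bij_betw_def \<nu>_def by auto
    moreover have "x = (\<Sum>d\<in>BB. cscale (\<nu>' d x) d)" "y = (\<Sum>d\<in>BB. cscale (\<nu>' d y) d)"
      using \<nu>'(3) BB(4) that by blast+
    ultimately show ?thesis by (metis (no_types, lifting) sum.cong)
  qed
  have "\<exists>sol. hol_solver p N sol \<and> (\<forall>\<^sub>F q in nhds p. \<forall>x y. (\<forall>i<N. (\<Sum>j<N. \<nu> i (f j q) * x j) = y i) \<longleftrightarrow> (\<forall>i<N. x i = sol q y i))"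
    unfolding hol_solver_def
  proof (rule local_solve[of N "\<lambda>i j q. \<nu> i (f j q)" p])
    fix i j assume "i < N" "j < N"
    show "\<nu> i (f j p) = (if i = j then 1 else 0)" using \<nu>f \<open>i < N\<close> \<open>j < N\<close> by simp
    show "hol_at (\<lambda>q. \<nu> i (f j q)) p"
      using vholD[OF holo_vector_map_vhol[OF s V0] \<nu>] by (cases "j < m") (simp_all add: f_def)
  qed
  then obtain sol where sol: "hol_solver p N sol"
    "\<forall>\<^sub>F q in nhds p. \<forall>x y. (\<forall>i<N. (\<Sum>j<N. \<nu> i (f j q) * x j) = y i) \<longleftrightarrow> (\<forall>i<N. x i = sol q y i)"
    by blast
  \<comment> \<open>The inverse of the matrix with entries \<open>\<nu> i (f j q)\<close>, column by
    column: solutions for unit right hand sides. Uniqueness of solutions makes \<open>sol\<close>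
    linear, which is \<open>sol_lin\<close>.\<close>
  define H where "H i j q = sol q (\<lambda>k. if k = j then 1 else 0) i" for i j q
  have "hol_at (H i j) p" if "i < N" for i j
    unfolding H_def by (rule hol_solverD[OF sol(1) _ that]) simp
  then have "\<forall>\<^sub>F q in nhds p. \<forall>i\<in>{..<N}. \<forall>j\<in>{..<N}. hol_at (H i j) q"
    by (intro eventually_ball_finite ballI hol_at_eventually_hol_at) auto
  moreover have "\<forall>\<^sub>F q in nhds p. q \<in> V0" unfolding eventually_nhds using V0 by blast
  ultimately have "\<forall>\<^sub>F q in nhds p. q \<in> V0 \<and> (\<forall>i\<in>{..<N}. \<forall>j\<in>{..<N}. hol_at (H i j) q) \<and>
      (\<forall>x y. (\<forall>i<N. (\<Sum>j<N. \<nu> i (f j q) * x j) = y i) \<longleftrightarrow> (\<forall>i<N. x i = sol q y i))"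
    using sol(2) by eventually_elim blast
  then obtain V where V: "open V" "p \<in> V" and V': "\<forall>q\<in>V. q \<in> V0 \<and> (\<forall>i\<in>{..<N}. \<forall>j\<in>{..<N}. hol_at (H i j) q) \<and>
      (\<forall>x y. (\<forall>i<N. (\<Sum>j<N. \<nu> i (f j q) * x j) = y i) \<longleftrightarrow> (\<forall>i<N. x i = sol q y i))"
    unfolding eventually_nhds by (elim exE conjE) (rule that)
  have VV: "\<And>q. q \<in> V \<Longrightarrow> q \<in> V0"
    "\<And>q i j. q \<in> V \<Longrightarrow> i < N \<Longrightarrow> j < N \<Longrightarrow> hol_at (H i j) q"
    "\<And>q x y. q \<in> V \<Longrightarrow> (\<forall>i<N. (\<Sum>j<N. \<nu> i (f j q) * x j) = y i) \<longleftrightarrow> (\<forall>i<N. x i = sol q y i)"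
    using V' by simp_all
  define K where "K q u i = (\<Sum>j<N. H i j q * \<nu> j u)" for q u i
  have sol_lin: "sol q y i = (\<Sum>j<N. H i j q * y j)" if q: "q \<in> V" and i: "i < N" for q y i
  proof -
    have "(\<Sum>l<N. \<nu> k (f l q) * (\<Sum>j<N. H l j q * y j)) = y k" if k: "k < N" for k
    proof -
      have "(\<Sum>l<N. \<nu> k (f l q) * H l j q) = (if k = j then 1 else 0)" if "j < N" for j
        using VV(3)[OF q, of "\<lambda>l. H l j q" "\<lambda>k. if k = j then 1 else 0"] k unfolding H_def by blast
      then have "(\<Sum>j<N. (\<Sum>l<N. \<nu> k (f l q) * H l j q) * y j) = (\<Sum>j<N. if k = j then y j else 0)"
        by (intro sum.cong) auto
      also have "\<dots> = y k" using k by simp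
      finally have "(\<Sum>j<N. (\<Sum>l<N. \<nu> k (f l q) * H l j q) * y j) = y k" .
      moreover have "(\<Sum>l<N. \<nu> k (f l q) * (\<Sum>j<N. H l j q * y j)) =
          (\<Sum>j<N. (\<Sum>l<N. \<nu> k (f l q) * H l j q) * y j)"
        unfolding sum_distrib_left sum_distrib_right mult.assoc by (rule sum.swap)
      ultimately show ?thesis by simp
    qed
    then show ?thesis using VV(3)[OF q, of "\<lambda>l. \<Sum>j<N. H l j q * y j" y] i by simp
  qed
  have f_in: "f j q \<in> U \<times> U" if "j < N" "q \<in> V" for j q
  proof (cases "j < m")
    case True
    have "s j q = (\<Sum>l<m. cscale (if l = j then 1 else 0) (s l q))"
      using True by (simp add: if_distrib[of "\<lambda>c. cscale c _"] cong: if_cong)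
    then have "s j q \<in> S q" unfolding span[OF VV(1)[OF that(2)]]
      by (intro CollectI exI[of _ "\<lambda>l. if l = j then 1 else 0"]) simp
    then show ?thesis using S_sub True by (auto simp: f_def)
  next
    case False
    then have "e (j - m) \<in> BB - T" using e that(1) unfolding bij_betw_def N_def by auto
    then show ?thesis using BB(2) False unfolding f_def by auto
  qed
  have \<nu>_comb: "\<nu> i (\<Sum>j<N. cscale (x j) (f j q)) = (\<Sum>j<N. \<nu> i (f j q) * x j)" for i x q
    unfolding cfunD(5)[OF \<nu>] cfunD(3)[OF \<nu>] by (simp add: mult.commute)
  have K_expand: "u = (\<Sum>j<N. cscale (K q u j) (f j q))" if "q \<in> V" "u \<in> U \<times> U" for q u
  proof (rule \<nu>_faithful[OF that(2)])
    show "(\<Sum>j<N. cscale (K q u j) (f j q)) \<in> U \<times> U"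
      using f_in that(1) by (intro cx.subspace_sum cx.subspace_scale subUU) auto
    show "\<nu> i u = \<nu> i (\<Sum>j<N. cscale (K q u j) (f j q))" if "i < N" for i
      unfolding \<nu>_comb K_def using VV(3)[OF \<open>q \<in> V\<close>, of "\<lambda>l. \<Sum>j<N. H l j q * \<nu> j u" "\<lambda>j. \<nu> j u"]
        sol_lin[OF \<open>q \<in> V\<close>] that by simp
  qed
  have K_unique: "K q (\<Sum>j<N. cscale (x j) (f j q)) i = x i" if "q \<in> V" "i < N" for q x i
    unfolding K_def \<nu>_comb
    using VV(3)[OF that(1), of x "\<lambda>i. \<Sum>j<N. \<nu> i (f j q) * x j"] sol_lin[OF that(1)] that(2) by simp
  have K_add: "K q (u + v) i = K q u i + K q v i" and K_scale: "K q (cscale c u) i = c * K q u i"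
    and K_diff: "K q (u - v) i = K q u i - K q v i" for q u v c i
    unfolding K_def cfunD(1)[OF \<nu>] cfunD(2)[OF \<nu>] cfunD(3)[OF \<nu>]
    by (simp_all add: ring_distribs sum.distrib sum_subtractf sum_distrib_left mult_ac)
  have S_iff: "u \<in> S q \<longleftrightarrow> (\<forall>i<r. K q u (m + i) = 0)" if q: "q \<in> V" and u: "u \<in> U \<times> U" for q u
  proof
    assume "u \<in> S q"
    then obtain c where c: "u = (\<Sum>k<m. cscale (c k) (s k q))" unfolding span[OF VV(1)[OF q]] by blast
    have "u = (\<Sum>j<N. cscale (if j < m then c j else 0) (f j q))"
    proof -
      have "(\<Sum>j<N. cscale (if j < m then c j else 0) (f j q)) = (\<Sum>j<m. cscale (if j < m then c j else 0) (f j q))"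
        by (rule sum.mono_neutral_right) (auto simp: N_def)
      then show ?thesis unfolding c by (simp add: f_def)
    qed
    then show "\<forall>i<r. K q u (m + i) = 0"
      using K_unique[OF q, of _ "\<lambda>j. if j < m then c j else 0"] by (auto simp: N_def)
  next
    assume 0: "\<forall>i<r. K q u (m + i) = 0"
    have "K q u j = 0" if "j \<in> {..<N} - {..<m}" for j
      using 0[rule_format, of "j - m"] that by (auto simp: N_def)
    then have "(\<Sum>j<N. cscale (K q u j) (f j q)) = (\<Sum>j<m. cscale (K q u j) (f j q))"
      by (intro sum.mono_neutral_right) (auto simp: N_def)
    then have "u = (\<Sum>j<m. cscale (K q u j) (s j q))" using K_expand[OF q u] by (simp add: f_def)
    then show "u \<in> S q" unfolding span[OF VV(1)[OF q]] by blast
  qed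
  \<comment> \<open>Any representative of the coset may be used, since the coordinates from
    \<open>m\<close> onwards vanish on \<open>S\<close>.\<close>
  define \<phi> where "\<phi> x i = (if i < r then K (fst x) (SOME u. u \<in> U \<times> U \<and> u \<in> snd x) (m + i) else 0)" for x i
  have \<phi>_cl: "\<phi> (cl q u) i = (if i < r then K q u (m + i) else 0)" if q: "q \<in> V" and u: "u \<in> U \<times> U" for q u i
  proof -
    define v where "v = (SOME v. v \<in> U \<times> U \<and> v \<in> coset S q u)"
    have "u \<in> U \<times> U \<and> u \<in> coset S q u" using u coset_self by blast
    then have v: "v \<in> U \<times> U \<and> v \<in> coset S q u" unfolding v_def by (rule someI)
    then have vu: "v - u \<in> S q" using coset_mem by blast
    have "v - u \<in> U \<times> U" using v u cx.subspace_diff[OF subUU] by blast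
    then have "\<forall>i<r. K q v (m + i) = K q u (m + i)"
      using S_iff[OF q, of "v - u"] vu K_diff by simp
    then show ?thesis unfolding \<phi>_def cl_def v_def by simp
  qed
  have "local_triv B V r \<phi>"
    unfolding local_triv_def
  proof (intro conjI ballI allI)
    show "cp1_open V" using V(1) by (simp add: open_cp1_def)
    fix q assume q: "q \<in> V"
    show "bij_betw \<phi> (fibre B q) (Cn r)"
      unfolding bij_betw_def
    proof
      show "inj_on \<phi> (fibre B q)"
      proof (rule inj_onI)
        fix x y assume "x \<in> fibre B q" "y \<in> fibre B q" and eq: "\<phi> x = \<phi> y"
        then obtain u v where uv: "u \<in> U \<times> U" "v \<in> U \<times> U" "x = cl q u" "y = cl q v"
          unfolding fibre_B by blast
        have "K q u (m + i) = K q v (m + i)" if "i < r" for i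
          using fun_cong[OF eq, of i] that \<phi>_cl[OF q] uv by simp
        then have "u - v \<in> S q"
          using S_iff[OF q, of "u - v"] cx.subspace_diff[OF subUU uv(1,2)] K_diff by simp
        then show "x = y" unfolding uv cl_eq by simp
      qed
      show "\<phi> ` fibre B q = Cn r"
      proof (intro equalityI subsetI)
        fix y assume "y \<in> \<phi> ` fibre B q"
        then show "y \<in> Cn r" unfolding Cn_def \<phi>_def by auto
      next
        fix y assume y: "y \<in> Cn r"
        define x where "x j = (if j < m then 0 else y (j - m))" for j
        define u where "u = (\<Sum>j<N. cscale (x j) (f j q))"
        have u: "u \<in> U \<times> U" unfolding u_def using f_in q by (intro cx.subspace_sum cx.subspace_scale subUU) auto
        have "\<phi> (cl q u) i = y i" for i
          unfolding \<phi>_cl[OF q u] using K_unique[OF q, of "m + i" x] y unfolding u_def x_def Cn_def N_def by auto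
        then have "\<phi> (cl q u) = y" by (simp add: fun_eq_iff)
        then show "y \<in> \<phi> ` fibre B q" unfolding fibre_B using u by blast
      qed
    qed
    fix x assume "x \<in> fibre B q"
    then obtain u where u: "u \<in> U \<times> U" "x = cl q u" unfolding fibre_B by blast
    fix c
    have cu: "cscale c u \<in> U \<times> U" using cx.subspace_scale[OF subUU u(1)] .
    show "vscale B c x \<in> fibre B q" unfolding u(2) vscale_cl fibre_B by (rule imageI[OF cu])
    show "\<phi> (vscale B c x) = (\<lambda>i. c * \<phi> x i)"
      unfolding u(2) vscale_cl by (rule ext) (simp add: \<phi>_cl[OF q cu] \<phi>_cl[OF q u(1)] K_scale)
  next
    fix q x y assume q: "q \<in> V" and "x \<in> fibre B q" "y \<in> fibre B q"
    then obtain u v where u: "u \<in> U \<times> U" "x = cl q u" and v: "v \<in> U \<times> U" "y = cl q v" unfolding fibre_B by blast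
    have uv: "u + v \<in> U \<times> U" using cx.subspace_add[OF subUU u(1) v(1)] .
    show "vadd B x y \<in> fibre B q" unfolding u(2) v(2) vadd_cl fibre_B by (rule imageI[OF uv])
    show "\<phi> (vadd B x y) = (\<lambda>i. \<phi> x i + \<phi> y i)"
      unfolding u(2) v(2) vadd_cl
      by (rule ext) (simp add: \<phi>_cl[OF q uv] \<phi>_cl[OF q u(1)] \<phi>_cl[OF q v(1)] K_add)
  qed
  moreover have "hol_at (\<lambda>q. \<phi> (cl q u) i) q" if "u \<in> U \<times> U" "i < r" "q \<in> V" for u i q
  proof -
    have "hol_at (\<lambda>q. K q u (m + i)) q"
      unfolding K_def using VV(2)[OF that(3)] that(2)
      by (intro hol_at_sum hol_at_mult hol_at_const) (auto simp: N_def)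
    moreover have "\<forall>\<^sub>F q' in nhds q. K q' u (m + i) = \<phi> (cl q' u) i"
      unfolding eventually_nhds using V(1) that \<phi>_cl by auto
    ultimately show ?thesis by (rule hol_at_transfer)
  qed
  ultimately have "(V, r, \<phi>) \<in> atlas B" unfolding atlas_iff by blast
  then show ?thesis using V(2) by blast
qed

text \<open>For maximality, the class of a constant vector is expanded in the frame of an atlas
  member; a compatible trivialisation is then seen to be holomorphic on it.\<close>

theorem holo_bundle_quot: "holo_bundle B"
  unfolding holo_bundle_def
proof (intro conjI allI ballI impI)
  show "case x of (V, n, \<phi>) \<Rightarrow> local_triv B V n \<phi>" if "x \<in> atlas B" for x
    using that atlas_iff by (cases x) auto
  show "\<exists>(V, n, \<phi>)\<in>atlas B. p \<in> V" for p
    using atlas_exists by fast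
  show "holo_transition B a b" if "a \<in> atlas B" "b \<in> atlas B" for a b
  proof -
    obtain V n \<phi> where a: "a = (V, n, \<phi>)" by (cases a)
    obtain W m \<psi> where b: "b = (W, m, \<psi>)" by (cases b)
    have "open (V \<inter> W)" using that local_trivD(1) unfolding a b atlas_iff by blast
    then show ?thesis
      unfolding a b holo_transition_def using transition_hol that[unfolded a b] by (auto simp: cp1_holo_iff)
  qed
  fix V n \<phi>
  assume *: "local_triv B V n \<phi> \<and> (\<forall>b\<in>atlas B. holo_transition B (V, n, \<phi>) b \<and> holo_transition B b (V, n, \<phi>))"
  then have tr: "local_triv B V n \<phi>" by blast
  have "hol_at (\<lambda>q. \<phi> (cl q u) i) p" if u: "u \<in> U \<times> U" and i: "i < n" and p: "p \<in> V" for u i p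
  proof -
    obtain W m \<psi> where W: "(W, m, \<psi>) \<in> atlas B" "p \<in> W" using atlas_exists by blast
    have tr': "local_triv B W m \<psi>" using W(1) atlas_iff by blast
    have op: "open (W \<inter> V)" using local_trivD(1) tr tr' by blast
    have "holo_transition B (W, m, \<psi>) (V, n, \<phi>)" using * W(1) by blast
    then have h: "hol_at (\<lambda>q. \<phi> (frame B \<psi> j q) i) p" if "j < m" for j
      using that i p W(2) cp1_holo_iff[OF op] unfolding holo_transition_def by auto
    have "hol_at (\<lambda>q. \<Sum>j<m. \<psi> (cl q u) j * \<phi> (frame B \<psi> j q) i) p"
      using h W(2) u W(1)[unfolded atlas_iff] by (intro hol_at_sum hol_at_mult) auto
    moreover have "\<forall>\<^sub>F q in nhds p. (\<Sum>j<m. \<psi> (cl q u) j * \<phi> (frame B \<psi> j q) i) = \<phi> (cl q u) i"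
      unfolding eventually_nhds
    proof (intro exI[of _ "W \<inter> V"] conjI op ballI)
      fix q assume q: "q \<in> W \<inter> V"
      have "cl q u \<in> fibre B q" unfolding fibre_B using u by blast
      then have "\<phi> (cl q u) i = (\<Sum>j<m. \<psi> (cl q u) j * \<phi> (frame B \<psi> j q) i)"
        using q local_trivD(4,6)[OF tr] by (intro linear_in_frame[OF tr', where L = \<phi>]) auto
      then show "(\<Sum>j<m. \<psi> (cl q u) j * \<phi> (frame B \<psi> j q) i) = \<phi> (cl q u) i" ..
    qed (use p W in auto)
    ultimately show ?thesis by (rule hol_at_transfer)
  qed
  then show "(V, n, \<phi>) \<in> atlas B" unfolding atlas_iff using tr by blast
qed

end

section \<open>The bundle of a co-CR quaternionic vector space\<close>

lemma dual_separates:
  assumes "subspace E" "x \<in> E" "x \<noteq> 0"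
  obtains \<alpha> where "\<alpha> \<in> Dual E" "\<alpha> x \<noteq> 0"
proof -
  obtain g :: "'a \<Rightarrow> real" where g: "linear g" "g x = 1"
    using linear_independent_extend[of "{x}" "\<lambda>_. 1 :: real"] assms(3) by auto
  define \<alpha> where "\<alpha> y = (if y \<in> E then g y else 0)" for y
  have "\<alpha> \<in> Dual E"
    unfolding Dual_def
    by (intro HomI) (auto simp: \<alpha>_def linear_add[OF g(1)] linear_scale[OF g(1)]
        subspace_add[OF assms(1)] subspace_scale[OF assms(1)])
  moreover have "\<alpha> x \<noteq> 0" using g(2) assms(2) by (simp add: \<alpha>_def)
  ultimately show ?thesis using that by blast
qed

text \<open>The defining condition on the dual, read on the kernel \<open>K\<close> of \<open>\<rho>\<close>: \<open>K \<inter> J K = 0\<close> for all \<open>J\<close>.\<close>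

lemma kernel_condition:
  assumes X: "cocr_quat X" and J: "J \<in> adm (qstr X)" and x: "x \<in> qspc X" "rho X x = 0" "rho X (J x) = 0"
  shows "x = 0"
proof (rule ccontr)
  assume xnz: "x \<noteq> 0"
  have str: "quat_structure (qspc X) (qstr X)" and \<rho>: "rho X \<in> Hom (qspc X) (spc X)"
    and fdU: "fin_dim (spc X)"
    and cr: "cr_quat (Dual (spc X)) (Dual (qspc X)) (dual_structure (qspc X) (qstr X)) (transp (spc X) (rho X))"
    using X unfolding cocr_quat_def by auto
  obtain \<sigma> v where s: "\<sigma> \<in> qstr X" "norm v = 1" "J = \<sigma> (0, v)" using J unfolding adm_def by blast
  interpret qspace "qspc X" \<sigma>
    using structure_memD[OF str s(1)] str unfolding quat_structure_def by unfold_locales auto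
  obtain \<alpha> where \<alpha>: "\<alpha> \<in> Dual (qspc X)" "\<alpha> x \<noteq> 0" using dual_separates[OF sub x(1) xnz] by blast
  \<comment> \<open>The admissible structure of the dual that belongs to \<open>J\<close>. The CR
    condition writes the separating functional as
    \<open>\<alpha> = \<beta> \<rho> - \<gamma> \<rho> J\<close>, which vanishes at
    \<open>x\<close>.\<close>
  define J' where "J' = (\<lambda>q. transp (qspc X) (\<sigma> (qcnj q))) (0, v)"
  have "J' \<in> adm (dual_structure (qspc X) (qstr X))"
    unfolding adm_def J'_def
    by (rule CollectI, rule exI[of _ "\<lambda>q. transp (qspc X) (\<sigma> (qcnj q))"], rule exI[of _ v])
      (use s(1,2) in \<open>auto simp: dual_structure_def\<close>)
  then have "\<alpha> \<in> {x + J' y |x y. x \<in> transp (spc X) (rho X) ` Dual (spc X) \<and> y \<in> transp (spc X) (rho X) ` Dual (spc X)}"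
    using cr \<alpha>(1) unfolding cr_quat_def by blast
  then obtain \<beta> \<gamma> where bc: "\<beta> \<in> Dual (spc X)" "\<gamma> \<in> Dual (spc X)"
    "\<alpha> = transp (spc X) (rho X) \<beta> + J' (transp (spc X) (rho X) \<gamma>)" by blast
  have in_dual: "transp (spc X) (rho X) \<gamma> \<in> Dual (qspc X)"
    using cr bc(2) HomD(1) unfolding cr_quat_def by blast
  have zero: "\<delta> 0 = 0" if "\<delta> \<in> Dual (spc X)" for \<delta>
    using Hom_more(1)[OF that[unfolded Dual_def] fin_dim_subspace[OF fdU]] .
  have neg: "\<sigma> (0, - v) x = - J x" using s_minus[of "(0, v)" x] s(3) by simp
  have "rho X (- J x) = 0"
    using Hom_more(2)[OF \<rho> sub, of "J x"] sD(1)[OF x(1)] s(3) x(3) by simp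
  then have "\<alpha> x = 0"
    unfolding bc(3) J'_def using in_dual bc(1,2) x(2) zero[OF bc(1)] zero[OF bc(2)] neg
    by (simp add: transp_def qcnj_def)
  then show False using \<alpha>(2) by simp
qed

lemma map_prod_Hom_scale:
  assumes "f \<in> Hom E F" "subspace E" "x \<in> E \<times> E"
  shows "map_prod f f (cscale c x) = cscale c (map_prod f f x)"
proof -
  have "fst x \<in> E" "snd x \<in> E" using assms(3) by auto
  then show ?thesis
    using subspace_scale[OF assms(2)]
    by (simp add: cscale_def HomD(2,3)[OF assms(1)] Hom_more(3)[OF assms(1,2)])
qed

lemma map_prod_Hom_add:
  assumes "f \<in> Hom E F" "x \<in> E \<times> E" "y \<in> E \<times> E"
  shows "map_prod f f (x + y) = map_prod f f x + map_prod f f y"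
  using assms by (auto simp: HomD(2)[OF assms(1)])

text \<open>Fixing a representative \<open>\<sigma>\<close> fixes the Hopf parametrisation of the
  admissible structures. Later the locale is interpreted for one space with several representatives
  at once.\<close>

locale cocrs =
  fixes X :: "('u::real_vector, 'e::real_vector) cocr" and \<sigma> :: "quat \<Rightarrow> 'e \<Rightarrow> 'e"
  assumes X: "cocr_quat X" and s: "\<sigma> \<in> qstr X"
begin

lemma str: "quat_structure (qspc X) (qstr X)" and rho: "rho X \<in> Hom (qspc X) (spc X)"
  and fdU: "fin_dim (spc X)" and rho_surj: "rho X ` qspc X = spc X"
  using X unfolding cocr_quat_def by auto

lemma Qrep: "qstr X = {\<sigma> \<circ> so3_act R |R. rotation_matrix R}"
  using structure_memD(2)[OF str s] .

sublocale E: qspace "qspc X" \<sigma>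
  using structure_memD[OF str s] str unfolding quat_structure_def by unfold_locales auto

lemma std_adm: "E.std p \<in> adm (qstr X)"
  using E.std_bij[OF Qrep] unfolding bij_betw_def by blast

lemma adm_std: "J \<in> adm (qstr X) \<Longrightarrow> \<exists>p. J = E.std p"
  using E.std_bij[OF Qrep] unfolding bij_betw_def by blast

definition R :: "'e \<Rightarrow> 'u" where
  "R = (SOME g. linear g \<and> (\<forall>x\<in>qspc X. g x = rho X x))"

lemma R: "linear R" "x \<in> qspc X \<Longrightarrow> R x = rho X x"
proof -
  have "\<exists>g. linear g \<and> (\<forall>x\<in>qspc X. g x = rho X x)"
    using Hom_extend[OF rho E.sub] by metis
  then have "linear R \<and> (\<forall>x\<in>qspc X. R x = rho X x)"
    unfolding R_def by (rule someI_ex)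
  then show "linear R" "x \<in> qspc X \<Longrightarrow> R x = rho X x" by auto
qed

definition A :: "'e \<times> 'e \<Rightarrow> 'u \<times> 'u" where "A = map_prod R R"
definition A' :: "'e \<times> 'e \<Rightarrow> 'u \<times> 'u" where "A' w = A (E.Jc w)"

lemma A: "clin A" "w \<in> qspc X \<times> qspc X \<Longrightarrow> A w = map_prod (rho X) (rho X) w"
  unfolding A_def using clin_map_prod[OF R(1)] by (auto simp: R(2))

lemma A': "clin A'" unfolding A'_def by (rule clin_comp[OF E.Jc_clin A(1)])

sublocale P: pencil E.W A A'
proof -
  have "x = 0" if "norm v = 1" "x \<in> qspc X" "R x = 0" "R (\<sigma> (0, v) x) = 0" for v x
    by (rule kernel_condition[OF X, of "\<sigma> (0, v)", OF _ that(2)])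
      (use that R(2) E.sD(1) adm_structure[OF Qrep] in auto)
  then have "pencil E.W (map_prod R R) (\<lambda>w. map_prod R R (E.Jc w))" by (rule E.pencil_of_kernel[OF R(1)])
  then show "pencil E.W A A'" unfolding A_def[abs_def] A'_def[abs_def] .
qed

lemma E01_kernel:
  assumes w: "w \<in> E01 (qspc X) (E.std p)" "A w = 0"
  shows "w = 0"
proof -
  obtain a b where ab: "(a, b) \<noteq> (0, 0)" "p = pt a b" by (rule pt_exhaust)
  obtain w' where w': "w' \<in> E.W" "w = cscale a w' + cscale b (E.Jc w')"
    using w(1) unfolding ab(2) E.E01_std[OF ab(1)] by blast
  have "cscale a (A w') + cscale b (A' w') = 0"
    using w(2) unfolding w'(2) by (simp add: A'_def clinD[OF A(1)])
  then have "w' = 0" by (rule P.inj[OF ab(1) w'(1)])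
  then show ?thesis unfolding w'(2) by (simp add: clinD[OF E.Jc_clin])
qed

lemma E01_sub: "E01 E J \<subseteq> E \<times> E" unfolding E01_def by auto

lemma img_E01: "P.img p = map_prod (rho X) (rho X) ` E01 (qspc X) (E.std p)"
proof -
  obtain a b where ab: "(a, b) \<noteq> (0, 0)" "p = pt a b" by (rule pt_exhaust)
  have "map_prod (rho X) (rho X) ` E01 (qspc X) (E.std p) = A ` E01 (qspc X) (E.std p)"
    by (rule image_cong[OF refl]) (use A(2) E01_sub in \<open>metis subsetD\<close>)
  also have "\<dots> = {A (cscale a w + cscale b (E.Jc w)) |w. w \<in> E.W}"
    unfolding ab(2) E.E01_std[OF ab(1)] by blast
  also have "\<dots> = P.img p"
    unfolding ab(2) P.img_pt[OF ab(1)] by (simp add: A'_def clinD[OF A(1)])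
  finally show ?thesis ..
qed

text \<open>The comparison between the Hopf parametrisation and the arbitrary
  \<open>ident X\<close>. By \<open>ident_std\<close> it is biholomorphic, which is how the choice
  is brought under control.\<close>

definition \<theta> :: "cp1 \<Rightarrow> cp1" where "\<theta> = ident X \<circ> E.std"

lemma ident: "cp1_ident (qspc X) (qstr X) (ident X)"
  unfolding ident_def by (rule someI_ex[OF E.ident_exists[OF Qrep]])

lemma \<theta>: "cp1_biholo \<theta>" "cstr X (\<theta> p) = E.std p" "ident X (E.std p) = \<theta> p"
  unfolding \<theta>_def cstr_def using E.ident_std[OF Qrep ident] by auto

lemma bij_\<theta>: "bij \<theta>" using \<theta>(1) cp1_biholoD by blast

lemma \<theta>_surj: "\<exists>q. p = \<theta> q" using bij_\<theta> by (metis bij_pointE)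

lemma \<theta>_inj: "\<theta> p = \<theta> q \<longleftrightarrow> p = q" using bij_\<theta> by (metis bij_pointE)

lemma ker_img: "ker_bundle X (\<theta> p) = P.img p"
  unfolding ker_bundle_def \<theta>(2) img_E01 ..

text \<open>The complexified \<open>\<rho>\<close> is injective on each eigenspace, so it carries a
  holomorphic frame to a holomorphic frame.\<close>

lemma ker_holo_subbundle: "holo_subbundle (spc X) (ker_bundle X)"
  unfolding holo_subbundle_def
proof
  fix p
  have "holo_subbundle (qspc X) (\<lambda>p. E01 (qspc X) (cstr X p))"
    using ident unfolding cp1_ident_def cstr_def by blast
  then obtain V n and s :: "nat \<Rightarrow> cp1 \<Rightarrow> 'e \<times> 'e" where *: "cp1_open V \<and> p \<in> V \<and>
      (\<forall>k<n. holo_vector_map (qspc X) V (s k)) \<and>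
      (\<forall>q\<in>V. E01 (qspc X) (cstr X q) = {\<Sum>k<n. cscale (c k) (s k q) |c. True} \<and>
         (\<forall>c. (\<Sum>k<n. cscale (c k) (s k q)) = 0 \<longrightarrow> (\<forall>k<n. c k = 0)))"
    unfolding holo_subbundle_def by (elim allE[of _ p] exE) (rule that)
  define s' where "s' k q = A (s k q)" for k q
  have comb: "(\<Sum>k<n. cscale (c k) (s' k q)) = A (\<Sum>k<n. cscale (c k) (s k q))" for c q
    unfolding s'_def cxp.linear_sum[OF A(1)] by (simp add: clinD[OF A(1)])
  have "holo_vector_map (spc X) V (s' k)" if "k < n" for k
  proof -
    obtain m and w :: "nat \<Rightarrow> 'e \<times> 'e" and h where
      w: "\<forall>j<m. w j \<in> qspc X \<times> qspc X \<and> cp1_holo V (h j)" "\<forall>p\<in>V. s k p = (\<Sum>j<m. cscale (h j p) (w j))"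
    proof -
      have "holo_vector_map (qspc X) V (s k)" using * \<open>k < n\<close> by blast
      then show ?thesis unfolding holo_vector_map_def using that by blast
    qed
    have "\<forall>j<m. A (w j) \<in> spc X \<times> spc X \<and> cp1_holo V (h j)"
    proof (intro allI impI conjI)
      fix j assume j: "j < m"
      then have "A (w j) = map_prod (rho X) (rho X) (w j)" using A(2) w(1) by blast
      then show "A (w j) \<in> spc X \<times> spc X" using w(1) j HomD(1)[OF rho] by (auto simp: mem_Times_iff)
      show "cp1_holo V (h j)" using w(1) j by blast
    qed
    moreover have "\<forall>p\<in>V. s' k p = (\<Sum>j<m. cscale (h j p) (A (w j)))"
      using w(2) unfolding s'_def by (simp add: cxp.linear_sum[OF A(1)] clinD[OF A(1)])
    ultimately show ?thesis unfolding holo_vector_map_def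
      by (intro exI[of _ m] exI[of _ "\<lambda>j. A (w j)"] exI[of _ h]) simp
  qed
  moreover have "ker_bundle X q = {\<Sum>k<n. cscale (c k) (s' k q) |c. True} \<and>
      (\<forall>c. (\<Sum>k<n. cscale (c k) (s' k q)) = 0 \<longrightarrow> (\<forall>k<n. c k = 0))" if "q \<in> V" for q
  proof -
    obtain q' where q': "q = \<theta> q'" using \<theta>_surj by blast
    have E01: "E01 (qspc X) (cstr X q) = {\<Sum>k<n. cscale (c k) (s k q) |c. True}" using * that by blast
    have "ker_bundle X q = A ` E01 (qspc X) (cstr X q)"
      unfolding ker_bundle_def by (rule image_cong[OF refl]) (use A(2) E01_sub in \<open>metis subsetD\<close>)
    also have "\<dots> = {\<Sum>k<n. cscale (c k) (s' k q) |c. True}"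
      unfolding E01 comb by blast
    finally have 1: "ker_bundle X q = {\<Sum>k<n. cscale (c k) (s' k q) |c. True}" .
    have "\<forall>k<n. c k = 0" if "(\<Sum>k<n. cscale (c k) (s' k q)) = 0" for c
    proof -
      have "(\<Sum>k<n. cscale (c k) (s k q)) \<in> E01 (qspc X) (E.std q')"
        using E01 unfolding q' \<theta>(2) by blast
      then have "(\<Sum>k<n. cscale (c k) (s k q)) = 0" using E01_kernel that unfolding comb by blast
      then show ?thesis using * \<open>q \<in> V\<close> by blast
    qed
    then show ?thesis using 1 by blast
  qed
  ultimately have "cp1_open V \<and> p \<in> V \<and> (\<forall>k<n. holo_vector_map (spc X) V (s' k)) \<and>
      (\<forall>q\<in>V. ker_bundle X q = {\<Sum>k<n. cscale (c k) (s' k q) |c. True} \<and>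
         (\<forall>c. (\<Sum>k<n. cscale (c k) (s' k q)) = 0 \<longrightarrow> (\<forall>k<n. c k = 0)))"
    using * by (intro conjI ballI allI impI) blast+
  then show "\<exists>V n (s :: nat \<Rightarrow> cp1 \<Rightarrow> 'u \<times> 'u). cp1_open V \<and> p \<in> V \<and> (\<forall>k<n. holo_vector_map (spc X) V (s k)) \<and>
      (\<forall>q\<in>V. ker_bundle X q = {\<Sum>k<n. cscale (c k) (s k q) |c. True} \<and>
         (\<forall>c. (\<Sum>k<n. cscale (c k) (s k q)) = 0 \<longrightarrow> (\<forall>k<n. c k = 0)))"
    by blast
qed

sublocale Q: quot "spc X" "ker_bundle X"
  using fdU ker_holo_subbundle by unfold_locales

lemma F_obj: "F_obj X = Q.B" unfolding F_obj_def ..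

lemma holo_bundle_F: "holo_bundle (F_obj X)" unfolding F_obj by (rule Q.holo_bundle_quot)

lemma cconj_E01: "cconj ` E01 (qspc X) (E.std p) = E01 (qspc X) (E.std (antip p))"
proof -
  have "cconj ` E01 (qspc X) (E.std p) = {(x, E.std (antip p) x) |x. x \<in> qspc X}"
    unfolding E.std_def E.E01_graph[OF norm_sphp] sphp_antip Setcompr_eq_image image_image
    using E.s_minus[of "(0, sphp p)"] by (simp add: cconj_def)
  then show ?thesis unfolding E.std_def E.E01_graph[OF norm_sphp] .
qed

lemma cconj_ker: "cconj ` ker_bundle X (\<theta> p) = ker_bundle X (\<theta> (antip p))"
proof -
  have conj_rho: "cconj (map_prod (rho X) (rho X) w) = map_prod (rho X) (rho X) (cconj w)" if "w \<in> qspc X \<times> qspc X" for w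
    using that Hom_more(2)[OF rho E.sub] by (auto simp: cconj_def)
  then have "cconj ` map_prod (rho X) (rho X) ` E01 (qspc X) (E.std p) =
      map_prod (rho X) (rho X) ` cconj ` E01 (qspc X) (E.std p)"
  proof -
    have "cconj (map_prod (rho X) (rho X) w) = map_prod (rho X) (rho X) (cconj w)"
      if "w \<in> E01 (qspc X) (E.std p)" for w
    proof -
      have "w \<in> qspc X \<times> qspc X" using that E01_sub by blast
      then show ?thesis by (rule conj_rho)
    qed
    then show ?thesis unfolding image_image by (rule image_cong[OF refl])
  qed
  then show ?thesis unfolding ker_bundle_def \<theta>(2) cconj_E01 .
qed

lemma conjugation_cl: "conjugation X (Q.cl (\<theta> p) u) = Q.cl (\<theta> (antip p)) (cconj u)"
proof -
  have add: "cconj (x + y) = cconj x + cconj y" for x y :: "'u \<times> 'u" by (simp add: cconj_def)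
  have "cconj ` coset (ker_bundle X) (\<theta> p) u = coset (ker_bundle X) (\<theta> (antip p)) (cconj u)"
    unfolding coset_def cconj_ker[symmetric] Setcompr_eq_image image_image by (simp add: add)
  moreover have "ident X (- E.std p) = \<theta> (antip p)"
    using \<theta>(3)[of "antip p"] unfolding E.std_antip .
  ultimately show ?thesis unfolding conjugation_def Q.cl_def fst_conv snd_conv \<theta>(2) by (simp only:)
qed

lemma conj_UU: "u \<in> spc X \<times> spc X \<Longrightarrow> cconj u \<in> spc X \<times> spc X"
  using subspace_neg[OF Q.subU] by (auto simp: cconj_def)

lemma total_F: "total (F_obj X) = {Q.cl (\<theta> p) u |p u. u \<in> spc X \<times> spc X}"
  unfolding F_obj Q.B_simps(1)
proof (intro set_eqI iffI)
  fix x assume "x \<in> {Q.cl p u |p u. u \<in> spc X \<times> spc X}"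
  then obtain p u where pu: "x = Q.cl p u" "u \<in> spc X \<times> spc X" by blast
  obtain q where "p = \<theta> q" using \<theta>_surj[of p] by (elim exE)
  then show "x \<in> {Q.cl (\<theta> p) u |p u. u \<in> spc X \<times> spc X}" using pu by blast
qed blast

lemma img_Inter_zero: "(\<And>p. x \<in> ker_bundle X (\<theta> p)) \<Longrightarrow> x = 0"
  unfolding ker_img by (rule P.img_Inter)

end

section \<open>The category of co-CR quaternionic vector spaces\<close>

lemma orient_isometryI:
  assumes "T \<in> adm Q \<rightarrow>\<^sub>E adm Q'" "\<sigma> \<in> Q" "\<sigma>' \<in> Q'" "\<And>v. norm v = 1 \<Longrightarrow> T (\<sigma> (0, v)) = \<sigma>' (0, v)"
  shows "orient_isometry Q Q' T"
  unfolding orient_isometry_def using assms rotation_one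
  by (intro conjI bexI[of _ \<sigma>] bexI[of _ \<sigma>'] exI[of _ "mat 1"]) auto

text \<open>The rotation in the definition is absorbed into the representative of the target, so
  that in coordinates the isometry becomes the identity.\<close>

lemma orient_isometryE:
  assumes "orient_isometry Q Q' T" "quat_structure E Q" "quat_structure E' Q'" "\<sigma> \<in> Q"
  obtains \<sigma>' where "\<sigma>' \<in> Q'" "\<And>v. norm v = 1 \<Longrightarrow> T (\<sigma> (0, v)) = \<sigma>' (0, v)"
proof -
  obtain \<tau> \<tau>' A where *: "\<tau> \<in> Q" "\<tau>' \<in> Q'" "rotation_matrix A" "\<And>v. norm v = 1 \<Longrightarrow> T (\<tau> (0, v)) = \<tau>' (0, A *v v)"
    using assms(1) unfolding orient_isometry_def by blast
  obtain S where S: "rotation_matrix S" "\<sigma> = \<tau> \<circ> so3_act S"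
    using structure_memD(2)[OF assms(2) *(1)] assms(4) by blast
  have "\<tau>' \<circ> so3_act (A ** S) \<in> Q'"
    using structure_memD(2)[OF assms(3) *(2)] rotation_mult[OF *(3) S(1)] by blast
  moreover have "T (\<sigma> (0, v)) = (\<tau>' \<circ> so3_act (A ** S)) (0, v)" if "norm v = 1" for v
    using *(4)[of "S *v v"] that rotation_norm[OF S(1)] unfolding S(2)
    by (simp add: so3_act_def matrix_vector_mul_assoc)
  ultimately show ?thesis using that by blast
qed

lemma cocr_morD:
  assumes "(t, T) \<in> cocr_mor X Y"
  shows "t \<in> Hom (spc X) (spc Y)" "orient_isometry (qstr X) (qstr Y) T" "T \<in> adm (qstr X) \<rightarrow>\<^sub>E adm (qstr Y)"
  using assms unfolding cocr_mor_def orient_isometry_def by auto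

lemma Hom_comp: "f \<in> Hom E F \<Longrightarrow> g \<in> Hom F G \<Longrightarrow> subspace F \<Longrightarrow> g \<circ> f \<in> Hom E G"
  by (intro HomI) (auto simp: HomD Hom_more(1))

lemma id_Hom: "subspace E \<Longrightarrow> id_map E \<in> Hom E E"
  by (intro HomI) (auto simp: id_map_def subspace_add subspace_scale)

lemma cocr_basic:
  assumes "cocr_quat X"
  shows "subspace (spc X)" "subspace (qspc X)" "quat_structure (qspc X) (qstr X)" "fin_dim (spc X)"
    "rho X \<in> Hom (qspc X) (spc X)" "\<exists>\<sigma>. \<sigma> \<in> qstr X" "rho X ` qspc X = spc X"
proof -
  show 1: "fin_dim (spc X)" "quat_structure (qspc X) (qstr X)" "rho X \<in> Hom (qspc X) (spc X)" "rho X ` qspc X = spc X"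
    using assms unfolding cocr_quat_def by auto
  show "subspace (spc X)" "subspace (qspc X)"
    using 1 fin_dim_subspace unfolding quat_structure_def by auto
  show "\<exists>\<sigma>. \<sigma> \<in> qstr X"
    by (rule structure_rep[OF 1(2)]) (use structure_self in blast)
qed

lemma adm_Hom:
  assumes "quat_structure E Q" "J \<in> adm Q"
  shows "J \<in> Hom E E"
  using assms structure_memD(1)[OF assms(1)] unfolding adm_def quat_hom_def by blast

lemma cocr_mor_id:
  assumes "cocr_quat X"
  shows "(id_map (spc X), restrict id (adm (qstr X))) \<in> cocr_mor X X"
proof -
  note b = cocr_basic[OF assms]
  obtain \<sigma> where s: "\<sigma> \<in> qstr X" using b(6) by blast
  have "orient_isometry (qstr X) (qstr X) (restrict id (adm (qstr X)))"
    by (rule orient_isometryI[OF _ s s]) (use s in \<open>auto simp: adm_def\<close>)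
  moreover have "quat_linear (qspc X) (qstr X) (qspc X) (restrict id (adm (qstr X))) (id_map (qspc X))"
    unfolding quat_linear_def
  proof (intro conjI ballI)
    show "id_map (qspc X) \<in> Hom (qspc X) (qspc X)" using id_Hom b(2) by blast
    fix J assume J: "J \<in> adm (qstr X)"
    have "J \<in> Hom (qspc X) (qspc X)" using adm_Hom[OF b(3) J] .
    then show "id_map (qspc X) \<circ> J = restrict id (adm (qstr X)) J \<circ> id_map (qspc X)"
      using J HomD(1,4)[of J] Hom_more(1)[of J, OF _ b(2)]
      by (auto simp: fun_eq_iff id_map_def)
  qed
  moreover have "rho X \<circ> id_map (qspc X) = id_map (spc X) \<circ> rho X"
    using HomD(1,4)[OF b(5)] Hom_more(1)[OF b(5,2)] by (auto simp: fun_eq_iff id_map_def)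
  ultimately show ?thesis
    unfolding cocr_mor_def using id_Hom[OF b(1)] by auto
qed

lemma cocr_mor_comp:
  assumes X: "cocr_quat X" and Y: "cocr_quat Y" and Z: "cocr_quat Z"
    and t: "(t, T) \<in> cocr_mor X Y" and t': "(t', T') \<in> cocr_mor Y Z"
  shows "(t' \<circ> t, compose (adm (qstr X)) T' T) \<in> cocr_mor X Z"
proof -
  note bX = cocr_basic[OF X] and bY = cocr_basic[OF Y] and bZ = cocr_basic[OF Z]
  obtain f where f: "quat_linear (qspc X) (qstr X) (qspc Y) T f" "rho Y \<circ> f = t \<circ> rho X"
    using t unfolding cocr_mor_def by blast
  obtain f' where f': "quat_linear (qspc Y) (qstr Y) (qspc Z) T' f'" "rho Z \<circ> f' = t' \<circ> rho Y"
    using t' unfolding cocr_mor_def by blast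
  have TT: "compose (adm (qstr X)) T' T \<in> adm (qstr X) \<rightarrow>\<^sub>E adm (qstr Z)"
    using cocr_morD(3)[OF t] cocr_morD(3)[OF t'] by (auto simp: compose_def PiE_iff)
  obtain \<sigma> where s: "\<sigma> \<in> qstr X" using bX(6) by blast
  obtain \<sigma>' where s': "\<sigma>' \<in> qstr Y" "\<And>v. norm v = 1 \<Longrightarrow> T (\<sigma> (0, v)) = \<sigma>' (0, v)"
    by (rule orient_isometryE[OF cocr_morD(2)[OF t] bX(3) bY(3) s]) (rule that)
  obtain \<sigma>'' where s'': "\<sigma>'' \<in> qstr Z" "\<And>v. norm v = 1 \<Longrightarrow> T' (\<sigma>' (0, v)) = \<sigma>'' (0, v)"
    by (rule orient_isometryE[OF cocr_morD(2)[OF t'] bY(3) bZ(3) s'(1)]) (rule that)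
  have "orient_isometry (qstr X) (qstr Z) (compose (adm (qstr X)) T' T)"
  proof (rule orient_isometryI[OF TT s s''(1)])
    fix v :: "real ^ 3" assume v: "norm v = 1"
    then have "\<sigma> (0, v) \<in> adm (qstr X)" using s unfolding adm_def by blast
    then show "compose (adm (qstr X)) T' T (\<sigma> (0, v)) = \<sigma>'' (0, v)"
      by (simp add: compose_eq s'(2)[OF v] s''(2)[OF v])
  qed
  moreover have "quat_linear (qspc X) (qstr X) (qspc Z) (compose (adm (qstr X)) T' T) (f' \<circ> f)"
    unfolding quat_linear_def
  proof (intro conjI ballI)
    show "f' \<circ> f \<in> Hom (qspc X) (qspc Z)"
      using Hom_comp f(1) f'(1) bY(2) unfolding quat_linear_def by blast
    fix J assume J: "J \<in> adm (qstr X)"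
    then have "T J \<in> adm (qstr Y)" using cocr_morD(3)[OF t] by blast
    then have "f' \<circ> T J = T' (T J) \<circ> f'" "f \<circ> J = T J \<circ> f"
      using f(1) f'(1) J unfolding quat_linear_def by blast+
    then show "f' \<circ> f \<circ> J = compose (adm (qstr X)) T' T J \<circ> (f' \<circ> f)"
      unfolding compose_eq[OF J] by (metis comp_assoc)
  qed
  moreover have "rho Z \<circ> (f' \<circ> f) = t' \<circ> t \<circ> rho X" by (metis comp_assoc f(2) f'(2))
  ultimately show ?thesis
    unfolding cocr_mor_def using Hom_comp[OF cocr_morD(1)[OF t] cocr_morD(1)[OF t'] bY(1)] by blast
qed

theorem cocr_category: "is_category cocr_cat"
  unfolding is_category_def cocr_cat_def
proof (simp del: split_paired_All, intro conjI allI impI ballI)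
  fix X :: "('a, 'b) cocr" assume "cocr_quat X"
  then show "(id_map (spc X), restrict id (adm (qstr X))) \<in> cocr_mor X X" by (rule cocr_mor_id)
next
  fix X Y Z :: "('a, 'b) cocr" and f g
  assume "cocr_quat X" "cocr_quat Y" "cocr_quat Z" "f \<in> cocr_mor X Y" "g \<in> cocr_mor Y Z"
  then show "(fst g \<circ> fst f, compose (adm (qstr X)) (snd g) (snd f)) \<in> cocr_mor X Z"
    using cocr_mor_comp[of X Y Z "fst f" "snd f" "fst g" "snd g"] by simp
next
  fix X Y :: "('a, 'b) cocr" and f
  assume X: "cocr_quat X" and Y: "cocr_quat Y" and f: "f \<in> cocr_mor X Y"
  obtain t T where tT: "f = (t, T)" by (cases f)
  note t = f[unfolded tT]
  have "t \<circ> id_map (spc X) = t" "id_map (spc Y) \<circ> t = t"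
    using HomD(1,4)[OF cocr_morD(1)[OF t]] Hom_more(1)[OF cocr_morD(1)[OF t] cocr_basic(1)[OF X]]
    by (auto simp: fun_eq_iff id_map_def)
  moreover have "compose (adm (qstr X)) T (restrict id (adm (qstr X))) = T"
    "compose (adm (qstr X)) (restrict id (adm (qstr Y))) T = T"
    using cocr_morD(3)[OF t] by (auto simp: compose_def fun_eq_iff PiE_iff extensional_def)
  ultimately show "(fst f \<circ> id_map (spc X), compose (adm (qstr X)) (snd f) (restrict id (adm (qstr X)))) = f"
    "(id_map (spc Y) \<circ> fst f, compose (adm (qstr X)) (restrict id (adm (qstr Y))) (snd f)) = f"
    unfolding tT by auto
next
  fix X Y Z W :: "('a, 'b) cocr" and f g h
  assume "f \<in> cocr_mor X Y"
  then have "snd f \<in> adm (qstr X) \<rightarrow>\<^sub>E adm (qstr Y)" using cocr_morD(3)[of "fst f" "snd f"] by simp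
  then show "compose (adm (qstr X)) (snd h) (compose (adm (qstr X)) (snd g) (snd f)) =
      compose (adm (qstr X)) (compose (adm (qstr Y)) (snd h) (snd g)) (snd f)"
    by (auto simp: compose_def fun_eq_iff PiE_iff)
qed (auto simp: comp_assoc)

section \<open>The functor\<close>

lemma (in qspace) E01_std_graph: "E01 E (std p) = {(x, std p x) |x. x \<in> E}"
  unfolding std_def by (rule E01_graph[OF norm_sphp])

locale cocr_pair = X: cocrs X \<sigma> + Y: cocrs Y \<sigma>'
  for X :: "('u::real_vector, 'e::real_vector) cocr" and \<sigma>
    and Y :: "('u, 'e) cocr" and \<sigma>'

text \<open>With representatives matched by \<open>T\<close>, the map induced on the base is the
  identity in the Hopf parameters, as \<open>g\<close> records.\<close>

locale cocr_aligned = cocr_pair +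
  fixes t T
  assumes mor: "(t, T) \<in> cocr_mor X Y"
    and T: "\<And>v. norm v = 1 \<Longrightarrow> T (\<sigma> (0, v)) = \<sigma>' (0, v)"
begin

definition g :: "cp1 \<Rightarrow> cp1" where "g = Y.\<theta> \<circ> inv X.\<theta>"

lemma g: "cp1_biholo g" "g (X.\<theta> p) = Y.\<theta> p"
  unfolding g_def using X.\<theta>(1) Y.\<theta>(1) cp1_biholo_compose cp1_biholo_inv X.bij_\<theta>
  by (auto simp: bij_is_inj)

lemma tHom: "t \<in> Hom (spc X) (spc Y)" using cocr_morD(1)[OF mor] .

abbreviation tc where "tc \<equiv> map_prod t t"

lemma tc_in: "u \<in> spc X \<times> spc X \<Longrightarrow> tc u \<in> spc Y \<times> spc Y"
  using HomD(1)[OF tHom] by auto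

lemma tc_add: "u \<in> spc X \<times> spc X \<Longrightarrow> v \<in> spc X \<times> spc X \<Longrightarrow> tc (u + v) = tc u + tc v"
  by (rule map_prod_Hom_add[OF tHom])

lemma tc_scale: "u \<in> spc X \<times> spc X \<Longrightarrow> tc (cscale c u) = cscale c (tc u)"
  by (rule map_prod_Hom_scale[OF tHom X.Q.subU])

lemma tc_diff: "u \<in> spc X \<times> spc X \<Longrightarrow> v \<in> spc X \<times> spc X \<Longrightarrow> tc (u - v) = tc u - tc v"
  using Hom_more(3)[OF tHom X.Q.subU] by auto

lemma tc_cconj: "u \<in> spc X \<times> spc X \<Longrightarrow> tc (cconj u) = cconj (tc u)"
  using Hom_more(2)[OF tHom X.Q.subU] by (auto simp: cconj_def)

lemma T_std: "T (X.E.std p) = Y.E.std p"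
  unfolding X.E.std_def Y.E.std_def by (rule T[OF norm_sphp])

text \<open>The quaternionic lift \<open>f\<close> carries \<open>(x, J x)\<close> to
  \<open>(f x, T J (f x))\<close>, and the relation \<open>rho Y \<circ> f = t \<circ> rho X\<close>
  transfers this to the images under \<open>\<rho>\<close>.\<close>

lemma tc_ker: "u \<in> ker_bundle X (X.\<theta> p) \<Longrightarrow> tc u \<in> ker_bundle Y (Y.\<theta> p)"
proof -
  assume u: "u \<in> ker_bundle X (X.\<theta> p)"
  obtain f where f: "quat_linear (qspc X) (qstr X) (qspc Y) T f" "rho Y \<circ> f = t \<circ> rho X"
    using mor unfolding cocr_mor_def by blast
  have fH: "f \<in> Hom (qspc X) (qspc Y)" and fJ: "f \<circ> X.E.std p = Y.E.std p \<circ> f"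
    using f(1) X.std_adm[of p] T_std[of p] unfolding quat_linear_def by auto
  obtain w where w: "w \<in> E01 (qspc X) (X.E.std p)" "u = map_prod (rho X) (rho X) w"
    using u unfolding ker_bundle_def X.\<theta>(2) by (rule imageE) (rule that)
  obtain x where x: "x \<in> qspc X" "w = (x, X.E.std p x)"
    using w(1) unfolding X.E.E01_std_graph by blast
  have "(f x, Y.E.std p (f x)) \<in> E01 (qspc Y) (Y.E.std p)"
    unfolding Y.E.E01_std_graph using HomD(1)[OF fH x(1)] by blast
  moreover have "tc u = map_prod (rho Y) (rho Y) (f x, Y.E.std p (f x))"
    unfolding w(2) x(2) using fun_cong[OF f(2), of x] fun_cong[OF f(2), of "X.E.std p x"] fun_cong[OF fJ, of x] by simp
  ultimately show ?thesis unfolding ker_bundle_def Y.\<theta>(2) by blast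
qed

text \<open>The union in \<open>F_mor\<close> runs over one coset, and by \<open>tc_ker\<close> all
  its members have the same image coset, so the union is that single coset.\<close>

lemma F_mor_cl:
  assumes "u \<in> spc X \<times> spc X"
  shows "F_mor X Y (t, T) (X.Q.cl p u) = Y.Q.cl (g p) (tc u)"
proof -
  obtain q where q: "p = X.\<theta> q" using X.\<theta>_surj[of p] by (elim exE)
  have in_tot: "X.Q.cl p u \<in> total (F_obj X)" unfolding X.F_obj X.Q.B_simps(1) using assms by blast
  have "coset (ker_bundle Y) (Y.\<theta> q) (tc v) = coset (ker_bundle Y) (Y.\<theta> q) (tc u)"
    if "v \<in> coset (ker_bundle X) p u" for v
  proof -
    have d: "v - u \<in> ker_bundle X p" using that X.Q.coset_mem by blast
    then have "v - u \<in> spc X \<times> spc X" using X.Q.S_sub by blast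
    then have "v \<in> spc X \<times> spc X" using X.Q.subUU assms cx.subspace_add by (metis diff_add_cancel)
    then show ?thesis
      unfolding Y.Q.coset_eq using tc_ker[of "v - u" q] d assms unfolding q by (simp add: tc_diff)
  qed
  moreover have "u \<in> coset (ker_bundle X) p u" by (rule X.Q.coset_self)
  ultimately have un: "(\<Union>v\<in>coset (ker_bundle X) p u. coset (ker_bundle Y) (Y.\<theta> q) (tc v)) = coset (ker_bundle Y) (Y.\<theta> q) (tc u)"
    by blast
  have "ident Y (T (cstr X p)) = Y.\<theta> q" unfolding q X.\<theta>(2) T_std Y.\<theta>(3) ..
  then have "F_mor X Y (t, T) (X.Q.cl p u) = (Y.\<theta> q, coset (ker_bundle Y) (Y.\<theta> q) (tc u))"
    using in_tot un unfolding F_mor_def X.Q.cl_def by (simp add: Let_def)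
  then show ?thesis unfolding Y.Q.cl_def q g(2) .
qed

text \<open>For holomorphy the frame is lifted by \<open>local_lift\<close> to a combination of
  constant sections, and the induced map sends constant sections to constant sections.\<close>

lemma F_mor_over: "mor_over (F_obj X) (F_obj Y) g (F_mor X Y (t, T))"
  unfolding mor_over_def X.F_obj Y.F_obj
proof (intro conjI allI impI ballI)
  show "cp1_biholo g" by (rule g(1))
  have cl: "\<exists>p u. u \<in> spc X \<times> spc X \<and> x = X.Q.cl p u" if "x \<in> total X.Q.B" for x
    using that unfolding X.Q.B_simps(1) by blast
  show "F_mor X Y (t, T) \<in> total X.Q.B \<rightarrow>\<^sub>E total Y.Q.B"
  proof
    fix x assume "x \<in> total X.Q.B"
    then obtain p u where u: "u \<in> spc X \<times> spc X" "x = X.Q.cl p u" using cl by blast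
    show "F_mor X Y (t, T) x \<in> total Y.Q.B"
      unfolding u(2) F_mor_cl[OF u(1)] Y.Q.B_simps(1) by (intro CollectI exI[of _ "g p"] exI[of _ "tc u"] conjI refl tc_in u)
  qed (simp add: F_mor_def X.F_obj)
  show "F_mor X Y (t, T) x \<in> fibre Y.Q.B (g p)" if xx: "x \<in> fibre X.Q.B p" for x p
  proof -
    obtain u where u: "u \<in> spc X \<times> spc X" "x = X.Q.cl p u" using xx unfolding X.Q.fibre_B by blast
    show ?thesis unfolding u(2) F_mor_cl[OF u(1)] Y.Q.fibre_B by (rule imageI[OF tc_in[OF u(1)]])
  qed
  show "F_mor X Y (t, T) (vadd X.Q.B x y) = vadd Y.Q.B (F_mor X Y (t, T) x) (F_mor X Y (t, T) y)"
    if xy: "x \<in> fibre X.Q.B p" "y \<in> fibre X.Q.B p" for x y p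
  proof -
    obtain u v where u: "u \<in> spc X \<times> spc X" "x = X.Q.cl p u" and v: "v \<in> spc X \<times> spc X" "y = X.Q.cl p v"
      using xy unfolding X.Q.fibre_B by blast
    show ?thesis
      unfolding u(2) v(2) X.Q.vadd_cl F_mor_cl[OF u(1)] F_mor_cl[OF v(1)] Y.Q.vadd_cl
        F_mor_cl[OF cx.subspace_add[OF X.Q.subUU u(1) v(1)]] tc_add[OF u(1) v(1)] ..
  qed
  show "F_mor X Y (t, T) (vscale X.Q.B c x) = vscale Y.Q.B c (F_mor X Y (t, T) x)" if xx: "x \<in> total X.Q.B" for c x
  proof -
    obtain p u where u: "u \<in> spc X \<times> spc X" "x = X.Q.cl p u" using cl[OF xx] by (elim exE conjE) (rule that)
    show ?thesis
      unfolding u(2) X.Q.vscale_cl F_mor_cl[OF u(1)] Y.Q.vscale_cl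
        F_mor_cl[OF cx.subspace_scale[OF X.Q.subUU u(1)]] tc_scale[OF u(1)] ..
  qed
  fix V n \<phi> W m \<psi> p j i
  assume a: "(V, n, \<phi>) \<in> atlas X.Q.B" "(W, m, \<psi>) \<in> atlas Y.Q.B" "j < n" "i < m" "p \<in> V" "g p \<in> W"
  have tr: "local_triv X.Q.B V n \<phi>" and trW: "local_triv Y.Q.B W m \<psi>"
    and holW: "\<And>u q. u \<in> spc Y \<times> spc Y \<Longrightarrow> q \<in> W \<Longrightarrow> hol_at (\<lambda>p. \<psi> (Y.Q.cl p u) i) q"
    using a(1,2,4) X.Q.atlas_iff Y.Q.atlas_iff by auto
  obtain c sol where c: "\<And>i. i < n \<Longrightarrow> c i \<in> spc X \<times> spc X" and sol: "hol_solver p n sol"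
    and ev: "\<forall>\<^sub>F q in nhds p. q \<in> V \<and> (\<forall>x\<in>fibre X.Q.B q. x = X.Q.cl q (\<Sum>i<n. cscale (sol q (\<phi> x) i) (c i)))"
    by (rule X.Q.local_lift[OF a(1,5)]) (rule that)
  let ?e = "\<lambda>i. if i = j then 1 else (0 :: complex)"
  have "hol_at (\<lambda>q. \<Sum>l<n. sol q ?e l * \<psi> (Y.Q.cl (g q) (tc (c l))) i) p"
  proof (intro hol_at_sum hol_at_mult)
    fix l assume l: "l \<in> {..<n}"
    then show "hol_at (\<lambda>q. sol q ?e l) p" by (intro hol_solverD[OF sol]) auto
    have "hol_at (\<lambda>q. \<psi> (Y.Q.cl q (tc (c l))) i) (g p)" using holW tc_in c l a(6) by auto
    then show "hol_at (\<lambda>q. \<psi> (Y.Q.cl (g q) (tc (c l))) i) p"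
      using hmap_at_compose[OF cp1_biholoD(1)[OF g(1)]] by blast
  qed
  moreover have "\<forall>\<^sub>F q in nhds p. g q \<in> W"
    using topological_tendstoD[OF hmap_at_tendsto[OF cp1_biholoD(1)[OF g(1)]] local_trivD(1)[OF trW] a(6)] .
  with ev have "\<forall>\<^sub>F q in nhds p. (\<Sum>l<n. sol q ?e l * \<psi> (Y.Q.cl (g q) (tc (c l))) i) =
      \<psi> (F_mor X Y (t, T) (frame X.Q.B \<phi> j q)) i"
  proof eventually_elim
    case (elim q)
    have f: "frame X.Q.B \<phi> j q \<in> fibre X.Q.B q" "\<phi> (frame X.Q.B \<phi> j q) = ?e"
      using frame_props[OF tr _ a(3)] elim(1) by blast+
    have "frame X.Q.B \<phi> j q = X.Q.cl q (\<Sum>l<n. cscale (sol q (\<phi> (frame X.Q.B \<phi> j q)) l) (c l))"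
      using elim(1) f(1) by blast
    then have fr: "frame X.Q.B \<phi> j q = X.Q.cl q (\<Sum>l<n. cscale (sol q ?e l) (c l))"
      unfolding f(2) .
    have sum_in: "(\<Sum>l\<in>I. cscale (a l) (c l)) \<in> spc X \<times> spc X" if "I \<subseteq> {..<n}" for I a
      using that c by (intro cx.subspace_sum cx.subspace_scale X.Q.subUU) auto
    have "tc (\<Sum>l\<in>I. cscale (a l) (c l)) = (\<Sum>l\<in>I. cscale (a l) (tc (c l)))" if "finite I" "I \<subseteq> {..<n}" for I a
      using that
    proof (induction I)
      case empty
      then show ?case using Hom_more(1)[OF tHom X.Q.subU] by (simp add: zero_prod_def)
    next
      case (insert l I)
      then show ?case
        using tc_add[OF cx.subspace_scale[OF X.Q.subUU c] sum_in] tc_scale[OF c] by simp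
    qed
    then have "\<psi> (F_mor X Y (t, T) (frame X.Q.B \<phi> j q)) i = \<psi> (Y.Q.cl (g q) (\<Sum>l<n. cscale (sol q ?e l) (tc (c l)))) i"
      unfolding fr F_mor_cl[OF sum_in[OF order_refl]] by simp
    also have "\<dots> = (\<Sum>l<n. sol q ?e l * \<psi> (Y.Q.cl (g q) (tc (c l))) i)"
      by (rule Y.Q.triv_sum[OF trW elim(2)]) (use c tc_in in blast)
    finally show ?case ..
  qed
  ultimately show "hol_at (\<lambda>p. \<psi> (F_mor X Y (t, T) (frame X.Q.B \<phi> j p)) i) p"
    by (rule hol_at_transfer)
qed

lemma F_mor_mor: "F_mor X Y (t, T) \<in> bundle_mor (F_obj X) (F_obj Y)"
  using F_mor_over bundle_mor_iff[OF X.holo_bundle_F Y.holo_bundle_F] by blast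

lemma F_mor_intertwines: "intertwines X Y (F_mor X Y (t, T))"
  unfolding intertwines_def
proof
  fix x assume "x \<in> total (F_obj X)"
  then obtain p u where u: "u \<in> spc X \<times> spc X" "x = X.Q.cl (X.\<theta> p) u" unfolding X.total_F by blast
  show "F_mor X Y (t, T) (conjugation X x) = conjugation Y (F_mor X Y (t, T) x)"
    unfolding u(2) X.conjugation_cl F_mor_cl[OF u(1)] F_mor_cl[OF X.conj_UU[OF u(1)]] g(2)
      Y.conjugation_cl tc_cconj[OF u(1)] ..
qed

end

lemma aligned_exists:
  assumes "cocr_quat X" "cocr_quat Y" "(t, T) \<in> cocr_mor X Y" "\<sigma> \<in> qstr X"
  obtains \<sigma>' where "cocr_aligned X \<sigma> Y \<sigma>' t T"
proof -
  obtain \<sigma>' where s': "\<sigma>' \<in> qstr Y" "\<And>v. norm v = 1 \<Longrightarrow> T (\<sigma> (0, v)) = \<sigma>' (0, v)"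
    by (rule orient_isometryE[OF cocr_morD(2)[OF assms(3)] cocr_basic(3)[OF assms(1)] cocr_basic(3)[OF assms(2)] assms(4)])
      (rule that)
  have "cocr_aligned X \<sigma> Y \<sigma>' t T"
    by (intro cocr_aligned.intro cocr_pair.intro cocrs.intro cocr_aligned_axioms.intro assms s') simp_all
  then show ?thesis using that by blast
qed

theorem F_functor: "is_functor cocr_cat bundle_cat F_obj F_mor"
  unfolding is_functor_def cocr_cat_def bundle_cat_def
proof (simp del: split_paired_All, intro conjI allI impI ballI)
  fix X :: "('a, 'b) cocr" assume X: "cocr_quat X"
  obtain \<sigma> where s: "\<sigma> \<in> qstr X" using cocr_basic(6)[OF X] by blast
  interpret X: cocrs X \<sigma> using X s by unfold_locales
  show "holo_bundle (F_obj X)" by (rule X.holo_bundle_F)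
next
  fix X Y :: "('a, 'b) cocr" and f
  assume X: "cocr_quat X" and Y: "cocr_quat Y" and f: "f \<in> cocr_mor X Y"
  obtain t T where tT: "f = (t, T)" by (cases f)
  obtain \<sigma> where s: "\<sigma> \<in> qstr X" using cocr_basic(6)[OF X] by blast
  obtain \<sigma>' where "cocr_aligned X \<sigma> Y \<sigma>' t T" by (rule aligned_exists[OF X Y f[unfolded tT] s])
  then interpret cocr_aligned X \<sigma> Y \<sigma>' t T .
  show "F_mor X Y f \<in> bundle_mor (F_obj X) (F_obj Y)" unfolding tT by (rule F_mor_mor)
next
  fix X :: "('a, 'b) cocr" assume X: "cocr_quat X"
  obtain \<sigma> where s: "\<sigma> \<in> qstr X" using cocr_basic(6)[OF X] by blast
  have "cocr_aligned X \<sigma> X \<sigma> (id_map (spc X)) (restrict id (adm (qstr X)))"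
    by (intro cocr_aligned.intro cocr_pair.intro cocrs.intro cocr_aligned_axioms.intro X s cocr_mor_id)
      (use s in \<open>auto simp: adm_def\<close>)
  then interpret cocr_aligned X \<sigma> X \<sigma> "id_map (spc X)" "restrict id (adm (qstr X))" .
  show "F_mor X X (id_map (spc X), restrict id (adm (qstr X))) = restrict id (total (F_obj X))"
  proof
    fix x show "F_mor X X (id_map (spc X), restrict id (adm (qstr X))) x = restrict id (total (F_obj X)) x"
    proof (cases "x \<in> total (F_obj X)")
      case True
      then obtain p u where u: "u \<in> spc X \<times> spc X" "x = X.Q.cl (X.\<theta> p) u" unfolding X.total_F by blast
      have "tc u = u" using u(1) by (auto simp: id_map_def)
      then show ?thesis using True unfolding u(2) F_mor_cl[OF u(1)] g(2) by simp
    qed (simp add: F_mor_def)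
  qed
next
  fix X Y Z :: "('a, 'b) cocr" and f h
  assume X: "cocr_quat X" and Y: "cocr_quat Y" and Z: "cocr_quat Z" and f: "f \<in> cocr_mor X Y" and h: "h \<in> cocr_mor Y Z"
  obtain t T where tT: "f = (t, T)" by (cases f)
  obtain t' T' where tT': "h = (t', T')" by (cases h)
  obtain \<sigma> where s: "\<sigma> \<in> qstr X" using cocr_basic(6)[OF X] by blast
  obtain \<sigma>' where a: "cocr_aligned X \<sigma> Y \<sigma>' t T" by (rule aligned_exists[OF X Y f[unfolded tT] s])
  interpret XY: cocr_aligned X \<sigma> Y \<sigma>' t T by (rule a)
  obtain \<sigma>'' where b: "cocr_aligned Y \<sigma>' Z \<sigma>'' t' T'"
    by (rule aligned_exists[OF Y Z h[unfolded tT'] XY.Y.s])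
  interpret YZ: cocr_aligned Y \<sigma>' Z \<sigma>'' t' T' by (rule b)
  have mor: "(t' \<circ> t, compose (adm (qstr X)) T' T) \<in> cocr_mor X Z"
    by (rule cocr_mor_comp[OF X Y Z f[unfolded tT] h[unfolded tT']])
  have c: "cocr_aligned X \<sigma> Z \<sigma>'' (t' \<circ> t) (compose (adm (qstr X)) T' T)"
  proof (intro cocr_aligned.intro cocr_pair.intro cocrs.intro cocr_aligned_axioms.intro X Z s YZ.Y.s mor)
    fix v :: "real ^ 3" assume v: "norm v = 1"
    then have "\<sigma> (0, v) \<in> adm (qstr X)" using s unfolding adm_def by blast
    then show "compose (adm (qstr X)) T' T (\<sigma> (0, v)) = \<sigma>'' (0, v)"
      by (simp add: compose_eq XY.T[OF v] YZ.T[OF v])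
  qed
  interpret XZ: cocr_aligned X \<sigma> Z \<sigma>'' "t' \<circ> t" "compose (adm (qstr X)) T' T" by (rule c)
  show "F_mor X Z (fst h \<circ> fst f, compose (adm (qstr X)) (snd h) (snd f)) =
      compose (total (F_obj X)) (F_mor Y Z h) (F_mor X Y f)"
    unfolding tT tT' fst_conv snd_conv
  proof
    fix x show "F_mor X Z (t' \<circ> t, compose (adm (qstr X)) T' T) x =
        compose (total (F_obj X)) (F_mor Y Z (t', T')) (F_mor X Y (t, T)) x"
    proof (cases "x \<in> total (F_obj X)")
      case True
      then obtain p u where u: "u \<in> spc X \<times> spc X" "x = XY.X.Q.cl (XY.X.\<theta> p) u" unfolding XY.X.total_F by blast
      have "map_prod (t' \<circ> t) (t' \<circ> t) u = map_prod t' t' (map_prod t t u)" by (cases u) simp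
      then show ?thesis
        unfolding compose_eq[OF True] unfolding u(2) XZ.F_mor_cl[OF u(1)] XY.F_mor_cl[OF u(1)]
          YZ.F_mor_cl[OF XY.tc_in[OF u(1)]] XZ.g(2) XY.g(2) YZ.g(2) by simp
    qed (simp add: F_mor_def compose_def)
  qed
qed

section \<open>Fullness\<close>

lemma quat_components:
  assumes "f \<in> Hom E F" "qspace E \<sigma>" "qspace E' \<sigma>'" "f' \<in> Hom E' F'" "x \<in> E" "y \<in> E'"
    "f x = f' y" "f (\<sigma> qi x) = f' (\<sigma>' qi y)" "f (\<sigma> qj x) = f' (\<sigma>' qj y)" "f (\<sigma> qk x) = f' (\<sigma>' qk y)"
  shows "f (\<sigma> q x) = f' (\<sigma>' q y)"
proof -
  interpret E: qspace E \<sigma> by fact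
  interpret E': qspace E' \<sigma>' by fact
  obtain a b c d where q: "q = Q4 a b c d" using Q4_exhaust by blast
  have "f (\<sigma> q x) = a *\<^sub>R f x + b *\<^sub>R f (\<sigma> qi x) + c *\<^sub>R f (\<sigma> qj x) + d *\<^sub>R f (\<sigma> qk x)"
    unfolding q E.s_Q4[OF assms(5), of a]
    using E.sD(1) assms(5) subspace_add[OF E.sub] subspace_scale[OF E.sub]
    by (simp add: HomD(2,3)[OF assms(1)])
  moreover have "f' (\<sigma>' q y) = a *\<^sub>R f' y + b *\<^sub>R f' (\<sigma>' qi y) + c *\<^sub>R f' (\<sigma>' qj y) + d *\<^sub>R f' (\<sigma>' qk y)"
    unfolding q E'.s_Q4[OF assms(6), of a]
    using E'.sD(1) assms(6) subspace_add[OF E'.sub] subspace_scale[OF E'.sub]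
    by (simp add: HomD(2,3)[OF assms(4)])
  ultimately show ?thesis using assms(7-10) by simp
qed

context cocr_pair
begin

lemma section_hol:
  assumes m: "mor_over (F_obj X) (F_obj Y) g \<T>" and u: "u \<in> spc X \<times> spc X"
    and W: "(W, m, \<psi>) \<in> atlas (F_obj Y)" "g p \<in> W" "i < m"
  shows "hol_at (\<lambda>q. \<psi> (\<T> (X.Q.cl q u)) i) p"
proof -
  obtain V n \<phi> where V: "(V, n, \<phi>) \<in> atlas (F_obj X)" "p \<in> V"
    using holo_bundleD(2)[OF X.holo_bundle_F] by blast
  have tr: "local_triv (F_obj X) V n \<phi>" and trW: "local_triv (F_obj Y) W m \<psi>"
    using V(1) W(1) holo_bundleD(1)[OF X.holo_bundle_F] holo_bundleD(1)[OF Y.holo_bundle_F] by auto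
  have "hol_at (\<lambda>q. \<Sum>j<n. \<phi> (X.Q.cl q u) j * \<psi> (\<T> (frame (F_obj X) \<phi> j q)) i) p"
  proof (intro hol_at_sum hol_at_mult)
    fix j assume j: "j \<in> {..<n}"
    show "hol_at (\<lambda>q. \<phi> (X.Q.cl q u) j) p"
      using V[unfolded X.F_obj X.Q.atlas_iff] u j by blast
    show "hol_at (\<lambda>q. \<psi> (\<T> (frame (F_obj X) \<phi> j q)) i) p"
      using mor_overD(6)[OF m V(1) W(1) _ W(3) V(2) W(2)] j by simp
  qed
  moreover have "\<forall>\<^sub>F q in nhds p. (\<Sum>j<n. \<phi> (X.Q.cl q u) j * \<psi> (\<T> (frame (F_obj X) \<phi> j q)) i) =
      \<psi> (\<T> (X.Q.cl q u)) i"
  proof -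
    have "open (V \<inter> g -` W)"
      using local_trivD(1)[OF tr] local_trivD(1)[OF trW] cp1_holo_map_vimage mor_overD(2)[OF m]
      unfolding cp1_biholo_def by blast
    then have "\<forall>\<^sub>F q in nhds p. q \<in> V \<inter> g -` W" unfolding eventually_nhds using V(2) W(2) by blast
    then show ?thesis
    proof eventually_elim
      case (elim q)
      then have q: "q \<in> V" "g q \<in> W" by auto
      have x: "X.Q.cl q u \<in> fibre (F_obj X) q" unfolding X.F_obj X.Q.fibre_B by (rule imageI[OF u])
      have "\<psi> (\<T> (X.Q.cl q u)) i = (\<Sum>j<n. \<phi> (X.Q.cl q u) j * \<psi> (\<T> (frame (F_obj X) \<phi> j q)) i)"
        by (rule linear_in_frame[OF tr q(1) x, where L = "\<lambda>x. \<psi> (\<T> x)"])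
          (use mor_overD[OF m] local_trivD(4,6)[OF trW q(2)] in auto)
      then show ?case ..
    qed
  qed
  ultimately show ?thesis by (rule hol_at_transfer)
qed

end

text \<open>Here the representative of \<open>Y\<close> is already adjusted so that the base map is
  the identity in the Hopf parameters; \<open>full_setup_exists\<close> shows that this can be
  achieved.\<close>

locale full_setup = cocr_pair +
  fixes g \<T>
  assumes m: "mor_over (F_obj X) (F_obj Y) g \<T>" and it: "intertwines X Y \<T>"
    and aligned: "\<And>p. g (X.\<theta> p) = Y.\<theta> p"
begin

text \<open>The image of a constant section is a global holomorphic section of the target bundle,
  and \<open>constant_section\<close> finds a constant vector that represents it everywhere.\<close>

lemma lift_exists:
  assumes u: "u \<in> spc X \<times> spc X"
  shows "\<exists>v\<in>spc Y \<times> spc Y. \<forall>p. \<T> (X.Q.cl (X.\<theta> p) u) = Y.Q.cl (Y.\<theta> p) v"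
proof -
  have fib: "\<T> (X.Q.cl (X.\<theta> p) u) \<in> fibre Y.Q.B (Y.\<theta> p)" for p
    using mor_overD(3)[OF m, of "X.Q.cl (X.\<theta> p) u" "X.\<theta> p"] u aligned
    unfolding X.F_obj Y.F_obj X.Q.fibre_B by simp
  have "\<exists>v\<in>spc Y \<times> spc Y. \<forall>p. v \<in> snd (\<T> (X.Q.cl (X.\<theta> p) u))"
  proof -
    obtain D where D: "finite D" "spc Y \<times> spc Y \<subseteq> cx.span D" by (rule complexification_fin_dim[OF Y.fdU])
    show ?thesis
    proof (rule Y.P.constant_section[OF Y.Q.subUU D])
      have "w \<in> qspc Y \<times> qspc Y \<Longrightarrow> Y.A w \<in> spc Y \<times> spc Y" for w
        using Y.A(2)[of w] HomD(1)[OF Y.rho] by (auto simp: mem_Times_iff)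
      moreover have "Y.E.Jc w \<in> qspc Y \<times> qspc Y" if "w \<in> Y.E.W" for w
      proof -
        obtain x where x: "x \<in> qspc Y" "w = (x, \<sigma>' qi x)" using \<open>w \<in> Y.E.W\<close> unfolding Y.E.W_def by blast
        show ?thesis unfolding x(2) Y.E.Jc_W[OF x(1)] using Y.E.sD(1)[OF x(1)] subspace_neg[OF Y.E.sub] by simp
      qed
      ultimately show "Y.A ` Y.E.W \<subseteq> spc Y \<times> spc Y" "Y.A' ` Y.E.W \<subseteq> spc Y \<times> spc Y"
        unfolding Y.A'_def using Y.E.W_sub_E by blast+
    next
      fix q x y assume x: "x \<in> snd (\<T> (X.Q.cl (X.\<theta> q) u))"
      obtain v where v: "\<T> (X.Q.cl (X.\<theta> q) u) = Y.Q.cl (Y.\<theta> q) v"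
        using fib[of q] unfolding Y.Q.fibre_B by blast
      have "x - v \<in> ker_bundle Y (Y.\<theta> q)" using x unfolding v Y.Q.cl_def snd_conv Y.Q.coset_mem .
      then have "y - v \<in> ker_bundle Y (Y.\<theta> q) \<longleftrightarrow> y - x \<in> ker_bundle Y (Y.\<theta> q)"
        using cx.subspace_diff[OF Y.Q.S_subspace, of "y - v" _ "x - v"] cx.subspace_add[OF Y.Q.S_subspace, of "y - x" _ "x - v"]
        by auto
      then show "y \<in> snd (\<T> (X.Q.cl (X.\<theta> q) u)) \<longleftrightarrow> y - x \<in> Y.P.img q"
        unfolding v Y.Q.cl_def snd_conv Y.Q.coset_mem Y.ker_img .
    next
      fix p
      obtain W m \<psi> where W: "(W, m, \<psi>) \<in> atlas Y.Q.B" "Y.\<theta> p \<in> W"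
        using Y.Q.atlas_exists by blast
      obtain c sol where c: "\<And>i. i < m \<Longrightarrow> c i \<in> spc Y \<times> spc Y" and sol: "hol_solver (Y.\<theta> p) m sol"
        and ev: "\<forall>\<^sub>F q in nhds (Y.\<theta> p). q \<in> W \<and> (\<forall>x\<in>fibre Y.Q.B q. x = Y.Q.cl q (\<Sum>i<m. cscale (sol q (\<psi> x) i) (c i)))"
        by (rule Y.Q.local_lift[OF W]) (rule that)
      \<comment> \<open>The coordinates of the image section, moved to the base of \<open>Y\<close>
        along the inverse of \<open>g\<close>, where the solver of \<open>local_lift\<close>
        applies.\<close>
      define Z where "Z q = \<psi> (\<T> (X.Q.cl (inv g q) u))" for q
      have bg: "bij g" using mor_overD(2)[OF m] cp1_biholoD by blast
      have ig: "inv g (Y.\<theta> p) = X.\<theta> p" for p using bg aligned by (metis bij_inv_eq_iff)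
      have "hol_at (\<lambda>q. Z q j) (Y.\<theta> p)" if "j < m" for j
        unfolding Z_def
      proof (rule hmap_at_compose[of "inv g"])
        show "hmap_at (inv g) (Y.\<theta> p)" using cp1_biholoD(1)[OF cp1_biholo_inv[OF mor_overD(2)[OF m]]] .
        show "hol_at (\<lambda>q. \<psi> (\<T> (X.Q.cl q u)) j) (inv g (Y.\<theta> p))"
          unfolding ig using section_hol[OF m u] W that aligned unfolding Y.F_obj by simp
      qed
      then have "hol_at (\<lambda>q. sol q (Z q) i) (Y.\<theta> p)" if "i < m" for i
        using hol_solverD[OF sol _ that] by blast
      then have "hol_at (\<lambda>q. sol (Y.\<theta> q) (Z (Y.\<theta> q)) i) p" if "i < m" for i
        using hmap_at_compose[OF cp1_biholoD(1)[OF Y.\<theta>(1)]] that by blast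
      then have "vhol (\<lambda>q. \<Sum>i<m. cscale (sol (Y.\<theta> q) (Z (Y.\<theta> q)) i) (c i)) p"
        by (intro vhol_sum vhol_scale vhol_const) simp
      moreover have "\<forall>\<^sub>F q in nhds p. (\<Sum>i<m. cscale (sol (Y.\<theta> q) (Z (Y.\<theta> q)) i) (c i)) \<in> spc Y \<times> spc Y \<and>
          (\<Sum>i<m. cscale (sol (Y.\<theta> q) (Z (Y.\<theta> q)) i) (c i)) \<in> snd (\<T> (X.Q.cl (X.\<theta> q) u))"
      proof -
        have "\<forall>\<^sub>F q in nhds p. Y.\<theta> q \<in> W \<and> (\<forall>x\<in>fibre Y.Q.B (Y.\<theta> q). x = Y.Q.cl (Y.\<theta> q) (\<Sum>i<m. cscale (sol (Y.\<theta> q) (\<psi> x) i) (c i)))"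
          using hmap_at_tendsto[OF cp1_biholoD(1)[OF Y.\<theta>(1)]] ev unfolding filterlim_iff by blast
        then show ?thesis
        proof eventually_elim
          case (elim q)
          have "\<T> (X.Q.cl (X.\<theta> q) u) = Y.Q.cl (Y.\<theta> q) (\<Sum>i<m. cscale (sol (Y.\<theta> q) (\<psi> (\<T> (X.Q.cl (X.\<theta> q) u))) i) (c i))"
            using elim fib by blast
          then have "snd (\<T> (X.Q.cl (X.\<theta> q) u)) = snd (Y.Q.cl (Y.\<theta> q) (\<Sum>i<m. cscale (sol (Y.\<theta> q) (\<psi> (\<T> (X.Q.cl (X.\<theta> q) u))) i) (c i)))"
            by (rule arg_cong)
          then have "(\<Sum>i<m. cscale (sol (Y.\<theta> q) (\<psi> (\<T> (X.Q.cl (X.\<theta> q) u))) i) (c i)) \<in> snd (\<T> (X.Q.cl (X.\<theta> q) u))"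
            unfolding Y.Q.cl_def snd_conv by (simp only: Y.Q.coset_self)
          moreover have "(\<Sum>i<m. cscale (sol (Y.\<theta> q) (Z (Y.\<theta> q)) i) (c i)) \<in> spc Y \<times> spc Y"
            using c by (intro cx.subspace_sum cx.subspace_scale Y.Q.subUU) auto
          ultimately show ?case unfolding Z_def ig by blast
        qed
      qed
      ultimately show "\<exists>u'. vhol u' p \<and> (\<forall>\<^sub>F q in nhds p. u' q \<in> spc Y \<times> spc Y \<and> u' q \<in> snd (\<T> (X.Q.cl (X.\<theta> q) u)))"
        by blast
    qed
  qed
  then obtain v where v: "v \<in> spc Y \<times> spc Y" "\<And>p. v \<in> snd (\<T> (X.Q.cl (X.\<theta> p) u))" by blast
  have "\<T> (X.Q.cl (X.\<theta> p) u) = Y.Q.cl (Y.\<theta> p) v" for p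
  proof -
    obtain v' where v': "\<T> (X.Q.cl (X.\<theta> p) u) = Y.Q.cl (Y.\<theta> p) v'"
      using fib[of p] unfolding Y.Q.fibre_B by blast
    have "v - v' \<in> ker_bundle Y (Y.\<theta> p)"
      using v(2)[of p] unfolding v' Y.Q.cl_def snd_conv Y.Q.coset_mem .
    then have "v' - v \<in> ker_bundle Y (Y.\<theta> p)"
      using cx.subspace_neg[OF Y.Q.S_subspace] by (metis minus_diff_eq)
    then show ?thesis unfolding v' Y.Q.cl_eq by simp
  qed
  then show ?thesis using v(1) by blast
qed

definition L :: "'a \<times> 'a \<Rightarrow> 'a \<times> 'a" where
  "L u = (SOME v. v \<in> spc Y \<times> spc Y \<and> (\<forall>p. \<T> (X.Q.cl (X.\<theta> p) u) = Y.Q.cl (Y.\<theta> p) v))"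

lemma L:
  assumes "u \<in> spc X \<times> spc X"
  shows "L u \<in> spc Y \<times> spc Y" "\<T> (X.Q.cl (X.\<theta> p) u) = Y.Q.cl (Y.\<theta> p) (L u)"
proof -
  have "\<exists>v. v \<in> spc Y \<times> spc Y \<and> (\<forall>p. \<T> (X.Q.cl (X.\<theta> p) u) = Y.Q.cl (Y.\<theta> p) v)"
    using lift_exists[OF assms] by blast
  then have "L u \<in> spc Y \<times> spc Y \<and> (\<forall>p. \<T> (X.Q.cl (X.\<theta> p) u) = Y.Q.cl (Y.\<theta> p) (L u))"
    unfolding L_def by (rule someI_ex)
  then show "L u \<in> spc Y \<times> spc Y" "\<T> (X.Q.cl (X.\<theta> p) u) = Y.Q.cl (Y.\<theta> p) (L u)" by auto
qed

text \<open>The difference of the two vectors lies in every fibre of the kernel bundle. The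
  resulting uniqueness of lifts lets the algebraic properties of \<open>L\<close> be inherited from
  \<open>\<T>\<close>.\<close>

lemma cl_Y_inj: "(\<And>p. Y.Q.cl (Y.\<theta> p) v = Y.Q.cl (Y.\<theta> p) w) \<Longrightarrow> v = w"
  using Y.img_Inter_zero[of "v - w"] unfolding Y.Q.cl_eq by simp

lemma L_eqI: "u \<in> spc X \<times> spc X \<Longrightarrow> (\<And>p. \<T> (X.Q.cl (X.\<theta> p) u) = Y.Q.cl (Y.\<theta> p) v) \<Longrightarrow> L u = v"
  using L(2) by (intro cl_Y_inj) simp

lemma cl_X_fibre: "u \<in> spc X \<times> spc X \<Longrightarrow> X.Q.cl p u \<in> fibre (F_obj X) p"
  unfolding X.F_obj X.Q.fibre_B by (rule imageI)

lemma L_add: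
  assumes "u \<in> spc X \<times> spc X" "v \<in> spc X \<times> spc X"
  shows "L (u + v) = L u + L v"
proof (rule L_eqI[OF cx.subspace_add[OF X.Q.subUU assms]])
  fix p
  show "\<T> (X.Q.cl (X.\<theta> p) (u + v)) = Y.Q.cl (Y.\<theta> p) (L u + L v)"
    using mor_overD(4)[OF m cl_X_fibre[OF assms(1)] cl_X_fibre[OF assms(2)], of "X.\<theta> p"]
    unfolding X.F_obj Y.F_obj X.Q.vadd_cl L(2)[OF assms(1)] L(2)[OF assms(2)] Y.Q.vadd_cl .
qed

lemma L_scale:
  assumes "u \<in> spc X \<times> spc X"
  shows "L (cscale c u) = cscale c (L u)"
proof (rule L_eqI[OF cx.subspace_scale[OF X.Q.subUU assms]])
  fix p
  show "\<T> (X.Q.cl (X.\<theta> p) (cscale c u)) = Y.Q.cl (Y.\<theta> p) (cscale c (L u))"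
    using mor_overD(5)[OF m cl_X_fibre[OF assms], where p = "X.\<theta> p" and c = c]
    unfolding X.F_obj Y.F_obj X.Q.vscale_cl L(2)[OF assms] Y.Q.vscale_cl .
qed

lemma antip_antip: "antip (antip p) = p"
proof -
  obtain a b where ab: "(a, b) \<noteq> (0, 0)" "p = pt a b" by (rule pt_exhaust)
  then have "(- cnj b, cnj a) \<noteq> (0, 0)" by auto
  then show ?thesis unfolding ab(2) using ab(1) by (auto simp: antip_pt pt_eq_iff)
qed

lemma L_cconj:
  assumes "u \<in> spc X \<times> spc X"
  shows "L (cconj u) = cconj (L u)"
proof (rule L_eqI[OF X.conj_UU[OF assms]])
  fix p
  have tot: "X.Q.cl (X.\<theta> (antip p)) u \<in> total (F_obj X)"
    unfolding X.total_F using assms by blast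
  have "\<T> (X.Q.cl (X.\<theta> p) (cconj u)) = \<T> (conjugation X (X.Q.cl (X.\<theta> (antip p)) u))"
    unfolding X.conjugation_cl antip_antip ..
  also have "\<dots> = conjugation Y (Y.Q.cl (Y.\<theta> (antip p)) (L u))"
    using it tot unfolding intertwines_def L(2)[OF assms, symmetric] by blast
  finally show "\<T> (X.Q.cl (X.\<theta> p) (cconj u)) = Y.Q.cl (Y.\<theta> p) (cconj (L u))"
    unfolding Y.conjugation_cl antip_antip .
qed

definition t :: "'a \<Rightarrow> 'a" where
  "t x = (if x \<in> spc X then fst (L (x, 0)) else 0)"

text \<open>Commuting with conjugation, \<open>L\<close> preserves real vectors, so it is the
  complexification of its restriction to them.\<close>

lemma L_t:
  assumes "u \<in> spc X \<times> spc X"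
  shows "L u = map_prod t t u"
proof -
  have 0: "0 \<in> spc X" using subspace_0[OF X.Q.subU] .
  have real: "L (x, 0) = (t x, 0)" if "x \<in> spc X" for x
  proof -
    have "L (cconj (x, 0)) = cconj (L (x, 0))" using that 0 by (intro L_cconj) simp
    then have "snd (L (x, 0)) = - snd (L (x, 0))" by (simp add: cconj_def prod_eq_iff)
    then have "snd (L (x, 0)) = 0" by (metis scaleR_2 scaleR_eq_0_iff add_eq_0_iff2 zero_neq_numeral)
    then show ?thesis using that by (simp add: t_def prod_eq_iff)
  qed
  obtain x y where xy: "u = (x, y)" "x \<in> spc X" "y \<in> spc X" using assms by (cases u) auto
  have "u = (x, 0) + cscale \<i> (y, 0)" unfolding xy(1) by (simp add: cscale_def)
  then have "L u = L (x, 0) + cscale \<i> (L (y, 0))"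
    using L_add[of "(x, 0)" "cscale \<i> (y, 0)"] L_scale[of "(y, 0)" \<i>] xy 0 cx.subspace_scale[OF X.Q.subUU, of "(y, 0)" \<i>]
    by simp
  then show ?thesis unfolding real[OF xy(2)] real[OF xy(3)] xy(1) by (simp add: cscale_def)
qed

lemma t_Hom: "t \<in> Hom (spc X) (spc Y)"
proof (rule HomI)
  have 0: "0 \<in> spc X" using subspace_0[OF X.Q.subU] .
  show "t x \<in> spc Y" if "x \<in> spc X" for x
    using L(1)[of "(x, 0)"] that 0 by (auto simp: t_def mem_Times_iff)
  show "t (x + y) = t x + t y" if "x \<in> spc X" "y \<in> spc X" for x y
    using L_add[of "(x, 0)" "(y, 0)"] that 0 subspace_add[OF X.Q.subU that] by (simp add: t_def)
  show "t (r *\<^sub>R x) = r *\<^sub>R t x" if "x \<in> spc X" for r x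
    using L_scale[of "(x, 0)" "complex_of_real r"] that 0 subspace_scale[OF X.Q.subU that] by (simp add: t_def cscale_def)
qed (simp add: t_def)

lemma L_ker: "s \<in> ker_bundle X (X.\<theta> p) \<Longrightarrow> L s \<in> ker_bundle Y (Y.\<theta> p)"
proof -
  assume s: "s \<in> ker_bundle X (X.\<theta> p)"
  have s_in: "s \<in> spc X \<times> spc X" using X.Q.S_sub s by blast
  have z_in: "0 \<in> spc X \<times> spc X" by (rule cx.subspace_0[OF X.Q.subUU])
  have "X.Q.cl (X.\<theta> p) s = X.Q.cl (X.\<theta> p) 0" unfolding X.Q.cl_eq using s by simp
  then have "Y.Q.cl (Y.\<theta> p) (L s) = Y.Q.cl (Y.\<theta> p) (L 0)" using L(2)[OF s_in] L(2)[OF z_in] by metis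
  moreover have "L 0 = 0" using L_scale[OF z_in, of 0] by simp
  ultimately show ?thesis unfolding Y.Q.cl_eq by simp
qed

text \<open>The vector \<open>y\<close> is the real part of the \<open>w'\<close> with
  \<open>L (A w) = A w'\<close>, which exists since \<open>L\<close> maps the image at
  \<open>[1 : 0]\<close> into the image there. The point is that the same \<open>w'\<close> also
  serves for \<open>A'\<close>; together the two equations give the claim for 1, \<open>i\<close>,
  \<open>j\<close> and \<open>k\<close>.\<close>

lemma quat_lift:
  assumes x: "x \<in> qspc X"
  shows "\<exists>y\<in>qspc Y. \<forall>q. rho Y (\<sigma>' q y) = t (rho X (\<sigma> q x))"
proof -
  define w where "w = (x, \<sigma> qi x)"
  have w: "w \<in> X.E.W" unfolding w_def by (rule X.E.WI[OF x])
  have A_in: "X.A v \<in> spc X \<times> spc X" if "v \<in> qspc X \<times> qspc X" for v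
    using X.A(2)[OF that] that HomD(1)[OF X.rho] by (auto simp: mem_Times_iff)
  have w_in: "w \<in> qspc X \<times> qspc X" "X.E.Jc w \<in> qspc X \<times> qspc X"
    using w X.E.W_sub_E X.E.sD(1)[OF x] subspace_neg[OF X.E.sub] X.E.Jc_W[OF x] unfolding w_def by auto
  have Aw: "X.A w \<in> spc X \<times> spc X" "X.A' w \<in> spc X \<times> spc X"
    unfolding X.A'_def by (rule A_in[OF w_in(1)], rule A_in[OF w_in(2)])
  have img: "cscale a (L (X.A w)) + cscale b (L (X.A' w)) \<in> Y.P.img (pt a b)" if "(a, b) \<noteq> (0, 0)" for a b
  proof -
    have "cscale a (X.A w) + cscale b (X.A' w) \<in> ker_bundle X (X.\<theta> (pt a b))"
      unfolding X.ker_img by (rule X.P.img_ptI[OF w that])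
    then have "L (cscale a (X.A w) + cscale b (X.A' w)) \<in> Y.P.img (pt a b)"
      using L_ker unfolding Y.ker_img by blast
    then show ?thesis using Aw by (simp add: L_add L_scale cx.subspace_scale[OF X.Q.subUU])
  qed
  obtain w' where w': "w' \<in> Y.E.W" "L (X.A w) = Y.A w'"
  proof -
    have "L (X.A w) \<in> Y.P.img (pt 1 0)" using img[of 1 0] by simp
    moreover have "Y.P.img (pt 1 0) = {Y.A w |w. w \<in> Y.E.W}" using Y.P.img_pt[of 1 0] by simp
    ultimately show ?thesis using that by blast
  qed
  \<comment> \<open>For \<open>b \<noteq> 0\<close> the difference of two elements of the image at
    \<open>[a : b]\<close> is \<open>b z\<close>. So \<open>z\<close> lies in the image at every
    point but one, by closedness at that one too, and is zero by \<open>img_Inter\<close>.\<close>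
  define z where "z = L (X.A' w) - Y.A' w'"
  have z1: "z \<in> Y.P.img (pt a b)" if "b \<noteq> 0" for a b
  proof -
    have ab: "(a, b) \<noteq> (0, 0)" using that by simp
    have "cscale a (L (X.A w)) + cscale b (L (X.A' w)) - (cscale a (Y.A w') + cscale b (Y.A' w')) \<in> Y.P.img (pt a b)"
      by (intro cx.subspace_diff Y.P.img_subspace img Y.P.img_ptI w' ab)
    then have "cscale b z \<in> Y.P.img (pt a b)" unfolding w'(2) z_def by (simp add: cx.scale_right_diff_distrib)
    from cx.subspace_scale[OF Y.P.img_subspace this, of "1 / b"] show ?thesis using that by simp
  qed
  have "z \<in> Y.P.img q" for q
  proof (cases rule: aff1_cases[of q])
    case (1 u)
    then show ?thesis using z1[of 1 u] by (simp add: aff_pt)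
  next
    case 2
    have "z \<in> Y.P.img q'" if "q' \<noteq> q" for q'
    proof (cases rule: aff1_cases[of q'])
      case (1 u)
      then show ?thesis using z1[of 1 u] by (simp add: aff_pt)
    qed (use that 2 in simp)
    then show ?thesis by (intro Y.P.img_closed[OF vhol_const] always_eventually) blast
  qed
  then have "z = 0" by (rule Y.P.img_Inter)
  then have L': "L (X.A' w) = Y.A' w'" unfolding z_def by simp
  obtain y where y: "y \<in> qspc Y" "w' = (y, \<sigma>' qi y)" using w'(1) unfolding Y.E.W_def by blast
  have y_in: "w' \<in> qspc Y \<times> qspc Y" "Y.E.Jc w' \<in> qspc Y \<times> qspc Y"
    using w'(1) Y.E.W_sub_E Y.E.sD(1)[OF y(1)] subspace_neg[OF Y.E.sub] Y.E.Jc_W[OF y(1)] unfolding y(2) by auto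
  have e1: "t (rho X x) = rho Y y" "t (rho X (\<sigma> qi x)) = rho Y (\<sigma>' qi y)"
    using w'(2) unfolding L_t[OF Aw(1)] unfolding X.A(2)[OF w_in(1)] Y.A(2)[OF y_in(1)] unfolding w_def y(2) by simp_all
  have e2: "t (rho X (\<sigma> qj x)) = rho Y (\<sigma>' qj y)" "t (rho X (- \<sigma> qk x)) = rho Y (- \<sigma>' qk y)"
    using L' unfolding L_t[OF Aw(2)] unfolding X.A'_def Y.A'_def X.A(2)[OF w_in(2)] Y.A(2)[OF y_in(2)]
    unfolding w_def y(2) X.E.Jc_W[OF x] Y.E.Jc_W[OF y(1)] by simp_all
  have tr: "t \<circ> rho X \<in> Hom (qspc X) (spc Y)" by (rule Hom_comp[OF X.rho t_Hom X.Q.subU])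
  have e3: "t (rho X (\<sigma> qk x)) = rho Y (\<sigma>' qk y)"
    using e2(2) Hom_more(2)[OF tr X.E.sub X.E.sD(1)[OF x]] Hom_more(2)[OF Y.rho Y.E.sub Y.E.sD(1)[OF y(1)]] by simp
  have "(t \<circ> rho X) (\<sigma> q x) = rho Y (\<sigma>' q y)" for q
    by (rule quat_components[OF tr X.E.qspace_axioms Y.E.qspace_axioms Y.rho x y(1)])
      (use e1 e2 e3 in simp_all)
  then show ?thesis using y(1) by (intro bexI[of _ y]) auto
qed

text \<open>A vector whose quaternionic multiples are all killed by \<open>\<rho>\<close> is zero by
  the kernel condition. Hence the choice in \<open>f\<close> below is forced, and \<open>f\<close>
  is linear and equivariant.\<close>

lemma quat_lift_unique:
  assumes "y \<in> qspc Y" "z \<in> qspc Y" "\<And>q. rho Y (\<sigma>' q y) = rho Y (\<sigma>' q z)"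
  shows "y = z"
proof -
  have d: "y - z \<in> qspc Y" using subspace_diff[OF Y.E.sub assms(1,2)] .
  have "rho Y (\<sigma>' q (y - z)) = 0" for q
    using assms Y.E.sD(1)[of y q] Y.E.sD(1)[of z q] by (simp add: Y.E.sD(7) Hom_more(3)[OF Y.rho Y.E.sub])
  from this[of "(1, 0)"] this[of "(0, sphp (aff0 0))"]
  have "rho Y (y - z) = 0" "rho Y (Y.E.std (aff0 0) (y - z)) = 0"
    using Y.E.s_one[OF d] by (simp_all add: Y.E.std_def)
  then have "y - z = 0" using kernel_condition[OF Y.X Y.std_adm d] by blast
  then show ?thesis by simp
qed

definition f :: "'b \<Rightarrow> 'b" where
  "f x = (if x \<in> qspc X then (SOME y. y \<in> qspc Y \<and> (\<forall>q. rho Y (\<sigma>' q y) = t (rho X (\<sigma> q x)))) else 0)"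

lemma f:
  assumes "x \<in> qspc X"
  shows "f x \<in> qspc Y" "rho Y (\<sigma>' q (f x)) = t (rho X (\<sigma> q x))"
proof -
  have "\<exists>y. y \<in> qspc Y \<and> (\<forall>q. rho Y (\<sigma>' q y) = t (rho X (\<sigma> q x)))" using quat_lift[OF assms] by blast
  then have "f x \<in> qspc Y \<and> (\<forall>q. rho Y (\<sigma>' q (f x)) = t (rho X (\<sigma> q x)))"
    unfolding f_def using assms by (simp del: split_paired_All) (rule someI_ex)
  then show "f x \<in> qspc Y" "rho Y (\<sigma>' q (f x)) = t (rho X (\<sigma> q x))" by blast+
qed

lemma f_Hom: "f \<in> Hom (qspc X) (qspc Y)"
proof (rule HomI)
  have tr: "t \<circ> rho X \<in> Hom (qspc X) (spc Y)" by (rule Hom_comp[OF X.rho t_Hom X.Q.subU])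
  show "f x \<in> qspc Y" if "x \<in> qspc X" for x using f(1)[OF that] .
  show "f (x + y) = f x + f y" if "x \<in> qspc X" "y \<in> qspc X" for x y
  proof (rule quat_lift_unique)
    have xy: "x + y \<in> qspc X" using subspace_add[OF X.E.sub that] .
    show "f (x + y) \<in> qspc Y" "f x + f y \<in> qspc Y" using f(1) that xy subspace_add[OF Y.E.sub] by auto
    fix q
    have "rho Y (\<sigma>' q (f (x + y))) = (t \<circ> rho X) (\<sigma> q x + \<sigma> q y)"
      using f(2)[OF xy, of q] X.E.sD(2)[OF that] by simp
    also have "\<dots> = rho Y (\<sigma>' q (f x)) + rho Y (\<sigma>' q (f y))"
      using HomD(2)[OF tr X.E.sD(1)[OF that(1)] X.E.sD(1)[OF that(2)]] f(2) that by simp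
    also have "\<dots> = rho Y (\<sigma>' q (f x + f y))"
      using f(1) that Y.E.sD(1) by (simp add: Y.E.sD(2) HomD(2)[OF Y.rho])
    finally show "rho Y (\<sigma>' q (f (x + y))) = rho Y (\<sigma>' q (f x + f y))" .
  qed
  show "f (r *\<^sub>R x) = r *\<^sub>R f x" if "x \<in> qspc X" for r x
  proof (rule quat_lift_unique)
    have rx: "r *\<^sub>R x \<in> qspc X" using subspace_scale[OF X.E.sub that] .
    show "f (r *\<^sub>R x) \<in> qspc Y" "r *\<^sub>R f x \<in> qspc Y" using f(1) that rx subspace_scale[OF Y.E.sub] by auto
    fix q
    have "rho Y (\<sigma>' q (f (r *\<^sub>R x))) = (t \<circ> rho X) (r *\<^sub>R \<sigma> q x)"
      using f(2)[OF rx, of q] X.E.sD(3)[OF that] by simp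
    also have "\<dots> = r *\<^sub>R rho Y (\<sigma>' q (f x))"
      using HomD(3)[OF tr X.E.sD(1)[OF that]] f(2) that by simp
    also have "\<dots> = rho Y (\<sigma>' q (r *\<^sub>R f x))"
      using f(1) that Y.E.sD(1) by (simp add: Y.E.sD(3) HomD(3)[OF Y.rho])
    finally show "rho Y (\<sigma>' q (f (r *\<^sub>R x))) = rho Y (\<sigma>' q (r *\<^sub>R f x))" .
  qed
qed (simp add: f_def)

lemma f_quat: "x \<in> qspc X \<Longrightarrow> f (\<sigma> p x) = \<sigma>' p (f x)"
  using f X.E.sD(1) Y.E.sD(1) by (intro quat_lift_unique) (auto simp: X.E.s_mult Y.E.s_mult)

definition T :: "('b \<Rightarrow> 'b) \<Rightarrow> 'b \<Rightarrow> 'b" where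
  "T = restrict (\<lambda>J. cstr Y (g (ident X J))) (adm (qstr X))"

lemma T_std: "T (X.E.std p) = Y.E.std p"
  unfolding T_def using X.std_adm by (simp add: X.\<theta>(3) aligned Y.\<theta>(2))

lemma mor_tT: "(t, T) \<in> cocr_mor X Y"
proof -
  have T_adm: "T \<in> adm (qstr X) \<rightarrow>\<^sub>E adm (qstr Y)"
  proof
    fix J assume "J \<in> adm (qstr X)"
    then obtain p where "J = X.E.std p" using X.adm_std by blast
    then show "T J \<in> adm (qstr Y)" using T_std Y.std_adm by simp
  qed (simp add: T_def)
  have "T (\<sigma> (0, v)) = \<sigma>' (0, v)" if v: "norm v = 1" for v
  proof -
    obtain p where "sphp p = v" using sphp_surj[OF v] by blast
    then show ?thesis using T_std[of p] unfolding X.E.std_def Y.E.std_def by simp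
  qed
  then have "orient_isometry (qstr X) (qstr Y) T"
    by (rule orient_isometryI[OF T_adm X.s Y.s])
  moreover have "quat_linear (qspc X) (qstr X) (qspc Y) T f"
    unfolding quat_linear_def
  proof (intro conjI ballI f_Hom)
    fix J assume "J \<in> adm (qstr X)"
    then obtain p where p: "J = X.E.std p" using X.adm_std by blast
    show "f \<circ> J = T J \<circ> f"
      unfolding p T_std
    proof
      fix x show "(f \<circ> X.E.std p) x = (Y.E.std p \<circ> f) x"
      proof (cases "x \<in> qspc X")
        case True
        then show ?thesis unfolding X.E.std_def Y.E.std_def by (simp add: f_quat)
      next
        case False
        then show ?thesis
          unfolding X.E.std_def Y.E.std_def
          by (simp add: X.E.sD(4) Y.E.sD(5) Hom_more(1)[OF f_Hom X.E.sub] HomD(4)[OF f_Hom])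
      qed
    qed
  qed
  moreover have "rho Y \<circ> f = t \<circ> rho X"
  proof
    fix x show "(rho Y \<circ> f) x = (t \<circ> rho X) x"
    proof (cases "x \<in> qspc X")
      case True
      then show ?thesis using f(2)[OF True, of "(1, 0)"] f(1)[OF True] by (simp add: X.E.s_one Y.E.s_one)
    next
      case False
      then show ?thesis
        by (simp add: HomD(4)[OF f_Hom] HomD(4)[OF X.rho] Hom_more(1)[OF Y.rho Y.E.sub] Hom_more(1)[OF t_Hom X.Q.subU])
    qed
  qed
  ultimately show ?thesis unfolding cocr_mor_def using t_Hom by blast
qed

lemma F_mor_tT: "F_mor X Y (t, T) = \<T>"
proof -
  have "cocr_aligned X \<sigma> Y \<sigma>' t T"
  proof (intro cocr_aligned.intro cocr_pair_axioms cocr_aligned_axioms.intro mor_tT)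
    fix v :: "real ^ 3" assume "norm v = 1"
    then obtain p where "sphp p = v" using sphp_surj by blast
    then show "T (\<sigma> (0, v)) = \<sigma>' (0, v)" using T_std[of p] unfolding X.E.std_def Y.E.std_def by simp
  qed
  then interpret al: cocr_aligned X \<sigma> Y \<sigma>' t T .
  show ?thesis
  proof
    fix x show "F_mor X Y (t, T) x = \<T> x"
    proof (cases "x \<in> total (F_obj X)")
      case True
      then obtain p u where u: "u \<in> spc X \<times> spc X" "x = X.Q.cl (X.\<theta> p) u" unfolding X.total_F by blast
      show ?thesis unfolding u(2) al.F_mor_cl[OF u(1)] L(2)[OF u(1)] L_t[OF u(1)] al.g(2) ..
    next
      case False
      then show ?thesis using PiE_arb[OF mor_overD(1)[OF m] False] by (simp add: F_mor_def)
    qed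
  qed
qed

end

section \<open>Adjusting the representative of the target to the base map\<close>

lemma (in cocr_pair) base_antipode:
  assumes m: "mor_over (F_obj X) (F_obj Y) g \<T>" and it: "intertwines X Y \<T>"
    and q: "g (X.\<theta> p) = Y.\<theta> q"
  shows "g (X.\<theta> (antip p)) = Y.\<theta> (antip q)"
proof -
  have 0: "0 \<in> spc X \<times> spc X" by (rule cx.subspace_0[OF X.Q.subUU])
  let ?x = "X.Q.cl (X.\<theta> p) 0" and ?x' = "X.Q.cl (X.\<theta> (antip p)) (cconj 0)"
  have x: "?x \<in> fibre (F_obj X) (X.\<theta> p)" "?x' \<in> fibre (F_obj X) (X.\<theta> (antip p))"
    unfolding X.F_obj X.Q.fibre_B by (rule imageI[OF 0], rule imageI[OF X.conj_UU[OF 0]])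
  obtain v where v: "\<T> ?x = Y.Q.cl (Y.\<theta> q) v"
    using mor_overD(3)[OF m x(1)] unfolding q Y.F_obj Y.Q.fibre_B by blast
  obtain v' where v': "\<T> ?x' = Y.Q.cl (g (X.\<theta> (antip p))) v'"
    using mor_overD(3)[OF m x(2)] unfolding Y.F_obj Y.Q.fibre_B by blast
  have "\<T> (conjugation X ?x) = conjugation Y (\<T> ?x)"
    using bspec[OF it[unfolded intertwines_def] conjunct1[OF fibre_total[OF x(1)]]] .
  then have "Y.Q.cl (g (X.\<theta> (antip p))) v' = Y.Q.cl (Y.\<theta> (antip q)) (cconj v)"
    unfolding X.conjugation_cl v v' Y.conjugation_cl .
  then show ?thesis unfolding Y.Q.cl_eq by blast
qed

text \<open>The representative of \<open>Y\<close> is corrected twice. The first rotation makes the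
  base map fix \<open>[1 : 0]\<close>; it then also commutes with the antipodal map and so
  multiplies the affine coordinate by a unit number, which the second rotation, about the axis of
  that point, removes.\<close>

lemma full_setup_exists:
  fixes X Y :: "('u::real_vector, 'e::real_vector) cocr"
  assumes X: "cocr_quat X" and Y: "cocr_quat Y" and s: "\<sigma> \<in> qstr X"
    and m: "mor_over (F_obj X) (F_obj Y) g \<T>" and it: "intertwines X Y \<T>"
  obtains \<sigma>' where "full_setup X \<sigma> Y \<sigma>' g \<T>"
proof -
  obtain \<sigma>0 where s0: "\<sigma>0 \<in> qstr Y" using cocr_basic(6)[OF Y] by blast
  interpret X: cocrs X \<sigma> using X s by unfold_locales
  interpret Y0: cocrs Y \<sigma>0 using Y s0 by unfold_locales
  obtain q0 where q0: "g (X.\<theta> (aff0 0)) = Y0.\<theta> q0" using Y0.\<theta>_surj[of "g (X.\<theta> (aff0 0))"] by (elim exE)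
  obtain R :: "real ^ 3 ^ 3" where R: "rotation_matrix R" "R *v axis 1 1 = sphp q0"
    by (rule rotation_to_vector[OF norm_sphp])
  define \<sigma>1 where "\<sigma>1 = \<sigma>0 \<circ> so3_act R"
  have s1: "\<sigma>1 \<in> qstr Y" unfolding Y0.Qrep \<sigma>1_def using R(1) by blast
  interpret Y1: cocrs Y \<sigma>1 using Y s1 by unfold_locales
  have "\<sigma>1 (0, axis 1 1) = \<sigma>0 (0, sphp q0)"
    by (simp add: \<sigma>1_def so3_act_def R(2))
  then have "Y1.E.std (aff0 0) = Y0.E.std q0"
    unfolding Y1.E.std_def Y0.E.std_def sphp_aff0 .
  then have Y1_0: "Y1.\<theta> (aff0 0) = g (X.\<theta> (aff0 0))"
    unfolding q0 Y1.\<theta>(3)[symmetric] Y0.\<theta>(3)[symmetric] by simp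
  interpret XY1: cocr_pair X \<sigma> Y \<sigma>1 by unfold_locales
  define h where "h = inv Y1.\<theta> \<circ> (g \<circ> X.\<theta>)"
  have h: "cp1_biholo h"
    unfolding h_def by (intro cp1_biholo_compose cp1_biholo_inv X.\<theta> Y1.\<theta> mor_overD(2)[OF m])
  have hY: "Y1.\<theta> (h p) = g (X.\<theta> p)" for p
    unfolding h_def using Y1.bij_\<theta> by (simp add: bij_is_surj surj_f_inv_f)
  have h0: "h (aff0 0) = aff0 0"
    using hY[of "aff0 0"] Y1_0 Y1.\<theta>_inj by metis
  have ha: "h (antip p) = antip (h p)" for p
    using XY1.base_antipode[OF m it hY[symmetric, of p]] hY[of "antip p"] Y1.\<theta>_inj by metis
  obtain c where c: "cmod c = 1" "\<And>a b. (a, b) \<noteq> (0, 0) \<Longrightarrow> h (pt a b) = pt a (c * b)"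
    by (rule antip_commuting_automorphism[OF h h0 ha]) (rule that)
  obtain S :: "real ^ 3 ^ 3" where S: "rotation_matrix S"
    "\<And>a b. (a, b) \<noteq> (0, 0) \<Longrightarrow> sphp (pt a (c * b)) = S *v sphp (pt a b)"
    by (rule rotation_about_axis[OF c(1)]) (rule that)
  define \<sigma>2 where "\<sigma>2 = \<sigma>1 \<circ> so3_act S"
  have s2: "\<sigma>2 \<in> qstr Y" unfolding Y1.Qrep \<sigma>2_def using S(1) by blast
  interpret Y2: cocrs Y \<sigma>2 using Y s2 by unfold_locales
  have "Y2.\<theta> p = g (X.\<theta> p)" for p
  proof -
    obtain a b where ab: "(a, b) \<noteq> (0, 0)" "p = pt a b" by (rule pt_exhaust)
    have "\<sigma>2 (0, sphp p) = \<sigma>1 (0, sphp (h p))"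
      unfolding ab(2) c(2)[OF ab(1)] S(2)[OF ab(1)] by (simp add: \<sigma>2_def so3_act_def)
    then have "Y2.E.std p = Y1.E.std (h p)" unfolding Y2.E.std_def Y1.E.std_def .
    then have "Y2.\<theta> p = Y1.\<theta> (h p)" unfolding Y2.\<theta>(3)[symmetric] Y1.\<theta>(3)[symmetric] by simp
    then show ?thesis using hY by simp
  qed
  then have "full_setup X \<sigma> Y \<sigma>2 g \<T>"
    using m it by unfold_locales simp_all
  then show ?thesis using that by blast
qed

section \<open>Full faithfulness and the comparison of isomorphisms\<close>

theorem F_full_faithful:
  fixes X Y :: "('u::real_vector, 'e::real_vector) cocr"
  assumes X: "cocr_quat X" and Y: "cocr_quat Y"
    and T: "\<T> \<in> bundle_mor (F_obj X) (F_obj Y)" and it: "intertwines X Y \<T>"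
  shows "\<exists>!t. t \<in> cocr_mor X Y \<and> F_mor X Y t = \<T>"
proof (rule ex_ex1I)
  obtain \<sigma> where s: "\<sigma> \<in> qstr X" using cocr_basic(6)[OF X] by blast
  obtain \<sigma>0 where s0: "\<sigma>0 \<in> qstr Y" using cocr_basic(6)[OF Y] by blast
  interpret X: cocrs X \<sigma> using X s by unfold_locales
  interpret Y0: cocrs Y \<sigma>0 using Y s0 by unfold_locales
  obtain g where m: "mor_over (F_obj X) (F_obj Y) g \<T>"
    using T bundle_mor_iff[OF X.holo_bundle_F Y0.holo_bundle_F] by blast
  obtain \<sigma>' where "full_setup X \<sigma> Y \<sigma>' g \<T>" by (rule full_setup_exists[OF X Y s m it])
  then interpret fs: full_setup X \<sigma> Y \<sigma>' g \<T> .
  show "\<exists>t. t \<in> cocr_mor X Y \<and> F_mor X Y t = \<T>" using fs.mor_tT fs.F_mor_tT by blast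
  fix a b assume a: "a \<in> cocr_mor X Y \<and> F_mor X Y a = \<T>" and b: "b \<in> cocr_mor X Y \<and> F_mor X Y b = \<T>"
  obtain t T where tT: "a = (t, T)" by (cases a)
  obtain t' T' where tT': "b = (t', T')" by (cases b)
  have mor: "(t, T) \<in> cocr_mor X Y" "(t', T') \<in> cocr_mor X Y" using a b unfolding tT tT' by auto
  have eq: "F_mor X Y (t, T) = F_mor X Y (t', T')" using a b unfolding tT tT' by simp
  obtain \<tau> where "cocr_aligned X \<sigma> Y \<tau> t T" by (rule aligned_exists[OF X Y mor(1) s])
  then interpret A: cocr_aligned X \<sigma> Y \<tau> t T .
  obtain \<tau>' where "cocr_aligned X \<sigma> Y \<tau>' t' T'" by (rule aligned_exists[OF X Y mor(2) s])
  then interpret B: cocr_aligned X \<sigma> Y \<tau>' t' T' .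
  have cl: "Y0.Q.cl (A.Y.\<theta> p) (map_prod t t u) = Y0.Q.cl (B.Y.\<theta> p) (map_prod t' t' u)"
    if "u \<in> spc X \<times> spc X" for u p
    using fun_cong[OF eq, of "X.Q.cl (X.\<theta> p) u"] A.F_mor_cl[OF that] B.F_mor_cl[OF that]
    by (simp add: A.g(2) B.g(2))
  have z: "0 \<in> spc X \<times> spc X" by (rule cx.subspace_0[OF X.Q.subUU])
  \<comment> \<open>The zero section determines the base map, and thus \<open>T\<close>. The vector
    part \<open>t\<close> is then determined because a vector in all fibres of the kernel bundle
    vanishes.\<close>
  have \<theta>\<theta>: "A.Y.\<theta> p = B.Y.\<theta> p" for p using cl[OF z] unfolding Y0.Q.cl_eq by blast
  have "T J = T' J" for J
  proof (cases "J \<in> adm (qstr X)")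
    case True
    then obtain p where p: "J = X.E.std p" using X.adm_std by blast
    have "A.Y.E.std p = B.Y.E.std p" using \<theta>\<theta>[of p] A.Y.\<theta>(2)[of p] B.Y.\<theta>(2)[of p] by simp
    then show ?thesis unfolding p using A.T_std B.T_std by simp
  next
    case False
    then show ?thesis using PiE_arb[OF cocr_morD(3)[OF mor(1)]] PiE_arb[OF cocr_morD(3)[OF mor(2)]] by simp
  qed
  moreover have "t x = t' x" for x
  proof (cases "x \<in> spc X")
    case True
    have x: "(x, 0) \<in> spc X \<times> spc X" using True subspace_0[OF X.Q.subU] by simp
    have "map_prod t t (x, 0) - map_prod t' t' (x, 0) \<in> ker_bundle Y (A.Y.\<theta> p)" for p
      using cl[OF x, of p] unfolding Y0.Q.cl_eq by blast
    then have "map_prod t t (x, 0) - map_prod t' t' (x, 0) = 0" by (rule A.Y.img_Inter_zero)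
    then show ?thesis by (simp add: zero_prod_def)
  next
    case False
    then show ?thesis using HomD(4)[OF cocr_morD(1)[OF mor(1)]] HomD(4)[OF cocr_morD(1)[OF mor(2)]] by simp
  qed
  ultimately show "a = b" unfolding tT tT' by (simp add: fun_eq_iff)
qed

text \<open>The inverse of an intertwining isomorphism intertwines as well, so both come from
  morphisms; these are inverse to each other because the functor is faithful.\<close>

theorem F_iso:
  fixes X Y :: "('u::real_vector, 'e::real_vector) cocr"
  assumes X: "cocr_quat X" and Y: "cocr_quat Y"
  shows "(\<exists>t. is_iso cocr_cat X Y t) \<longleftrightarrow> (\<exists>\<T>. is_iso bundle_cat (F_obj X) (F_obj Y) \<T> \<and> intertwines X Y \<T>)"
proof
  have int: "F_mor X Y f \<in> bundle_mor (F_obj X) (F_obj Y) \<and> intertwines X Y (F_mor X Y f)"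
    if X: "cocr_quat X" and Y: "cocr_quat Y" and f: "f \<in> cocr_mor X Y" for X Y :: "('u, 'e) cocr" and f
  proof -
    obtain t T where tT: "f = (t, T)" by (cases f)
    obtain \<sigma> where s: "\<sigma> \<in> qstr X" using cocr_basic(6)[OF X] by blast
    obtain \<sigma>' where "cocr_aligned X \<sigma> Y \<sigma>' t T" by (rule aligned_exists[OF X Y f[unfolded tT] s])
    then interpret cocr_aligned X \<sigma> Y \<sigma>' t T .
    show ?thesis unfolding tT using F_mor_mor F_mor_intertwines by blast
  qed
  have FF: "is_functor (cocr_cat :: (('u, 'e) cocr, _) cat) bundle_cat F_obj F_mor" by (rule F_functor)
  have uniq: "a = b" if "cocr_quat X" "cocr_quat Y" "a \<in> cocr_mor X Y" "b \<in> cocr_mor X Y" "F_mor X Y a = F_mor X Y b"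
    for X Y :: "('u, 'e) cocr" and a b
    using F_full_faithful[OF that(1,2) conjunct1[OF int[OF that(1,2,4)]] conjunct2[OF int[OF that(1,2,4)]]] that(3-5)
    by (elim ex1E) metis
  have fun_cmp: "F_mor X Z (Cmp cocr_cat X Y Z g f) = Cmp bundle_cat (F_obj X) (F_obj Y) (F_obj Z) (F_mor Y Z g) (F_mor X Y f)"
    if "cocr_quat X" "cocr_quat Y" "cocr_quat Z" "f \<in> cocr_mor X Y" "g \<in> cocr_mor Y Z" for X Y Z :: "('u, 'e) cocr" and f g
    using FF that unfolding is_functor_def by (simp add: cocr_cat_def)
  have fun_id: "F_mor X X (Idn cocr_cat X) = Idn bundle_cat (F_obj X)" if "cocr_quat X" for X :: "('u, 'e) cocr"
    using FF that unfolding is_functor_def by (simp add: cocr_cat_def)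
  have mor_id: "Idn cocr_cat X \<in> cocr_mor X X" if "cocr_quat X" for X :: "('u, 'e) cocr"
    using cocr_mor_id[OF that] by (simp add: cocr_cat_def)
  have mor_cmp: "Cmp cocr_cat X Y Z g f \<in> cocr_mor X Z"
    if "cocr_quat X" "cocr_quat Y" "cocr_quat Z" "f \<in> cocr_mor X Y" "g \<in> cocr_mor Y Z" for X Y Z :: "('u, 'e) cocr" and f g
    using cocr_mor_comp[of X Y Z "fst f" "snd f" "fst g" "snd g"] that by (simp add: cocr_cat_def)
  have Mor: "Mor cocr_cat = cocr_mor" "Mor bundle_cat = bundle_mor" by (simp_all add: cocr_cat_def bundle_cat_def)
  {
    assume "\<exists>t. is_iso cocr_cat X Y t"
    then obtain t s where t: "t \<in> cocr_mor X Y" and s: "s \<in> cocr_mor Y X"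
      and ts: "Cmp cocr_cat X Y X s t = Idn cocr_cat X" "Cmp cocr_cat Y X Y t s = Idn cocr_cat Y"
      unfolding is_iso_def Mor by blast
    have "is_iso bundle_cat (F_obj X) (F_obj Y) (F_mor X Y t)"
      unfolding is_iso_def Mor
      using int[OF X Y t] int[OF Y X s] fun_cmp[OF X Y X t s] fun_cmp[OF Y X Y s t] fun_id[OF X] fun_id[OF Y] ts
      by (intro conjI bexI[of _ "F_mor Y X s"]) simp_all
    then show "\<exists>\<T>. is_iso bundle_cat (F_obj X) (F_obj Y) \<T> \<and> intertwines X Y \<T>"
      using int[OF X Y t] by blast
  }
  {
    assume "\<exists>\<T>. is_iso bundle_cat (F_obj X) (F_obj Y) \<T> \<and> intertwines X Y \<T>"
    then obtain \<T> \<G> where T: "\<T> \<in> bundle_mor (F_obj X) (F_obj Y)" and G: "\<G> \<in> bundle_mor (F_obj Y) (F_obj X)"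
      and TG: "Cmp bundle_cat (F_obj X) (F_obj Y) (F_obj X) \<G> \<T> = Idn bundle_cat (F_obj X)"
        "Cmp bundle_cat (F_obj Y) (F_obj X) (F_obj Y) \<T> \<G> = Idn bundle_cat (F_obj Y)"
      and it: "intertwines X Y \<T>"
      unfolding is_iso_def Mor by blast
    obtain \<sigma> where s: "\<sigma> \<in> qstr X" using cocr_basic(6)[OF X] by blast
    interpret X: cocrs X \<sigma> using X s by unfold_locales
    have GT: "\<G> (\<T> x) = x" if "x \<in> total (F_obj X)" for x
      using fun_cong[OF TG(1), of x] that by (simp add: bundle_cat_def compose_eq)
    have TG': "\<T> (\<G> y) = y" if "y \<in> total (F_obj Y)" for y
      using fun_cong[OF TG(2), of y] that by (simp add: bundle_cat_def compose_eq)
    have conj_tot: "conjugation X x \<in> total (F_obj X)" if "x \<in> total (F_obj X)" for x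
      using that X.conj_UU X.conjugation_cl unfolding X.total_F by fastforce
    have itG: "intertwines Y X \<G>"
      unfolding intertwines_def
    proof
      fix y assume y: "y \<in> total (F_obj Y)"
      have x: "\<G> y \<in> total (F_obj X)" by (rule PiE_mem[OF conjunct1[OF G[unfolded bundle_mor_def mem_Collect_eq]] y])
      have "\<G> (conjugation Y y) = \<G> (conjugation Y (\<T> (\<G> y)))" using TG'[OF y] by simp
      also have "\<dots> = \<G> (\<T> (conjugation X (\<G> y)))" using it x unfolding intertwines_def by simp
      also have "\<dots> = conjugation X (\<G> y)" by (rule GT[OF conj_tot[OF x]])
      finally show "\<G> (conjugation Y y) = conjugation X (\<G> y)" .
    qed
    obtain t where t: "t \<in> cocr_mor X Y" "F_mor X Y t = \<T>" using F_full_faithful[OF X Y T it] by blast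
    obtain u where u: "u \<in> cocr_mor Y X" "F_mor Y X u = \<G>" using F_full_faithful[OF Y X G itG] by blast
    have "Cmp cocr_cat X Y X u t = Idn cocr_cat X"
    proof -
      have "F_mor X X (Cmp cocr_cat X Y X u t) = F_mor X X (Idn cocr_cat X)"
        unfolding fun_cmp[OF X Y X t(1) u(1)] fun_id[OF X] t(2) u(2) TG(1) ..
      then show ?thesis by (rule uniq[OF X X mor_cmp[OF X Y X t(1) u(1)] mor_id[OF X]])
    qed
    moreover have "Cmp cocr_cat Y X Y t u = Idn cocr_cat Y"
    proof -
      have "F_mor Y Y (Cmp cocr_cat Y X Y t u) = F_mor Y Y (Idn cocr_cat Y)"
        unfolding fun_cmp[OF Y X Y u(1) t(1)] fun_id[OF Y] t(2) u(2) TG(2) ..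
      then show ?thesis by (rule uniq[OF Y Y mor_cmp[OF Y X Y u(1) t(1)] mor_id[OF Y]])
    qed
    ultimately have "is_iso cocr_cat X Y t" unfolding is_iso_def Mor using t(1) u(1) by blast
    then show "\<exists>t. is_iso cocr_cat X Y t" by blast
  }
qed

section \<open>Dimension and extension of isomorphisms\<close>

lemma fin_dimI:
  assumes "subspace E" "finite D" "E \<subseteq> span D"
  shows "fin_dim E"
proof -
  obtain B where B: "B \<subseteq> E" "independent B" "E \<subseteq> span B" by (rule maximal_independent_subset)
  have "finite B" using independent_span_bound[OF assms(2) B(2)] B(1) assms(3) by blast
  moreover have "span B = E" using span_subspace[OF B(1,3) assms(1)] .
  ultimately show ?thesis unfolding fin_dim_def by blast
qed

lemma fin_dim_basis:
  assumes "fin_dim E"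
  obtains B where "finite B" "B \<subseteq> E" "independent B" "span B = E" "card B = dim E"
proof -
  obtain D where D: "finite D" "span D = E" using assms unfolding fin_dim_def by blast
  obtain B where B: "B \<subseteq> E" "independent B" "E \<subseteq> span B" "card B = dim E" by (rule basis_exists)
  have "finite B" using independent_span_bound[OF D(1) B(2)] B(1) D(2) by blast
  then show ?thesis using that B span_subspace[OF B(1,3) fin_dim_subspace[OF assms]] by blast
qed

lemma fin_dim_subset: "fin_dim T \<Longrightarrow> subspace S \<Longrightarrow> S \<subseteq> T \<Longrightarrow> fin_dim S"
  by (rule fin_dim_basis) (auto intro: fin_dimI)

text \<open>\<open>dim\<close> is the \<open>card\<close> of a basis, hence 0 for infinite
  dimensional sets; monotonicity therefore comes with \<open>fin_dim\<close>.\<close>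

lemma dim_mono_fin_dim:
  assumes "fin_dim T" "S \<subseteq> T"
  shows "dim S \<le> dim T"
proof -
  obtain B where "finite B" "span B = T" "card B = dim T" by (rule fin_dim_basis[OF assms(1)])
  then show ?thesis using dim_le_card[of S B] assms(2) by simp
qed

lemma subspace_eqI_dim:
  assumes T: "fin_dim T" and S: "subspace S" "S \<subseteq> T" "dim T \<le> dim S"
  shows "S = T"
proof -
  obtain B where B: "finite B" "B \<subseteq> S" "independent B" "span B = S" "card B = dim S"
    by (rule fin_dim_basis[OF fin_dim_subset[OF T S(1,2)]])
  obtain C where C: "B \<subseteq> C" "C \<subseteq> T" "independent C" "T \<subseteq> span C"
    using maximal_independent_subset_extend[of B T] B(2,3) S(2) by blast
  obtain D where D: "finite D" "span D = T" using T unfolding fin_dim_def by blast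
  have "finite C" using independent_span_bound[OF D(1) C(3)] C(2) D(2) by blast
  moreover have "card C = dim T" using basis_card_eq_dim[OF C(2,4,3)] .
  ultimately have "B = C" using card_seteq[OF _ C(1)] B(5) S(3) by simp
  then show ?thesis using B(4) C(4) S(2) by blast
qed

lemma dim_zero: "dim {0 :: 'a::real_vector} = 0"
  using dim_span[of "{} :: 'a set"] dim_eq_card_independent[OF independent_empty, where ?'a='a] by simp

lemma rank_nullity:
  fixes f :: "'a::real_vector \<Rightarrow> 'b::real_vector"
  assumes E: "fin_dim E" and f: "linear f"
  shows "dim E = dim (f ` E) + dim {x \<in> E. f x = 0}" "fin_dim (f ` E)"
proof -
  let ?N = "{x \<in> E. f x = 0}"
  have sub: "subspace E" using E fin_dim_subspace by blast
  have subN: "subspace ?N"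
    using sub by (auto simp: subspace_def linear_0[OF f] linear_add[OF f] linear_scale[OF f])
  obtain B where B: "finite B" "B \<subseteq> ?N" "independent B" "span B = ?N" "card B = dim ?N"
    by (rule fin_dim_basis[OF fin_dim_subset[OF E subN]]) auto
  obtain C where C: "B \<subseteq> C" "C \<subseteq> E" "independent C" "E \<subseteq> span C"
    using maximal_independent_subset_extend[of B E] B(2,3) by auto
  obtain D where D: "finite D" "span D = E" using E unfolding fin_dim_def by blast
  have finC: "finite C" using independent_span_bound[OF D(1) C(3)] C(2) D(2) by blast
  have cardC: "card C = dim E" using basis_card_eq_dim[OF C(2,4,3)] .
  have ind: "independent (C - B)" using C(3) independent_mono by blast
  have inj: "inj_on f (span (C - B))"
  proof (rule inj_onI)
    fix x y assume xy: "x \<in> span (C - B)" "y \<in> span (C - B)" "f x = f y"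
    let ?z = "x - y"
    have z: "?z \<in> span (C - B)" using xy span_diff by blast
    moreover have "?z \<in> E" using z span_minimal[of "C - B" E] C(2) sub by blast
    ultimately have zB: "?z \<in> span B" unfolding B(4) using xy(3) by (simp add: linear_diff[OF f])
    \<comment> \<open>A vector in the spans of two disjoint parts of a basis has only zero
      coordinates.\<close>
    have "representation C ?z = representation B ?z" "representation C ?z = representation (C - B) ?z"
      using representation_extend[OF C(3) zB C(1)] representation_extend[OF C(3) z] by auto
    then have "representation C ?z b = 0" for b
      using representation_ne_zero[of B ?z b] representation_ne_zero[of "C - B" ?z b] by auto
    moreover have "?z \<in> span C" using z span_mono[of "C - B" C] by blast
    ultimately have "?z = 0"
      using sum_nonzero_representation_eq[OF C(3), of ?z] by simp
    then show "x = y" by simp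
  qed
  have indf: "independent (f ` (C - B))" using linear_independent_injective_image[OF f ind inj] .
  have spf: "f ` E \<subseteq> span (f ` (C - B))"
  proof
    fix y assume "y \<in> f ` E"
    then obtain x where x: "x \<in> span ((C - B) \<union> B)" "y = f x" using C(1,4) by (auto simp: Un_absorb2)
    then obtain u v where uv: "x = u + v" "u \<in> span (C - B)" "v \<in> span B" unfolding span_Un by auto
    have "f x = f u" using uv B(4) by (simp add: linear_add[OF f])
    then show "y \<in> span (f ` (C - B))" using x(2) uv(2) linear_span_image[OF f] by auto
  qed
  have "f ` (C - B) \<subseteq> f ` E" using C(2) by blast
  then have "dim (f ` E) = card (f ` (C - B))" using basis_card_eq_dim[OF _ spf indf] by simp
  also have "\<dots> = card (C - B)" using inj span_superset by (intro card_image) (rule inj_on_subset)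
  also have "\<dots> = dim E - dim ?N" using card_Diff_subset[OF B(1) C(1)] cardC B(5) by simp
  finally show "dim E = dim (f ` E) + dim ?N"
    using card_mono[OF finC C(1)] cardC B(5) by simp
  show "fin_dim (f ` E)"
    using fin_dimI[OF linear_subspace_image[OF f sub] _ spf] finC by simp
qed

lemma dim_Times_fin_dim:
  assumes S: "fin_dim S" and T: "fin_dim T"
  shows "fin_dim (S \<times> T)" "dim (S \<times> T) = dim S + dim T"
proof -
  obtain B where B: "finite B" "span B = S" using S unfolding fin_dim_def by blast
  obtain C where C: "finite C" "span C = T" using T unfolding fin_dim_def by blast
  have lin: "linear (\<lambda>x. (x, 0 :: 'b))" "linear (\<lambda>y. (0 :: 'a, y))" "linear (fst :: 'a \<times> 'b \<Rightarrow> 'a)"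
    by (auto intro!: linearI)
  let ?G = "(\<lambda>x. (x, 0 :: 'b)) ` B \<union> (\<lambda>y. (0 :: 'a, y)) ` C"
  have "S \<times> T \<subseteq> span ?G"
  proof
    fix w assume w: "w \<in> S \<times> T"
    have "(fst w, 0) \<in> span ((\<lambda>x. (x, 0 :: 'b)) ` B)" "(0, snd w) \<in> span ((\<lambda>y. (0 :: 'a, y)) ` C)"
      using w unfolding linear_span_image[OF lin(1)] linear_span_image[OF lin(2)] B(2) C(2) by auto
    then have "(fst w, 0) \<in> span ?G" "(0, snd w) \<in> span ?G"
      using subsetD[OF span_mono[OF Un_upper1]] subsetD[OF span_mono[OF Un_upper2]] by auto
    then have "(fst w, 0) + (0, snd w) \<in> span ?G" by (rule span_add)
    then show "w \<in> span ?G" by simp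
  qed
  then show fd: "fin_dim (S \<times> T)"
    by (rule fin_dimI[OF subspace_Times[OF S[THEN fin_dim_subspace] T[THEN fin_dim_subspace]], rotated])
      (simp add: B(1) C(1))
  have 0: "0 \<in> S" "0 \<in> T" using S T fin_dim_subspace subspace_0 by blast+
  have "fst ` (S \<times> T) = S" "{w \<in> S \<times> T. fst w = 0} = (\<lambda>y. (0, y)) ` T" using 0 by auto
  moreover have "dim ((\<lambda>y. (0 :: 'a, y)) ` T) = dim T"
  proof -
    have "{y \<in> T. (0 :: 'a, y) = 0} = {0}" using 0 by (auto simp: zero_prod_def)
    then show ?thesis using rank_nullity(1)[OF T lin(2)] by (simp add: dim_zero)
  qed
  ultimately show "dim (S \<times> T) = dim S + dim T" using rank_nullity(1)[OF fd lin(3)] by simp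
qed

text \<open>Modules over a real division subalgebra of the quaternions; only \<open>\<real>\<close> and \<open>\<H>\<close> are needed.\<close>

definition division_subalgebra :: "quat set \<Rightarrow> bool" where
  "division_subalgebra D \<longleftrightarrow> (\<forall>r. (r, 0) \<in> D) \<and> (\<forall>p\<in>D. \<forall>q\<in>D. p + q \<in> D \<and> qmult p q \<in> D) \<and>
     (\<forall>q\<in>D. q \<noteq> 0 \<longrightarrow> (\<exists>p\<in>D. qmult p q = (1, 0)))"

lemma qmult_algebra:
  "qmult q (p + p') = qmult q p + qmult q p'" "qmult (q + p) p' = qmult q p' + qmult p p'"
  "qmult (qmult q p) p' = qmult q (qmult p p')"
proof -
  obtain a b c d where 1: "q = Q4 a b c d" using Q4_exhaust by blast
  obtain a' b' c' d' where 2: "p = Q4 a' b' c' d'" using Q4_exhaust by blast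
  obtain a'' b'' c'' d'' where 3: "p' = Q4 a'' b'' c'' d''" using Q4_exhaust by blast
  show "qmult q (p + p') = qmult q p + qmult q p'" "qmult (q + p) p' = qmult q p' + qmult p p'"
    "qmult (qmult q p) p' = qmult q (qmult p p')"
    unfolding 1 2 3 by (simp_all add: qmult_Q4 Q4_add algebra_simps)
qed

lemma qmult_real: "qmult (r, 0) p = r *\<^sub>R p" "qmult p (r, 0) = r *\<^sub>R p"
  by (simp_all add: qmult_def scaleR_prod_def)

lemma division_subalgebra_real: "division_subalgebra (range (\<lambda>r. (r, 0)))"
proof -
  have "\<exists>t. qmult (t, 0) (r, 0) = (1, 0)" if "(r, 0) \<noteq> (0 :: quat)" for r
    using that by (intro exI[of _ "1 / r"]) (simp add: qmult_def zero_prod_def)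
  then show ?thesis unfolding division_subalgebra_def by (auto simp: qmult_def)
qed

lemma division_subalgebra_quat: "division_subalgebra UNIV"
proof -
  have "\<exists>p. qmult p q = (1, 0)" if nz: "q \<noteq> 0" for q
  proof -
    obtain a b c d where q: "q = Q4 a b c d" using Q4_exhaust by blast
    have "q = hq (Complex a (- b)) (Complex c d)" unfolding q hq_def by simp
    moreover have "(Complex a (- b), Complex c d) \<noteq> (0, 0)"
      using nz unfolding q Q4_0 Q4_eq_iff by (auto simp: complex_eq_iff)
    ultimately obtain p where "qmult p q = (1, 0)" using hq_inverse by metis
    then show ?thesis by blast
  qed
  then show ?thesis unfolding division_subalgebra_def by blast
qed

text \<open>In contrast to \<open>quat_hom\<close> nothing is said about the action off
  \<open>E\<close>, so submodules and transported modules need no truncation.\<close>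

definition dmod :: "quat set \<Rightarrow> (quat \<Rightarrow> 'a \<Rightarrow> 'a) \<Rightarrow> 'a::real_vector set \<Rightarrow> bool" where
  "dmod D s E \<longleftrightarrow> subspace E \<and> (\<forall>q\<in>D. \<forall>x\<in>E. s q x \<in> E) \<and>
     (\<forall>q\<in>D. \<forall>x\<in>E. \<forall>y\<in>E. s q (x + y) = s q x + s q y) \<and>
     (\<forall>p\<in>D. \<forall>q\<in>D. \<forall>x\<in>E. s (p + q) x = s p x + s q x \<and> s (qmult p q) x = s p (s q x)) \<and>
     (\<forall>r. \<forall>x\<in>E. s (r, 0) x = r *\<^sub>R x)"

lemma dmodD:
  assumes "dmod D s E"
  shows "subspace E" "q \<in> D \<Longrightarrow> x \<in> E \<Longrightarrow> s q x \<in> E"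
    "q \<in> D \<Longrightarrow> x \<in> E \<Longrightarrow> y \<in> E \<Longrightarrow> s q (x + y) = s q x + s q y"
    "p \<in> D \<Longrightarrow> q \<in> D \<Longrightarrow> x \<in> E \<Longrightarrow> s (p + q) x = s p x + s q x"
    "p \<in> D \<Longrightarrow> q \<in> D \<Longrightarrow> x \<in> E \<Longrightarrow> s (qmult p q) x = s p (s q x)"
    "x \<in> E \<Longrightarrow> s (r, 0) x = r *\<^sub>R x"
  using assms unfolding dmod_def by blast+

lemma dmod_subspace: "dmod D s E \<Longrightarrow> subspace F \<Longrightarrow> F \<subseteq> E \<Longrightarrow> (\<And>q x. q \<in> D \<Longrightarrow> x \<in> F \<Longrightarrow> s q x \<in> F) \<Longrightarrow> dmod D s F"
  unfolding dmod_def by blast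

text \<open>Real homogeneity is equivariance under the elements \<open>(r, 0)\<close>, which lie in
  every division subalgebra; this treats real and quaternionic linear maps alike.\<close>

definition dlin :: "quat set \<Rightarrow> (quat \<Rightarrow> 'a \<Rightarrow> 'a) \<Rightarrow> (quat \<Rightarrow> 'b \<Rightarrow> 'b) \<Rightarrow> 'a::real_vector set \<Rightarrow> ('a \<Rightarrow> 'b::real_vector) \<Rightarrow> bool" where
  "dlin D s s' E f \<longleftrightarrow> (\<forall>x\<in>E. \<forall>y\<in>E. f (x + y) = f x + f y) \<and> (\<forall>q\<in>D. \<forall>x\<in>E. f (s q x) = s' q (f x))"

lemma dlinD:
  assumes "dlin D s s' E f"
  shows "x \<in> E \<Longrightarrow> y \<in> E \<Longrightarrow> f (x + y) = f x + f y" "q \<in> D \<Longrightarrow> x \<in> E \<Longrightarrow> f (s q x) = s' q (f x)"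
  using assms unfolding dlin_def by blast+

lemma dlin_diff:
  assumes f: "dlin D s s' E f" and E: "subspace E" and xy: "x \<in> E" "y \<in> E"
  shows "f (x - y) = f x - f y" "f 0 = 0"
proof -
  have "f x = f (x - y) + f y"
    using dlinD(1)[OF f subspace_diff[OF E xy] xy(2)] by simp
  then show "f (x - y) = f x - f y" by simp
  show "f 0 = 0" using dlinD(1)[OF f subspace_0[OF E] subspace_0[OF E]] by simp
qed

lemma dlin_inv:
  assumes E: "dmod D s E" and f: "dlin D s s' E f" and b: "bij_betw f E E'"
  shows "dlin D s' s E' (inv_into E f)"
  unfolding dlin_def
proof (intro conjI ballI)
  have inj: "inj_on f E" and img: "f ` E = E'" using b unfolding bij_betw_def by auto
  have mem: "inv_into E f x \<in> E" "f (inv_into E f x) = x" if "x \<in> E'" for x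
    using that inv_into_into[of x f E] f_inv_into_f[of x f E] unfolding img by auto
  fix x assume x: "x \<in> E'"
  { fix y assume y: "y \<in> E'"
    have "inv_into E f (x + y) = inv_into E f (f (inv_into E f x + inv_into E f y))"
      using dlinD(1)[OF f mem(1)[OF x] mem(1)[OF y]] mem(2) x y by simp
    also have "\<dots> = inv_into E f x + inv_into E f y"
      using inv_into_f_f[OF inj subspace_add[OF dmodD(1)[OF E] mem(1)[OF x] mem(1)[OF y]]] .
    finally show "inv_into E f (x + y) = inv_into E f x + inv_into E f y" . }
  { fix q assume q: "q \<in> D"
    have "inv_into E f (s' q x) = inv_into E f (f (s q (inv_into E f x)))"
      using dlinD(2)[OF f q mem(1)[OF x]] mem(2) x by simp
    also have "\<dots> = s q (inv_into E f x)"
      using inv_into_f_f[OF inj dmodD(2)[OF E q mem(1)[OF x]]] .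
    finally show "inv_into E f (s' q x) = s q (inv_into E f x)" . }
qed

lemma dlin_linear:
  assumes D: "division_subalgebra D" and E: "dmod D s E" and E': "dmod D s' E'"
    and f: "dlin D s s' E f" "f ` E \<subseteq> E'"
  obtains g where "linear g" "\<And>x. x \<in> E \<Longrightarrow> g x = f x"
proof -
  have r: "f (r *\<^sub>R x) = r *\<^sub>R f x" if x: "x \<in> E" for r x
    using dlinD(2)[OF f(1) _ x, of "(r, 0)"] dmodD(6)[OF E x] dmodD(6)[OF E', of "f x"] f(2) x D
    unfolding division_subalgebra_def by auto
  have sub: "subspace E" by (rule dmodD(1)[OF E])
  have "(\<lambda>x. if x \<in> E then f x else 0) \<in> Hom E UNIV"
    by (rule HomI) (simp_all add: r subspace_add[OF sub] subspace_scale[OF sub] dlinD(1)[OF f(1)])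
  then obtain g where g: "linear g" "\<And>x. x \<in> E \<Longrightarrow> g x = (if x \<in> E then f x else 0)"
    by (rule Hom_extend[OF _ sub]) (rule that)
  show ?thesis by (rule that[OF g(1)]) (simp add: g(2))
qed

lemma dlin_bij_dim:
  assumes "division_subalgebra D" "dmod D s E" "dmod D s' E'"
    and "dlin D s s' E f" "f ` E \<subseteq> E'" "inj_on f E" "fin_dim E"
  shows "dim (f ` E) = dim E" "subspace (f ` E)" "fin_dim (f ` E)"
proof -
  obtain g where g: "linear g" "\<And>x. x \<in> E \<Longrightarrow> g x = f x" by (rule dlin_linear[OF assms(1-5)]) (rule that)
  have eq: "f ` E = g ` E" using g(2) by force
  have z: "0 \<in> E" by (rule subspace_0[OF dmodD(1)[OF assms(2)]])
  have "{x \<in> E. g x = 0} = {0}"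
    using z g assms(6) linear_0[OF g(1)] unfolding inj_on_def by force
  then show "dim (f ` E) = dim E" unfolding eq using rank_nullity(1)[OF assms(7) g(1)] by (simp add: dim_zero)
  show "subspace (f ` E)" unfolding eq by (rule linear_subspace_image[OF g(1) dmodD(1)[OF assms(2)]])
  show "fin_dim (f ` E)" unfolding eq by (rule rank_nullity(2)[OF assms(7) g(1)])
qed

text \<open>The homomorphism theorem in a form without quotient spaces: two maps with the same
  kernel have isomorphic images.\<close>

lemma factor_iso:
  assumes M: "dmod D s M" and p1: "dlin D s s1 M p1" and p2: "dlin D s s2 M p2"
    and ker: "\<And>e. e \<in> M \<Longrightarrow> p1 e = 0 \<longleftrightarrow> p2 e = 0"
  obtains f where "\<And>e. e \<in> M \<Longrightarrow> f (p1 e) = p2 e" "bij_betw f (p1 ` M) (p2 ` M)" "dlin D s1 s2 (p1 ` M) f"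
proof -
  have sub: "subspace M" by (rule dmodD(1)[OF M])
  have eq: "p1 e = p1 e' \<longleftrightarrow> p2 e = p2 e'" if e: "e \<in> M" "e' \<in> M" for e e'
    using ker[OF subspace_diff[OF sub e]] dlin_diff(1)[OF p1 sub e] dlin_diff(1)[OF p2 sub e] by simp
  define f where "f x = p2 (inv_into M p1 x)" for x
  have f: "f (p1 e) = p2 e" if e: "e \<in> M" for e
    unfolding f_def using eq[OF inv_into_into[of "p1 e" p1 M] e] f_inv_into_f[of "p1 e" p1 M] e by simp
  have "bij_betw f (p1 ` M) (p2 ` M)"
    unfolding bij_betw_def inj_on_def using eq f by (auto simp: image_image cong: image_cong)
  moreover have "dlin D s1 s2 (p1 ` M) f"
    unfolding dlin_def
  proof (intro conjI ballI; (elim imageE)?)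
    fix x y e e' assume e: "e \<in> M" "e' \<in> M" "x = p1 e" "y = p1 e'"
    show "f (x + y) = f x + f y"
      unfolding e dlinD(1)[OF p1 e(1,2), symmetric] f[OF e(1)] f[OF e(2)] f[OF subspace_add[OF sub e(1,2)]]
      by (rule dlinD(1)[OF p2 e(1,2)])
  next
    fix q x e assume q: "q \<in> D" and e: "e \<in> M" "x = p1 e"
    show "f (s1 q x) = s2 q (f x)"
      unfolding e dlinD(2)[OF p1 q e(1), symmetric] f[OF e(1)] f[OF dmodD(2)[OF M q e(1)]]
      by (rule dlinD(2)[OF p2 q e(1)])
  qed
  ultimately show ?thesis using that f by blast
qed

text \<open>This is where division enters: a nonzero \<open>q\<close> could be inverted, and
  \<open>x\<close> would lie in \<open>F\<close>.\<close>

lemma dmod_independent: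
  assumes D: "division_subalgebra D" and E: "dmod D s E" and F: "dmod D s F"
    and x: "x \<in> E" "x \<notin> F" and y: "y \<in> F" and q: "q \<in> D" and 0: "y + s q x = 0"
  shows "y = 0 \<and> q = 0"
proof -
  have "q = 0"
  proof (rule ccontr)
    assume "q \<noteq> 0"
    then obtain p where p: "p \<in> D" "qmult p q = (1, 0)"
      using D q unfolding division_subalgebra_def by blast
    have "s q x = - y" using 0 by (simp add: add_eq_0_iff)
    then have "s q x \<in> F" using subspace_neg[OF dmodD(1)[OF F] y] by simp
    then have "s p (s q x) \<in> F" using dmodD(2)[OF F p(1)] by blast
    then show False
      using x(2) dmodD(5)[OF E p(1) q x(1)] dmodD(6)[OF E x(1), of 1] unfolding p(2) by simp
  qed
  moreover have "s 0 x = 0" using dmodD(6)[OF E x(1), of 0] by (simp add: zero_prod_def)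
  ultimately show ?thesis using 0 by simp
qed

text \<open>Induction on the codimension of \<open>F\<close>: adjoin one vector \<open>x\<close> on
  the left and one vector \<open>x'\<close> on the right. Equality of the dimensions guarantees that
  both sides are exhausted together.\<close>

lemma extend_iso:
  assumes D: "division_subalgebra D" and E: "dmod D s E" "fin_dim E" and E': "dmod D s' E'" "fin_dim E'"
    and dims: "dim E = dim E'" and F: "dmod D s F" "F \<subseteq> E" and f: "dlin D s s' F f" "f ` F \<subseteq> E'" "inj_on f F"
  shows "\<exists>g. dlin D s s' E g \<and> bij_betw g E E' \<and> (\<forall>x\<in>F. g x = f x)"
  using F f
proof (induction "dim E - dim F" arbitrary: F f rule: less_induct)
  case less
  note F = less.prems(1,2) and f = less.prems(3-5)
  have fdF: "fin_dim F" by (rule fin_dim_subset[OF E(2) dmodD(1)[OF F(1)] F(2)])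
  note fF = dlin_bij_dim[OF D F(1) E'(1) f(1-3) fdF]
  show ?case
  proof (cases "F = E")
    case True
    then have "f ` E = E'" using subspace_eqI_dim[OF E'(2) fF(2) f(2)] fF(1) dims by simp
    then show ?thesis using f True unfolding bij_betw_def by blast
  next
    case False
    then obtain x where x: "x \<in> E" "x \<notin> F" using F(2) by blast
    have "dim F < dim E"
      using subspace_eqI_dim[OF E(2) dmodD(1)[OF F(1)] F(2)] False by linarith
    then have "f ` F \<noteq> E'" using fF(1) dims by auto
    then obtain x' where x': "x' \<in> E'" "x' \<notin> f ` F" using f(2) by blast
    have subD: "subspace D"
    proof -
      have "0 \<in> D" using D unfolding division_subalgebra_def by (simp add: zero_prod_def)
      then show ?thesis using D unfolding division_subalgebra_def subspace_def qmult_real(1)[symmetric] by blast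
    qed
    \<comment> \<open>The external direct sum of \<open>F\<close> and \<open>D\<close>. It maps to
      the submodules generated by \<open>F\<close> with \<open>x\<close> and by \<open>f F\<close>
      with \<open>x'\<close>, in both cases with zero kernel, so \<open>factor_iso\<close> gives the
      enlarged isomorphism.\<close>
    define M where "M = F \<times> D"
    define t where "t q = (\<lambda>(y, p). (s q y, qmult q p))" for q
    have tM: "dmod D t M"
      unfolding dmod_def
    proof (intro conjI ballI allI)
      show "subspace M" unfolding M_def by (rule subspace_Times[OF dmodD(1)[OF F(1)] subD])
      fix q assume q: "q \<in> D"
      fix w assume w: "w \<in> M"
      then obtain y p where yp: "w = (y, p)" "y \<in> F" "p \<in> D" unfolding M_def by blast
      show "t q w \<in> M"
        unfolding yp t_def M_def using dmodD(2)[OF F(1) q yp(2)] D q yp(3)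
        unfolding division_subalgebra_def by simp
      { fix w' assume w': "w' \<in> M"
        then obtain y' p' where yp': "w' = (y', p')" "y' \<in> F" "p' \<in> D" unfolding M_def by blast
        show "t q (w + w') = t q w + t q w'"
          unfolding yp yp' t_def using dmodD(3)[OF F(1) q yp(2) yp'(2)] by (simp add: qmult_algebra qmult_real) }
      { fix q' assume q': "q' \<in> D"
        show "t (q + q') w = t q w + t q' w" "t (qmult q q') w = t q (t q' w)"
          unfolding yp t_def using dmodD(4,5)[OF F(1) q q' yp(2)] by (simp_all add: qmult_algebra qmult_real) }
    next
      fix r w assume "w \<in> M"
      then obtain y p where yp: "w = (y, p)" "y \<in> F" "p \<in> D" unfolding M_def by blast
      show "t (r, 0) w = r *\<^sub>R w"
        unfolding yp t_def using dmodD(6)[OF F(1) yp(2)] by (simp add: qmult_algebra qmult_real)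
    qed
    have extension: "dlin D t s'' M (\<lambda>(y, q). h y + s'' q z)"
      if E'': "dmod D s'' E''" and z: "z \<in> E''" and h: "dlin D s s'' F h" "h ` F \<subseteq> E''" for s'' h and z :: "'c::real_vector" and E''
      unfolding dlin_def
    proof (intro conjI ballI)
      fix w assume w: "w \<in> M"
      then obtain y p where yp: "w = (y, p)" "y \<in> F" "p \<in> D" unfolding M_def by blast
      { fix w' assume w': "w' \<in> M"
        then obtain y' p' where yp': "w' = (y', p')" "y' \<in> F" "p' \<in> D" unfolding M_def by blast
        show "(\<lambda>(y, q). h y + s'' q z) (w + w') = (\<lambda>(y, q). h y + s'' q z) w + (\<lambda>(y, q). h y + s'' q z) w'"
          unfolding yp yp' using dlinD(1)[OF h(1) yp(2) yp'(2)] dmodD(4)[OF E'' yp(3) yp'(3) z] by simp }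
      { fix q assume q: "q \<in> D"
        have "h y \<in> E''" using h(2) yp(2) by blast
        then show "(\<lambda>(y, q). h y + s'' q z) (t q w) = s'' q ((\<lambda>(y, q). h y + s'' q z) w)"
          unfolding yp t_def
          using dlinD(2)[OF h(1) q yp(2)] dmodD(5)[OF E'' q yp(3) z] dmodD(3)[OF E'' q _ dmodD(2)[OF E'' yp(3) z]]
          by simp }
    qed
    define p1 where "p1 = (\<lambda>(y, q). y + s q x)"
    define p2 where "p2 = (\<lambda>(y, q). f y + s' q x')"
    have p2: "dlin D t s' M p2" unfolding p2_def by (rule extension[OF E'(1) x'(1) f(1,2)])
    have p1: "dlin D t s M p1"
    proof -
      have "dlin D s s F (\<lambda>y. y)" "(\<lambda>y. y) ` F \<subseteq> E" using F(2) unfolding dlin_def by auto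
      then show ?thesis unfolding p1_def by (rule extension[OF E(1) x(1)])
    qed
    have fFm: "dmod D s' (f ` F)"
    proof (rule dmod_subspace[OF E'(1) fF(2) f(2)])
      fix q z assume q: "q \<in> D" and "z \<in> f ` F"
      then obtain y where y: "y \<in> F" "z = f y" by blast
      show "s' q z \<in> f ` F"
        unfolding y(2) dlinD(2)[OF f(1) q y(1), symmetric] by (rule imageI[OF dmodD(2)[OF F(1) q y(1)]])
    qed
    have ker: "p1 w = 0 \<longleftrightarrow> p2 w = 0" if "w \<in> M" for w
    proof -
      obtain y q where yq: "w = (y, q)" "y \<in> F" "q \<in> D" using \<open>w \<in> M\<close> unfolding M_def by blast
      have z: "s 0 x = 0" "s' 0 x' = 0"
        using dmodD(6)[OF E(1) x(1), of 0] dmodD(6)[OF E'(1) x'(1), of 0] by (simp_all add: zero_prod_def)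
      have f0: "f 0 = 0" by (rule dlin_diff(2)[OF f(1) dmodD(1)[OF F(1)] yq(2) yq(2)])
      have "p1 w = 0 \<longleftrightarrow> y = 0 \<and> q = 0"
        unfolding p1_def yq(1) using dmod_independent[OF D E(1) F(1) x yq(2,3)] z by auto
      also have "\<dots> \<longleftrightarrow> f y = 0 \<and> q = 0"
        using f(3) f0 yq(2) subspace_0[OF dmodD(1)[OF F(1)]] unfolding inj_on_def by metis
      also have "\<dots> \<longleftrightarrow> p2 w = 0"
        unfolding p2_def yq(1) using dmod_independent[OF D E'(1) fFm x' imageI[OF yq(2)] yq(3)] z by auto
      finally show ?thesis .
    qed
    obtain f2 where f2: "\<And>w. w \<in> M \<Longrightarrow> f2 (p1 w) = p2 w" "bij_betw f2 (p1 ` M) (p2 ` M)" "dlin D s s' (p1 ` M) f2"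
      by (rule factor_iso[OF tM p1 p2 ker]) (use that in blast)+
    have ME: "p1 ` M \<subseteq> E" "p2 ` M \<subseteq> E'"
      unfolding p1_def p2_def M_def
      using subspace_add[OF dmodD(1)[OF E(1)]] subspace_add[OF dmodD(1)[OF E'(1)]] F(2) f(2)
        dmodD(2)[OF E(1) _ x(1)] dmodD(2)[OF E'(1) _ x'(1)] by auto
    have D01: "0 \<in> D" "(1, 0) \<in> D" using D subspace_0[OF subD] unfolding division_subalgebra_def by auto
    have p1_0: "p1 (y, 0) = y" for y
      unfolding p1_def using dmodD(6)[OF E(1) x(1), of 0] by (simp add: zero_prod_def)
    have FM: "F \<subseteq> p1 ` M"
    proof
      fix y assume "y \<in> F"
      then have "(y, 0) \<in> M" unfolding M_def using D01 by simp
      then show "y \<in> p1 ` M" using p1_0 by (metis imageI)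
    qed
    have "p1 (0, (1, 0)) = x" unfolding p1_def using dmodD(6)[OF E(1) x(1), of 1] by simp
    moreover have "(0, (1, 0)) \<in> M" unfolding M_def using D01 subspace_0[OF dmodD(1)[OF F(1)]] by simp
    ultimately have xM: "x \<in> p1 ` M" by (metis imageI)
    obtain g where g: "linear g" "\<And>w. w \<in> M \<Longrightarrow> g w = p1 w"
      by (rule dlin_linear[OF D tM E(1) p1 ME(1)]) (rule that)
    have "p1 ` M = g ` M" using g(2) by force
    then have subM: "subspace (p1 ` M)"
      using linear_subspace_image[OF g(1) dmodD(1)[OF tM]] by simp
    have modM: "dmod D s (p1 ` M)"
    proof (rule dmod_subspace[OF E(1) subM ME(1)])
      fix q z assume q: "q \<in> D" and "z \<in> p1 ` M"
      then obtain w where w: "w \<in> M" "z = p1 w" by blast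
      show "s q z \<in> p1 ` M"
        unfolding w(2) dlinD(2)[OF p1 q w(1), symmetric] by (rule imageI[OF dmodD(2)[OF tM q w(1)]])
    qed
    have "F \<noteq> p1 ` M" using xM x(2) by blast
    then have "dim F < dim (p1 ` M)"
      using subspace_eqI_dim[OF fin_dim_subset[OF E(2) subM ME(1)] dmodD(1)[OF F(1)] FM] by linarith
    moreover have "dim (p1 ` M) \<le> dim E" by (rule dim_mono_fin_dim[OF E(2) ME(1)])
    ultimately have "dim E - dim (p1 ` M) < dim E - dim F" by linarith
    moreover have "f2 ` p1 ` M \<subseteq> E'" "inj_on f2 (p1 ` M)" using f2(2) ME(2) unfolding bij_betw_def by auto
    ultimately obtain g where g: "dlin D s s' E g" "bij_betw g E E'" "\<forall>x\<in>p1 ` M. g x = f2 x"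
      using less.hyps[OF _ modM ME(1) f2(3)] by blast
    have "g y = f y" if y: "y \<in> F" for y
    proof -
      have w: "(y, 0) \<in> M" unfolding M_def using D01 y by simp
      have "g y = f2 (p1 (y, 0))" using g(3) FM y p1_0 by auto
      also have "\<dots> = f y"
        unfolding f2(1)[OF w] p2_def using dmodD(6)[OF E'(1) x'(1), of 0] by (simp add: zero_prod_def)
      finally show ?thesis .
    qed
    then show ?thesis using g by blast
  qed
qed


section \<open>Kernels of co-CR quaternionic structures\<close>

text \<open>
  If \<open>dim K\<close> were half of \<open>dim E\<close>, the determinant of the map from the fibres \<open>E\<^sup>J\<close> to the
  complexification of \<open>E / K\<close> would be a section of a line bundle of positive degree, hence vanish somewhere.
\<close>

lemma (in qmodule) kernel_dim_less:
  assumes K: "subspace K" "K \<subseteq> E" and E: "E \<noteq> {0}"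
    and ker: "\<And>v x. norm v = 1 \<Longrightarrow> x \<in> K \<Longrightarrow> \<sigma> (0, v) x \<in> K \<Longrightarrow> x = 0"
  shows "2 * dim K < dim E"
proof -
  obtain g :: "'e \<Rightarrow> 'e" where g: "range g \<subseteq> K" "linear g" "\<forall>x\<in>K. g (id x) = x"
    using linear_exists_left_inverse_on[OF linear_id K(1)] by auto
  \<comment> \<open>A linear map with kernel exactly \<open>K\<close>; its image stands for the
    quotient of \<open>E\<close> by \<open>K\<close>.\<close>
  define R where "R x = x - g x" for x
  have R: "linear R" unfolding R_def by (intro linear_compose_sub linear_id[unfolded id_def] g(2))
  have RK: "R x = 0 \<longleftrightarrow> x \<in> K" for x
    unfolding R_def using g(1,3) by (metis UNIV_I eq_iff_diff_eq_0 id_apply image_subset_iff)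
  interpret P: pencil W "map_prod R R" "\<lambda>w. map_prod R R (Jc w)"
    by (rule pencil_of_kernel[OF R]) (use ker RK in blast)
  \<comment> \<open>The first map of the pencil, transported from \<open>W\<close> to
    \<open>E\<close>. It is injective but by \<open>not_onto\<close> does not fill
    \<open>R E \<times> R E\<close>, which yields
    \<open>dim E < 2 * (dim E - dim K)\<close>.\<close>
  define \<alpha> where "\<alpha> x = (R x, R (lext qi x))" for x
  have \<alpha>: "linear \<alpha>"
    unfolding \<alpha>_def by (intro linearI) (simp_all add: linear_add[OF R] linear_scale[OF R] linear_add[OF lext(1)] linear_scale[OF lext(1)])
  have img: "map_prod R R ` W = \<alpha> ` E"
    unfolding W_def \<alpha>_def by (force simp: lext(2))
  obtain x0 where x0: "x0 \<in> E" "x0 \<noteq> 0" using E sub subspace_0 by blast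
  have "(\<lambda>w. map_prod R R (Jc w)) ` W \<subseteq> R ` E \<times> R ` E"
  proof (rule image_subsetI)
    fix w assume "w \<in> W"
    then obtain x where x: "x \<in> E" "w = (x, \<sigma> qi x)" by (rule WE)
    have "- \<sigma> qk x \<in> E" by (rule subspace_neg[OF sub sD(1)[OF x(1)]])
    then show "map_prod R R (Jc w) \<in> R ` E \<times> R ` E"
      unfolding x(2) Jc_W[OF x(1)] using sD(1)[OF x(1)] by simp
  qed
  then have ne: "\<alpha> ` E \<noteq> R ` E \<times> R ` E"
    using P.not_onto[OF WI[OF x0(1)]] x0(2) unfolding img by (simp add: zero_prod_def)
  have z: "0 \<in> E" by (rule subspace_0[OF sub])
  have "{x \<in> E. \<alpha> x = 0} = {0}"
  proof (intro equalityI subsetI)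
    fix x assume "x \<in> {x \<in> E. \<alpha> x = 0}"
    then have x: "x \<in> E" "R x = 0" "R (\<sigma> qi x) = 0" unfolding \<alpha>_def by (auto simp: lext(2) zero_prod_def)
    then have "cscale 1 (map_prod R R (x, \<sigma> qi x)) + cscale 0 (map_prod R R (Jc (x, \<sigma> qi x))) = 0"
      by (simp add: zero_prod_def[symmetric])
    then have "(x, \<sigma> qi x) = 0" using P.inj[OF _ WI[OF x(1)], of 1 0] by simp
    then show "x \<in> {0}" by (simp add: zero_prod_def)
  qed (use z linear_0[OF \<alpha>] in auto)
  then have "dim (\<alpha> ` E) = dim E" using rank_nullity(1)[OF fd \<alpha>] by (simp add: dim_zero)
  moreover have "dim (\<alpha> ` E) < dim (R ` E \<times> R ` E)"
  proof (rule ccontr)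
    assume "\<not> dim (\<alpha> ` E) < dim (R ` E \<times> R ` E)"
    moreover have "\<alpha> ` E \<subseteq> R ` E \<times> R ` E"
      unfolding \<alpha>_def using imageI[OF sD(1), of _ R qi] by (auto simp: lext(2))
    ultimately have "\<alpha> ` E = R ` E \<times> R ` E"
      using subspace_eqI_dim[OF dim_Times_fin_dim(1) linear_subspace_image[OF \<alpha> sub]]
        rank_nullity(2)[OF fd R] by simp
    then show False using ne by blast
  qed
  moreover have "dim (R ` E \<times> R ` E) = dim (R ` E) + dim (R ` E)"
    by (intro dim_Times_fin_dim(2) rank_nullity(2)[OF fd R])
  moreover have "{x \<in> E. R x = 0} = K" using RK K(2) by blast
  then have "dim E = dim (R ` E) + dim K" using rank_nullity(1)[OF fd R] by simp
  ultimately show ?thesis by linarith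
qed

text \<open>\<open>K\<close> stands for the kernel of \<open>\<rho>\<close>. Up to isomorphism the
  pair determines the co-CR space, as \<open>\<rho>\<close> is onto and so \<open>U\<close> is the
  quotient of \<open>E\<close> by \<open>K\<close>.\<close>

definition crk :: "'a::real_vector set \<Rightarrow> (quat \<Rightarrow> 'a \<Rightarrow> 'a) \<Rightarrow> 'a set \<Rightarrow> bool" where
  "crk E s K \<longleftrightarrow> dmod UNIV s E \<and> fin_dim E \<and> subspace K \<and> K \<subseteq> E \<and>
     (\<forall>v. \<forall>x\<in>K. norm v = 1 \<longrightarrow> s (0, v) x \<in> K \<longrightarrow> x = 0)"

definition crk_iso :: "'a::real_vector set \<Rightarrow> (quat \<Rightarrow> 'a \<Rightarrow> 'a) \<Rightarrow> 'a set \<Rightarrow>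
    'b::real_vector set \<Rightarrow> (quat \<Rightarrow> 'b \<Rightarrow> 'b) \<Rightarrow> 'b set \<Rightarrow> bool" where
  "crk_iso E s K E' s' K' \<longleftrightarrow> (\<exists>f. dlin UNIV s s' E f \<and> bij_betw f E E' \<and> f ` K = K')"

lemma dmod_quat_hom:
  assumes "dmod UNIV s E"
  shows "quat_hom E (\<lambda>q x. if x \<in> E then s q x else 0)"
proof -
  note d = dmodD[OF assms] dmodD(2-5)[OF assms, OF UNIV_I] dmodD(4,5)[OF assms, OF UNIV_I UNIV_I]
  have sc: "s (r *\<^sub>R q) x = r *\<^sub>R s q x" if x: "x \<in> E" for r q x
  proof -
    show ?thesis
      unfolding qmult_real(1)[symmetric]
      using dmodD(5)[OF assms UNIV_I UNIV_I x] dmodD(6)[OF assms dmodD(2)[OF assms UNIV_I x]] by simp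
  qed
  have neg: "s q (r *\<^sub>R x) = r *\<^sub>R s q x" if x: "x \<in> E" for r q x
  proof -
    show ?thesis
      using dmodD(5)[OF assms UNIV_I UNIV_I x, of q "(r, 0)"] dmodD(6)[OF assms x] sc[OF x] by (simp add: qmult_real)
  qed
  have z: "s q 0 = 0" for q using neg[OF subspace_0[OF d(1)], of q 0] by simp
  show ?thesis
    unfolding quat_hom_def
  proof (intro conjI allI)
    show "linear (\<lambda>q x. if x \<in> E then s q x else 0)"
      by (rule linearI) (auto simp: fun_eq_iff scaleR_fun_def sc dmodD(4)[OF assms UNIV_I UNIV_I])
    show "(\<lambda>x. if x \<in> E then s q x else 0) \<in> Hom E E" for q
      by (rule HomI) (simp_all add: subspace_add[OF d(1)] subspace_scale[OF d(1)] neg dmodD(2,3)[OF assms UNIV_I])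
    show "(\<lambda>x. if x \<in> E then s (1, 0) x else 0) = id_map E"
      by (auto simp: id_map_def dmodD(6)[OF assms])
    show "(\<lambda>x. if x \<in> E then s (qmult p q) x else 0) =
        (\<lambda>x. if x \<in> E then s p x else 0) \<circ> (\<lambda>x. if x \<in> E then s q x else 0)" for p q
      by (auto simp: fun_eq_iff dmodD(5)[OF assms UNIV_I UNIV_I] dmodD(2)[OF assms UNIV_I] z)
  qed
qed

lemma crk_dim_less:
  assumes "crk E s K" "E \<noteq> {0}"
  shows "2 * dim K < dim E"
proof -
  interpret qmodule E "\<lambda>q x. if x \<in> E then s q x else 0"
    using assms(1) dmod_quat_hom unfolding crk_def by unfold_locales auto
  show ?thesis
    by (rule kernel_dim_less) (use assms in \<open>auto simp: crk_def split: if_splits\<close>)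
qed


section \<open>Free quaternionic modules and the pair of relations of a kernel\<close>

definition Hn :: "nat \<Rightarrow> (nat \<Rightarrow> quat) set" where
  "Hn d = {q. \<forall>i\<ge>d. q i = 0}"

definition hmul :: "quat \<Rightarrow> (nat \<Rightarrow> quat) \<Rightarrow> nat \<Rightarrow> quat" where
  "hmul p q = (\<lambda>i. qmult p (q i))"

lemma dmod_Hn: "dmod UNIV hmul (Hn d)"
  unfolding dmod_def
proof (intro conjI ballI allI)
  show "subspace (Hn d)" unfolding subspace_def Hn_def by (auto simp: scaleR_fun_def)
  have "qmult p 0 = 0" for p using qmult_real(2)[of p 0] by (simp add: zero_prod_def)
  then show "hmul p q \<in> Hn d" if "q \<in> Hn d" for p q using that unfolding Hn_def hmul_def by auto
qed (auto simp: hmul_def fun_eq_iff qmult_algebra qmult_real scaleR_fun_def)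

lemma Hn_dim: "fin_dim (Hn d) \<and> dim (Hn d) = 4 * d"
proof (induction d)
  case 0
  have "Hn 0 = {0}" unfolding Hn_def by (auto simp: fun_eq_iff)
  moreover have "fin_dim {0 :: nat \<Rightarrow> quat}" unfolding fin_dim_def by (intro exI[of _ "{}"]) simp
  ultimately show ?case by (simp add: dim_zero)
next
  case (Suc d)
  define \<epsilon> :: "quat \<Rightarrow> nat \<Rightarrow> quat" where "\<epsilon> x = (\<lambda>i. if i = d then x else 0)" for x
  have \<epsilon>: "linear \<epsilon>" by (rule linearI) (auto simp: \<epsilon>_def fun_eq_iff scaleR_fun_def)
  obtain B where B: "finite B" "span B = Hn d" using Suc unfolding fin_dim_def by blast
  have "Hn (Suc d) \<subseteq> span (B \<union> \<epsilon> ` Basis)"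
  proof
    fix q assume q: "q \<in> Hn (Suc d)"
    have "q - \<epsilon> (q d) \<in> span B"
      using q unfolding B(2) Hn_def \<epsilon>_def by (auto simp: not_less_eq_eq le_Suc_eq dest: le_neq_implies_less)
    moreover have "\<epsilon> (q d) \<in> span (\<epsilon> ` Basis)" unfolding linear_span_image[OF \<epsilon>] by simp
    ultimately have "q - \<epsilon> (q d) \<in> span (B \<union> \<epsilon> ` Basis)" "\<epsilon> (q d) \<in> span (B \<union> \<epsilon> ` Basis)"
      using subsetD[OF span_mono[OF Un_upper1]] subsetD[OF span_mono[OF Un_upper2]] by auto
    then have "q - \<epsilon> (q d) + \<epsilon> (q d) \<in> span (B \<union> \<epsilon> ` Basis)" by (rule span_add)
    then show "q \<in> span (B \<union> \<epsilon> ` Basis)" by simp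
  qed
  then have fd: "fin_dim (Hn (Suc d))"
    by (rule fin_dimI[OF dmodD(1)[OF dmod_Hn], rotated]) (simp add: B(1))
  have lin: "linear (\<lambda>q :: nat \<Rightarrow> quat. q d)" by (rule linearI) (auto simp: scaleR_fun_def)
  have "(\<lambda>q. q d) ` Hn (Suc d) = UNIV"
  proof (intro equalityI subsetI)
    fix x :: quat
    show "x \<in> (\<lambda>q. q d) ` Hn (Suc d)"
      by (rule image_eqI[of _ _ "\<epsilon> x"]) (simp_all add: Hn_def \<epsilon>_def)
  qed simp
  moreover have "{q \<in> Hn (Suc d). q d = 0} = Hn d"
    unfolding Hn_def by (auto simp: Suc_le_eq) (metis le_neq_implies_less)
  moreover have "dim (UNIV :: quat set) = 4" by simp
  ultimately show ?case using rank_nullity(1)[OF fd lin] fd Suc by simp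
qed

text \<open>A real basis \<open>k\<close> of \<open>K\<close> identifies the tensor product of the
  quaternions with \<open>K\<close> with the concrete module \<open>Hn d\<close>. So the module of
  relations \<open>E1\<close> has the same type for every \<open>E\<close>, which the induction
  relies on.\<close>

locale kframe =
  fixes E :: "'a::real_vector set" and s :: "quat \<Rightarrow> 'a \<Rightarrow> 'a" and K :: "'a set" and k :: "nat \<Rightarrow> 'a" and d :: nat
  assumes crk: "crk E s K" and K: "K = {\<Sum>i<d. r i *\<^sub>R k i |r. True}"
    and ind: "\<And>r i. (\<Sum>i<d. r i *\<^sub>R k i) = 0 \<Longrightarrow> i < d \<Longrightarrow> r i = 0" and d: "d = dim K"
begin

lemma E: "dmod UNIV s E" and fdE: "fin_dim E" and subK: "subspace K" and KE: "K \<subseteq> E"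
  and cond: "norm v = 1 \<Longrightarrow> x \<in> K \<Longrightarrow> s (0, v) x \<in> K \<Longrightarrow> x = 0"
  using crk unfolding crk_def by blast+

lemmas sE = dmodD(2)[OF E UNIV_I] dmodD(3)[OF E UNIV_I] dmodD(4)[OF E UNIV_I UNIV_I]
  dmodD(5)[OF E UNIV_I UNIV_I] dmodD(6)[OF E]
lemmas subE = dmodD(1)[OF E]

lemma s_scaleR:
  assumes x: "x \<in> E"
  shows "s (r *\<^sub>R q) x = r *\<^sub>R s q x" "s q (r *\<^sub>R x) = r *\<^sub>R s q x"
proof -
  have "s (r *\<^sub>R q) x = s (qmult (r, 0) q) x" by (simp add: qmult_real)
  also have "\<dots> = r *\<^sub>R s q x" unfolding sE(4)[OF x] by (rule sE(5)[OF sE(1)[OF x]])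
  finally show 1: "s (r *\<^sub>R q) x = r *\<^sub>R s q x" .
  have "s q (r *\<^sub>R x) = s (qmult q (r, 0)) x" unfolding sE(4)[OF x] sE(5)[OF x] ..
  then show "s q (r *\<^sub>R x) = r *\<^sub>R s q x" unfolding qmult_real 1 .
qed

lemma s_0: "s q 0 = 0"
  using s_scaleR(2)[OF subspace_0[OF subE], of q 0] by simp

lemma s_sum: "finite I \<Longrightarrow> (\<And>i. i \<in> I \<Longrightarrow> f i \<in> E) \<Longrightarrow> s q (sum f I) = (\<Sum>i\<in>I. s q (f i))"
proof (induction rule: finite_induct)
  case empty
  then show ?case by (simp add: s_0)
next
  case (insert x F)
  then show ?case by (simp add: sE(2) subspace_sum[OF subE])
qed

definition comb :: "(nat \<Rightarrow> real) \<Rightarrow> 'a" where "comb r = (\<Sum>i<d. r i *\<^sub>R k i)"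
definition \<mu> :: "(nat \<Rightarrow> quat) \<Rightarrow> 'a" where "\<mu> q = (\<Sum>i<d. s (q i) (k i))"
definition E1 :: "(nat \<Rightarrow> quat) set" where "E1 = {q \<in> Hn d. \<mu> q = 0}"
definition K1 :: "(nat \<Rightarrow> quat) set" where "K1 = {q \<in> E1. \<forall>i. fst (q i) = 0}"

lemma kK: "i < d \<Longrightarrow> k i \<in> K"
proof -
  assume i: "i < d"
  have "(\<Sum>j<d. (if j = i then 1 else 0) *\<^sub>R k j) = (\<Sum>j<d. if j = i then k j else 0)"
    by (rule sum.cong) auto
  then have "k i = (\<Sum>j<d. (if j = i then 1 else 0) *\<^sub>R k j)" using i by simp
  then show "k i \<in> K" unfolding K by (intro CollectI exI conjI TrueI)
qed

lemma kE: "i < d \<Longrightarrow> k i \<in> E" using kK KE by blast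

lemma comb_K: "comb r \<in> K" and K_comb: "x \<in> K \<Longrightarrow> \<exists>r. x = comb r"
  unfolding K comb_def by blast+

lemma s_comb: "s q (comb r) = (\<Sum>i<d. s q (r i *\<^sub>R k i))"
  unfolding comb_def by (rule s_sum) (auto intro: subspace_scale[OF subE] kE)

lemma comb_zero: "comb r = 0 \<longleftrightarrow> (\<forall>i<d. r i = 0)"
  unfolding comb_def using ind by auto

lemma comb_add: "comb (r + r') = comb r + comb r'" "comb (\<lambda>i. a * r i) = a *\<^sub>R comb r"
  unfolding comb_def by (simp_all add: scaleR_left_distrib sum.distrib scaleR_right.sum)

lemma \<mu>_E: "\<mu> q \<in> E"
  unfolding \<mu>_def using sE(1) kE by (intro subspace_sum[OF subE]) auto

lemma \<mu>_dlin: "dlin UNIV hmul s M \<mu>"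
  unfolding dlin_def
proof (intro conjI ballI)
  fix p q
  show "\<mu> (p + q) = \<mu> p + \<mu> q"
    unfolding \<mu>_def sum.distrib[symmetric] by (intro sum.cong) (simp_all add: sE(3)[OF kE])
next
  fix p q
  have "s p (\<mu> q) = (\<Sum>i<d. s p (s (q i) (k i)))"
    unfolding \<mu>_def by (rule s_sum) (auto intro: sE(1) kE)
  also have "\<dots> = \<mu> (hmul p q)"
    unfolding \<mu>_def hmul_def by (intro sum.cong) (simp_all add: sE(4)[OF kE])
  finally show "\<mu> (hmul p q) = s p (\<mu> q)" ..
qed

lemma \<mu>_real: "\<mu> (\<lambda>i. (r i, 0)) = comb r"
  unfolding \<mu>_def comb_def using sE(5)[OF kE] by (intro sum.cong) auto

lemma \<mu>_cong: "(\<And>i. i < d \<Longrightarrow> q i = q' i) \<Longrightarrow> \<mu> q = \<mu> q'"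
  unfolding \<mu>_def by (intro sum.cong) auto

text \<open>The coordinates of a quaternion \<open>q\<close> are the real parts of \<open>q\<close>,
  \<open>- i q\<close>, \<open>- j q\<close> and \<open>- k q\<close>. Thus \<open>\<mu>\<close> is
  known once the real parts of all multiples of its argument are, which links it to the isomorphism
  of relation pairs.\<close>

lemma \<mu>_components: "\<mu> q = comb (\<lambda>i. fst (hmul (1, 0) q i)) + s qi (comb (\<lambda>i. fst (hmul (- qi) q i)))
    + s qj (comb (\<lambda>i. fst (hmul (- qj) q i))) + s qk (comb (\<lambda>i. fst (hmul (- qk) q i)))"
proof -
  let ?c = "\<lambda>u i. fst (hmul u q i)"
  have comp: "q i = (?c (1, 0) i, 0) + ?c (- qi) i *\<^sub>R qi + ?c (- qj) i *\<^sub>R qj + ?c (- qk) i *\<^sub>R qk" for i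
  proof -
    obtain a b c d where "q i = Q4 a b c d" using Q4_exhaust by blast
    moreover have "(a, 0) = Q4 a 0 0 0" for a by (simp add: Q4_def vec3_eq_iff)
    ultimately show ?thesis
      unfolding hmul_def by (simp add: Q4_1 Q4_minus qmult_Q4 Q4_scale Q4_add) (simp add: Q4_def vec3_eq_iff)
  qed
  have "s (q i) (k i) = ?c (1, 0) i *\<^sub>R k i + s qi (?c (- qi) i *\<^sub>R k i) + s qj (?c (- qj) i *\<^sub>R k i) + s qk (?c (- qk) i *\<^sub>R k i)"
    if i: "i < d" for i
    by (subst comp) (simp only: sE(3,5)[OF kE[OF i]] s_scaleR[OF kE[OF i]])
  then show ?thesis
    unfolding \<mu>_def s_comb unfolding comb_def by (simp add: sum.distrib)
qed

lemma HK: "dmod UNIV s (\<mu> ` Hn d)" "\<mu> ` Hn d \<subseteq> E" "K \<subseteq> \<mu> ` Hn d" "fin_dim (\<mu> ` Hn d)"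
  "dim E1 + dim (\<mu> ` Hn d) = 4 * d" "dmod UNIV hmul E1" "fin_dim E1" "E1 \<subseteq> Hn d"
proof -
  show im: "\<mu> ` Hn d \<subseteq> E" using \<mu>_E by blast
  obtain g where g: "linear g" "\<And>q. q \<in> Hn d \<Longrightarrow> g q = \<mu> q"
    by (rule dlin_linear[OF division_subalgebra_quat dmod_Hn E \<mu>_dlin im]) (rule that)
  have gi: "\<mu> ` Hn d = g ` Hn d" using g(2) by force
  have gk: "E1 = {q \<in> Hn d. g q = 0}" unfolding E1_def using g(2) by auto
  have fd: "fin_dim (Hn d)" "dim (Hn d) = 4 * d" using Hn_dim by auto
  have "subspace (\<mu> ` Hn d)" unfolding gi by (rule linear_subspace_image[OF g(1) dmodD(1)[OF dmod_Hn]])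
  then show "dmod UNIV s (\<mu> ` Hn d)"
  proof (rule dmod_subspace[OF E _ im])
    fix p x assume "x \<in> \<mu> ` Hn d"
    then obtain q where q: "q \<in> Hn d" "x = \<mu> q" by blast
    show "s p x \<in> \<mu> ` Hn d"
      unfolding q(2) dlinD(2)[OF \<mu>_dlin UNIV_I q(1), symmetric] by (rule imageI[OF dmodD(2)[OF dmod_Hn UNIV_I q(1)]])
  qed
  show "K \<subseteq> \<mu> ` Hn d"
  proof
    fix x assume "x \<in> K"
    then obtain r where r: "x = comb r" using K_comb by blast
    have "x = \<mu> (\<lambda>i. if i < d then (r i, 0) else 0)"
      unfolding r \<mu>_real[symmetric] by (rule \<mu>_cong) simp
    moreover have "(\<lambda>i. if i < d then (r i, 0) else 0) \<in> Hn d" unfolding Hn_def by simp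
    ultimately show "x \<in> \<mu> ` Hn d" by blast
  qed
  show "fin_dim (\<mu> ` Hn d)" "dim E1 + dim (\<mu> ` Hn d) = 4 * d"
    using rank_nullity[OF fd(1) g(1)] fd(2) unfolding gi gk by auto
  show sub1: "E1 \<subseteq> Hn d" unfolding E1_def by blast
  have "subspace E1"
    unfolding gk using dmodD(1)[OF dmod_Hn, of d]
    by (auto simp: subspace_def linear_0[OF g(1)] linear_add[OF g(1)] linear_scale[OF g(1)])
  then show "dmod UNIV hmul E1"
  proof (rule dmod_subspace[OF dmod_Hn _ sub1])
    fix p q assume q: "q \<in> E1"
    show "hmul p q \<in> E1"
      using q dlinD(2)[OF \<mu>_dlin UNIV_I, of q "Hn d" p] dmodD(2)[OF dmod_Hn UNIV_I, of q d p] unfolding E1_def by (simp add: s_0)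
  qed
  then show "fin_dim E1" by (intro fin_dim_subset[OF fd(1) _ sub1] dmodD(1))
qed

text \<open>Together with \<open>HK\<close> this says that the image of \<open>\<mu>\<close> is the
  submodule generated by \<open>K\<close>, independently of the basis.\<close>

lemma HK_least:
  assumes F: "dmod UNIV s F" "K \<subseteq> F"
  shows "\<mu> ` Hn d \<subseteq> F"
proof (rule image_subsetI)
  fix q
  have "s (q i) (k i) \<in> F" if "i \<in> {..<d}" for i
    by (rule dmodD(2)[OF F(1) UNIV_I subsetD[OF F(2) kK]]) (use that in simp)
  then show "\<mu> q \<in> F" unfolding \<mu>_def by (rule subspace_sum[OF dmodD(1)[OF F(1)]])
qed

text \<open>Let \<open>H\<close> be the submodule generated by \<open>K\<close>. If \<open>H\<close>
  is nonzero, \<open>crk_dim_less\<close> for \<open>H\<close> and \<open>K\<close> gives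
  \<open>2 d < dim H\<close>, so \<open>dim E1 = 4 d - dim H < 2 d < dim H\<close>, which is at most
  \<open>dim E\<close>.\<close>

lemma E1_dim_less:
  assumes "E \<noteq> {0}"
  shows "dim E1 < dim E"
proof (cases "\<mu> ` Hn d = {0}")
  case True
  then have "K \<subseteq> {0}" using HK(3) by simp
  then have "d = 0" unfolding d using dim_mono_fin_dim[of "{0}" K] by (simp add: dim_zero fin_dim_def exI[of _ "{}"])
  moreover have "dim E \<noteq> 0"
    using assms subspace_eqI_dim[OF fdE subspace_single_0, unfolded dim_zero] subspace_0[OF subE] by auto
  ultimately show ?thesis using HK(5) by simp
next
  case False
  have "crk (\<mu> ` Hn d) s K" using HK(1,3,4) crk unfolding crk_def by blast
  then have "2 * d < dim (\<mu> ` Hn d)" unfolding d using crk_dim_less False d by blast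
  moreover have "dim (\<mu> ` Hn d) \<le> dim E" by (rule dim_mono_fin_dim[OF fdE HK(2)])
  ultimately show ?thesis using HK(5) by linarith
qed

text \<open>With \<open>v = i\<close> after a rotation, \<open>w\<close> and \<open>i w\<close> imaginary force \<open>w = j y + k z\<close> with \<open>y, z\<close> real,
  and \<open>\<mu> w = 0\<close> becomes \<open>\<mu> y = i \<mu> z\<close>.\<close>

lemma E1_crk: "crk E1 hmul K1"
  unfolding crk_def
proof (intro conjI allI ballI impI)
  show "dmod UNIV hmul E1" "fin_dim E1" by (rule HK)+
  show "K1 \<subseteq> E1" unfolding K1_def by blast
  show "subspace K1"
    using dmodD(1)[OF HK(6)] unfolding subspace_def K1_def by (auto simp: scaleR_fun_def)
  fix v :: "real ^ 3" and w assume v: "norm v = 1" and w: "w \<in> K1" "hmul (0, v) w \<in> K1"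
  obtain R :: "real ^ 3 ^ 3" where R: "rotation_matrix R" "R *v axis 1 1 = v" by (rule rotation_to_vector[OF v])
  define z y where "z i = (transpose R *v snd (w i)) $ 3" and "y i = (transpose R *v snd (w i)) $ 2" for i
  have RR: "so3_act R (so3_act (transpose R) q) = q" for q
    unfolding comp_apply[of "so3_act R" _ q, symmetric] so3_act_mult[symmetric] rotation_inverse(2)[OF R(1)] so3_act_one
    by simp
  \<comment> \<open>The real parts of \<open>w i\<close> and of \<open>v\<close> times
    \<open>w i\<close> vanish, so \<open>w i\<close> is imaginary and orthogonal to
    \<open>v\<close>; after rotating \<open>v\<close> to \<open>i\<close> only the coordinates along
    \<open>j\<close> and \<open>k\<close> remain.\<close>
  have wi: "w i = so3_act R (Q4 0 0 (y i) (z i))" for i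
  proof -
    have f: "fst (w i) = 0" "fst (qmult (0, v) (w i)) = 0" using w unfolding K1_def hmul_def by auto
    have "(R *v axis 1 1) \<bullet> snd (w i) = 0" using f unfolding R(2) by (simp add: qmult_def)
    then have "(transpose R *v snd (w i)) $ 1 = 0"
      using dot_lmul_matrix[of "snd (w i)" R "axis 1 1"] inner_commute[of "R *v axis 1 1"] by (simp add: inner_axis)
    then have "so3_act (transpose R) (w i) = Q4 0 0 (y i) (z i)"
      using f(1) unfolding so3_act_def y_def z_def by (simp add: Q4_def vec3_eq_iff)
    then show ?thesis using RR[of "w i"] by simp
  qed
  define t where "t q = s (so3_act R q)" for q
  have act: "so3_act R (a *\<^sub>R p + b *\<^sub>R q) = a *\<^sub>R so3_act R p + b *\<^sub>R so3_act R q" for a b p q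
    by (simp add: so3_act_def matrix_vector_right_distrib matrix_vector_mult_scaleR)
  have "t (Q4 0 0 (y i) (z i)) (k i) = t qj (y i *\<^sub>R k i) + t qk (z i *\<^sub>R k i)" if i: "i < d" for i
  proof -
    have "Q4 0 0 (y i) (z i) = y i *\<^sub>R qj + z i *\<^sub>R qk" unfolding Q4_scale Q4_add by simp
    then show ?thesis unfolding t_def by (simp add: act sE(3)[OF kE[OF i]] s_scaleR[OF kE[OF i]])
  qed
  then have "\<mu> w = t qj (comb y) + t qk (comb z)"
    unfolding \<mu>_def wi t_def s_comb by (simp add: sum.distrib)
  then have 0: "t qj (comb y) + t qk (comb z) = 0" using w(1) unfolding K1_def E1_def by simp
  have cE: "comb r \<in> E" for r using comb_K KE by blast
  have tm: "t p (t q x) = t (qmult p q) x" if "x \<in> E" for p q x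
    unfolding t_def so3_act_qmult[OF R(1)] using sE(4)[OF that] by simp
  have t1: "t (- (1, 0)) x = - x" if "x \<in> E" for x
    unfolding t_def so3_act_def using sE(5)[OF that, of "- 1"] by simp
  \<comment> \<open>Multiplication by \<open>j\<close> turns \<open>j y + k z = 0\<close> into
    \<open>i z = y\<close>, so \<open>z\<close> and \<open>v z\<close> both lie in
    \<open>K\<close>.\<close>
  have "t qj (t qj (comb y) + t qk (comb z)) = 0"
    unfolding 0 unfolding t_def by (rule s_0)
  then have "t qj (t qj (comb y)) + t qj (t qk (comb z)) = 0"
    unfolding t_def using sE(1,2) cE by simp
  then have "t (- (1, 0)) (comb y) + t qi (comb z) = 0"
    unfolding tm[OF cE] qmult_Q4 Q4_1 Q4_minus by simp
  then have eq: "t qi (comb z) = comb y" unfolding t1[OF cE] by simp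
  have "qi = (0, axis 1 1)" by (simp add: Q4_def vec3_eq_iff axis_def)
  then have "t qi = s (0, v)" unfolding t_def so3_act_def by (simp add: R(2))
  then have "comb z = 0" using cond[OF v comb_K] eq comb_K by metis
  then have "comb y = 0" using eq unfolding t_def by (simp add: s_0)
  show "w = 0"
  proof
    fix i
    show "w i = 0 i"
    proof (cases "i < d")
      case True
      then have "y i = 0" "z i = 0" using \<open>comb y = 0\<close> \<open>comb z = 0\<close> unfolding comb_zero by auto
      then show ?thesis by (simp add: wi Q4_0[symmetric] so3_act_def zero_prod_def)
    next
      case False
      then show ?thesis using w(1) unfolding K1_def E1_def Hn_def by simp
    qed
  qed
qed

end

lemma kframe_exists:
  assumes "crk E s K"
  obtains k where "kframe E s K k (dim K)"
proof -
  have "fin_dim K" using assms fin_dim_subset unfolding crk_def by blast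
  then obtain B where B: "finite B" "independent B" "span B = K" "card B = dim K" by (rule fin_dim_basis)
  obtain k where k: "bij_betw k {..<dim K} B"
    using ex_bij_betw_nat_finite[OF B(1)] unfolding atLeast0LessThan B(4) by blast
  have inj: "inj_on k {..<dim K}" and img: "B = k ` {..<dim K}" using k unfolding bij_betw_def by auto
  have re: "(\<Sum>i<dim K. r (k i) *\<^sub>R k i) = (\<Sum>b\<in>B. r b *\<^sub>R b)" for r
    unfolding img sum.reindex[OF inj] by simp
  have inv: "inv_into {..<dim K} k (k i) = i" if "i < dim K" for i using inv_into_f_f[OF inj] that by simp
  have re': "(\<Sum>i<dim K. r i *\<^sub>R k i) = (\<Sum>b\<in>B. r (inv_into {..<dim K} k b) *\<^sub>R b)" for r
    unfolding re[symmetric] using inv by (intro sum.cong) auto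
  have "kframe E s K k (dim K)"
  proof
    show "crk E s K" by fact
    show "K = {\<Sum>i<dim K. r i *\<^sub>R k i |r. True}"
    proof (intro set_eqI iffI)
      fix x assume "x \<in> K"
      then obtain u where "x = (\<Sum>b\<in>B. u b *\<^sub>R b)" unfolding B(3)[symmetric] span_finite[OF B(1)] by blast
      then show "x \<in> {\<Sum>i<dim K. r i *\<^sub>R k i |r. True}"
        unfolding re[symmetric] by (intro CollectI exI conjI TrueI)
    next
      fix x assume "x \<in> {\<Sum>i<dim K. r i *\<^sub>R k i |r. True}"
      then obtain r where r: "x = (\<Sum>i<dim K. r i *\<^sub>R k i)" by blast
      have "x \<in> span B" unfolding r re' by (intro span_sum span_scale span_base)
      then show "x \<in> K" unfolding B(3) .
    qed
    fix r i assume 0: "(\<Sum>i<dim K. r i *\<^sub>R k i) = 0" and i: "i < dim K"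
    have "r (inv_into {..<dim K} k (k i)) = 0"
      using independentD[OF B(2,1) order_refl 0[unfolded re']] img i by blast
    then show "r i = 0" using inv[OF i] by simp
  qed simp
  then show ?thesis by (rule that)
qed


section \<open>Recovering a pair from its relations\<close>

definition rmul :: "quat \<Rightarrow> 'a::real_vector \<Rightarrow> 'a" where "rmul q x = fst q *\<^sub>R x"

lemma dmod_real: "subspace E \<Longrightarrow> dmod (range (\<lambda>r. (r, 0))) rmul E"
  unfolding dmod_def rmul_def by (auto simp: subspace_scale scaleR_right_distrib scaleR_left_distrib qmult_def)

lemma hmul_real: "hmul (r, 0) q = r *\<^sub>R q"
  unfolding hmul_def by (simp add: qmult_real scaleR_fun_def)

text \<open>The isomorphism \<open>\<psi>\<close> of relation pairs is used to move the basis of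
  \<open>K\<close> to a basis \<open>l\<close> of \<open>K'\<close> with exactly the same relations.
  Equal relations identify the submodules generated by the kernels, and equal dimensions extend this
  to \<open>E\<close> and \<open>E'\<close>.\<close>

lemma crk_iso_of_kernels:
  assumes A: "kframe E s K k d" and B: "kframe E' s' K' k' d" and dims: "dim E = dim E'"
    and iso: "crk_iso (kframe.E1 s k d) hmul (kframe.K1 s k d) (kframe.E1 s' k' d) hmul (kframe.K1 s' k' d)"
  shows "crk_iso E s K E' s' K'"
proof -
  interpret A: kframe E s K k d by fact
  interpret B: kframe E' s' K' k' d by fact
  obtain \<psi> where \<psi>: "dlin UNIV hmul hmul A.E1 \<psi>" and bij: "bij_betw \<psi> A.E1 B.E1" and \<psi>K: "\<psi> ` A.K1 = B.K1"
    using iso unfolding crk_iso_def by blast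
  let ?R = "range (\<lambda>r. (r, 0)) :: quat set"
  have sub1: "subspace A.E1" by (rule dmodD(1)[OF A.HK(6)])
  have \<psi>E: "\<psi> e \<in> B.E1" if "e \<in> A.E1" for e using bij that unfolding bij_betw_def by blast
  \<comment> \<open>Taking real parts of a relation and combining them with the basis gives a map to
    \<open>K\<close> whose kernel is \<open>K1\<close>; \<open>p2\<close> is the same for
    \<open>K'\<close> after \<open>\<psi>\<close>. Since \<open>\<psi>\<close> matches
    \<open>K1\<close> with its counterpart, the kernels agree.\<close>
  define p1 where "p1 e = A.comb (\<lambda>i. fst (e i))" for e :: "nat \<Rightarrow> quat"
  define p2 where "p2 e = B.comb (\<lambda>i. fst (\<psi> e i))" for e
  have p1: "dlin ?R rmul rmul A.E1 p1"
    unfolding dlin_def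
  proof (intro conjI ballI)
    fix x y show "p1 (x + y) = p1 x + p1 y" unfolding p1_def A.comb_add(1)[symmetric] by (simp add: plus_fun_def)
  next
    fix q :: quat and x assume "q \<in> ?R"
    then show "p1 (rmul q x) = rmul q (p1 x)"
      unfolding p1_def rmul_def A.comb_add(2)[symmetric] by (simp add: scaleR_fun_def)
  qed
  have p2: "dlin ?R rmul rmul A.E1 p2"
    unfolding dlin_def
  proof (intro conjI ballI)
    fix x y assume "x \<in> A.E1" "y \<in> A.E1"
    then show "p2 (x + y) = p2 x + p2 y"
      unfolding p2_def B.comb_add(1)[symmetric] using dlinD(1)[OF \<psi>] by (simp add: plus_fun_def)
  next
    fix q :: quat and x assume "q \<in> ?R" and x: "x \<in> A.E1"
    then obtain r where r: "q = (r, 0)" by blast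
    have "\<psi> (r *\<^sub>R x) = r *\<^sub>R \<psi> x" using dlinD(2)[OF \<psi> UNIV_I x, of "(r, 0)"] by (simp add: hmul_real)
    then show "p2 (rmul q x) = rmul q (p2 x)"
      unfolding p2_def rmul_def r B.comb_add(2)[symmetric] by (simp add: scaleR_fun_def)
  qed
  have "p1 e = 0 \<longleftrightarrow> p2 e = 0" if e: "e \<in> A.E1" for e
  proof -
    have "fst (e i) = 0" "fst (\<psi> e i) = 0" if "\<not> i < d" for i
      using that e \<psi>E[OF e] A.HK(8) B.HK(8) unfolding Hn_def by auto
    then have "p1 e = 0 \<longleftrightarrow> e \<in> A.K1" "p2 e = 0 \<longleftrightarrow> \<psi> e \<in> B.K1"
      unfolding p1_def p2_def A.comb_zero B.comb_zero A.K1_def B.K1_def using e \<psi>E[OF e] by blast+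
    moreover have "\<psi> e \<in> B.K1 \<longleftrightarrow> e \<in> A.K1"
      unfolding \<psi>K[symmetric] using bij e A.K1_def unfolding bij_betw_def inj_on_def by blast
    ultimately show ?thesis by blast
  qed
  then obtain g where g: "\<And>e. e \<in> A.E1 \<Longrightarrow> g (p1 e) = p2 e" "bij_betw g (p1 ` A.E1) (p2 ` A.E1)"
      "dlin ?R rmul rmul (p1 ` A.E1) g"
    by (rule factor_iso[OF dmod_real[OF sub1] p1 p2]) (use that in blast)+
  have im: "p1 ` A.E1 \<subseteq> K" "p2 ` A.E1 \<subseteq> K'" unfolding p1_def p2_def using A.comb_K B.comb_K by auto
  have "subspace (p1 ` A.E1)"
  proof -
    obtain h where h: "linear h" "\<And>e. e \<in> A.E1 \<Longrightarrow> h e = p1 e"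
      by (rule dlin_linear[OF division_subalgebra_real dmod_real[OF sub1] dmod_real[OF A.subK] p1 im(1)]) (rule that)
    have "p1 ` A.E1 = h ` A.E1" using h(2) by force
    then show ?thesis using linear_subspace_image[OF h(1) sub1] by simp
  qed
  then have m: "dmod ?R rmul (p1 ` A.E1)" by (rule dmod_real)
  have gK: "g ` p1 ` A.E1 \<subseteq> K'" "inj_on g (p1 ` A.E1)" using g(2) im(2) unfolding bij_betw_def by auto
  have dK: "dim K = dim K'" using A.d B.d by simp
  \<comment> \<open>The extension from the image of \<open>p1\<close> to all of \<open>K\<close> is
    arbitrary; any one preserves the relations of the basis, as shown below.\<close>
  obtain G where G: "dlin ?R rmul rmul K G" "bij_betw G K K'" "\<And>x. x \<in> p1 ` A.E1 \<Longrightarrow> G x = g x"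
    using extend_iso[OF division_subalgebra_real dmod_real[OF A.subK] fin_dim_subset[OF A.fdE A.subK A.KE]
      dmod_real[OF B.subK] fin_dim_subset[OF B.fdE B.subK B.KE] dK m im(1) g(3) gK] by blast
  have GK: "G ` K = K'" "inj_on G K" using G(2) unfolding bij_betw_def by auto
  obtain h where h: "linear h" "\<And>x. x \<in> K \<Longrightarrow> h x = G x"
    by (rule dlin_linear[OF division_subalgebra_real dmod_real[OF A.subK] dmod_real[OF B.subK] G(1)])
      (use GK that in auto)
  define l where "l i = G (k i)" for i
  have l: "(\<Sum>i<d. r i *\<^sub>R l i) = G (A.comb r)" for r
  proof -
    have "(\<Sum>i<d. r i *\<^sub>R l i) = (\<Sum>i<d. r i *\<^sub>R h (k i))"
      unfolding l_def using h(2) A.kK by (intro sum.cong) auto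
    also have "\<dots> = h (A.comb r)"
      unfolding A.comb_def by (simp add: linear_sum[OF h(1)] linear_scale[OF h(1)])
    finally show ?thesis using h(2) A.comb_K by simp
  qed
  interpret C: kframe E' s' K' l d
  proof
    show "crk E' s' K'" by (rule B.crk)
    show "d = dim K'" by (rule B.d)
    show "K' = {\<Sum>i<d. r i *\<^sub>R l i |r. True}"
      unfolding l GK(1)[symmetric] A.K A.comb_def by blast
    fix r i assume 0: "(\<Sum>i<d. r i *\<^sub>R l i) = 0" and i: "i < d"
    have "G 0 = 0" by (rule dlin_diff(2)[OF G(1) A.subK subspace_0[OF A.subK] subspace_0[OF A.subK]])
    then have "A.comb r = 0"
      using 0 GK(2) A.comb_K subspace_0[OF A.subK] unfolding l inj_on_def by metis
    then show "r i = 0" using A.comb_zero i by blast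
  qed
  have Ccomb: "C.comb r = G (A.comb r)" for r unfolding C.comb_def l ..
  \<comment> \<open>For a relation \<open>e\<close> every multiple \<open>u e\<close> is a relation,
    and \<open>G\<close> sends the combination of its real parts to that of
    \<open>\<psi> (u e) = u (\<psi> e)\<close>. By \<open>\<mu>_components\<close> this gives
    \<open>C.\<mu> e = B.\<mu> (\<psi> e) = 0\<close>.\<close>
  have "A.E1 \<subseteq> C.E1"
  proof
    fix e assume e: "e \<in> A.E1"
    have "C.comb (\<lambda>i. fst (hmul u e i)) = B.comb (\<lambda>i. fst (hmul u (\<psi> e) i))" for u
    proof -
      have ue: "hmul u e \<in> A.E1" by (rule dmodD(2)[OF A.HK(6) UNIV_I e])
      have "C.comb (\<lambda>i. fst (hmul u e i)) = G (p1 (hmul u e))" unfolding Ccomb p1_def ..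
      also have "\<dots> = p2 (hmul u e)" using G(3) g(1) ue by simp
      finally show ?thesis unfolding p2_def dlinD(2)[OF \<psi> UNIV_I e] .
    qed
    then have "C.\<mu> e = B.\<mu> (\<psi> e)" unfolding C.\<mu>_components B.\<mu>_components by simp
    then show "e \<in> C.E1" using \<psi>E[OF e] e unfolding A.E1_def B.E1_def C.E1_def by simp
  qed
  \<comment> \<open>The submodule generated by \<open>K'\<close> is the same for both bases, so the
    relation modules of both have the same dimension; this turns the inclusion into an
    equality.\<close>
  moreover have "dim C.E1 \<le> dim A.E1"
  proof -
    have "B.\<mu> ` Hn d = C.\<mu> ` Hn d"
      using B.HK_least[OF C.HK(1,3)] C.HK_least[OF B.HK(1,3)] by blast
    then have "dim C.E1 = dim B.E1" using B.HK(5) C.HK(5) by simp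
    moreover have "dim B.E1 = dim A.E1"
      using dlin_bij_dim(1)[OF division_subalgebra_quat A.HK(6) B.HK(6) \<psi> _ _ A.HK(7)] bij
      unfolding bij_betw_def by auto
    ultimately show ?thesis by simp
  qed
  ultimately have eq: "A.E1 = C.E1" using subspace_eqI_dim[OF C.HK(7) sub1] by blast
  have "A.\<mu> q = 0 \<longleftrightarrow> C.\<mu> q = 0" if "q \<in> Hn d" for q
    using eq that unfolding A.E1_def C.E1_def by blast
  then obtain f where f: "\<And>q. q \<in> Hn d \<Longrightarrow> f (A.\<mu> q) = C.\<mu> q" "bij_betw f (A.\<mu> ` Hn d) (C.\<mu> ` Hn d)"
      "dlin UNIV s s' (A.\<mu> ` Hn d) f"
    by (rule factor_iso[OF dmod_Hn A.\<mu>_dlin C.\<mu>_dlin]) (use that in blast)+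
  have fE: "f ` A.\<mu> ` Hn d \<subseteq> E'" "inj_on f (A.\<mu> ` Hn d)" using f(2) C.HK(2) unfolding bij_betw_def by auto
  \<comment> \<open>The isomorphism between the generated submodules extends because submodules over
    a division algebra have complements and the total dimensions agree.\<close>
  obtain F where F: "dlin UNIV s s' E F" "bij_betw F E E'" "\<And>x. x \<in> A.\<mu> ` Hn d \<Longrightarrow> F x = f x"
    using extend_iso[OF division_subalgebra_quat A.E A.fdE B.E B.fdE dims A.HK(1,2) f(3) fE] by blast
  have Fc: "F (A.comb r) = C.comb r" for r
  proof -
    let ?q = "\<lambda>i. if i < d then (r i, 0) else 0 :: quat"
    have q: "?q \<in> Hn d" unfolding Hn_def by simp
    have "A.comb r = A.\<mu> ?q" "C.comb r = C.\<mu> ?q"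
      unfolding A.\<mu>_real[symmetric] C.\<mu>_real[symmetric] by (auto intro: A.\<mu>_cong C.\<mu>_cong)
    then show ?thesis using F(3) f(1)[OF q] q by simp
  qed
  have "F ` K = K'"
  proof (intro equalityI subsetI)
    fix y assume "y \<in> F ` K"
    then show "y \<in> K'" using A.K_comb Fc C.comb_K by force
  next
    fix y assume "y \<in> K'"
    then obtain r where "y = C.comb r" using C.K_comb by blast
    then show "y \<in> F ` K" using Fc A.comb_K by (metis imageI)
  qed
  then show ?thesis unfolding crk_iso_def using F(1,2) by blast
qed

text \<open>Finiteness is expressed by a numerical code that separates isomorphism classes. Codes
  can be compared across types, which matters because the relation pair lives in another type than
  the pair itself.\<close>

definition classifies :: "('a::real_vector set \<times> (quat \<Rightarrow> 'a \<Rightarrow> 'a) \<times> 'a set \<Rightarrow> nat) \<Rightarrow> nat \<Rightarrow> bool" where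
  "classifies c n \<longleftrightarrow> finite (c ` {(E, s, K). crk E s K \<and> dim E = n}) \<and>
     (\<forall>E s K E' s' K'. crk E s K \<longrightarrow> crk E' s' K' \<longrightarrow> dim E = n \<longrightarrow> dim E' = n \<longrightarrow>
        c (E, s, K) = c (E', s', K') \<longrightarrow> crk_iso E s K E' s' K')"

lemma classifiesD:
  "classifies c n \<Longrightarrow> crk E s K \<Longrightarrow> crk E' s' K' \<Longrightarrow> dim E = n \<Longrightarrow> dim E' = n \<Longrightarrow>
    c (E, s, K) = c (E', s', K') \<Longrightarrow> crk_iso E s K E' s' K'"
  unfolding classifies_def by blast

text \<open>The code of a pair consists of \<open>dim K\<close>, the dimension of the relation
  module and the code of the relation pair. The first is at most \<open>n\<close> and the second
  below \<open>n\<close>, so finitely many codes arise.\<close>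

lemma classifies_step:
  assumes IH: "\<And>m. m < n \<Longrightarrow> \<exists>c :: (nat \<Rightarrow> quat) set \<times> (quat \<Rightarrow> (nat \<Rightarrow> quat) \<Rightarrow> nat \<Rightarrow> quat) \<times> (nat \<Rightarrow> quat) set \<Rightarrow> nat. classifies c m"
  shows "\<exists>c :: 'a::real_vector set \<times> (quat \<Rightarrow> 'a \<Rightarrow> 'a) \<times> 'a set \<Rightarrow> nat. classifies c n"
proof (cases "n = 0")
  case True
  have E0: "E = {0} \<and> K = {0}" if "crk E s K" "dim E = n" for E :: "'a set" and s K
  proof -
    have E: "subspace E" "fin_dim E" "K \<subseteq> E" "subspace K" using that(1) dmodD(1) unfolding crk_def by blast+
    have "{0} = E" by (rule subspace_eqI_dim[OF E(2)]) (use that(2) True subspace_0[OF E(1)] in auto)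
    then show ?thesis using E(3) subspace_0[OF E(4)] by auto
  qed
  have "crk_iso E s K E' s' K'" if "crk E s K" "crk E' s' K'" "dim E = n" "dim E' = n" for E E' :: "'a set" and s s' K K'
  proof -
    have "s' q 0 = 0" for q
    proof -
      have "s' q 0 \<in> E'" using that(2) E0[OF that(2,4)] dmodD(2)[of UNIV s' E' q 0] unfolding crk_def by auto
      then show ?thesis using E0[OF that(2,4)] by simp
    qed
    then show ?thesis
      using E0[OF that(1,3)] E0[OF that(2,4)] unfolding crk_iso_def
      by (intro exI[of _ "\<lambda>_. 0"]) (auto simp: dlin_def bij_betw_def)
  qed
  moreover have "finite ((\<lambda>_. 0 :: nat) ` S)" for S :: "('a set \<times> (quat \<Rightarrow> 'a \<Rightarrow> 'a) \<times> 'a set) set"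
    by (rule finite_subset[of _ "{0}"]) auto
  ultimately show ?thesis unfolding classifies_def by (intro exI[of _ "\<lambda>_. 0"]) (auto simp: image_constant_conv)
next
  case False
  obtain c :: "nat \<Rightarrow> (nat \<Rightarrow> quat) set \<times> (quat \<Rightarrow> (nat \<Rightarrow> quat) \<Rightarrow> nat \<Rightarrow> quat) \<times> (nat \<Rightarrow> quat) set \<Rightarrow> nat"
    where c: "\<And>m. m < n \<Longrightarrow> classifies (c m) m" using IH by metis
  \<comment> \<open>The relation pair depends on a basis of \<open>K\<close>, so one is chosen for
    each pair.\<close>
  define fr :: "'a set \<Rightarrow> (quat \<Rightarrow> 'a \<Rightarrow> 'a) \<Rightarrow> 'a set \<Rightarrow> nat \<Rightarrow> 'a"
    where "fr E s K = (SOME k. kframe E s K k (dim K))" for E s K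
  have fr: "kframe E s K (fr E s K) (dim K)" if "crk E s K" for E s K
    unfolding fr_def using kframe_exists[OF that] someI_ex[of "\<lambda>k. kframe E s K k (dim K)"] by blast
  define Er where "Er E s K = kframe.E1 s (fr E s K) (dim K)" for E s K
  define Kr where "Kr E s K = kframe.K1 s (fr E s K) (dim K)" for E s K
  define code where "code = (\<lambda>(E, s, K). prod_encode (dim K, prod_encode (dim (Er E s K), c (dim (Er E s K)) (Er E s K, hmul, Kr E s K))))"
  have less: "dim (Er E s K) < n" "crk (Er E s K) hmul (Kr E s K)" "dim K \<le> n" if "crk E s K" "dim E = n" for E s K
  proof -
    interpret kframe E s K "fr E s K" "dim K" by (rule fr[OF that(1)])
    have "E \<noteq> {0}" using that(2) False dim_zero by metis
    then show "dim (Er E s K) < n" "crk (Er E s K) hmul (Kr E s K)" "dim K \<le> n"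
      using E1_dim_less E1_crk dim_mono_fin_dim[OF fdE KE] that(2) unfolding Er_def Kr_def by auto
  qed
  define T where "T m = c m ` {(E, s, K). crk E s K \<and> dim E = m}" for m
  have finT: "finite (T m)" if "m < n" for m using c[OF that] unfolding classifies_def T_def by blast
  have "code ` {(E, s, K). crk E s K \<and> dim E = n} \<subseteq> (\<lambda>(d, m, j). prod_encode (d, prod_encode (m, j))) ` ({..n} \<times> Sigma {..<n} T)"
  proof
    fix x assume "x \<in> code ` {(E, s, K). crk E s K \<and> dim E = n}"
    then obtain E s K where t: "crk E s K" "dim E = n" "x = code (E, s, K)" by blast
    have "c (dim (Er E s K)) (Er E s K, hmul, Kr E s K) \<in> T (dim (Er E s K))"
      unfolding T_def using less(2)[OF t(1,2)] by blast
    then have "(dim K, dim (Er E s K), c (dim (Er E s K)) (Er E s K, hmul, Kr E s K)) \<in> {..n} \<times> Sigma {..<n} T"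
      using less(1,3)[OF t(1,2)] by simp
    then show "x \<in> (\<lambda>(d, m, j). prod_encode (d, prod_encode (m, j))) ` ({..n} \<times> Sigma {..<n} T)"
      unfolding t(3) code_def by (rule rev_image_eqI) simp
  qed
  moreover have "finite ((\<lambda>(d, m, j). prod_encode (d, prod_encode (m, j))) ` ({..n} \<times> Sigma {..<n} T))"
    using finT by (intro finite_imageI finite_cartesian_product finite_SigmaI) auto
  ultimately have "finite (code ` {(E, s, K). crk E s K \<and> dim E = n})" by (rule finite_subset)
  moreover have "crk_iso E s K E' s' K'"
    if t: "crk E s K" "crk E' s' K'" "dim E = n" "dim E' = n" and eq: "code (E, s, K) = code (E', s', K')" for E s K E' s' K'
  proof -
    have e: "dim K = dim K'" "dim (Er E s K) = dim (Er E' s' K')"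
      "c (dim (Er E s K)) (Er E s K, hmul, Kr E s K) = c (dim (Er E s K)) (Er E' s' K', hmul, Kr E' s' K')"
      using eq unfolding code_def by (auto simp: prod_encode_eq)
    have "crk_iso (Er E s K) hmul (Kr E s K) (Er E' s' K') hmul (Kr E' s' K')"
      by (rule classifiesD[OF c[OF less(1)[OF t(1,3)]] less(2)[OF t(1,3)] less(2)[OF t(2,4)] refl e(2)[symmetric] e(3)])
    then show ?thesis
      using crk_iso_of_kernels[OF fr[OF t(1)] fr[OF t(2), folded e(1)]] t(3,4) unfolding Er_def Kr_def e(1) by simp
  qed
  ultimately show ?thesis unfolding classifies_def by blast
qed

text \<open>Relation pairs always live in \<open>nat \<Rightarrow> quat\<close>. The induction is
  therefore run at this type alone, and one more step reaches an arbitrary ambient type.\<close>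

lemma classification: "\<exists>c :: 'a::real_vector set \<times> (quat \<Rightarrow> 'a \<Rightarrow> 'a) \<times> 'a set \<Rightarrow> nat. classifies c n"
proof (rule classifies_step)
  fix m show "\<exists>c :: (nat \<Rightarrow> quat) set \<times> (quat \<Rightarrow> (nat \<Rightarrow> quat) \<Rightarrow> nat \<Rightarrow> quat) \<times> (nat \<Rightarrow> quat) set \<Rightarrow> nat. classifies c m"
    by (induction m rule: less_induct) (rule classifies_step)
qed

section \<open>Passing from pairs back to co-CR quaternionic vector spaces\<close>

lemma cocr_crk:
  assumes "cocr_quat X" "\<sigma> \<in> qstr X"
  shows "crk (qspc X) \<sigma> {x \<in> qspc X. rho X x = 0}"
proof -
  interpret cocrs X \<sigma> using assms by unfold_locales
  have "\<sigma> (r, 0) x = r *\<^sub>R x" if "x \<in> qspc X" for r x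
    using E.s_scale[of r "(1, 0)" x] E.s_one[OF that] by simp
  then have "dmod UNIV \<sigma> (qspc X)"
    unfolding dmod_def by (simp add: E.sub E.sD(1,2) E.s_add E.s_mult del: split_paired_All)
  moreover have "subspace {x \<in> qspc X. rho X x = 0}"
    using E.sub HomD(2,3)[OF rho] Hom_more(1)[OF rho E.sub] by (auto simp: subspace_def)
  moreover have "x = 0" if "norm v = 1" "x \<in> qspc X" "rho X x = 0" "rho X (\<sigma> (0, v) x) = 0" for v x
    by (rule kernel_condition[OF X, of "\<sigma> (0, v)", OF _ that(2-4)]) (use that(1) adm_structure[OF Qrep] in blast)
  ultimately show ?thesis unfolding crk_def using E.fd by auto
qed

text \<open>A module map that matches the kernels descends along the surjections
  \<open>\<rho>\<close> to the map \<open>t\<close>; the map \<open>T\<close> is the identity in the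
  coordinates given by \<open>\<sigma>\<close> and \<open>\<sigma>'\<close>.\<close>

lemma cocr_mor_of_crk_iso:
  fixes X Y :: "('u::real_vector, 'e::real_vector) cocr"
  assumes X: "cocrs X \<sigma>" and Y: "cocrs Y \<sigma>'" and \<phi>: "dlin UNIV \<sigma> \<sigma>' (qspc X) \<phi>" "\<And>x. x \<in> qspc X \<Longrightarrow> \<phi> x \<in> qspc Y"
    and ker: "\<And>x. x \<in> qspc X \<Longrightarrow> rho X x = 0 \<longleftrightarrow> rho Y (\<phi> x) = 0"
  shows "\<exists>t T. (t, T) \<in> cocr_mor X Y \<and> (\<forall>x\<in>qspc X. t (rho X x) = rho Y (\<phi> x)) \<and>
    (\<forall>v. norm v = 1 \<longrightarrow> T (\<sigma> (0, v)) = \<sigma>' (0, v))"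
proof -
  interpret X: cocrs X \<sigma> by fact
  interpret Y: cocrs Y \<sigma>' by fact
  let ?R = "range (\<lambda>r. (r, 0)) :: quat set"
  have \<phi>r: "\<phi> (r *\<^sub>R x) = r *\<^sub>R \<phi> x" if x: "x \<in> qspc X" for r x
    using dlinD(2)[OF \<phi>(1) UNIV_I x, of "(r, 0)"] X.E.s_scale[of r "(1, 0)" x] Y.E.s_scale[of r "(1, 0)" "\<phi> x"]
      X.E.s_one[OF x] Y.E.s_one[OF \<phi>(2)[OF x]] by simp
  have \<phi>0: "\<phi> 0 = 0" by (rule dlin_diff(2)[OF \<phi>(1) X.E.sub subspace_0[OF X.E.sub] subspace_0[OF X.E.sub]])
  have rho0: "rho Y 0 = 0" by (rule Hom_more(1)[OF Y.rho Y.E.sub])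
  have p1: "dlin ?R rmul rmul (qspc X) (rho X)"
    unfolding dlin_def rmul_def using HomD(2,3)[OF X.rho] by simp
  have p2: "dlin ?R rmul rmul (qspc X) (\<lambda>x. rho Y (\<phi> x))"
    unfolding dlin_def rmul_def
    using HomD(2,3)[OF Y.rho] \<phi>(2) \<phi>r dlinD(1)[OF \<phi>(1)] by simp
  obtain f where f: "\<And>x. x \<in> qspc X \<Longrightarrow> f (rho X x) = rho Y (\<phi> x)" "dlin ?R rmul rmul (rho X ` qspc X) f"
    by (rule factor_iso[OF dmod_real[OF X.E.sub] p1 p2 ker]) (use that in blast)+
  define t where "t u = (if u \<in> spc X then f u else 0)" for u
  have t: "t (rho X x) = rho Y (\<phi> x)" if "x \<in> qspc X" for x
    unfolding t_def using f(1)[OF that] HomD(1)[OF X.rho that] by simp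
  define T where "T = restrict (\<lambda>J. \<sigma>' (inv \<sigma> J)) (adm (qstr X))"
  have admX: "adm (qstr X) = {\<sigma> (0, v) |v. norm v = 1}" and admY: "adm (qstr Y) = {\<sigma>' (0, v) |v. norm v = 1}"
    by (rule adm_structure[OF X.Qrep], rule adm_structure[OF Y.Qrep])
  have inj: "inj \<sigma>" using X.E.s_inj by (rule injI)
  have T: "T (\<sigma> (0, v)) = \<sigma>' (0, v)" if "norm v = 1" for v
    unfolding T_def using that admX inv_f_f[OF inj] by auto
  have tHom: "t \<in> Hom (spc X) (spc Y)"
  proof (rule HomI)
    have subU: "subspace (spc X)" by (rule fin_dim_subspace[OF X.fdU])
    show "t u \<in> spc Y" if "u \<in> spc X" for u
      using that t HomD(1)[OF Y.rho] \<phi>(2) unfolding X.rho_surj[symmetric] by auto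
    show "t (u + v) = t u + t v" if "u \<in> spc X" "v \<in> spc X" for u v
      using that dlinD(1)[OF f(2)] subspace_add[OF subU] unfolding t_def X.rho_surj by simp
    show "t (r *\<^sub>R u) = r *\<^sub>R t u" if "u \<in> spc X" for r u
      using that dlinD(2)[OF f(2), of "(r, 0)" u] subspace_scale[OF subU] unfolding t_def X.rho_surj rmul_def by simp
  qed (simp add: t_def)
  have "orient_isometry (qstr X) (qstr Y) T"
    unfolding orient_isometry_def
  proof (intro conjI)
    show "T \<in> adm (qstr X) \<rightarrow>\<^sub>E adm (qstr Y)"
    proof (rule PiE_I)
      show "T J \<in> adm (qstr Y)" if "J \<in> adm (qstr X)" for J
        using that T unfolding admX admY by auto
    qed (simp add: T_def)
    show "\<exists>\<sigma>\<in>qstr X. \<exists>\<sigma>'\<in>qstr Y. \<exists>A. rotation_matrix A \<and> (\<forall>v. norm v = 1 \<longrightarrow> T (\<sigma> (0, v)) = \<sigma>' (0, A *v v))"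
      by (rule bexI[OF _ X.s], rule bexI[OF _ Y.s], rule exI[of _ "mat 1"]) (simp add: T rotation_one)
  qed
  moreover have "quat_linear (qspc X) (qstr X) (qspc Y) T (\<lambda>x. if x \<in> qspc X then \<phi> x else 0)"
    unfolding quat_linear_def
  proof (intro conjI ballI)
    show "(\<lambda>x. if x \<in> qspc X then \<phi> x else 0) \<in> Hom (qspc X) (qspc Y)"
      by (rule HomI) (simp_all add: \<phi>(2) \<phi>r dlinD(1)[OF \<phi>(1)] subspace_add[OF X.E.sub] subspace_scale[OF X.E.sub])
    fix J assume "J \<in> adm (qstr X)"
    then obtain v where v: "norm v = 1" "J = \<sigma> (0, v)" unfolding admX by blast
    show "(\<lambda>x. if x \<in> qspc X then \<phi> x else 0) \<circ> J = T J \<circ> (\<lambda>x. if x \<in> qspc X then \<phi> x else 0)"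
      unfolding v(2) T[OF v(1)]
      by (rule HOL.ext) (simp add: X.E.sD(1,4,5) Y.E.sD(5) dlinD(2)[OF \<phi>(1)] \<phi>0)
  qed
  moreover have "rho Y \<circ> (\<lambda>x. if x \<in> qspc X then \<phi> x else 0) = t \<circ> rho X"
  proof
    fix x
    have "t 0 = 0" using t[OF subspace_0[OF X.E.sub]] Hom_more(1)[OF X.rho X.E.sub] \<phi>0 rho0 by simp
    then show "(rho Y \<circ> (\<lambda>x. if x \<in> qspc X then \<phi> x else 0)) x = (t \<circ> rho X) x"
      using t[of x] HomD(4)[OF X.rho, of x] rho0 by simp
  qed
  ultimately have "(t, T) \<in> cocr_mor X Y" unfolding cocr_mor_def using tHom by blast
  then show ?thesis using t T by blast
qed

lemma cocr_mor_inverse: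
  assumes X: "cocrs X \<sigma>" and Y: "cocrs Y \<sigma>'"
    and t: "(t, T) \<in> cocr_mor X Y" "\<And>x. x \<in> qspc X \<Longrightarrow> t (rho X x) = rho Y (\<phi> x)"
      "\<And>v. norm v = 1 \<Longrightarrow> T (\<sigma> (0, v)) = \<sigma>' (0, v)"
    and u: "(u, S) \<in> cocr_mor Y X" "\<And>y. y \<in> qspc Y \<Longrightarrow> u (rho Y y) = rho X (\<psi> y)"
      "\<And>v. norm v = 1 \<Longrightarrow> S (\<sigma>' (0, v)) = \<sigma> (0, v)"
    and mem: "\<And>x. x \<in> qspc X \<Longrightarrow> \<phi> x \<in> qspc Y" and inv: "\<And>x. x \<in> qspc X \<Longrightarrow> \<psi> (\<phi> x) = x"
  shows "(u \<circ> t, compose (adm (qstr X)) S T) = (id_map (spc X), restrict id (adm (qstr X)))"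
proof -
  interpret X: cocrs X \<sigma> by fact
  interpret Y: cocrs Y \<sigma>' by fact
  have "(u \<circ> t) x = id_map (spc X) x" for x
  proof (cases "x \<in> spc X")
    case True
    then obtain e where e: "e \<in> qspc X" "x = rho X e" unfolding X.rho_surj[symmetric] by blast
    show ?thesis using True unfolding e(2) by (simp add: id_map_def t(2)[OF e(1)] u(2)[OF mem[OF e(1)]] inv[OF e(1)])
  next
    case False
    then show ?thesis
      using HomD(4)[OF cocr_morD(1)[OF t(1)]] Hom_more(1)[OF cocr_morD(1)[OF u(1)] fin_dim_subspace[OF Y.fdU]]
      by (simp add: id_map_def)
  qed
  moreover have "compose (adm (qstr X)) S T J = restrict id (adm (qstr X)) J" for J
  proof (cases "J \<in> adm (qstr X)")
    case True
    then obtain v where "norm v = 1" "J = \<sigma> (0, v)" unfolding adm_structure[OF X.Qrep] by blast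
    then show ?thesis using True by (simp add: compose_eq t(3) u(3))
  qed (simp add: compose_def)
  ultimately show ?thesis by (simp add: fun_eq_iff)
qed

lemma cocr_iso_of_crk_iso:
  fixes X Y :: "('u::real_vector, 'e::real_vector) cocr"
  assumes X: "cocrs X \<sigma>" and Y: "cocrs Y \<sigma>'"
    and iso: "crk_iso (qspc X) \<sigma> {x \<in> qspc X. rho X x = 0} (qspc Y) \<sigma>' {x \<in> qspc Y. rho Y x = 0}"
  shows "\<exists>t. is_iso cocr_cat X Y t"
proof -
  interpret X: cocrs X \<sigma> by fact
  interpret Y: cocrs Y \<sigma>' by fact
  obtain \<phi> where \<phi>: "dlin UNIV \<sigma> \<sigma>' (qspc X) \<phi>" "bij_betw \<phi> (qspc X) (qspc Y)"
    "\<phi> ` {x \<in> qspc X. rho X x = 0} = {x \<in> qspc Y. rho Y x = 0}"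
    using iso unfolding crk_iso_def by blast
  define \<psi> where "\<psi> = inv_into (qspc X) \<phi>"
  have dm: "dmod UNIV \<sigma> (qspc X)" using cocr_crk[OF X.X X.s] unfolding crk_def by blast
  have \<psi>: "dlin UNIV \<sigma>' \<sigma> (qspc Y) \<psi>" unfolding \<psi>_def by (rule dlin_inv[OF dm \<phi>(1,2)])
  have mem: "\<And>x. x \<in> qspc X \<Longrightarrow> \<phi> x \<in> qspc Y" "\<And>y. y \<in> qspc Y \<Longrightarrow> \<psi> y \<in> qspc X"
    and inv: "\<And>x. x \<in> qspc X \<Longrightarrow> \<psi> (\<phi> x) = x" "\<And>y. y \<in> qspc Y \<Longrightarrow> \<phi> (\<psi> y) = y"
    using \<phi>(2) inv_into_into[of _ \<phi> "qspc X"] inv_into_f_f[of \<phi> "qspc X"] f_inv_into_f[of _ \<phi> "qspc X"]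
    unfolding bij_betw_def \<psi>_def by auto
  have ker: "rho X x = 0 \<longleftrightarrow> rho Y (\<phi> x) = 0" if x: "x \<in> qspc X" for x
  proof
    assume "rho X x = 0"
    then have "\<phi> x \<in> {x \<in> qspc Y. rho Y x = 0}" unfolding \<phi>(3)[symmetric] using x by blast
    then show "rho Y (\<phi> x) = 0" by simp
  next
    assume "rho Y (\<phi> x) = 0"
    then have "\<phi> x \<in> \<phi> ` {x \<in> qspc X. rho X x = 0}" unfolding \<phi>(3) using mem(1)[OF x] by simp
    then obtain x' where x': "\<phi> x = \<phi> x'" "x' \<in> {x \<in> qspc X. rho X x = 0}" by (rule imageE)
    have "x = \<psi> (\<phi> x)" by (rule inv(1)[OF x, symmetric])
    also have "\<dots> = \<psi> (\<phi> x')" by (rule arg_cong[OF x'(1)])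
    also have "\<dots> = x'" by (rule inv(1)) (use x'(2) in blast)
    finally show "rho X x = 0" using x'(2) by blast
  qed
  have ker': "rho Y y = 0 \<longleftrightarrow> rho X (\<psi> y) = 0" if "y \<in> qspc Y" for y
    using ker[OF mem(2)[OF that]] inv(2)[OF that] by simp
  have "\<exists>t T. (t, T) \<in> cocr_mor X Y \<and> (\<forall>x\<in>qspc X. t (rho X x) = rho Y (\<phi> x)) \<and>
      (\<forall>v. norm v = 1 \<longrightarrow> T (\<sigma> (0, v)) = \<sigma>' (0, v))"
    by (rule cocr_mor_of_crk_iso[OF X Y \<phi>(1)]) (erule mem(1), erule ker)
  then obtain t T where t: "(t, T) \<in> cocr_mor X Y" "\<And>x. x \<in> qspc X \<Longrightarrow> t (rho X x) = rho Y (\<phi> x)"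
    "\<And>v. norm v = 1 \<Longrightarrow> T (\<sigma> (0, v)) = \<sigma>' (0, v)" by blast
  have "\<exists>u S. (u, S) \<in> cocr_mor Y X \<and> (\<forall>y\<in>qspc Y. u (rho Y y) = rho X (\<psi> y)) \<and>
      (\<forall>v. norm v = 1 \<longrightarrow> S (\<sigma>' (0, v)) = \<sigma> (0, v))"
    by (rule cocr_mor_of_crk_iso[OF Y X \<psi>]) (erule mem(2), erule ker')
  then obtain u S where u: "(u, S) \<in> cocr_mor Y X" "\<And>y. y \<in> qspc Y \<Longrightarrow> u (rho Y y) = rho X (\<psi> y)"
    "\<And>v. norm v = 1 \<Longrightarrow> S (\<sigma>' (0, v)) = \<sigma> (0, v)" by blast
  have ut: "(u \<circ> t, compose (adm (qstr X)) S T) = (id_map (spc X), restrict id (adm (qstr X)))"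
    by (rule cocr_mor_inverse[where \<phi> = \<phi> and \<psi> = \<psi>, OF X Y t(1) _ _ u(1)])
      (erule t(2) t(3) u(2) u(3) mem(1) inv(1))+
  have tu: "(t \<circ> u, compose (adm (qstr Y)) T S) = (id_map (spc Y), restrict id (adm (qstr Y)))"
    by (rule cocr_mor_inverse[where \<phi> = \<psi> and \<psi> = \<phi>, OF Y X u(1) _ _ t(1)])
      (erule t(2) t(3) u(2) u(3) mem(2) inv(2))+
  have "is_iso cocr_cat X Y (t, T)"
    unfolding is_iso_def
    using t(1) u(1) ut tu by (intro conjI bexI[of _ "(u, S)"]) (simp_all add: cocr_cat_def)
  then show ?thesis by blast
qed

lemma iso_rel_trans:
  assumes C: "is_category C" and XY: "(X, Y) \<in> iso_rel C" and YZ: "(Y, Z) \<in> iso_rel C"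
  shows "(X, Z) \<in> iso_rel C"
proof -
  have id: "\<And>X Y f. X \<in> Obj C \<Longrightarrow> Y \<in> Obj C \<Longrightarrow> f \<in> Mor C X Y \<Longrightarrow> Cmp C X X Y f (Idn C X) = f"
    and cmp: "\<And>X Y Z f g. X \<in> Obj C \<Longrightarrow> Y \<in> Obj C \<Longrightarrow> Z \<in> Obj C \<Longrightarrow> f \<in> Mor C X Y \<Longrightarrow> g \<in> Mor C Y Z \<Longrightarrow>
      Cmp C X Y Z g f \<in> Mor C X Z"
    and assoc: "\<And>X Y Z W f g h. X \<in> Obj C \<Longrightarrow> Y \<in> Obj C \<Longrightarrow> Z \<in> Obj C \<Longrightarrow> W \<in> Obj C \<Longrightarrow>
      f \<in> Mor C X Y \<Longrightarrow> g \<in> Mor C Y Z \<Longrightarrow> h \<in> Mor C Z W \<Longrightarrow>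
      Cmp C X Z W h (Cmp C X Y Z g f) = Cmp C X Y W (Cmp C Y Z W h g) f"
    using C unfolding is_category_def by blast+
  obtain f f' where O: "X \<in> Obj C" "Y \<in> Obj C" and f: "f \<in> Mor C X Y" "f' \<in> Mor C Y X"
    "Cmp C X Y X f' f = Idn C X" "Cmp C Y X Y f f' = Idn C Y"
    using XY unfolding iso_rel_def is_iso_def by blast
  obtain g g' where O': "Z \<in> Obj C" and g: "g \<in> Mor C Y Z" "g' \<in> Mor C Z Y"
    "Cmp C Y Z Y g' g = Idn C Y" "Cmp C Z Y Z g g' = Idn C Z"
    using YZ unfolding iso_rel_def is_iso_def by blast
  note gf = cmp[OF O O' f(1) g(1)] and fg' = cmp[OF O' O(2,1) g(2) f(2)]
  have "Cmp C X Z X (Cmp C Z Y X f' g') (Cmp C X Y Z g f) = Idn C X"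
    unfolding assoc[OF O O' O(1) f(1) g(1) fg'] assoc[OF O(2) O' O(2,1) g(1,2) f(2), symmetric] g(3) id[OF O(2,1) f(2)] f(3) ..
  moreover have "Cmp C Z X Z (Cmp C X Y Z g f) (Cmp C Z Y X f' g') = Idn C Z"
    unfolding assoc[OF O' O(2,1) O' g(2) f(2) gf] assoc[OF O(2,1,2) O' f(2,1) g(1), symmetric] f(4) id[OF O(2) O' g(1)] g(4) ..
  ultimately show ?thesis unfolding iso_rel_def is_iso_def using O O' gf fg' by blast
qed

lemma iso_rel_sym: "(X, Y) \<in> iso_rel C \<Longrightarrow> (Y, X) \<in> iso_rel C"
  unfolding iso_rel_def is_iso_def by blast

text \<open>Objects with the same code are isomorphic, so choosing an object for each of the
  finitely many codes already meets every class.\<close>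

theorem cocr_classes_finite:
  "finite ({X \<in> Obj (cocr_cat :: (('u::real_vector, 'e::real_vector) cocr, _) cat). dim (qspc X) = n} // iso_rel cocr_cat)"
proof -
  let ?C = "cocr_cat :: (('u, 'e) cocr, _) cat"
  let ?S = "{X \<in> Obj ?C. dim (qspc X) = n}"
  have Obj: "X \<in> Obj ?C \<longleftrightarrow> cocr_quat X" for X by (simp add: cocr_cat_def)
  obtain c :: "'e set \<times> (quat \<Rightarrow> 'e \<Rightarrow> 'e) \<times> 'e set \<Rightarrow> nat" where c: "classifies c n" using classification by blast
  define st :: "('u, 'e) cocr \<Rightarrow> quat \<Rightarrow> 'e \<Rightarrow> 'e" where "st X = (SOME \<sigma>. \<sigma> \<in> qstr X)" for X
  have st: "st X \<in> qstr X" if "X \<in> Obj ?C" for X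
    unfolding st_def using cocr_basic(6) that Obj by (metis someI_ex)
  define code where "code X = c (qspc X, st X, {x \<in> qspc X. rho X x = 0})" for X :: "('u, 'e) cocr"
  have eq: "iso_rel ?C `` {X} = iso_rel ?C `` {Y}" if X: "X \<in> ?S" and Y: "Y \<in> ?S" and e: "code X = code Y" for X Y
  proof -
    have O: "X \<in> Obj ?C" "Y \<in> Obj ?C" and d: "dim (qspc X) = n" "dim (qspc Y) = n" using X Y by auto
    have "crk_iso (qspc X) (st X) {x \<in> qspc X. rho X x = 0} (qspc Y) (st Y) {x \<in> qspc Y. rho Y x = 0}"
      by (rule classifiesD[OF c cocr_crk[OF O(1)[unfolded Obj] st[OF O(1)]] cocr_crk[OF O(2)[unfolded Obj] st[OF O(2)]]
            d e[unfolded code_def]])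
    then have "\<exists>t. is_iso ?C X Y t"
      by (rule cocr_iso_of_crk_iso[rotated 2]) (use O st in \<open>auto simp: cocrs_def Obj\<close>)
    then have XY: "(X, Y) \<in> iso_rel ?C" unfolding iso_rel_def using O by blast
    show ?thesis
      using iso_rel_trans[OF cocr_category XY] iso_rel_trans[OF cocr_category iso_rel_sym[OF XY]] by blast
  qed
  have "finite (code ` ?S)"
  proof (rule finite_subset)
    show "code ` ?S \<subseteq> c ` {(E, s, K). crk E s K \<and> dim E = n}"
      unfolding code_def using cocr_crk st Obj by fastforce
    show "finite (c ` {(E, s, K). crk E s K \<and> dim E = n})" using c unfolding classifies_def by blast
  qed
  moreover have "?S // iso_rel ?C \<subseteq> (\<lambda>i. iso_rel ?C `` {inv_into ?S code i}) ` code ` ?S"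
  proof
    fix A assume "A \<in> ?S // iso_rel ?C"
    then obtain X where X: "X \<in> ?S" "A = iso_rel ?C `` {X}" by (rule quotientE)
    have "A = iso_rel ?C `` {inv_into ?S code (code X)}"
      unfolding X(2) using eq[OF X(1) inv_into_into] f_inv_into_f X(1) by (metis (no_types, lifting) imageI)
    then show "A \<in> (\<lambda>i. iso_rel ?C `` {inv_into ?S code i}) ` code ` ?S" using X(1) by blast
  qed
  ultimately show ?thesis by (rule finite_surj)
qed

section \<open>Existence\<close>

lemma subspace_of_dim:
  assumes "\<not> fin_dim (UNIV :: 'a::real_vector set)"
  obtains S :: "'a::real_vector set" where "fin_dim S" "dim S = n"
proof -
  have "\<exists>B :: 'a set. finite B \<and> independent B \<and> card B = n"
  proof (induction n)
    case 0
    show ?case by (intro exI[of _ "{}"]) (simp add: independent_empty)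
  next
    case (Suc n)
    then obtain B :: "'a set" where B: "finite B" "independent B" "card B = n" by blast
    then obtain x where "x \<notin> span B" using assms unfolding fin_dim_def by blast
    then have "independent (insert x B)" "x \<notin> B" using independent_insertI B(2) span_base by blast+
    then show ?case using B by (intro exI[of _ "insert x B"]) simp
  qed
  then obtain B :: "'a set" where B: "finite B" "independent B" "card B = n" by blast
  show ?thesis
    by (rule that[of "span B"]) (use B fin_dim_def dim_span_eq_card_independent in blast)+
qed

lemma real_iso:
  fixes S :: "'a::real_vector set" and S' :: "'b::real_vector set"
  assumes "fin_dim S" "fin_dim S'" "dim S = dim S'"
  obtains h where "dlin (range (\<lambda>r. (r, 0))) rmul rmul S h" "bij_betw h S S'"
proof -
  have sub: "subspace S" "subspace S'" using assms fin_dim_subspace by blast+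
  have "dlin (range (\<lambda>r. (r, 0))) rmul rmul {0} (\<lambda>_ :: 'a. 0 :: 'b)"
    unfolding dlin_def rmul_def by simp
  moreover have "{0} \<subseteq> S" "(\<lambda>_ :: 'a. 0 :: 'b) ` {0} \<subseteq> S'" "inj_on (\<lambda>_ :: 'a. 0 :: 'b) {0}" using sub subspace_0 by auto
  ultimately show ?thesis
    using extend_iso[OF division_subalgebra_real dmod_real[OF sub(1)] assms(1) dmod_real[OF sub(2)] assms(2,3)
      dmod_real[OF subspace_single_0]] that by blast
qed

lemma sum_apply: "(\<Sum>i\<in>A. f i) x = (\<Sum>i\<in>A. f i x)" for f :: "'a \<Rightarrow> 'b \<Rightarrow> 'c::comm_monoid_add"
  by (induction A rule: infinite_finite_induct) auto

lemma Dual_subspace: "subspace E \<Longrightarrow> subspace (Dual E)"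
  unfolding subspace_def Dual_def Hom_def by (auto simp: scaleR_fun_def scaleR_right_distrib algebra_simps)

lemma Dual_fin_dim:
  assumes "fin_dim E"
  shows "fin_dim (Dual E)"
proof -
  have sub: "subspace E" by (rule fin_dim_subspace[OF assms])
  obtain B where B: "finite B" "B \<subseteq> E" "independent B" "span B = E" by (rule fin_dim_basis[OF assms])
  define \<beta> where "\<beta> b x = (if x \<in> E then representation B x b else 0)" for b x
  have "Dual E \<subseteq> span (\<beta> ` B)"
  proof
    fix \<alpha> assume a: "\<alpha> \<in> Dual E"
    obtain g where g: "linear g" "\<And>x. x \<in> E \<Longrightarrow> g x = \<alpha> x"
      by (rule Hom_extend[OF a[unfolded Dual_def] sub]) (rule that)
    have "\<alpha> = (\<Sum>b\<in>B. \<alpha> b *\<^sub>R \<beta> b)"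
    proof
      fix x
      show "\<alpha> x = (\<Sum>b\<in>B. \<alpha> b *\<^sub>R \<beta> b) x"
      proof (cases "x \<in> E")
        case True
        have "x = (\<Sum>b\<in>B. representation B x b *\<^sub>R b)"
          using sum_representation_eq[OF B(3) _ B(1) order_refl] True B(4) by simp
        then have "\<alpha> x = g (\<Sum>b\<in>B. representation B x b *\<^sub>R b)" using g(2)[OF True] by simp
        also have "\<dots> = (\<Sum>b\<in>B. representation B x b *\<^sub>R \<alpha> b)"
          unfolding linear_sum[OF g(1)] linear_scale[OF g(1)] using g(2) B(2) by (intro sum.cong) auto
        finally show ?thesis using True by (simp add: sum_apply scaleR_fun_def \<beta>_def mult.commute)
      next
        case False
        then show ?thesis using HomD(4)[OF a[unfolded Dual_def]] by (simp add: sum_apply scaleR_fun_def \<beta>_def)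
      qed
    qed
    moreover have "(\<Sum>b\<in>B. \<alpha> b *\<^sub>R \<beta> b) \<in> span (\<beta> ` B)" by (intro span_sum span_scale span_base imageI)
    ultimately show "\<alpha> \<in> span (\<beta> ` B)" by simp
  qed
  then show ?thesis by (rule fin_dimI[OF Dual_subspace[OF sub], rotated]) (simp add: B(1))
qed

text \<open>Conjugation and transposition both reverse products, so together they give a morphism of
  algebras. Conjugation commutes with rotations, so the dual of a whole class is again one
  class.\<close>

lemma dual_quat_structure:
  assumes "quat_structure E Q"
  shows "quat_structure (Dual E) (dual_structure E Q)"
proof -
  obtain \<sigma> where \<sigma>: "quat_hom E \<sigma>" "Q = {\<sigma> \<circ> so3_act R |R. rotation_matrix R}" "fin_dim E" "E \<noteq> {0}"
    by (rule structure_rep[OF assms])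
  interpret qspace E \<sigma> using \<sigma> by unfold_locales
  define \<tau> where "\<tau> q = transp E (\<sigma> (qcnj q))" for q
  have D: "\<And>x y. x \<in> E \<Longrightarrow> y \<in> E \<Longrightarrow> \<alpha> (x + y) = \<alpha> x + \<alpha> y" "\<And>r x. x \<in> E \<Longrightarrow> \<alpha> (r *\<^sub>R x) = r *\<^sub>R \<alpha> x"
    "\<alpha> 0 = 0" "\<And>x. x \<notin> E \<Longrightarrow> \<alpha> x = 0" if "\<alpha> \<in> Dual E" for \<alpha>
    using HomD(2-4)[OF that[unfolded Dual_def]] Hom_more(1)[OF that[unfolded Dual_def] sub] by auto
  have z: "0 \<in> E" by (rule subspace_0[OF sub])
  have cE: "\<alpha> \<circ> \<sigma> q \<in> Dual E" if a: "\<alpha> \<in> Dual E" for \<alpha> q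
    unfolding Dual_def by (rule HomI) (simp_all add: D[OF a] sD)
  have \<tau>: "\<tau> q \<alpha> = \<alpha> \<circ> \<sigma> (qcnj q)" if "\<alpha> \<in> Dual E" for q \<alpha> unfolding \<tau>_def transp_def using that by simp
  have \<tau>': "\<tau> q \<alpha> = 0" if "\<alpha> \<notin> Dual E" for q \<alpha> unfolding \<tau>_def transp_def using that by simp
  have subD: "subspace (Dual E)" by (rule Dual_subspace[OF sub])
  have hom: "quat_hom (Dual E) \<tau>"
    unfolding quat_hom_def
  proof (intro conjI allI)
    have cn: "qcnj (p + q) = qcnj p + qcnj q" "qcnj (r *\<^sub>R p) = r *\<^sub>R qcnj p" for p q r
      by (simp_all add: qcnj_def prod_eq_iff)
    show "linear \<tau>"
    proof (rule linearI)
      fix p q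
      show "\<tau> (p + q) = \<tau> p + \<tau> q"
      proof
        fix \<alpha> show "\<tau> (p + q) \<alpha> = (\<tau> p + \<tau> q) \<alpha>"
        proof (cases "\<alpha> \<in> Dual E")
          case a: True
          have "\<alpha> (\<sigma> (qcnj (p + q)) x) = \<alpha> (\<sigma> (qcnj p) x) + \<alpha> (\<sigma> (qcnj q) x)" for x
            unfolding cn s_add by (cases "x \<in> E") (simp_all add: D[OF a] sD z)
          then show ?thesis by (simp add: \<tau>[OF a] fun_eq_iff)
        qed (simp add: \<tau>')
      qed
    next
      fix r q
      show "\<tau> (r *\<^sub>R q) = r *\<^sub>R \<tau> q"
      proof
        fix \<alpha> show "\<tau> (r *\<^sub>R q) \<alpha> = (r *\<^sub>R \<tau> q) \<alpha>"
        proof (cases "\<alpha> \<in> Dual E")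
          case a: True
          have "\<alpha> (\<sigma> (qcnj (r *\<^sub>R q)) x) = r * \<alpha> (\<sigma> (qcnj q) x)" for x
            unfolding cn s_scale by (cases "x \<in> E") (simp_all add: D[OF a] sD z)
          then show ?thesis by (simp add: \<tau>[OF a] fun_eq_iff scaleR_fun_def)
        qed (simp add: \<tau>' scaleR_fun_def zero_fun_def)
      qed
    qed
    show "\<tau> q \<in> Hom (Dual E) (Dual E)" for q
      by (rule HomI) (simp_all add: \<tau> \<tau>' cE subspace_add[OF subD] subspace_scale[OF subD], simp_all add: fun_eq_iff scaleR_fun_def)
    show "\<tau> (1, 0) = id_map (Dual E)"
    proof
      fix \<alpha> show "\<tau> (1, 0) \<alpha> = id_map (Dual E) \<alpha>"
      proof (cases "\<alpha> \<in> Dual E")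
        case a: True
        have "\<alpha> (\<sigma> (1, 0) x) = \<alpha> x" for x
          by (cases "x \<in> E") (simp_all add: D[OF a] sD z s_one)
        then show ?thesis using a by (simp add: \<tau>[OF a] fun_eq_iff id_map_def qcnj_def)
      qed (simp add: \<tau>' id_map_def)
    qed
    fix p q
    have "qcnj (qmult p q) = qmult (qcnj q) (qcnj p)"
      by (simp add: qcnj_def qmult_def inner_commute cross_skew[of "snd q"] mult.commute)
    then have "\<tau> (qmult p q) \<alpha> = \<tau> p (\<tau> q \<alpha>)" for \<alpha>
    proof (cases "\<alpha> \<in> Dual E")
      case a: True
      then show ?thesis
        unfolding \<tau>[OF a] \<tau>[OF cE[OF a]] \<open>qcnj (qmult p q) = qmult (qcnj q) (qcnj p)\<close>
        by (simp add: fun_eq_iff s_mult)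
    next
      case False
      then show ?thesis using \<tau>[OF subspace_0[OF subD], of p] by (simp add: \<tau>' fun_eq_iff)
    qed
    then show "\<tau> (qmult p q) = \<tau> p \<circ> \<tau> q" by (simp add: fun_eq_iff)
  qed
  have cr: "qcnj (so3_act R q) = so3_act R (qcnj q)" for R q
    using matrix_vector_mult_scaleR[of R "-1" "snd q"] by (simp add: qcnj_def so3_act_def)
  have eq: "(\<lambda>q. transp E ((\<sigma> \<circ> so3_act R) (qcnj q))) = \<tau> \<circ> so3_act R" for R
    by (simp add: \<tau>_def cr comp_def)
  have "dual_structure E Q = {\<lambda>q. transp E ((\<sigma> \<circ> so3_act R) (qcnj q)) |R. rotation_matrix R}"
    unfolding dual_structure_def \<sigma>(2) by blast
  also have "\<dots> = {\<tau> \<circ> so3_act R |R. rotation_matrix R}" by (simp only: eq)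
  finally have ds: "dual_structure E Q = {\<tau> \<circ> so3_act R |R. rotation_matrix R}" .
  have nz': "Dual E \<noteq> {0}"
  proof -
    obtain x where x: "x \<in> E" "x \<noteq> 0" using \<sigma>(4) z by blast
    obtain \<alpha> where "\<alpha> \<in> Dual E" "\<alpha> x \<noteq> 0" by (rule dual_separates[OF sub x])
    then show ?thesis using singletonD[of \<alpha> 0] by (metis zero_fun_def)
  qed
  show ?thesis
    unfolding quat_structure_def
    by (rule conjI, rule Dual_fin_dim[OF \<sigma>(3)], rule conjI, rule nz', rule exI[of _ \<tau>], rule conjI, rule hom, rule ds)
qed

text \<open>The case of zero kernel: the transpose of \<open>\<rho>\<close> is already onto, so the
  CR condition holds for every \<open>J\<close>.\<close>

lemma cocr_quat_of_bij:
  assumes str: "quat_structure E Q" and U: "fin_dim U" and \<rho>: "\<rho> \<in> Hom E U" "bij_betw \<rho> E U"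
  shows "cocr_quat \<lparr>spc = U, qspc = E, qstr = Q, rho = \<rho>\<rparr>"
proof -
  have sub: "subspace E" using str fin_dim_subspace unfolding quat_structure_def by blast
  have inj: "inj_on \<rho> E" and img: "\<rho> ` E = U" using \<rho>(2) unfolding bij_betw_def by auto
  have subU: "subspace U" by (rule fin_dim_subspace[OF U])
  have \<rho>0: "\<rho> 0 = 0" by (rule Hom_more(1)[OF \<rho>(1) sub])
  have tr: "transp U \<rho> \<alpha> = \<alpha> \<circ> \<rho>" if "\<alpha> \<in> Dual U" for \<alpha> using that unfolding transp_def by simp
  have a0: "\<alpha> 0 = 0" if "\<alpha> \<in> Dual U" for \<alpha> using Hom_more(1)[OF that[unfolded Dual_def] subU] .
  have mem: "\<alpha> \<circ> \<rho> \<in> Dual E" if a: "\<alpha> \<in> Dual U" for \<alpha>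
    unfolding Dual_def
    by (rule HomI) (simp_all add: HomD[OF \<rho>(1)] HomD[OF a[unfolded Dual_def]] a0[OF a])
  have subD: "subspace (Dual U)" by (rule Dual_subspace[OF subU])
  have Hom: "transp U \<rho> \<in> Hom (Dual U) (Dual E)"
    by (rule HomI) (simp_all add: tr mem subspace_add[OF subD] subspace_scale[OF subD],
        simp_all add: fun_eq_iff scaleR_fun_def transp_def)
  have onto: "transp U \<rho> ` Dual U = Dual E"
  proof (intro equalityI subsetI)
    fix \<beta> assume b: "\<beta> \<in> Dual E"
    note bD = HomD[OF b[unfolded Dual_def]]
    define \<alpha> where "\<alpha> u = (if u \<in> U then \<beta> (inv_into E \<rho> u) else 0)" for u
    have a: "\<alpha> (\<rho> x) = \<beta> x" if "x \<in> E" for x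
      unfolding \<alpha>_def using inv_into_f_f[OF inj that] HomD(1)[OF \<rho>(1) that] by simp
    have "\<alpha> \<in> Dual U"
      unfolding Dual_def
    proof (rule HomI)
      fix u v assume "u \<in> U" "v \<in> U"
      then obtain x y where "x \<in> E" "y \<in> E" "u = \<rho> x" "v = \<rho> y" unfolding img[symmetric] by blast
      then show "\<alpha> (u + v) = \<alpha> u + \<alpha> v"
        using a subspace_add[OF sub] by (simp add: HomD(2)[OF \<rho>(1), symmetric] bD(2))
    next
      fix r u assume "u \<in> U"
      then obtain x where "x \<in> E" "u = \<rho> x" unfolding img[symmetric] by blast
      then show "\<alpha> (r *\<^sub>R u) = r *\<^sub>R \<alpha> u"
        using a subspace_scale[OF sub] by (simp add: HomD(3)[OF \<rho>(1), symmetric] bD(3))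
    qed (simp_all add: \<alpha>_def)
    moreover have "\<alpha> \<circ> \<rho> = \<beta>"
    proof
      fix x show "(\<alpha> \<circ> \<rho>) x = \<beta> x"
        using a HomD(4)[OF \<rho>(1), of x] bD(4)[of x] a[OF subspace_0[OF sub]] \<rho>0 Hom_more(1)[OF b[unfolded Dual_def] sub]
        by (cases "x \<in> E") simp_all
    qed
    ultimately show "\<beta> \<in> transp U \<rho> ` Dual U" using tr by (metis imageI)
  qed (use tr mem in auto)
  have "inj_on (transp U \<rho>) (Dual U)"
  proof (rule inj_onI)
    fix \<alpha> \<beta> assume ab: "\<alpha> \<in> Dual U" "\<beta> \<in> Dual U" "transp U \<rho> \<alpha> = transp U \<rho> \<beta>"
    show "\<alpha> = \<beta>"
    proof
      fix u
      show "\<alpha> u = \<beta> u"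
      proof (cases "u \<in> U")
        case True
        then obtain x where "u = \<rho> x" unfolding img[symmetric] by blast
        then show ?thesis using fun_cong[OF ab(3), of x] tr[OF ab(1)] tr[OF ab(2)] by simp
      next
        case False
        then show ?thesis using HomD(4)[OF ab(1)[unfolded Dual_def]] HomD(4)[OF ab(2)[unfolded Dual_def]] by simp
      qed
    qed
  qed
  moreover have "{x + J y |x y. x \<in> transp U \<rho> ` Dual U \<and> y \<in> transp U \<rho> ` Dual U} = Dual E"
    if J: "J \<in> adm (dual_structure E Q)" for J
  proof -
    obtain \<tau> v where \<tau>: "\<tau> \<in> dual_structure E Q" "J = \<tau> (0, v)" using J unfolding adm_def by blast
    have JH: "J \<in> Hom (Dual E) (Dual E)"
      unfolding \<tau>(2) using structure_memD(1)[OF dual_quat_structure[OF str] \<tau>(1)] unfolding quat_hom_def by blast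
    have s: "subspace (Dual E)" by (rule Dual_subspace[OF sub])
    have "x = x + J 0" for x using Hom_more(1)[OF JH s] by simp
    then show ?thesis unfolding onto using subspace_add[OF s] HomD(1)[OF JH] subspace_0[OF s] by blast
  qed
  ultimately have "cr_quat (Dual U) (Dual E) (dual_structure E Q) (transp U \<rho>)"
    unfolding cr_quat_def using Dual_fin_dim[OF U] dual_quat_structure[OF str] Hom by blast
  then show ?thesis unfolding cocr_quat_def using str U \<rho>(1) img by simp
qed

text \<open>The standard module \<open>Hn k\<close> is transported to a subspace of the ambient type
  along a real linear bijection, and \<open>U\<close> is taken as a copy of it. Infinite dimensional
  ambient spaces supply subspaces of dimension \<open>4 * k\<close>.\<close>

theorem cocr_exists:
  assumes "\<not> fin_dim (UNIV :: 'u::real_vector set)" "\<not> fin_dim (UNIV :: 'e::real_vector set)" and k: "k > 0"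
  obtains X :: "('u::real_vector, 'e::real_vector) cocr" where "cocr_quat X" "dim (qspc X) = 4 * k"
proof -
  obtain U :: "'u set" where U: "fin_dim U" "dim U = 4 * k" by (rule subspace_of_dim[OF assms(1)])
  obtain E :: "'e set" where E: "fin_dim E" "dim E = 4 * k" by (rule subspace_of_dim[OF assms(2)])
  have V: "fin_dim (Hn k)" "dim (Hn k) = dim E" using Hn_dim E(2) by auto
  obtain h where h: "dlin (range (\<lambda>r. (r, 0))) rmul rmul (Hn k) h" "bij_betw h (Hn k) E"
    by (rule real_iso[OF V(1) E(1) V(2)])
  obtain g where g: "dlin (range (\<lambda>r. (r, 0))) rmul rmul E g" "bij_betw g E U"
    using real_iso[OF E(1) U(1)] E(2) U(2) by auto
  have subE: "subspace E" by (rule fin_dim_subspace[OF E(1)])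
  note sV = dmodD[OF dmod_Hn]
  define i where "i = inv_into (Hn k) h"
  have i: "dlin (range (\<lambda>r. (r, 0))) rmul rmul E i"
    unfolding i_def by (rule dlin_inv[OF dmod_real[OF sV(1)] h])
  have mem: "i x \<in> Hn k" "h (i x) = x" if "x \<in> E" for x
    using that h(2) inv_into_into[of x h "Hn k"] f_inv_into_f[of x h "Hn k"] unfolding i_def bij_betw_def by auto
  have hi: "i (h q) = q" "h q \<in> E" if "q \<in> Hn k" for q
    using that h(2) inv_into_f_f[of h "Hn k" q] unfolding i_def bij_betw_def by auto
  have hr: "h (r *\<^sub>R q) = r *\<^sub>R h q" if "q \<in> Hn k" for r q
    using dlinD(2)[OF h(1) _ that, of "(r, 0)"] unfolding rmul_def by simp
  define s where "s q x = h (hmul q (i x))" for q x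
  have "dmod UNIV s E"
    unfolding dmod_def s_def
  proof (intro conjI ballI allI)
    show "subspace E" by (rule subE)
    fix p q x y assume x: "x \<in> E" and y: "y \<in> E"
    note V = sV(2)[OF UNIV_I mem(1)[OF x]] sV(2)[OF UNIV_I mem(1)[OF y]]
    show "h (hmul q (i x)) \<in> E" by (rule hi(2)[OF V(1)])
    show "h (hmul q (i (x + y))) = h (hmul q (i x)) + h (hmul q (i y))"
      unfolding dlinD(1)[OF i x y] sV(3)[OF UNIV_I mem(1)[OF x] mem(1)[OF y]] by (rule dlinD(1)[OF h(1) V])
    show "h (hmul (p + q) (i x)) = h (hmul p (i x)) + h (hmul q (i x))"
      unfolding sV(4)[OF UNIV_I UNIV_I mem(1)[OF x]] by (rule dlinD(1)[OF h(1) V(1) V(1)])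
    show "h (hmul (qmult p q) (i x)) = h (hmul p (i (h (hmul q (i x)))))"
      unfolding sV(5)[OF UNIV_I UNIV_I mem(1)[OF x]] hi(1)[OF V(1)] ..
  next
    fix r x assume x: "x \<in> E"
    show "h (hmul (r, 0) (i x)) = r *\<^sub>R x"
      unfolding hmul_real hr[OF mem(1)[OF x]] mem(2)[OF x] ..
  qed
  note hom = dmod_quat_hom[OF this]
  have "E \<noteq> {0}" using E(2) k dim_zero[where ?'a='e] by auto
  then have str: "quat_structure E {(\<lambda>q x. if x \<in> E then s q x else 0) \<circ> so3_act R |R. rotation_matrix R}"
    unfolding quat_structure_def using E(1) hom by blast
  have gr: "g (r *\<^sub>R x) = r *\<^sub>R g x" if "x \<in> E" for r x
    using dlinD(2)[OF g(1) _ that, of "(r, 0)"] unfolding rmul_def by simp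
  have "(\<lambda>x. if x \<in> E then g x else 0) \<in> Hom E U"
    by (rule HomI) (use g(2) in \<open>auto simp: bij_betw_def gr dlinD(1)[OF g(1)] subspace_add[OF subE] subspace_scale[OF subE]\<close>)
  moreover have "bij_betw (\<lambda>x. if x \<in> E then g x else 0) E U"
    using g(2) by (simp cong: bij_betw_cong)
  ultimately show ?thesis
    by (intro that[OF cocr_quat_of_bij[OF str U(1)]]) (simp_all add: E(2))
qed

text \<open>The ambient types bound the dimensions that can occur. Nonemptiness is therefore
  asserted for infinite dimensional ambient spaces, which contain copies of all finite dimensional
  ones, while finiteness is asserted throughout.\<close>

theorem theorem3p4:
  shows "is_category (cocr_cat :: (('u::real_vector, 'e::real_vector) cocr, _) cat) \<and>
    is_category (bundle_cat :: ((cp1 \<times> ('u \<times> 'u) set) hbundle, _) cat) \<and>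
    is_functor (cocr_cat :: (('u, 'e) cocr, _) cat) bundle_cat F_obj F_mor \<and>
    (\<forall>X\<in>Obj (cocr_cat :: (('u, 'e) cocr, _) cat). \<forall>Y\<in>Obj cocr_cat.
       \<forall>\<T>\<in>Mor bundle_cat (F_obj X) (F_obj Y). intertwines X Y \<T> \<longrightarrow>
         (\<exists>!t. t \<in> Mor cocr_cat X Y \<and> F_mor X Y t = \<T>)) \<and>
    (\<forall>X\<in>Obj (cocr_cat :: (('u, 'e) cocr, _) cat). \<forall>Y\<in>Obj cocr_cat.
       (\<exists>t. is_iso cocr_cat X Y t) \<longleftrightarrow>
       (\<exists>\<T>. is_iso bundle_cat (F_obj X) (F_obj Y) \<T> \<and> intertwines X Y \<T>)) \<and>
    (\<forall>k::nat. k > 0 \<longrightarrow>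
       finite ({X \<in> Obj cocr_cat. dim (qspc X) = 4 * k}
                 // iso_rel (cocr_cat :: (('u, 'e) cocr, _) cat)) \<and>
       (\<not> fin_dim (UNIV :: 'u set) \<and> \<not> fin_dim (UNIV :: 'e set) \<longrightarrow>
          {X \<in> Obj cocr_cat. dim (qspc X) = 4 * k}
            // iso_rel (cocr_cat :: (('u, 'e) cocr, _) cat) \<noteq> {}))"
proof (intro conjI ballI allI impI)
  have Obj: "X \<in> Obj cocr_cat \<longleftrightarrow> cocr_quat X" for X :: "('u, 'e) cocr" by (simp add: cocr_cat_def)
  have Mor: "Mor cocr_cat = cocr_mor" "Mor bundle_cat = bundle_mor" by (simp_all add: cocr_cat_def bundle_cat_def)
  show "is_category (cocr_cat :: (('u, 'e) cocr, _) cat)" by (rule cocr_category)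
  show "is_category (bundle_cat :: ((cp1 \<times> ('u \<times> 'u) set) hbundle, _) cat)" by (rule bundle_category)
  show "is_functor (cocr_cat :: (('u, 'e) cocr, _) cat) bundle_cat F_obj F_mor" by (rule F_functor)
  { fix X Y :: "('u, 'e) cocr" and \<T>
    assume "X \<in> Obj cocr_cat" "Y \<in> Obj cocr_cat" "\<T> \<in> Mor bundle_cat (F_obj X) (F_obj Y)" "intertwines X Y \<T>"
    then show "\<exists>!t. t \<in> Mor cocr_cat X Y \<and> F_mor X Y t = \<T>"
      unfolding Obj Mor by (rule F_full_faithful) }
  { fix X Y :: "('u, 'e) cocr"
    assume "X \<in> Obj cocr_cat" "Y \<in> Obj cocr_cat"
    then show "(\<exists>t. is_iso cocr_cat X Y t) \<longleftrightarrow> (\<exists>\<T>. is_iso bundle_cat (F_obj X) (F_obj Y) \<T> \<and> intertwines X Y \<T>)"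
      unfolding Obj by (rule F_iso) }
  fix k :: nat assume k: "k > 0"
  show "finite ({X \<in> Obj cocr_cat. dim (qspc X) = 4 * k} // iso_rel (cocr_cat :: (('u, 'e) cocr, _) cat))"
    by (rule cocr_classes_finite)
  assume inf: "\<not> fin_dim (UNIV :: 'u set) \<and> \<not> fin_dim (UNIV :: 'e set)"
  obtain X :: "('u, 'e) cocr" where "cocr_quat X" "dim (qspc X) = 4 * k"
    by (rule cocr_exists[OF conjunct1[OF inf] conjunct2[OF inf] k])
  then show "{X \<in> Obj cocr_cat. dim (qspc X) = 4 * k} // iso_rel (cocr_cat :: (('u, 'e) cocr, _) cat) \<noteq> {}"
    unfolding quotient_def Obj[symmetric] by blast
qed

end
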